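(* For any hereditarily atomic von Neumann algebras $A$ and $B$, there exists a unique Scott-continuous and linear map $\beta:\mathcal M\,\mathbf Q(A,B)\to\mathbf Q(A,B)$ (the barycentre map, $\beta(\nu)=\sup\{\sum_i r_ix_i : s=\sum_i r_i\delta_{x_i}\text{ simple},\ s\ll\nu\}$) such that $(\mathbf Q(A,B),\beta)$ is an Eilenberg–Moore algebra of the monad $\mathcal M$.
   Context: $\mathbf Q(A,B)$ is the set of normal, completely positive, subunital linear maps $B\to A$, ordered by $\varphi\le\psi$ iff $\psi-\varphi$ is completely positive, with convex structure $\varphi+_r\psi=r\varphi+(1-r)\psi$ and zero map as bottom; finite convex sums $\sum r_ix_i$ are formed from these operations. A von Neumann algebra is hereditarily atomic if it is $*$-isomorphic to an $\ell^\infty$-product of full matrix algebras. For a dcpo $D$ with Scott topology $\sigma D$, a subprobability valuation is a Scott-continuous, strict, modular map $\nu:\sigma D\to[0,1]$; these form a dcpo $\mathcal VD$ in the pointwise order. Dirac valuations $\delta_x$ and simple valuations $\sum r_i\delta_{x_i}$ ($r_i\ge0,\sum r_i\le1$) are as usual; $\mathcal MD$ is the smallest sub-dcpo of $\mathcal VD$ containing the simple valuations, with convex structure $\nu_1+_r\nu_2=r\nu_1+(1-r)\nu_2$ and least element $0$; "linear" for a map out of $\mathcal MD$ means preserving $0$ and $+_r$. $\mathcal M$ is a monad on the category of dcpos and Scott-continuous maps with unit $\eta(x)=\delta_x$ and multiplication $\mu(\Xi)(U)=\int_{\nu\in\mathcal MD}\nu(U)\,d\Xi$, with action on maps $\mathcal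 M(h)(\nu)(U)=\nu(h^{-1}(U))$, where $\int f\,d\nu=\int_0^1\nu(f^{-1}((t,1]))\,dt$. An Eilenberg–Moore algebra is a Scott-continuous $\beta:\mathcal MK\to K$ with $\beta\circ\eta_K=\mathrm{id}$ and $\beta\circ\mathcal M\beta=\beta\circ\mu_K$. $\ll$ denotes the way-below relation in $\mathcal M\,\mathbf Q(A,B)$. *)

theory Defs
  imports
    "HOL-Analysis.Analysis"
    "HOL-Algebra.Module"
    "HOL-Algebra.Order"
    "Jordan_Normal_Form.Schur_Decomposition"
begin

section \<open>Dcpos and Scott-continuous maps\<close>

definition directed :: "('a, 'm) gorder_scheme \<Rightarrow> 'a set \<Rightarrow> bool" where
  "directed D S \<longleftrightarrow> S \<subseteq> carrier D \<and> S \<noteq> {} \<and>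
     (\<forall>x\<in>S. \<forall>y\<in>S. \<exists>z\<in>S. x \<sqsubseteq>\<^bsub>D\<^esub> z \<and> y \<sqsubseteq>\<^bsub>D\<^esub> z)"

definition dcpo :: "('a, 'm) gorder_scheme \<Rightarrow> bool" where
  "dcpo D \<longleftrightarrow> partial_order D \<and> (\<forall>S. directed D S \<longrightarrow> (\<exists>s. is_lub D s S))"

definition scott_continuous ::
  "('a, 'm) gorder_scheme \<Rightarrow> ('b, 'n) gorder_scheme \<Rightarrow> ('a \<Rightarrow> 'b) \<Rightarrow> bool" where
  "scott_continuous D E f \<longleftrightarrow>
     f \<in> carrier D \<rightarrow> carrier E \<and>
     (\<forall>x\<in>carrier D. \<forall>y\<in>carrier D. x \<sqsubseteq>\<^bsub>D\<^esub> y \<longrightarrow> f x \<sqsubseteq>\<^bsub>E\<^esub> f y) \<and>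
     (\<forall>S s. directed D S \<and> is_lub D s S \<longrightarrow> is_lub E (f s) (f ` S))"

definition scott_opens :: "('a, 'm) gorder_scheme \<Rightarrow> 'a set set" where
  "scott_opens D = {U. U \<subseteq> carrier D \<and>
     (\<forall>x\<in>U. \<forall>y\<in>carrier D. x \<sqsubseteq>\<^bsub>D\<^esub> y \<longrightarrow> y \<in> U) \<and>
     (\<forall>S s. directed D S \<and> is_lub D s S \<and> s \<in> U \<longrightarrow> S \<inter> U \<noteq> {})}"

definition way_below :: "('a, 'm) gorder_scheme \<Rightarrow> 'a \<Rightarrow> 'a \<Rightarrow> bool" where
  "way_below D x y \<longleftrightarrow> x \<in> carrier D \<and> y \<in> carrier D \<and>
     (\<forall>S s. directed D S \<and> is_lub D s S \<and> y \<sqsubseteq>\<^bsub>D\<^esub> s \<longrightarrow> (\<exists>d\<in>S. x \<sqsubseteq>\<^bsub>D\<^esub> d))"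

section \<open>Convex structure\<close>

text \<open>\<open>conv K r x y\<close> is $x +_r y$, the weight \<open>r\<close> going to \<open>x\<close>.\<close>

record 'a convex_order = "'a gorder" +
  conv :: "real \<Rightarrow> 'a \<Rightarrow> 'a \<Rightarrow> 'a"
  bot :: 'a

definition convex_linear ::
  "('a, 'm) convex_order_scheme \<Rightarrow> ('b, 'n) convex_order_scheme \<Rightarrow> ('a \<Rightarrow> 'b) \<Rightarrow> bool" where
  "convex_linear K L f \<longleftrightarrow> f (bot K) = bot L \<and>
     (\<forall>r\<in>{0..1}. \<forall>x\<in>carrier K. \<forall>y\<in>carrier K. f (conv K r x y) = conv L r (f x) (f y))"

text \<open>A formal subconvex combination $\sum_i r_i x_i$ is a list of pairs $(r_i, x_i)$.\<close>

definition subconvex :: "'a set \<Rightarrow> (real \<times> 'a) list \<Rightarrow> bool" where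
  "subconvex X l \<longleftrightarrow> (\<forall>(r, x)\<in>set l. 0 \<le> r \<and> x \<in> X) \<and> (\<Sum>(r, x)\<leftarrow>l. r) \<le> 1"

text \<open>For a subconvex combination,
  $\sum_{i\le n} r_i x_i = x_1 +_{r_1} \sum_{2\le i\le n} \frac{r_i}{1-r_1} x_i$, with the empty sum
  being the bottom element. If $r_1 = 1$, then division by zero turns the remaining
  weights, which are all 0, into 0 again, and they enter $+_1$ with weight 0.\<close>

function convex_sum :: "('a, 'm) convex_order_scheme \<Rightarrow> (real \<times> 'a) list \<Rightarrow> 'a" where
  "convex_sum K [] = bot K"
| "convex_sum K ((r, x) # l) =
     conv K r x (convex_sum K (map (\<lambda>(s, y). (s / (1 - r), y)) l))"
  by pat_completeness auto
termination by (relation "Wellfounded.measure (\<lambda>(K, l). length l)") auto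

section \<open>The monad of subprobability valuations\<close>

definition unit_interval :: "real gorder" where
  "unit_interval = \<lparr>carrier = {0..1}, eq = (=), le = (\<le>)\<rparr>"

definition opens_order :: "('a, 'm) gorder_scheme \<Rightarrow> 'a set gorder" where
  "opens_order D = \<lparr>carrier = scott_opens D, eq = (=), le = (\<subseteq>)\<rparr>"

definition valuations :: "('a, 'm) gorder_scheme \<Rightarrow> ('a set \<Rightarrow> real) set" where
  "valuations D = {\<nu> \<in> extensional (scott_opens D).
     scott_continuous (opens_order D) unit_interval \<nu> \<and> \<nu> {} = 0 \<and>
     (\<forall>U\<in>scott_opens D. \<forall>V\<in>scott_opens D. \<nu> U + \<nu> V = \<nu> (U \<union> V) + \<nu> (U \<inter> V))}"

definition V_dcpo :: "('a, 'm) gorder_scheme \<Rightarrow> ('a set \<Rightarrow> real) gorder" where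
  "V_dcpo D = \<lparr>carrier = valuations D, eq = (=), le = (\<lambda>\<nu> \<xi>. \<forall>U\<in>scott_opens D. \<nu> U \<le> \<xi> U)\<rparr>"

definition dirac :: "('a, 'm) gorder_scheme \<Rightarrow> 'a \<Rightarrow> 'a set \<Rightarrow> real" where
  "dirac D x = (\<lambda>U\<in>scott_opens D. if x \<in> U then 1 else 0)"

definition simple_valuation ::
  "('a, 'm) gorder_scheme \<Rightarrow> (real \<times> 'a) list \<Rightarrow> 'a set \<Rightarrow> real" where
  "simple_valuation D l = (\<lambda>U\<in>scott_opens D. \<Sum>(r, x)\<leftarrow>l. r * dirac D x U)"

definition sub_dcpo :: "('a, 'm) gorder_scheme \<Rightarrow> 'a set \<Rightarrow> bool" where
  "sub_dcpo D X \<longleftrightarrow> X \<subseteq> carrier D \<and>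
     (\<forall>S s. S \<subseteq> X \<and> directed D S \<and> is_lub D s S \<longrightarrow> s \<in> X)"

definition M_carrier :: "('a, 'm) gorder_scheme \<Rightarrow> ('a set \<Rightarrow> real) set" where
  "M_carrier D = \<Inter>{X. sub_dcpo (V_dcpo D) X \<and>
     simple_valuation D ` {l. subconvex (carrier D) l} \<subseteq> X}"

definition M_dcpo :: "('a, 'm) gorder_scheme \<Rightarrow> ('a set \<Rightarrow> real) convex_order" where
  "M_dcpo D = \<lparr>carrier = M_carrier D, eq = (=),
     le = (\<lambda>\<nu> \<xi>. \<forall>U\<in>scott_opens D. \<nu> U \<le> \<xi> U),
     conv = (\<lambda>r \<nu> \<xi>. \<lambda>U\<in>scott_opens D. r * \<nu> U + (1 - r) * \<xi> U),
     bot = (\<lambda>U\<in>scott_opens D. 0)\<rparr>"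

definition val_integral ::
  "('a, 'm) gorder_scheme \<Rightarrow> ('a \<Rightarrow> real) \<Rightarrow> ('a set \<Rightarrow> real) \<Rightarrow> real" where
  "val_integral D f \<nu> = integral {0..1} (\<lambda>t. \<nu> {x \<in> carrier D. f x \<in> {t<..1}})"

definition M_map ::
  "('a, 'm) gorder_scheme \<Rightarrow> ('b, 'n) gorder_scheme \<Rightarrow> ('a \<Rightarrow> 'b) \<Rightarrow> ('a set \<Rightarrow> real) \<Rightarrow> 'b set \<Rightarrow> real" where
  "M_map D E h \<nu> = (\<lambda>U\<in>scott_opens E. \<nu> {x \<in> carrier D. h x \<in> U})"

definition M_mult :: "('a, 'm) gorder_scheme \<Rightarrow> (('a set \<Rightarrow> real) set \<Rightarrow> real) \<Rightarrow> 'a set \<Rightarrow> real" where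
  "M_mult D \<Xi> = (\<lambda>U\<in>scott_opens D. val_integral (M_dcpo D) (\<lambda>\<nu>. \<nu> U) \<Xi>)"

text \<open>The conjunct \<open>dcpo K\<close> says that the underlying object is an object of the category
  on which the monad lives.\<close>

definition EM_algebra :: "('a, 'm) gorder_scheme \<Rightarrow> (('a set \<Rightarrow> real) \<Rightarrow> 'a) \<Rightarrow> bool" where
  "EM_algebra K \<beta> \<longleftrightarrow> dcpo K \<and> scott_continuous (M_dcpo K) K \<beta> \<and>
     (\<forall>x\<in>carrier K. \<beta> (dirac K x) = x) \<and>
     (\<forall>\<Xi>\<in>carrier (M_dcpo (M_dcpo K)). \<beta> (M_map (M_dcpo K) K \<beta> \<Xi>) = \<beta> (M_mult K \<Xi>))"

section \<open>Von Neumann algebras\<close>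

definition complex_ring :: "complex ring" where
  "complex_ring = \<lparr>carrier = UNIV, mult = (*), one = 1, zero = 0, add = (+)\<rparr>"

record 'a star_alg = "(complex, 'a) module" +
  star :: "'a \<Rightarrow> 'a"

text \<open>Unital complex star-algebras. The zero algebra is allowed.\<close>

locale star_algebra = module complex_ring A + ring A for A :: "'a star_alg" (structure) +
  assumes smult_mult_left: "\<lbrakk>x \<in> carrier A; y \<in> carrier A\<rbrakk> \<Longrightarrow> (c \<odot> x) \<otimes> y = c \<odot> (x \<otimes> y)"
    and smult_mult_right: "\<lbrakk>x \<in> carrier A; y \<in> carrier A\<rbrakk> \<Longrightarrow> x \<otimes> (c \<odot> y) = c \<odot> (x \<otimes> y)"
    and star_closed: "x \<in> carrier A \<Longrightarrow> star A x \<in> carrier A"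
    and star_star: "x \<in> carrier A \<Longrightarrow> star A (star A x) = x"
    and star_add: "\<lbrakk>x \<in> carrier A; y \<in> carrier A\<rbrakk> \<Longrightarrow> star A (x \<oplus> y) = star A x \<oplus> star A y"
    and star_smult: "x \<in> carrier A \<Longrightarrow> star A (c \<odot> x) = cnj c \<odot> star A x"
    and star_mult: "\<lbrakk>x \<in> carrier A; y \<in> carrier A\<rbrakk> \<Longrightarrow> star A (x \<otimes> y) = star A y \<otimes> star A x"

definition cstar_norm :: "'a star_alg \<Rightarrow> ('a \<Rightarrow> real) \<Rightarrow> bool" where
  "cstar_norm A N \<longleftrightarrow>
     (\<forall>x\<in>carrier A. 0 \<le> N x \<and> (N x = 0 \<longleftrightarrow> x = \<zero>\<^bsub>A\<^esub>)) \<and>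
     (\<forall>x\<in>carrier A. \<forall>y\<in>carrier A. N (x \<oplus>\<^bsub>A\<^esub> y) \<le> N x + N y) \<and>
     (\<forall>c. \<forall>x\<in>carrier A. N (c \<odot>\<^bsub>A\<^esub> x) = cmod c * N x) \<and>
     (\<forall>x\<in>carrier A. \<forall>y\<in>carrier A. N (x \<otimes>\<^bsub>A\<^esub> y) \<le> N x * N y) \<and>
     (\<forall>x\<in>carrier A. N (star A x \<otimes>\<^bsub>A\<^esub> x) = (N x)\<^sup>2) \<and>
     (\<forall>X :: nat \<Rightarrow> 'a. range X \<subseteq> carrier A \<and>
        (\<forall>e>0. \<exists>k. \<forall>m\<ge>k. \<forall>n\<ge>k. N (X m \<ominus>\<^bsub>A\<^esub> X n) < e) \<longrightarrow>
        (\<exists>x\<in>carrier A. (\<lambda>n. N (X n \<ominus>\<^bsub>A\<^esub> x)) \<longlonglongrightarrow> 0))"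

text \<open>\<open>functional_bound A N f c\<close>: the functional \<open>f\<close> has dual norm at most \<open>c\<close>.\<close>

definition functional_bound :: "'a star_alg \<Rightarrow> ('a \<Rightarrow> real) \<Rightarrow> ('a \<Rightarrow> complex) \<Rightarrow> real \<Rightarrow> bool" where
  "functional_bound A N f c \<longleftrightarrow> 0 \<le> c \<and> (\<forall>x\<in>carrier A. cmod (f x) \<le> c * N x)"

definition bounded_functionals :: "'a star_alg \<Rightarrow> ('a \<Rightarrow> real) \<Rightarrow> ('a \<Rightarrow> complex) set" where
  "bounded_functionals A N = {f \<in> extensional (carrier A).
     (\<forall>x\<in>carrier A. \<forall>y\<in>carrier A. f (x \<oplus>\<^bsub>A\<^esub> y) = f x + f y) \<and>
     (\<forall>c. \<forall>x\<in>carrier A. f (c \<odot>\<^bsub>A\<^esub> x) = c * f x) \<and>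
     (\<exists>c. functional_bound A N f c)}"

text \<open>A predual of \<open>A\<close>, embedded canonically into the dual of \<open>A\<close>: a norm-closed subspace \<open>P\<close>
  of the dual such that evaluation is an isometric isomorphism from \<open>A\<close> onto the dual of \<open>P\<close>.\<close>

definition predual :: "'a star_alg \<Rightarrow> ('a \<Rightarrow> real) \<Rightarrow> ('a \<Rightarrow> complex) set \<Rightarrow> bool" where
  "predual A N P \<longleftrightarrow>
     P \<subseteq> bounded_functionals A N \<and>
     (\<lambda>x\<in>carrier A. 0) \<in> P \<and>
     (\<forall>f\<in>P. \<forall>g\<in>P. (\<lambda>x\<in>carrier A. f x + g x) \<in> P) \<and>
     (\<forall>c. \<forall>f\<in>P. (\<lambda>x\<in>carrier A. c * f x) \<in> P) \<and>
     (\<forall>f\<in>bounded_functionals A N.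
        (\<forall>e>0. \<exists>g\<in>P. functional_bound A N (\<lambda>x. f x - g x) e) \<longrightarrow> f \<in> P) \<and>
     (\<forall>x\<in>carrier A. \<forall>c\<ge>0. (\<forall>f\<in>P. functional_bound A N f 1 \<longrightarrow> cmod (f x) \<le> c) \<longrightarrow> N x \<le> c) \<and>
     (\<forall>F :: ('a \<Rightarrow> complex) \<Rightarrow> complex.
        (\<forall>f\<in>P. \<forall>g\<in>P. F (\<lambda>x\<in>carrier A. f x + g x) = F f + F g) \<and>
        (\<forall>c. \<forall>f\<in>P. F (\<lambda>x\<in>carrier A. c * f x) = c * F f) \<and>
        (\<exists>k. \<forall>f\<in>P. \<forall>c. functional_bound A N f c \<longrightarrow> cmod (F f) \<le> k * c) \<longrightarrow>
        (\<exists>x\<in>carrier A. \<forall>f\<in>P. F f = f x))"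

text \<open>Von Neumann algebras in Sakai's space-free form (W*-algebras): C*-algebras that are
  isometrically the dual of a Banach space. The C*-norm is determined by the star-algebra, so
  having one is a property of it and not additional structure.\<close>

definition von_neumann_algebra :: "'a star_alg \<Rightarrow> bool" where
  "von_neumann_algebra A \<longleftrightarrow>
     star_algebra A \<and> (\<exists>N. cstar_norm A N \<and> (\<exists>P. predual A N P))"

definition op_norm_le :: "complex mat \<Rightarrow> real \<Rightarrow> bool" where
  "op_norm_le a c \<longleftrightarrow> (\<forall>v\<in>carrier_vec (dim_col a).
     L2_set (\<lambda>k. cmod (vec_index (a *\<^sub>v v) k)) {..<dim_row a} \<le>
     c * L2_set (\<lambda>k. cmod (vec_index v k)) {..<dim_col a})"

definition linf_matrix_product :: "'i set \<Rightarrow> ('i \<Rightarrow> nat) \<Rightarrow> ('i \<Rightarrow> complex mat) star_alg" where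
  "linf_matrix_product I n = \<lparr>
     carrier = {a \<in> (\<Pi>\<^sub>E i\<in>I. carrier_mat (n i) (n i)). \<exists>c. \<forall>i\<in>I. op_norm_le (a i) c},
     mult = (\<lambda>a b. \<lambda>i\<in>I. a i * b i),
     one = (\<lambda>i\<in>I. 1\<^sub>m (n i)),
     zero = (\<lambda>i\<in>I. 0\<^sub>m (n i) (n i)),
     add = (\<lambda>a b. \<lambda>i\<in>I. a i + b i),
     smult = (\<lambda>c a. \<lambda>i\<in>I. c \<cdot>\<^sub>m a i),
     star = (\<lambda>a. \<lambda>i\<in>I. mat_adjoint (a i))\<rparr>"

definition star_iso :: "'a star_alg \<Rightarrow> 'b star_alg \<Rightarrow> ('a \<Rightarrow> 'b) \<Rightarrow> bool" where
  "star_iso A B h \<longleftrightarrow> h \<in> Ring.ring_hom A B \<and> bij_betw h (carrier A) (carrier B) \<and>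
     (\<forall>c. \<forall>x\<in>carrier A. h (c \<odot>\<^bsub>A\<^esub> x) = c \<odot>\<^bsub>B\<^esub> h x) \<and>
     (\<forall>x\<in>carrier A. h (star A x) = star B (h x))"

text \<open>Index sets inside the type of \<open>A\<close> are no restriction: mapping an index to the unit of its
  (nonzero) matrix block injects every possible index set into \<open>A\<close>.\<close>

definition hereditarily_atomic :: "'a star_alg \<Rightarrow> bool" where
  "hereditarily_atomic A \<longleftrightarrow> von_neumann_algebra A \<and>
     (\<exists>(I :: 'a set) n h. (\<forall>i\<in>I. 0 < n i) \<and> star_iso A (linf_matrix_product I n) h)"

section \<open>Normal completely positive subunital maps\<close>

definition alg_le :: "'a star_alg \<Rightarrow> 'a \<Rightarrow> 'a \<Rightarrow> bool" where
  "alg_le A x y \<longleftrightarrow> (\<exists>z\<in>carrier A. y \<ominus>\<^bsub>A\<^esub> x = star A z \<otimes>\<^bsub>A\<^esub> z)"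

definition self_adjoint_order :: "'a star_alg \<Rightarrow> 'a gorder" where
  "self_adjoint_order A = \<lparr>carrier = {x \<in> carrier A. star A x = x}, eq = (=), le = alg_le A\<rparr>"

text \<open>Matrices over \<open>A\<close> are functions of two indices, of which only the values at
  indices below \<open>n\<close> matter; \<open>a\<close> is positive iff $a = x^* x$ for some
  matrix \<open>x\<close>.\<close>

definition matrix_positive :: "'a star_alg \<Rightarrow> nat \<Rightarrow> (nat \<Rightarrow> nat \<Rightarrow> 'a) \<Rightarrow> bool" where
  "matrix_positive A n a \<longleftrightarrow> (\<exists>x. (\<forall>i<n. \<forall>j<n. x i j \<in> carrier A) \<and>
     (\<forall>i<n. \<forall>j<n. a i j = (\<Oplus>\<^bsub>A\<^esub>k\<in>{..<n}. star A (x k i) \<otimes>\<^bsub>A\<^esub> x k j)))"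

definition completely_positive :: "'b star_alg \<Rightarrow> 'a star_alg \<Rightarrow> ('b \<Rightarrow> 'a) \<Rightarrow> bool" where
  "completely_positive B A \<phi> \<longleftrightarrow>
     \<phi> \<in> carrier B \<rightarrow> carrier A \<and>
     (\<forall>x\<in>carrier B. \<forall>y\<in>carrier B. \<phi> (x \<oplus>\<^bsub>B\<^esub> y) = \<phi> x \<oplus>\<^bsub>A\<^esub> \<phi> y) \<and>
     (\<forall>c. \<forall>x\<in>carrier B. \<phi> (c \<odot>\<^bsub>B\<^esub> x) = c \<odot>\<^bsub>A\<^esub> \<phi> x) \<and>
     (\<forall>n b. matrix_positive B n b \<longrightarrow> matrix_positive A n (\<lambda>i j. \<phi> (b i j)))"

text \<open>A positive linear map is normal if it preserves suprema of bounded increasing nets of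
  self-adjoint elements. In a von Neumann algebra the bounded increasing nets are those that have a
  supremum, so this is Scott continuity on the self-adjoint part.\<close>

definition normal_map :: "'b star_alg \<Rightarrow> 'a star_alg \<Rightarrow> ('b \<Rightarrow> 'a) \<Rightarrow> bool" where
  "normal_map B A \<phi> \<longleftrightarrow> scott_continuous (self_adjoint_order B) (self_adjoint_order A) \<phi>"

text \<open>The order of the arguments follows $\mathbf Q(A,B)$: its elements go from \<open>B\<close> to \<open>A\<close>.\<close>

definition Q_dcpo :: "'a star_alg \<Rightarrow> 'b star_alg \<Rightarrow> ('b \<Rightarrow> 'a) convex_order" where
  "Q_dcpo A B = \<lparr>
     carrier = {\<phi> \<in> extensional (carrier B).
       completely_positive B A \<phi> \<and> normal_map B A \<phi> \<and> alg_le A (\<phi> \<one>\<^bsub>B\<^esub>) \<one>\<^bsub>A\<^esub>},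
     eq = (=),
     le = (\<lambda>\<phi> \<psi>. completely_positive B A (\<lambda>b. \<psi> b \<ominus>\<^bsub>A\<^esub> \<phi> b)),
     conv = (\<lambda>r \<phi> \<psi>. \<lambda>b\<in>carrier B.
       (complex_of_real r \<odot>\<^bsub>A\<^esub> \<phi> b) \<oplus>\<^bsub>A\<^esub> (complex_of_real (1 - r) \<odot>\<^bsub>A\<^esub> \<psi> b)),
     bot = (\<lambda>b\<in>carrier B. \<zero>\<^bsub>A\<^esub>)\<rparr>"

text \<open>$\beta(\nu) = \sup\{\sum_i r_i x_i : s = \sum_i r_i \delta_{x_i} \mbox{ simple},\ s \ll \nu\}$.\<close>

definition is_barycentre_map ::
  "('a, 'm) convex_order_scheme \<Rightarrow> (('a set \<Rightarrow> real) \<Rightarrow> 'a) \<Rightarrow> bool" where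
  "is_barycentre_map K \<beta> \<longleftrightarrow> (\<forall>\<nu>\<in>carrier (M_dcpo K).
     is_lub K (\<beta> \<nu>) {convex_sum K l | l. subconvex (carrier K) l \<and>
       way_below (M_dcpo K) (simple_valuation K l) \<nu>})"

end

theory Submission
  imports Defs
begin

text \<open>
  Two facts about $K = \mathbf Q(A,B)$ carry the proof.

  First, \<open>K\<close> has enough functionals into $[0,1]$. For a positive matrix $b$ over \<open>B\<close>, a block
  \<open>i\<close> of \<open>A\<close> and a family of vectors $v_k$, the number
  $\sum_{k,l} \langle v_k, \varphi(b_{kl})_i v_l \rangle$ is affine and Scott-continuous in
  $\varphi$, and these numbers determine the order. Hence the barycentre of $\nu$ can be
  characterised by $f(\beta(\nu)) = \int f \, d\nu$ for all these functionals \<open>f\<close>. The valuations for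
  which such a point exists include the simple ones and are closed under directed suprema, so they
  exhaust $\mathcal M K$. The algebra law and uniqueness follow by the same density argument.

  Second, \<open>K\<close> is a continuous dcpo: $\varphi$ is the directed supremum of $c\,\varphi$
  truncated to finitely many blocks, $c < 1$. On finitely many blocks the order is that of finitely
  many Choi matrices, where a directed family of positive semidefinite matrices with supremum
  $Z$ eventually dominates $cZ$; so these truncations are way below $\varphi$.
  Continuity passes to $\mathcal M K$: if $c < 1$ and $y_i \ll x_i$, then
  $\sum_i c r_i \delta_{y_i} \ll \sum_i r_i \delta_{x_i}$, as only the finitely many open sets
  $\bigcup_{i \in J} \{z : y_i \ll z\}$ have to be tested. This gives the formula for $\beta$.
\<close>

section \<open>Directed suprema, approximation and valuations over an arbitrary order\<close>

section \<open>Directed suprema\<close>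

text \<open>\<open>M_carrier\<close> is given only by minimality: a general member has no
  description, so whatever is claimed of it must hold for simple valuations and survive directed
  suprema. In Q(A,B) the obstacle is order, not convergence: the limit of the Choi matrices may be
  singular, and being close to a singular matrix gives no inequality. A remedy exists because the
  error R satisfies 0 \<le> R \<le> Z, so it vanishes on the kernel of Z; the slack between c and 1
  then absorbs it. The same slack serves for valuations, whose directed suprema need not be reached
  either. Infinitely many blocks are handled by normality, which makes the value of a map at b the
  limit of its values at the finite truncations of b. Suprema of self-adjoint elements and of maps
  are built in one way: quadratic forms converge monotonically, polarization turns this into
  convergence of matrix entries, and a bound uniform over the blocks turns the limiting entries into
  an element of the algebra.\<close>

lemma is_lub_iff:
  assumes "S \<subseteq> carrier D"
  shows "is_lub D s S \<longleftrightarrow> s \<in> carrier D \<and> (\<forall>x\<in>S. x \<sqsubseteq>\<^bsub>D\<^esub> s) \<and>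
    (\<forall>u\<in>carrier D. (\<forall>x\<in>S. x \<sqsubseteq>\<^bsub>D\<^esub> u) \<longrightarrow> s \<sqsubseteq>\<^bsub>D\<^esub> u)"
  using assms unfolding least_def Upper_def by (auto simp: subset_iff)

lemma directed_subset: "directed D S \<Longrightarrow> S \<subseteq> carrier D"
  by (simp add: directed_def)

lemma directed_upper:
  assumes "directed D S" "x \<in> S" "y \<in> S"
  obtains z where "z \<in> S" "x \<sqsubseteq>\<^bsub>D\<^esub> z" "y \<sqsubseteq>\<^bsub>D\<^esub> z"
  using assms unfolding directed_def by blast

lemma directed_is_lub_iff:
  assumes "directed D S"
  shows "is_lub D s S \<longleftrightarrow> s \<in> carrier D \<and> (\<forall>x\<in>S. x \<sqsubseteq>\<^bsub>D\<^esub> s) \<and>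
    (\<forall>u\<in>carrier D. (\<forall>x\<in>S. x \<sqsubseteq>\<^bsub>D\<^esub> u) \<longrightarrow> s \<sqsubseteq>\<^bsub>D\<^esub> u)"
  using assms by (intro is_lub_iff) (simp add: directed_def)

lemma partial_orderI:
  assumes "\<And>x y. x .=\<^bsub>D\<^esub> y \<longleftrightarrow> x = y"
    and "\<And>x. x \<in> carrier D \<Longrightarrow> x \<sqsubseteq>\<^bsub>D\<^esub> x"
    and "\<And>x y. \<lbrakk>x \<in> carrier D; y \<in> carrier D; x \<sqsubseteq>\<^bsub>D\<^esub> y; y \<sqsubseteq>\<^bsub>D\<^esub> x\<rbrakk> \<Longrightarrow> x = y"
    and "\<And>x y z. \<lbrakk>x \<in> carrier D; y \<in> carrier D; z \<in> carrier D; x \<sqsubseteq>\<^bsub>D\<^esub> y; y \<sqsubseteq>\<^bsub>D\<^esub> z\<rbrakk> \<Longrightarrow> x \<sqsubseteq>\<^bsub>D\<^esub> z"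
  shows "partial_order D"
proof -
  have eq: "eq D = (=)" using assms(1) by (intro ext) simp
  show ?thesis
  proof
    fix x y z assume "x \<in> carrier D" "y \<in> carrier D" "z \<in> carrier D" "x \<sqsubseteq>\<^bsub>D\<^esub> y" "y \<sqsubseteq>\<^bsub>D\<^esub> z"
    then show "x \<sqsubseteq>\<^bsub>D\<^esub> z" by (rule assms(4))
  next
    fix x y assume "x \<sqsubseteq>\<^bsub>D\<^esub> y" "y \<sqsubseteq>\<^bsub>D\<^esub> x" "x \<in> carrier D" "y \<in> carrier D"
    then show "x .=\<^bsub>D\<^esub> y" using assms(3) by (simp add: eq)
  qed (simp_all add: eq assms(2))
qed

lemma partial_order_lub_unique:
  assumes "partial_order D" "is_lub D x S" "is_lub D y S"
  shows "x = y"
  using partial_order.least_unique[OF assms] .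

lemma partial_orderD:
  assumes "partial_order D"
  shows partial_order_refl: "x \<in> carrier D \<Longrightarrow> x \<sqsubseteq>\<^bsub>D\<^esub> x"
    and partial_order_trans: "\<lbrakk>x \<sqsubseteq>\<^bsub>D\<^esub> y; y \<sqsubseteq>\<^bsub>D\<^esub> z; x \<in> carrier D; y \<in> carrier D; z \<in> carrier D\<rbrakk> \<Longrightarrow> x \<sqsubseteq>\<^bsub>D\<^esub> z"
    and partial_order_antisym: "\<lbrakk>x \<sqsubseteq>\<^bsub>D\<^esub> y; y \<sqsubseteq>\<^bsub>D\<^esub> x; x \<in> carrier D; y \<in> carrier D\<rbrakk> \<Longrightarrow> x = y"
proof -
  interpret partial_order D by fact
  show "x \<in> carrier D \<Longrightarrow> x \<sqsubseteq>\<^bsub>D\<^esub> x" by simp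
  show "\<lbrakk>x \<sqsubseteq>\<^bsub>D\<^esub> y; y \<sqsubseteq>\<^bsub>D\<^esub> z; x \<in> carrier D; y \<in> carrier D; z \<in> carrier D\<rbrakk> \<Longrightarrow> x \<sqsubseteq>\<^bsub>D\<^esub> z"
    by (rule le_trans)
  show "\<lbrakk>x \<sqsubseteq>\<^bsub>D\<^esub> y; y \<sqsubseteq>\<^bsub>D\<^esub> x; x \<in> carrier D; y \<in> carrier D\<rbrakk> \<Longrightarrow> x = y"
    by (rule le_antisym)
qed

lemma directed_finite_upper:
  assumes "partial_order D" "directed D S" "finite F" "F \<subseteq> S"
  shows "\<exists>z\<in>S. \<forall>x\<in>F. x \<sqsubseteq>\<^bsub>D\<^esub> z"
  using assms(3,4)
proof (induction F)
  case empty
  then show ?case using assms(2) by (auto simp: directed_def)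
next
  case (insert a F)
  then obtain z where z: "z \<in> S" "\<forall>x\<in>F. x \<sqsubseteq>\<^bsub>D\<^esub> z" by auto
  have "a \<in> S" using insert.prems by simp
  then obtain w where w: "w \<in> S" "z \<sqsubseteq>\<^bsub>D\<^esub> w" "a \<sqsubseteq>\<^bsub>D\<^esub> w" using directed_upper[OF assms(2) z(1)] by blast
  have sub: "\<And>x. x \<in> S \<Longrightarrow> x \<in> carrier D" using directed_subset[OF assms(2)] by blast
  have "x \<sqsubseteq>\<^bsub>D\<^esub> w" if "x \<in> insert a F" for x
  proof (cases "x = a")
    case False
    then have x: "x \<in> F" using that by simp
    show ?thesis
      by (rule partial_order_trans[OF assms(1) bspec[OF z(2) x] w(2)])
        (use x insert.prems sub z(1) w(1) in auto)
  qed (use w in simp)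
  with w show ?case by blast
qed

lemma directed_image:
  assumes "directed D S" "h \<in> S \<rightarrow> carrier E"
    and "\<And>x y. \<lbrakk>x \<in> S; y \<in> S; x \<sqsubseteq>\<^bsub>D\<^esub> y\<rbrakk> \<Longrightarrow> h x \<sqsubseteq>\<^bsub>E\<^esub> h y"
  shows "directed E (h ` S)"
proof -
  have "\<exists>z\<in>h ` S. h x \<sqsubseteq>\<^bsub>E\<^esub> z \<and> h y \<sqsubseteq>\<^bsub>E\<^esub> z" if "x \<in> S" "y \<in> S" for x y
    using assms(1) that assms(3) unfolding directed_def by blast
  then show ?thesis using assms(1,2) unfolding directed_def by blast
qed

lemma scott_continuousD:
  assumes "scott_continuous D E f"
  shows scott_continuous_closed: "x \<in> carrier D \<Longrightarrow> f x \<in> carrier E"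
    and scott_continuous_mono: "\<lbrakk>x \<in> carrier D; y \<in> carrier D; x \<sqsubseteq>\<^bsub>D\<^esub> y\<rbrakk> \<Longrightarrow> f x \<sqsubseteq>\<^bsub>E\<^esub> f y"
    and scott_continuous_lub: "\<lbrakk>directed D S; is_lub D s S\<rbrakk> \<Longrightarrow> is_lub E (f s) (f ` S)"
    and scott_continuous_directed: "directed D S \<Longrightarrow> directed E (f ` S)"
proof -
  show closed: "f x \<in> carrier E" if "x \<in> carrier D" for x
    using assms that unfolding scott_continuous_def by blast
  show mono: "f x \<sqsubseteq>\<^bsub>E\<^esub> f y" if "x \<in> carrier D" "y \<in> carrier D" "x \<sqsubseteq>\<^bsub>D\<^esub> y" for x y
    using assms that unfolding scott_continuous_def by blast
  show "is_lub E (f s) (f ` S)" if "directed D S" "is_lub D s S" for S s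
    using assms that unfolding scott_continuous_def by blast
  show "directed E (f ` S)" if "directed D S" for S
    by (rule directed_image[OF that]) (use closed mono directed_subset[OF that] in blast)+
qed

lemma scott_opensD:
  assumes "U \<in> scott_opens D"
  shows scott_opens_subset: "U \<subseteq> carrier D"
    and scott_opens_up: "\<lbrakk>x \<in> U; y \<in> carrier D; x \<sqsubseteq>\<^bsub>D\<^esub> y\<rbrakk> \<Longrightarrow> y \<in> U"
    and scott_opens_lub: "\<lbrakk>directed D S; is_lub D s S; s \<in> U\<rbrakk> \<Longrightarrow> \<exists>x\<in>S. x \<in> U"
  using assms unfolding scott_opens_def by auto

lemma scott_opensI:
  assumes "U \<subseteq> carrier D"
    and "\<And>x y. \<lbrakk>x \<in> U; y \<in> carrier D; x \<sqsubseteq>\<^bsub>D\<^esub> y\<rbrakk> \<Longrightarrow> y \<in> U"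
    and "\<And>S s. \<lbrakk>directed D S; is_lub D s S; s \<in> U\<rbrakk> \<Longrightarrow> \<exists>x\<in>S. x \<in> U"
  shows "U \<in> scott_opens D"
  using assms unfolding scott_opens_def by (simp add: disjoint_iff) blast

lemma scott_opens_Union:
  assumes "W \<subseteq> scott_opens D" shows "\<Union>W \<in> scott_opens D"
proof (rule scott_opensI)
  show "\<Union>W \<subseteq> carrier D" using assms by (auto dest: scott_opens_subset)
next
  fix x y assume "x \<in> \<Union>W" "y \<in> carrier D" "x \<sqsubseteq>\<^bsub>D\<^esub> y"
  then show "y \<in> \<Union>W" using assms by (auto dest: scott_opens_up)
next
  fix S s assume S: "directed D S" "is_lub D s S" and "s \<in> \<Union>W"
  then obtain U where U: "U \<in> W" "s \<in> U" by blast
  then show "\<exists>x\<in>S. x \<in> \<Union>W" using scott_opens_lub[OF _ S, of U] assms by blast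
qed

lemma scott_opens_empty: "{} \<in> scott_opens D"
  using scott_opens_Union[of "{}" D] by simp

lemma scott_opens_Un: "\<lbrakk>U \<in> scott_opens D; V \<in> scott_opens D\<rbrakk> \<Longrightarrow> U \<union> V \<in> scott_opens D"
  using scott_opens_Union[of "{U, V}" D] by simp

lemma scott_opens_Int:
  assumes U: "U \<in> scott_opens D" and V: "V \<in> scott_opens D"
  shows "U \<inter> V \<in> scott_opens D"
proof (rule scott_opensI)
  show "U \<inter> V \<subseteq> carrier D" using scott_opens_subset[OF U] by blast
next
  fix x y assume "x \<in> U \<inter> V" "y \<in> carrier D" "x \<sqsubseteq>\<^bsub>D\<^esub> y"
  then show "y \<in> U \<inter> V" using scott_opens_up[OF U, of x y] scott_opens_up[OF V, of x y] by blast
next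
  fix S s assume S: "directed D S" "is_lub D s S" and s: "s \<in> U \<inter> V"
  then obtain x y where x: "x \<in> S" "x \<in> U" and y: "y \<in> S" "y \<in> V"
    using scott_opens_lub[OF U S] scott_opens_lub[OF V S] by blast
  obtain z where z: "z \<in> S" "x \<sqsubseteq>\<^bsub>D\<^esub> z" "y \<sqsubseteq>\<^bsub>D\<^esub> z" using directed_upper[OF S(1) x(1) y(1)] .
  then have "z \<in> carrier D" using S(1) by (auto simp: directed_def)
  with x y z have "z \<in> U \<inter> V" using scott_opens_up[OF U, of x z] scott_opens_up[OF V, of y z] by blast
  with z show "\<exists>x\<in>S. x \<in> U \<inter> V" by blast
qed

lemma scott_continuous_preimage:
  assumes f: "scott_continuous D E f" and U: "U \<in> scott_opens E"
  shows "{x \<in> carrier D. f x \<in> U} \<in> scott_opens D"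
proof (rule scott_opensI)
  fix x y assume "x \<in> {x \<in> carrier D. f x \<in> U}" "y \<in> carrier D" "x \<sqsubseteq>\<^bsub>D\<^esub> y"
  then show "y \<in> {x \<in> carrier D. f x \<in> U}"
    using scott_opens_up[OF U] scott_continuous_closed[OF f] scott_continuous_mono[OF f] by blast
next
  fix S s assume S: "directed D S" "is_lub D s S" and s: "s \<in> {x \<in> carrier D. f x \<in> U}"
  then have "\<exists>x\<in>f ` S. x \<in> U"
    using scott_opens_lub[OF U scott_continuous_directed[OF f S(1)] scott_continuous_lub[OF f S]] by blast
  then show "\<exists>x\<in>S. x \<in> {x \<in> carrier D. f x \<in> U}" using directed_subset[OF S(1)] by blast
qed blast

text \<open>Scott continuity into [0,1] is proved and used through this epsilon form
  throughout.\<close>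

lemma real_lub_eps:
  fixes g :: "'a \<Rightarrow> real"
  assumes "directed unit_interval (g ` S)"
  shows "is_lub unit_interval m (g ` S) \<longleftrightarrow>
    m \<in> {0..1} \<and> (\<forall>x\<in>S. g x \<le> m) \<and> (\<forall>e>0. \<exists>x\<in>S. m < g x + e)"
proof -
  have sub: "g x \<in> {0..1}" if "x \<in> S" for x
    using assms that by (force simp: directed_def unit_interval_def)
  have ne: "S \<noteq> {}" using assms by (auto simp: directed_def)
  have "(\<forall>u\<in>{0..1}. (\<forall>x\<in>S. g x \<le> u) \<longrightarrow> m \<le> u) \<longleftrightarrow> (\<forall>e>0. \<exists>x\<in>S. m < g x + e)"
    if m: "m \<in> {0..1}" and ub: "\<forall>x\<in>S. g x \<le> m"
    for m
  proof (intro iffI allI impI ballI)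
    fix e :: real assume L: "\<forall>u\<in>{0..1}. (\<forall>x\<in>S. g x \<le> u) \<longrightarrow> m \<le> u" and e: "e > 0"
    show "\<exists>x\<in>S. m < g x + e"
    proof (rule ccontr)
      assume "\<not> ?thesis"
      then have le: "\<forall>x\<in>S. g x \<le> m - e" by force
      \<comment> \<open>\<open>m - e\<close> dominates some \<open>g x\<close> and is therefore a
        legitimate competitor in the carrier [0,1].\<close>
      moreover from le ne sub have "0 \<le> m - e" by (meson atLeastAtMost_iff ex_in_conv order_trans)
      ultimately show False using L m e by (auto dest!: bspec[of _ _ "m - e"])
    qed
  next
    fix u :: real assume E: "\<forall>e>0. \<exists>x\<in>S. m < g x + e" and u: "\<forall>x\<in>S. g x \<le> u"
    show "m \<le> u"
    proof (rule field_le_epsilon)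
      fix e :: real assume "0 < e"
      with E u show "m \<le> u + e" by force
    qed
  qed
  then have "m \<in> {0..1} \<and> (\<forall>x\<in>S. g x \<le> m) \<and> (\<forall>u\<in>{0..1}. (\<forall>x\<in>S. g x \<le> u) \<longrightarrow> m \<le> u) \<longleftrightarrow>
    m \<in> {0..1} \<and> (\<forall>x\<in>S. g x \<le> m) \<and> (\<forall>e>0. \<exists>x\<in>S. m < g x + e)"
    by (intro conj_cong refl)
  then show ?thesis
    unfolding directed_is_lub_iff[OF assms] by (simp add: unit_interval_def)
qed

lemma scott_continuous_unit_interval_iff:
  "scott_continuous D unit_interval f \<longleftrightarrow>
    (\<forall>x\<in>carrier D. 0 \<le> f x \<and> f x \<le> 1) \<and>
    (\<forall>x\<in>carrier D. \<forall>y\<in>carrier D. x \<sqsubseteq>\<^bsub>D\<^esub> y \<longrightarrow> f x \<le> f y) \<and>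
    (\<forall>S s. directed D S \<and> is_lub D s S \<longrightarrow> (\<forall>e>0. \<exists>x\<in>S. f s < f x + e))"
  (is "?L \<longleftrightarrow> ?R")
proof
  assume L: ?L
  have "\<exists>x\<in>S. f s < f x + e" if "directed D S" "is_lub D s S" "e > 0" for S s e
    using real_lub_eps[OF scott_continuous_directed[OF L that(1)]] scott_continuous_lub[OF L that(1,2)] that(3)
    by blast
  then show ?R
    using scott_continuous_closed[OF L] scott_continuous_mono[OF L] by (auto simp: unit_interval_def)
next
  assume R: ?R
  have "is_lub unit_interval (f s) (f ` S)" if S: "directed D S" "is_lub D s S" for S s
  proof -
    have dir: "directed unit_interval (f ` S)"
      by (rule directed_image[OF S(1)]) (use R directed_subset[OF S(1)] in \<open>auto simp: unit_interval_def subset_iff\<close>)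
    have "s \<in> carrier D" "\<forall>x\<in>S. x \<sqsubseteq>\<^bsub>D\<^esub> s" using S(2) unfolding directed_is_lub_iff[OF S(1)] by auto
    moreover have "\<forall>e>0. \<exists>x\<in>S. f s < f x + e" using R S by blast
    ultimately show ?thesis
      unfolding real_lub_eps[OF dir] using R directed_subset[OF S(1)] by (simp add: subset_iff)
  qed
  then show ?L using R unfolding scott_continuous_def by (auto simp: unit_interval_def)
qed

lemma scott_open_greater:
  assumes "scott_continuous D unit_interval f"
  shows "{x \<in> carrier D. t < f x} \<in> scott_opens D"
proof (rule scott_opensI)
  fix x y assume "x \<in> {x \<in> carrier D. t < f x}" "y \<in> carrier D" "x \<sqsubseteq>\<^bsub>D\<^esub> y"
  then show "y \<in> {x \<in> carrier D. t < f x}"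
    using assms unfolding scott_continuous_unit_interval_iff by force
next
  fix S s assume S: "directed D S" "is_lub D s S" "s \<in> {x \<in> carrier D. t < f x}"
  then have "f s - t > 0" by simp
  with S assms obtain x where "x \<in> S" "f s < f x + (f s - t)"
    unfolding scott_continuous_unit_interval_iff by meson
  then show "\<exists>x\<in>S. x \<in> {x \<in> carrier D. t < f x}" using directed_subset[OF S(1)] by auto
qed blast

section \<open>Approximation from below\<close>

text \<open>For \<open>X = carrier D\<close> this is continuity of the order at x; a smaller X plays
  the role of a basis. Asking for some directed set of approximants avoids showing that all elements
  way below x form a directed set.\<close>

definition approximable :: "('a, 'm) gorder_scheme \<Rightarrow> 'a set \<Rightarrow> 'a \<Rightarrow> bool" where
  "approximable D X x \<longleftrightarrow> (\<exists>S\<subseteq>X. directed D S \<and> is_lub D x S \<and> (\<forall>d\<in>S. way_below D d x))"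

lemma way_below_le_trans:
  assumes "partial_order D" "way_below D x y" "y \<sqsubseteq>\<^bsub>D\<^esub> z" "z \<in> carrier D"
  shows "way_below D x z"
  unfolding way_below_def
proof (intro conjI allI impI)
  show "x \<in> carrier D" using assms(2) by (simp add: way_below_def)
  fix S s assume S: "directed D S \<and> is_lub D s S \<and> z \<sqsubseteq>\<^bsub>D\<^esub> s"
  then have "s \<in> carrier D" using directed_is_lub_iff by blast
  then have "y \<sqsubseteq>\<^bsub>D\<^esub> s"
    using S assms partial_order_trans[OF assms(1), of y z s] by (simp add: way_below_def)
  then show "\<exists>d\<in>S. x \<sqsubseteq>\<^bsub>D\<^esub> d" using assms(2) S by (auto simp: way_below_def)
qed fact

lemma le_way_below_trans:
  assumes "partial_order D" "x \<sqsubseteq>\<^bsub>D\<^esub> y" "x \<in> carrier D" "way_below D y z"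
  shows "way_below D x z"
  unfolding way_below_def
proof (intro conjI allI impI)
  show "z \<in> carrier D" using assms(4) by (simp add: way_below_def)
  fix S s assume S: "directed D S \<and> is_lub D s S \<and> z \<sqsubseteq>\<^bsub>D\<^esub> s"
  then obtain d where d: "d \<in> S" "y \<sqsubseteq>\<^bsub>D\<^esub> d" using assms(4) unfolding way_below_def by blast
  have "y \<in> carrier D" "d \<in> carrier D"
    using assms(4) d S directed_subset unfolding way_below_def by auto
  with d assms(2,3) show "\<exists>d\<in>S. x \<sqsubseteq>\<^bsub>D\<^esub> d" using partial_order_trans[OF assms(1), of x y d] by blast
qed fact

lemma way_below_imp_le:
  assumes "partial_order D" "way_below D x y"
  shows "x \<sqsubseteq>\<^bsub>D\<^esub> y"
proof -
  have y: "y \<in> carrier D" using assms(2) by (simp add: way_below_def)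
  have d: "directed D {y}" using y partial_order_refl[OF assms(1)] by (simp add: directed_def)
  have "is_lub D y {y}"
    using y partial_order_refl[OF assms(1)] unfolding directed_is_lub_iff[OF d] by simp
  then show ?thesis
    using assms(2) d partial_order_refl[OF assms(1) y] unfolding way_below_def by blast
qed

text \<open>For d way below s and e way below t, choose z in S above s and t. Then both are way
  below z, hence below members of the directed set \<open>T z\<close>, which has an upper bound of
  these two. This one argument gives the closure of approximability under suprema and also
  interpolation.\<close>

lemma directed_approximants:
  assumes po: "partial_order D" and S: "directed D S" "is_lub D x S"
    and T: "\<And>s. s \<in> S \<Longrightarrow> directed D (T s) \<and> is_lub D s (T s) \<and> (\<forall>d\<in>T s. way_below D d s)"
  shows "directed D (\<Union>(T ` S)) \<and> is_lub D x (\<Union>(T ` S)) \<and> (\<forall>d\<in>\<Union>(T ` S). way_below D d x)"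
proof -
  note tr = partial_order_trans[OF po]
  have x: "x \<in> carrier D" and ub: "\<And>s. s \<in> S \<Longrightarrow> s \<sqsubseteq>\<^bsub>D\<^esub> x"
    and lub: "\<And>u. \<lbrakk>u \<in> carrier D; \<forall>s\<in>S. s \<sqsubseteq>\<^bsub>D\<^esub> u\<rbrakk> \<Longrightarrow> x \<sqsubseteq>\<^bsub>D\<^esub> u"
    using S(2) unfolding directed_is_lub_iff[OF S(1)] by auto
  have TC: "\<And>s t. \<lbrakk>s \<in> S; t \<in> T s\<rbrakk> \<Longrightarrow> t \<in> carrier D" using T directed_subset by blast
  have SC: "\<And>s. s \<in> S \<Longrightarrow> s \<in> carrier D" using directed_subset[OF S(1)] by blast
  have wb: "way_below D d x" if "s \<in> S" "d \<in> T s" for s d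
    using that T ub x way_below_le_trans[OF po, of d s x] by blast
  have "\<exists>w\<in>\<Union>(T ` S). d \<sqsubseteq>\<^bsub>D\<^esub> w \<and> e \<sqsubseteq>\<^bsub>D\<^esub> w"
    if d: "s \<in> S" "d \<in> T s" and e: "t \<in> S" "e \<in> T t" for s t d e
  proof -
    obtain z where z: "z \<in> S" "s \<sqsubseteq>\<^bsub>D\<^esub> z" "t \<sqsubseteq>\<^bsub>D\<^esub> z" using directed_upper[OF S(1) d(1) e(1)] .
    have "way_below D d z" "way_below D e z"
      using way_below_le_trans[OF po, of d s z] way_below_le_trans[OF po, of e t z] z d e T SC by blast+
    moreover have Tz: "directed D (T z)" "is_lub D z (T z)" using T[OF z(1)] by auto
    ultimately obtain d' e' where d': "d' \<in> T z" "d \<sqsubseteq>\<^bsub>D\<^esub> d'" and e': "e' \<in> T z" "e \<sqsubseteq>\<^bsub>D\<^esub> e'"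
      using partial_order_refl[OF po SC[OF z(1)]] unfolding way_below_def by meson
    obtain w where w: "w \<in> T z" "d' \<sqsubseteq>\<^bsub>D\<^esub> w" "e' \<sqsubseteq>\<^bsub>D\<^esub> w"
      using directed_upper[OF Tz(1) d'(1) e'(1)] .
    have "d \<sqsubseteq>\<^bsub>D\<^esub> w" "e \<sqsubseteq>\<^bsub>D\<^esub> w"
      using tr[OF d'(2) w(2)] tr[OF e'(2) w(3)] TC[OF d] TC[OF e] TC[OF z(1)] d'(1) e'(1) w(1) by simp_all
    then show ?thesis using z(1) w(1) by blast
  qed
  moreover have "\<Union>(T ` S) \<noteq> {}"
  proof -
    obtain s where s: "s \<in> S" using S(1) by (auto simp: directed_def)
    then have "T s \<noteq> {}" using T[OF s] by (simp add: directed_def)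
    with s show ?thesis by blast
  qed
  ultimately have dir: "directed D (\<Union>(T ` S))"
    using TC unfolding directed_def by (auto simp del: bex_simps ball_simps)
  have "is_lub D x (\<Union>(T ` S))"
    unfolding directed_is_lub_iff[OF dir]
  proof (intro conjI ballI impI)
    fix y assume "y \<in> \<Union>(T ` S)"
    then show "y \<sqsubseteq>\<^bsub>D\<^esub> x" using wb way_below_imp_le[OF po] by blast
  next
    fix u assume u: "u \<in> carrier D" "\<forall>y\<in>\<Union>(T ` S). y \<sqsubseteq>\<^bsub>D\<^esub> u"
    have "s \<sqsubseteq>\<^bsub>D\<^esub> u" if "s \<in> S" for s
      using u that T[OF that] directed_is_lub_iff[of D "T s" s] by blast
    then show "x \<sqsubseteq>\<^bsub>D\<^esub> u" using lub u by blast
  qed (rule x)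
  with dir wb show ?thesis by blast
qed

lemma approximable_directed_lub:
  assumes "partial_order D" "directed D S" "is_lub D x S" "\<forall>s\<in>S. approximable D X s"
  shows "approximable D X x"
proof -
  from assms(4) obtain T where T: "\<And>s. s \<in> S \<Longrightarrow> T s \<subseteq> X \<and> directed D (T s) \<and> is_lub D s (T s) \<and> (\<forall>d\<in>T s. way_below D d s)"
    unfolding approximable_def by metis
  have "directed D (\<Union>(T ` S)) \<and> is_lub D x (\<Union>(T ` S)) \<and> (\<forall>d\<in>\<Union>(T ` S). way_below D d x)"
    using directed_approximants[OF assms(1-3), of T] T by blast
  moreover have "\<Union>(T ` S) \<subseteq> X" using T by blast
  ultimately show ?thesis unfolding approximable_def by blast
qed

text \<open>Interpolation: the approximants of the members of S form a directed set with the same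
  supremum s, so y lies below some d that is itself way below a member of S.\<close>

lemma scott_open_way_above:
  assumes po: "partial_order D" and dom: "\<And>x. x \<in> carrier D \<Longrightarrow> approximable D (carrier D) x"
  shows "{x. way_below D y x} \<in> scott_opens D"
proof (rule scott_opensI)
  show "{x. way_below D y x} \<subseteq> carrier D" by (auto simp: way_below_def)
  fix x z assume "x \<in> {x. way_below D y x}" "z \<in> carrier D" "x \<sqsubseteq>\<^bsub>D\<^esub> z"
  then show "z \<in> {x. way_below D y x}" using way_below_le_trans[OF po] by blast
next
  fix S s assume S: "directed D S" "is_lub D s S" "s \<in> {x. way_below D y x}"
  then have sc: "s \<in> carrier D" and y: "y \<in> carrier D" by (auto simp: way_below_def)
  have "\<forall>s\<in>S. \<exists>T. directed D T \<and> is_lub D s T \<and> (\<forall>d\<in>T. way_below D d s)"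
    using dom directed_subset[OF S(1)] unfolding approximable_def by blast
  then obtain T where T: "\<And>s. s \<in> S \<Longrightarrow> directed D (T s) \<and> is_lub D s (T s) \<and> (\<forall>d\<in>T s. way_below D d s)"
    by metis
  have "directed D (\<Union>(T ` S)) \<and> is_lub D s (\<Union>(T ` S))"
    using directed_approximants[OF po S(1,2), of T] T by blast
  then obtain d t where "t \<in> S" "d \<in> T t" "y \<sqsubseteq>\<^bsub>D\<^esub> d"
    using S(3) partial_order_refl[OF po sc] unfolding way_below_def by blast
  then show "\<exists>x\<in>S. x \<in> {x. way_below D y x}"
    using le_way_below_trans[OF po, of y d t] T y by blast
qed

section \<open>Valuations\<close>

lemma directed_opens_Union_lub:
  assumes "directed (opens_order D) W"
  shows "is_lub (opens_order D) (\<Union>W) W"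
proof -
  have W: "W \<subseteq> scott_opens D" using directed_subset[OF assms] by (simp add: opens_order_def)
  show ?thesis
    unfolding directed_is_lub_iff[OF assms]
    using scott_opens_Union[OF W] by (auto simp: opens_order_def)
qed

lemma opens_lub_eq_Union:
  assumes "directed (opens_order D) W" "is_lub (opens_order D) U W"
  shows "U = \<Union>W"
proof (rule antisym)
  have W: "W \<subseteq> scott_opens D" using directed_subset[OF assms(1)] by (simp add: opens_order_def)
  show "U \<subseteq> \<Union>W"
    using assms(2) scott_opens_Union[OF W] unfolding directed_is_lub_iff[OF assms(1)]
    by (auto simp: opens_order_def)
  show "\<Union>W \<subseteq> U"
    using assms(2) unfolding directed_is_lub_iff[OF assms(1)] by (auto simp: opens_order_def)
qed

text \<open>Directed suprema in \<open>opens_order\<close> are unions, so continuity has to be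
  tested at \<open>\<Union>W\<close> only.\<close>

lemma valuations_iff:
  "\<nu> \<in> valuations D \<longleftrightarrow> \<nu> \<in> extensional (scott_opens D) \<and>
    (\<forall>U\<in>scott_opens D. 0 \<le> \<nu> U \<and> \<nu> U \<le> 1) \<and>
    (\<forall>U\<in>scott_opens D. \<forall>V\<in>scott_opens D. U \<subseteq> V \<longrightarrow> \<nu> U \<le> \<nu> V) \<and>
    (\<forall>W. directed (opens_order D) W \<longrightarrow> (\<forall>e>0. \<exists>U\<in>W. \<nu> (\<Union>W) < \<nu> U + e)) \<and>
    \<nu> {} = 0 \<and>
    (\<forall>U\<in>scott_opens D. \<forall>V\<in>scott_opens D. \<nu> U + \<nu> V = \<nu> (U \<union> V) + \<nu> (U \<inter> V))"
proof -
  have "(\<forall>W s. directed (opens_order D) W \<and> is_lub (opens_order D) s W \<longrightarrow> (\<forall>e>0. \<exists>U\<in>W. \<nu> s < \<nu> U + e))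
    \<longleftrightarrow> (\<forall>W. directed (opens_order D) W \<longrightarrow> (\<forall>e>0. \<exists>U\<in>W. \<nu> (\<Union>W) < \<nu> U + e))"
    using directed_opens_Union_lub[of D] opens_lub_eq_Union[of D] by metis
  then show ?thesis
    unfolding valuations_def scott_continuous_unit_interval_iff
    by (simp add: opens_order_def)
qed

lemma valuationsD:
  assumes "\<nu> \<in> valuations D"
  shows valuation_extensional: "\<nu> \<in> extensional (scott_opens D)"
    and valuation_nonneg: "U \<in> scott_opens D \<Longrightarrow> 0 \<le> \<nu> U"
    and valuation_le_1: "U \<in> scott_opens D \<Longrightarrow> \<nu> U \<le> 1"
    and valuation_mono: "\<lbrakk>U \<in> scott_opens D; V \<in> scott_opens D; U \<subseteq> V\<rbrakk> \<Longrightarrow> \<nu> U \<le> \<nu> V"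
    and valuation_continuous: "\<lbrakk>directed (opens_order D) W; e > 0\<rbrakk> \<Longrightarrow> \<exists>U\<in>W. \<nu> (\<Union>W) < \<nu> U + e"
    and valuation_empty: "\<nu> {} = 0"
    and valuation_modular: "\<lbrakk>U \<in> scott_opens D; V \<in> scott_opens D\<rbrakk> \<Longrightarrow> \<nu> U + \<nu> V = \<nu> (U \<union> V) + \<nu> (U \<inter> V)"
  using assms unfolding valuations_iff by simp_all

lemma real_le_epsI:
  fixes x y :: real
  assumes "\<And>e. e > 0 \<Longrightarrow> x < y + e" shows "x \<le> y"
  by (rule field_le_epsilon) (rule less_imp_le[OF assms])

definition val_le :: "('a, 'm) gorder_scheme \<Rightarrow> ('a set \<Rightarrow> real) \<Rightarrow> ('a set \<Rightarrow> real) \<Rightarrow> bool" where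
  "val_le D \<nu> \<xi> \<longleftrightarrow> (\<forall>U\<in>scott_opens D. \<nu> U \<le> \<xi> U)"

text \<open>The supremum taken pointwise. It does not refer to a carrier order, so the same notion
  describes suprema in \<open>V_dcpo\<close> and in \<open>M_dcpo\<close>.\<close>

definition val_sup :: "('a, 'm) gorder_scheme \<Rightarrow> ('a set \<Rightarrow> real) set \<Rightarrow> ('a set \<Rightarrow> real) \<Rightarrow> bool" where
  "val_sup D S s \<longleftrightarrow> s \<in> valuations D \<and> (\<forall>\<nu>\<in>S. val_le D \<nu> s) \<and>
     (\<forall>U\<in>scott_opens D. \<forall>e>0. \<exists>\<nu>\<in>S. s U < \<nu> U + e)"

definition val_directed :: "('a, 'm) gorder_scheme \<Rightarrow> ('a set \<Rightarrow> real) set \<Rightarrow> bool" where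
  "val_directed D S \<longleftrightarrow> S \<subseteq> valuations D \<and> S \<noteq> {} \<and>
     (\<forall>\<nu>\<in>S. \<forall>\<xi>\<in>S. \<exists>\<zeta>\<in>S. val_le D \<nu> \<zeta> \<and> val_le D \<xi> \<zeta>)"

lemma val_leD: "\<lbrakk>val_le D \<nu> \<xi>; U \<in> scott_opens D\<rbrakk> \<Longrightarrow> \<nu> U \<le> \<xi> U"
  by (simp add: val_le_def)

lemma val_le_refl: "val_le D \<nu> \<nu>"
  by (simp add: val_le_def)

lemma val_le_trans: "\<lbrakk>val_le D \<nu> \<xi>; val_le D \<xi> \<zeta>\<rbrakk> \<Longrightarrow> val_le D \<nu> \<zeta>"
  by (force simp: val_le_def)

lemma val_le_antisym:
  assumes "\<nu> \<in> valuations D" "\<xi> \<in> valuations D" "val_le D \<nu> \<xi>" "val_le D \<xi> \<nu>"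
  shows "\<nu> = \<xi>"
  by (rule extensionalityI[OF assms(1,2)[THEN valuation_extensional]])
    (use assms(3,4) in \<open>force simp: val_le_def\<close>)

lemma V_dcpo_simps [simp]:
  "carrier (V_dcpo D) = valuations D" "\<nu> \<sqsubseteq>\<^bsub>V_dcpo D\<^esub> \<xi> \<longleftrightarrow> val_le D \<nu> \<xi>" "\<nu> .=\<^bsub>V_dcpo D\<^esub> \<xi> \<longleftrightarrow> \<nu> = \<xi>"
  by (simp_all add: V_dcpo_def val_le_def)

lemma M_dcpo_simps [simp]:
  "carrier (M_dcpo D) = M_carrier D" "\<nu> \<sqsubseteq>\<^bsub>M_dcpo D\<^esub> \<xi> \<longleftrightarrow> val_le D \<nu> \<xi>" "\<nu> .=\<^bsub>M_dcpo D\<^esub> \<xi> \<longleftrightarrow> \<nu> = \<xi>"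
  by (simp_all add: M_dcpo_def val_le_def)

text \<open>The pointwise supremum is a valuation. Directedness matters for modularity, where a
  single valuation must be nearly maximal on two open sets at once.\<close>

lemma val_sup_exists:
  assumes S: "val_directed D S"
  shows "\<exists>s. val_sup D S s"
proof -
  have SV: "\<And>\<nu>. \<nu> \<in> S \<Longrightarrow> \<nu> \<in> valuations D" and ne: "S \<noteq> {}"
    using S by (auto simp: val_directed_def)
  have up: "\<exists>\<zeta>\<in>S. val_le D \<nu> \<zeta> \<and> val_le D \<xi> \<zeta>" if "\<nu> \<in> S" "\<xi> \<in> S" for \<nu> \<xi>
    using S that by (auto simp: val_directed_def)
  define s where "s = (\<lambda>U\<in>scott_opens D. SUP \<nu>\<in>S. \<nu> U)"
  have bdd: "bdd_above ((\<lambda>\<nu>. \<nu> U) ` S)" if "U \<in> scott_opens D" for U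
    using valuation_le_1[OF SV that] by (intro bdd_aboveI[of _ 1]) auto
  have ub: "\<nu> U \<le> s U" if "U \<in> scott_opens D" "\<nu> \<in> S" for U \<nu>
    using cSUP_upper[OF that(2) bdd[OF that(1)]] that(1) by (simp add: s_def)
  have lub: "s U \<le> c" if "U \<in> scott_opens D" "\<And>\<nu>. \<nu> \<in> S \<Longrightarrow> \<nu> U \<le> c" for U c
    using cSUP_least[OF ne that(2)] that(1) by (simp add: s_def)
  have eps: "\<exists>\<nu>\<in>S. s U < \<nu> U + e" if "U \<in> scott_opens D" "e > 0" for U and e :: real
  proof (rule ccontr)
    assume "\<not> ?thesis"
    then have "s U \<le> s U - e" by (intro lub that(1)) force
    with that(2) show False by simp
  qed
  obtain \<nu>0 where \<nu>0: "\<nu>0 \<in> S" using ne by blast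
  have "s \<in> valuations D"
    unfolding valuations_iff
  proof (intro conjI ballI allI impI)
    show "s \<in> extensional (scott_opens D)" by (simp add: s_def)
    show "0 \<le> s U" if "U \<in> scott_opens D" for U
      using ub[OF that \<nu>0] valuation_nonneg[OF SV[OF \<nu>0] that] by simp
    show "s U \<le> 1" if "U \<in> scott_opens D" for U
      by (rule lub[OF that]) (rule valuation_le_1[OF SV that])
    show "s U \<le> s V" if "U \<in> scott_opens D" "V \<in> scott_opens D" "U \<subseteq> V" for U V
      by (rule lub[OF that(1)]) (use valuation_mono[OF SV that] ub[OF that(2)] in force)
    show "s {} = 0"
      using lub[OF scott_opens_empty, of 0] ub[OF scott_opens_empty \<nu>0] valuation_empty[OF SV]
        valuation_empty[OF SV[OF \<nu>0]] by force
  next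
    fix W and e :: real assume W: "directed (opens_order D) W" and e: "e > 0"
    have WO: "W \<subseteq> scott_opens D" using directed_subset[OF W] by (simp add: opens_order_def)
    obtain \<nu> where \<nu>: "\<nu> \<in> S" "s (\<Union>W) < \<nu> (\<Union>W) + e/2"
      using eps[OF scott_opens_Union[OF WO], of "e/2"] e by auto
    obtain U where U: "U \<in> W" "\<nu> (\<Union>W) < \<nu> U + e/2"
      using valuation_continuous[OF SV[OF \<nu>(1)] W, of "e/2"] e by auto
    have "\<nu> U \<le> s U" using ub[OF _ \<nu>(1)] U(1) WO by blast
    with \<nu> U show "\<exists>U\<in>W. s (\<Union>W) < s U + e" by (intro bexI[of _ U]) auto
  next
    fix U V assume U: "U \<in> scott_opens D" and V: "V \<in> scott_opens D"
    note UV = scott_opens_Un[OF U V] scott_opens_Int[OF U V]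
    show "s U + s V = s (U \<union> V) + s (U \<inter> V)"
    proof (rule antisym)
      show "s U + s V \<le> s (U \<union> V) + s (U \<inter> V)"
      proof (rule real_le_epsI)
        fix e :: real assume e: "e > 0"
        obtain \<nu> where \<nu>: "\<nu> \<in> S" "s U < \<nu> U + e/2" using eps[OF U, of "e/2"] e by auto
        obtain \<xi> where \<xi>: "\<xi> \<in> S" "s V < \<xi> V + e/2" using eps[OF V, of "e/2"] e by auto
        obtain \<zeta> where \<zeta>: "\<zeta> \<in> S" "val_le D \<nu> \<zeta>" "val_le D \<xi> \<zeta>" using up[OF \<nu>(1) \<xi>(1)] by auto
        show "s U + s V < s (U \<union> V) + s (U \<inter> V) + e"
          using \<nu> \<xi> val_leD[OF \<zeta>(2) U] val_leD[OF \<zeta>(3) V] valuation_modular[OF SV[OF \<zeta>(1)] U V]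
            ub[OF UV(1) \<zeta>(1)] ub[OF UV(2) \<zeta>(1)] by linarith
      qed
      show "s (U \<union> V) + s (U \<inter> V) \<le> s U + s V"
      proof (rule real_le_epsI)
        fix e :: real assume e: "e > 0"
        obtain \<nu> where \<nu>: "\<nu> \<in> S" "s (U \<union> V) < \<nu> (U \<union> V) + e/2" using eps[OF UV(1), of "e/2"] e by auto
        obtain \<xi> where \<xi>: "\<xi> \<in> S" "s (U \<inter> V) < \<xi> (U \<inter> V) + e/2" using eps[OF UV(2), of "e/2"] e by auto
        obtain \<zeta> where \<zeta>: "\<zeta> \<in> S" "val_le D \<nu> \<zeta>" "val_le D \<xi> \<zeta>" using up[OF \<nu>(1) \<xi>(1)] by auto
        show "s (U \<union> V) + s (U \<inter> V) < s U + s V + e"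
          using \<nu> \<xi> val_leD[OF \<zeta>(2) UV(1)] val_leD[OF \<zeta>(3) UV(2)] valuation_modular[OF SV[OF \<zeta>(1)] U V]
            ub[OF U \<zeta>(1)] ub[OF V \<zeta>(1)] by linarith
      qed
    qed
  qed
  then have "val_sup D S s" using ub eps by (simp add: val_sup_def val_le_def)
  then show ?thesis by (rule exI[of _ s])
qed

lemma val_sup_least:
  assumes "val_sup D S s" "\<forall>\<nu>\<in>S. val_le D \<nu> u"
  shows "val_le D s u"
  unfolding val_le_def
proof
  fix U assume U: "U \<in> scott_opens D"
  show "s U \<le> u U"
  proof (rule real_le_epsI)
    fix e :: real assume "e > 0"
    then obtain \<nu> where "\<nu> \<in> S" "s U < \<nu> U + e" using assms(1) U unfolding val_sup_def by blast
    with assms(2) U show "s U < u U + e" by (force simp: val_le_def)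
  qed
qed

lemma val_directed_V: "directed (V_dcpo D) S \<longleftrightarrow> val_directed D S"
  by (simp add: directed_def val_directed_def)

text \<open>A pointwise supremum exists, so antisymmetry identifies any abstract least upper bound
  with it.\<close>

lemma is_lub_V_dcpo:
  assumes S: "val_directed D S"
  shows "is_lub (V_dcpo D) s S \<longleftrightarrow> val_sup D S s"
proof -
  note d = directed_is_lub_iff[OF iffD2[OF val_directed_V S], simplified]
  obtain t where t: "val_sup D S t" using val_sup_exists[OF S] ..
  show ?thesis
  proof
    assume L: "is_lub (V_dcpo D) s S"
    then have "val_le D s t" "val_le D t s"
      using t val_sup_least[OF t] unfolding d by (auto simp: val_sup_def)
    then have "s = t"
      using val_le_antisym[of s D t] L t unfolding d by (simp add: val_sup_def)
    with t show "val_sup D S s" by simp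
  next
    assume "val_sup D S s"
    then show "is_lub (V_dcpo D) s S"
      using val_sup_least unfolding d by (auto simp: val_sup_def)
  qed
qed

lemma sub_dcpo_V_iff:
  "sub_dcpo (V_dcpo D) X \<longleftrightarrow> X \<subseteq> valuations D \<and>
     (\<forall>S s. S \<subseteq> X \<and> val_directed D S \<and> val_sup D S s \<longrightarrow> s \<in> X)"
proof -
  have "(val_directed D S \<and> is_lub (V_dcpo D) s S) = (val_directed D S \<and> val_sup D S s)" for S s
    by (rule conj_cong[OF refl is_lub_V_dcpo])
  then show ?thesis unfolding sub_dcpo_def val_directed_V by simp
qed

lemma dirac_apply: "U \<in> scott_opens D \<Longrightarrow> dirac D x U = (if x \<in> U then 1 else 0)"
  by (simp add: dirac_def)

lemma simple_valuation_apply: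
  "U \<in> scott_opens D \<Longrightarrow> simple_valuation D l U = (\<Sum>(r, x)\<leftarrow>l. if x \<in> U then r else 0)"
  unfolding simple_valuation_def
  by (auto simp: dirac_apply intro!: arg_cong[of _ _ sum_list])

lemma sum_list_pair_mono:
  fixes f g :: "real \<Rightarrow> 'a \<Rightarrow> real"
  assumes "\<And>r x. (r, x) \<in> set l \<Longrightarrow> f r x \<le> g r x"
  shows "(\<Sum>(r, x)\<leftarrow>l. f r x) \<le> (\<Sum>(r, x)\<leftarrow>l. g r x)"
  using assms by (intro sum_list_mono) auto

lemma subconvexD:
  assumes "subconvex X l"
  shows "(r, x) \<in> set l \<Longrightarrow> 0 \<le> r" "(r, x) \<in> set l \<Longrightarrow> x \<in> X" "(\<Sum>(r, x)\<leftarrow>l. r) \<le> 1"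
  using assms by (auto simp: subconvex_def)

text \<open>Continuity holds with equality: the list has finitely many points, so one member of the
  directed family W already contains all those that lie in \<open>\<Union>W\<close>.\<close>

lemma simple_valuation_in_valuations:
  assumes l: "subconvex (carrier D) l"
  shows "simple_valuation D l \<in> valuations D"
proof -
  note nn = subconvexD(1)[OF l]
  let ?s = "\<lambda>U. \<Sum>(r, x)\<leftarrow>l. if x \<in> U then r else 0"
  have mono: "?s U \<le> ?s V" if "U \<subseteq> V" for U V
    by (rule sum_list_pair_mono) (use nn that in auto)
  have mod: "?s U + ?s V = ?s (U \<union> V) + ?s (U \<inter> V)" for U V
    by (induction l) auto
  have cont: "\<exists>U\<in>W. ?s (\<Union>W) = ?s U" if W: "directed (opens_order D) W" for W
  proof -
    have "\<exists>U\<in>W. \<forall>p\<in>set l'. snd p \<in> \<Union>W \<longrightarrow> snd p \<in> U" for l' :: "(real \<times> 'a) list"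
    proof (induction l')
      case Nil
      then show ?case using W by (auto simp: directed_def)
    next
      case (Cons p l')
      then obtain U where U: "U \<in> W" "\<forall>p\<in>set l'. snd p \<in> \<Union>W \<longrightarrow> snd p \<in> U" by blast
      show ?case
      proof (cases "snd p \<in> \<Union>W")
        case True
        then obtain V where V: "V \<in> W" "snd p \<in> V" by blast
        obtain Z where Z: "Z \<in> W" "U \<subseteq> Z" "V \<subseteq> Z"
          using directed_upper[OF W U(1) V(1)] by (auto simp: opens_order_def)
        have "\<forall>q\<in>set (p # l'). snd q \<in> \<Union>W \<longrightarrow> snd q \<in> Z"
        proof
          fix q assume "q \<in> set (p # l')"
          then show "snd q \<in> \<Union>W \<longrightarrow> snd q \<in> Z"
            using U(2) V(2) Z(2,3) by (cases "q = p") (simp_all add: subset_iff)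
        qed
        with Z(1) show ?thesis by blast
      next
        case False
        then have "\<forall>q\<in>set (p # l'). snd q \<in> \<Union>W \<longrightarrow> snd q \<in> U" using U(2) by simp
        with U(1) show ?thesis by blast
      qed
    qed
    then obtain U where U: "U \<in> W" "\<forall>p\<in>set l. snd p \<in> \<Union>W \<longrightarrow> snd p \<in> U" by blast
    have "?s (\<Union>W) = ?s U"
    proof (intro arg_cong[of _ _ sum_list] map_cong refl)
      fix p assume "p \<in> set l"
      then have "snd p \<in> \<Union>W \<longleftrightarrow> snd p \<in> U" using U by blast
      then show "(case p of (r, x) \<Rightarrow> if x \<in> \<Union>W then r else 0) = (case p of (r, x) \<Rightarrow> if x \<in> U then r else 0)"
        by (simp add: case_prod_unfold)
    qed
    with U(1) show ?thesis by blast
  qed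
  have "0 \<le> ?s U" for U
    using sum_list_pair_mono[of l "\<lambda>_ _. 0" "\<lambda>r x. if x \<in> U then r else 0"] nn by (simp add: case_prod_unfold)
  moreover have "?s U \<le> 1" for U
    using sum_list_pair_mono[of l "\<lambda>r x. if x \<in> U then r else 0" "\<lambda>r x. r"] nn subconvexD(3)[OF l] by force
  moreover have "\<exists>U\<in>W. simple_valuation D l (\<Union>W) < simple_valuation D l U + e"
    if W: "directed (opens_order D) W" and e: "e > 0" for W e
  proof -
    obtain U where U: "U \<in> W" "?s (\<Union>W) = ?s U" using cont[OF W] ..
    have WO: "W \<subseteq> scott_opens D" using directed_subset[OF W] by (simp add: opens_order_def)
    have "simple_valuation D l (\<Union>W) = ?s (\<Union>W)" "simple_valuation D l U = ?s U"
      using simple_valuation_apply[OF scott_opens_Union[OF WO]] simple_valuation_apply[of U] U(1) WO by blast+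
    then show ?thesis using U e by (intro bexI[of _ U]) simp_all
  qed
  moreover have "simple_valuation D l {} = 0"
    by (simp add: simple_valuation_apply scott_opens_empty case_prod_unfold)
  moreover have "simple_valuation D l \<in> extensional (scott_opens D)"
    by (simp add: simple_valuation_def)
  ultimately show ?thesis
    unfolding valuations_iff using mono mod
    by (auto simp: simple_valuation_apply scott_opens_Un scott_opens_Int)
qed

lemma M_carrier_subset: "M_carrier D \<subseteq> valuations D"
proof -
  have "sub_dcpo (V_dcpo D) (valuations D)"
    unfolding sub_dcpo_V_iff by (auto simp: val_sup_def)
  then show ?thesis
    unfolding M_carrier_def using simple_valuation_in_valuations by blast
qed

lemma simple_valuation_in_M: "subconvex (carrier D) l \<Longrightarrow> simple_valuation D l \<in> M_carrier D"
  unfolding M_carrier_def by blast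

lemma val_sup_in_M:
  assumes "S \<subseteq> M_carrier D" "val_directed D S" "val_sup D S s"
  shows "s \<in> M_carrier D"
  using assms unfolding M_carrier_def sub_dcpo_V_iff by blast

text \<open>The minimality of \<open>M_carrier\<close> as an induction rule: the members satisfying
  P form a sub-dcpo containing the simple valuations.\<close>

lemma M_carrier_induct [consumes 1, case_names simple sup]:
  assumes "\<nu> \<in> M_carrier D"
    and simple: "\<And>l. subconvex (carrier D) l \<Longrightarrow> P (simple_valuation D l)"
    and sup: "\<And>S s. \<lbrakk>S \<subseteq> M_carrier D; val_directed D S; val_sup D S s; \<And>\<nu>. \<nu> \<in> S \<Longrightarrow> P \<nu>\<rbrakk> \<Longrightarrow> P s"
  shows "P \<nu>"
proof -
  have "sub_dcpo (V_dcpo D) {\<nu> \<in> M_carrier D. P \<nu>}"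
    unfolding sub_dcpo_V_iff
  proof (intro conjI allI impI)
    show "{\<nu> \<in> M_carrier D. P \<nu>} \<subseteq> valuations D" using M_carrier_subset by blast
    fix S s assume S: "S \<subseteq> {\<nu> \<in> M_carrier D. P \<nu>} \<and> val_directed D S \<and> val_sup D S s"
    then have "s \<in> M_carrier D" using val_sup_in_M[of S D s] by blast
    moreover have "P s" using sup[of S s] S by blast
    ultimately show "s \<in> {\<nu> \<in> M_carrier D. P \<nu>}" by simp
  qed
  moreover have "simple_valuation D ` {l. subconvex (carrier D) l} \<subseteq> {\<nu> \<in> M_carrier D. P \<nu>}"
    using simple simple_valuation_in_M by blast
  ultimately show ?thesis using assms(1) unfolding M_carrier_def by blast
qed

lemma directed_M_iff: "directed (M_dcpo D) S \<longleftrightarrow> S \<subseteq> M_carrier D \<and> val_directed D S"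
  using M_carrier_subset[of D] by (auto simp: directed_def val_directed_def)

text \<open>\<open>M_carrier\<close> is closed under pointwise suprema, so passing to this smaller
  carrier creates no new least upper bounds.\<close>

lemma is_lub_M_dcpo:
  assumes S: "directed (M_dcpo D) S"
  shows "is_lub (M_dcpo D) s S \<longleftrightarrow> val_sup D S s"
proof -
  have SM: "S \<subseteq> M_carrier D" and dS: "val_directed D S" using S by (auto simp: directed_M_iff)
  note d = directed_is_lub_iff[OF S, simplified]
  obtain t where t: "val_sup D S t" using val_sup_exists[OF dS] ..
  have tM: "t \<in> M_carrier D" by (rule val_sup_in_M[OF SM dS t])
  show ?thesis
  proof
    assume L: "is_lub (M_dcpo D) s S"
    then have "val_le D s t" "val_le D t s"
      using t tM val_sup_least[OF t] unfolding d by (auto simp: val_sup_def)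
    moreover have "s \<in> valuations D" using L M_carrier_subset[of D] unfolding d by blast
    ultimately have "s = t" using val_le_antisym[of s D t] t by (simp add: val_sup_def)
    with t show "val_sup D S s" by simp
  next
    assume s: "val_sup D S s"
    then show "is_lub (M_dcpo D) s S"
      using val_sup_least[OF s] val_sup_in_M[OF SM dS s] unfolding d by (auto simp: val_sup_def)
  qed
qed

lemma partial_order_M: "partial_order (M_dcpo D)"
proof (rule partial_orderI)
  fix x y assume "x \<in> carrier (M_dcpo D)" "y \<in> carrier (M_dcpo D)" "x \<sqsubseteq>\<^bsub>M_dcpo D\<^esub> y" "y \<sqsubseteq>\<^bsub>M_dcpo D\<^esub> x"
  then show "x = y" using M_carrier_subset[of D] val_le_antisym[of x D y] by auto
qed (use val_le_trans in \<open>auto simp: val_le_refl\<close>)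

lemma scott_continuous_M_I:
  assumes "\<And>\<nu>. \<nu> \<in> M_carrier D \<Longrightarrow> f \<nu> \<in> carrier E"
    and "\<And>\<nu> \<xi>. \<lbrakk>\<nu> \<in> M_carrier D; \<xi> \<in> M_carrier D; val_le D \<nu> \<xi>\<rbrakk> \<Longrightarrow> f \<nu> \<sqsubseteq>\<^bsub>E\<^esub> f \<xi>"
    and "\<And>S s. \<lbrakk>S \<subseteq> M_carrier D; val_directed D S; val_sup D S s; s \<in> M_carrier D; directed E (f ` S)\<rbrakk> \<Longrightarrow> is_lub E (f s) (f ` S)"
  shows "scott_continuous (M_dcpo D) E f"
  unfolding scott_continuous_def
proof (intro conjI allI impI ballI)
  fix S s assume "directed (M_dcpo D) S \<and> is_lub (M_dcpo D) s S"
  then have S: "directed (M_dcpo D) S" and s: "val_sup D S s" using is_lub_M_dcpo by blast+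
  have SM: "S \<subseteq> M_carrier D" and dS: "val_directed D S" using S by (auto simp: directed_M_iff)
  have "directed E (f ` S)"
    by (rule directed_image[OF S]) (use SM assms(1,2) in \<open>auto simp: subset_iff\<close>)
  then show "is_lub E (f s) (f ` S)"
    by (rule assms(3)[OF SM dS s val_sup_in_M[OF SM dS s]])
qed (use assms(1,2) in auto)

section \<open>Integration of decreasing functions\<close>

lemma decreasing_integrable:
  fixes g :: "real \<Rightarrow> real"
  assumes "\<And>s t. \<lbrakk>a \<le> s; s \<le> t; t \<le> b\<rbrakk> \<Longrightarrow> g t \<le> g s"
  shows "g integrable_on {a..b}"
proof -
  have "mono_on {a..b} (\<lambda>t. - g t)" using assms by (auto intro!: mono_onI)
  then have "(\<lambda>t. - g t) integrable_on {a..b}" by (rule integrable_on_mono_on)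
  from integrable_neg[OF this] show ?thesis by simp
qed

text \<open>For \<open>m = n\<close> the two sums differ by the telescoping amount (g 0 - g 1) / n,
  an error that depends on g only through its range. This uniformity is what
  \<open>val_integral_sup\<close> needs.\<close>

lemma decreasing_integral_riemann:
  fixes g :: "real \<Rightarrow> real"
  assumes dec: "\<And>s t. \<lbrakk>0 \<le> s; s \<le> t; t \<le> 1\<rbrakk> \<Longrightarrow> g t \<le> g s" and n: "n > 0"
  shows "m \<le> n \<Longrightarrow> integral {0..real m / n} g \<le> (\<Sum>k<m. g (real k / n) / n) \<and>
    (\<Sum>k<m. g (real (Suc k) / n) / n) \<le> integral {0..real m / n} g"
proof (induction m)
  case (Suc m)
  have le: "real m / n \<le> real (Suc m) / n" "real (Suc m) / n \<le> 1"
    using n Suc.prems by (auto simp: field_simps)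
  have int: "g integrable_on {s..t}" if "0 \<le> s" "t \<le> 1" for s t
    by (rule decreasing_integrable) (use dec that in auto)
  have diff: "real (Suc m) / n - real m / n = 1 / n" by (simp add: add_divide_distrib)
  have split: "integral {0..real (Suc m) / n} g = integral {0..real m / n} g + integral {real m / n..real (Suc m) / n} g"
    by (rule Henstock_Kurzweil_Integration.integral_combine[symmetric]) (use int le in auto)
  have up: "integral {real m / n..real (Suc m) / n} g \<le> integral {real m / n..real (Suc m) / n} (\<lambda>_. g (real m / n))"
    by (rule integral_le) (use int le dec in auto)
  have lo: "integral {real m / n..real (Suc m) / n} (\<lambda>_. g (real (Suc m) / n)) \<le> integral {real m / n..real (Suc m) / n} g"
  proof (rule integral_le)
    show "g (real (Suc m) / n) \<le> g x" if "x \<in> {real m / n..real (Suc m) / n}" for x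
      using that le n by (intro dec) (auto intro: order_trans[of 0 "real m / n"])
  qed (use int le in auto)
  show ?case
    using Suc up lo le split diff by simp
qed simp

section \<open>Integrals against valuations\<close>

definition level :: "('a, 'm) gorder_scheme \<Rightarrow> ('a \<Rightarrow> real) \<Rightarrow> real \<Rightarrow> 'a set" where
  "level D f t = {x \<in> carrier D. t < f x}"

context
  fixes D :: "('a, 'm) gorder_scheme" and f :: "'a \<Rightarrow> real"
  assumes f: "scott_continuous D unit_interval f"
begin

lemma level_open: "level D f t \<in> scott_opens D"
  unfolding level_def by (rule scott_open_greater[OF f])

lemma level_antimono: "s \<le> t \<Longrightarrow> level D f t \<subseteq> level D f s"
  by (auto simp: level_def)

lemma unit_valued_bounds: "x \<in> carrier D \<Longrightarrow> 0 \<le> f x \<and> f x \<le> 1"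
  using f unfolding scott_continuous_unit_interval_iff by blast

text \<open>Since f is bounded by 1, the cap at 1 in the level sets of \<open>val_integral\<close>
  has no effect.\<close>

lemma val_integral_eq: "val_integral D f \<nu> = integral {0..1} (\<lambda>t. \<nu> (level D f t))"
proof -
  have "{x \<in> carrier D. f x \<in> {t<..1}} = level D f t" for t
    using unit_valued_bounds by (auto simp: level_def)
  then show ?thesis by (simp add: val_integral_def)
qed

lemma valuation_level_integrable:
  assumes "\<nu> \<in> valuations D" shows "(\<lambda>t. \<nu> (level D f t)) integrable_on {0..1}"
  by (rule decreasing_integrable)
    (use valuation_mono[OF assms level_open level_open level_antimono] in auto)

lemma val_integral_mono:
  assumes "\<nu> \<in> valuations D" "\<xi> \<in> valuations D" "val_le D \<nu> \<xi>"
  shows "val_integral D f \<nu> \<le> val_integral D f \<xi>"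
  unfolding val_integral_eq
  by (rule integral_le)
    (use assms valuation_level_integrable level_open in \<open>auto simp: val_le_def\<close>)

text \<open>Monotone convergence for directed families. Riemann sums involve finitely many level
  sets, and directedness yields one valuation in S that is close to s on all of them.\<close>

lemma val_integral_sup:
  assumes dS: "val_directed D S" and s: "val_sup D S s" and e: "e > 0"
  shows "\<exists>\<nu>\<in>S. val_integral D f s < val_integral D f \<nu> + e"
proof -
  have sV: "s \<in> valuations D" using s by (simp add: val_sup_def)
  have SV: "\<And>\<nu>. \<nu> \<in> S \<Longrightarrow> \<nu> \<in> valuations D" using dS by (auto simp: val_directed_def)
  \<comment> \<open>Half of e pays for replacing s by a member of S on the level sets; the other
    half must exceed the gap between upper and lower sum, which is at most 1/n.\<close>
  obtain n :: nat where n: "n > 0" "1 / real n < e / 2"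
    using e by (metis half_gt_zero nat_approx_posE neq0_conv of_nat_Suc zero_less_Suc)
  let ?L = "\<lambda>k. level D f (real k / n)"
  have "\<exists>\<nu>\<in>S. \<forall>k<m. s (?L k) < \<nu> (?L k) + e / 2" for m
  proof (induction m)
    case 0
    then show ?case using dS by (auto simp: val_directed_def)
  next
    case (Suc m)
    then obtain \<nu> where \<nu>: "\<nu> \<in> S" "\<And>k. k < m \<Longrightarrow> s (?L k) < \<nu> (?L k) + e / 2" by blast
    obtain \<xi> where \<xi>: "\<xi> \<in> S" "s (?L m) < \<xi> (?L m) + e / 2"
      using s level_open[of "real m / n"] e half_gt_zero[OF e] unfolding val_sup_def by blast
    obtain \<zeta> where \<zeta>: "\<zeta> \<in> S" "val_le D \<nu> \<zeta>" "val_le D \<xi> \<zeta>"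
      using dS \<nu>(1) \<xi>(1) unfolding val_directed_def by blast
    have "s (?L k) < \<zeta> (?L k) + e / 2" if "k < Suc m" for k
      using that \<nu>(2)[of k] \<xi>(2) val_leD[OF \<zeta>(2) level_open] val_leD[OF \<zeta>(3) level_open]
      by (cases "k = m") (force simp: less_Suc_eq intro: less_le_trans)+
    with \<zeta>(1) show ?case by blast
  qed
  from this[of n] obtain \<nu> where \<nu>: "\<nu> \<in> S" "\<And>k. k < n \<Longrightarrow> s (?L k) < \<nu> (?L k) + e / 2" by blast
  have dec: "\<xi> (level D f t) \<le> \<xi> (level D f r)" if "\<xi> \<in> valuations D" "r \<le> t" for \<xi> t r
    using valuation_mono[OF that(1) level_open level_open level_antimono[OF that(2)]] .
  have "val_integral D f s \<le> (\<Sum>k<n. s (?L k) / n)"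
    using decreasing_integral_riemann[of "\<lambda>t. s (level D f t)", OF dec[OF sV] n(1) order_refl] n(1) by (simp add: val_integral_eq)
  also have "\<dots> \<le> (\<Sum>k<n. (\<nu> (?L k) + e / 2) / n)"
    by (rule sum_mono) (use less_imp_le[OF \<nu>(2)] in \<open>auto intro!: divide_right_mono\<close>)
  also have "\<dots> = (\<Sum>k<n. \<nu> (?L k) / n) + e / 2"
    using n(1) by (simp add: add_divide_distrib sum.distrib)
  \<comment> \<open>Shifting the index by one turns the upper sum into the lower sum. What remains
    after telescoping is at most \<open>\<nu> (?L 0) / n\<close>, hence at most 1/n.\<close>
  also have "(\<Sum>k<n. \<nu> (?L k) / n) \<le> (\<Sum>k<n. \<nu> (?L (Suc k)) / n) + 1 / n"
  proof -
    have "(\<Sum>k<n. \<nu> (?L k) / n) + \<nu> (?L n) / n = \<nu> (?L 0) / n + (\<Sum>k<n. \<nu> (?L (Suc k)) / n)"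
      using sum.lessThan_Suc[of "\<lambda>k. \<nu> (?L k) / n" n] sum.lessThan_Suc_shift[of "\<lambda>k. \<nu> (?L k) / n" n]
      by simp
    moreover have "0 \<le> \<nu> (?L n) / n" "\<nu> (?L 0) / n \<le> 1 / n"
      using valuation_nonneg[OF SV[OF \<nu>(1)] level_open] valuation_le_1[OF SV[OF \<nu>(1)] level_open]
      by (auto intro!: divide_right_mono)
    ultimately show ?thesis by linarith
  qed
  also have "(\<Sum>k<n. \<nu> (?L (Suc k)) / n) \<le> val_integral D f \<nu>"
    using decreasing_integral_riemann[of "\<lambda>t. \<nu> (level D f t)", OF dec[OF SV[OF \<nu>(1)]] n(1) order_refl] n(1) by (simp add: val_integral_eq)
  finally have "val_integral D f s \<le> val_integral D f \<nu> + 1 / n + e / 2" by simp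
  then have "val_integral D f s < val_integral D f \<nu> + e" using n(2) by linarith
  with \<nu>(1) show ?thesis by blast
qed

lemma has_integral_less_indicator:
  assumes "0 \<le> a" "a \<le> (1::real)"
  shows "((\<lambda>t. if t < a then r else 0) has_integral r * a) {0..1::real}"
proof -
  have "((\<lambda>t. if t < a then r else 0) has_integral r * a) {0..a}"
    by (rule has_integral_spike_finite[of "{a}" _ _ "\<lambda>_. r"])
      (use has_integral_const_real[of r 0 a] assms in \<open>auto simp: mult.commute\<close>)
  moreover have "((\<lambda>t. if t < a then r else 0) has_integral 0) {a..1}"
    by (rule has_integral_eq[of _ "\<lambda>_. 0"]) auto
  ultimately show ?thesis
    using has_integral_combine[of 0 a 1 "\<lambda>t. if t < a then r else 0" "r * a" 0] assms by simp
qed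

text \<open>Layer-cake formula: a point x of weight r is in the level set exactly for t < f x, and
  so contributes r * f x.\<close>

lemma val_integral_simple:
  assumes "subconvex (carrier D) l"
  shows "val_integral D f (simple_valuation D l) = (\<Sum>(r, x)\<leftarrow>l. r * f x)"
proof -
  have "((\<lambda>t. \<Sum>(r, x)\<leftarrow>l. if x \<in> level D f t then r else 0) has_integral (\<Sum>(r, x)\<leftarrow>l. r * f x)) {0..1}"
    using subconvexD(2)[OF assms]
  proof (induction l)
    case (Cons p l)
    obtain r x where p: "p = (r, x)" by fastforce
    have x: "x \<in> carrier D" using Cons.prems[of r x] p by simp
    have "((\<lambda>t. if x \<in> level D f t then r else 0) has_integral r * f x) {0..1}"
      using has_integral_less_indicator[of "f x" r] unit_valued_bounds[OF x] x by (simp add: level_def)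
    moreover have "((\<lambda>t. \<Sum>(r, x)\<leftarrow>l. if x \<in> level D f t then r else 0) has_integral (\<Sum>(r, x)\<leftarrow>l. r * f x)) {0..1}"
      by (rule Cons.IH) (use Cons.prems in auto)
    ultimately show ?case unfolding p by (simp add: has_integral_add)
  qed simp
  then show ?thesis
    unfolding val_integral_eq by (simp add: simple_valuation_apply level_open integral_unique)
qed

lemma val_integral_conv:
  assumes "\<nu> \<in> valuations D" "\<xi> \<in> valuations D"
  shows "val_integral D f (conv (M_dcpo D) r \<nu> \<xi>) = r * val_integral D f \<nu> + (1 - r) * val_integral D f \<xi>"
proof -
  note int = assms[THEN valuation_level_integrable]
  have "((\<lambda>t. r * \<nu> (level D f t) + (1 - r) * \<xi> (level D f t)) has_integral
      r * integral {0..1} (\<lambda>t. \<nu> (level D f t)) + (1 - r) * integral {0..1} (\<lambda>t. \<xi> (level D f t))) {0..1}"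
    by (intro has_integral_add has_integral_mult_right integrable_integral int)
  then show ?thesis
    unfolding val_integral_eq by (simp add: M_dcpo_def level_open integral_unique)
qed

end

section \<open>Convex combinations\<close>

lemma subconvex_Cons:
  assumes "subconvex X ((r, x) # l)"
  shows "0 \<le> r" "r \<le> 1" "x \<in> X" "subconvex X (map (\<lambda>(s, y). (s / (1 - r), y)) l)"
proof -
  show r: "0 \<le> r" "x \<in> X" using assms by (auto simp: subconvex_def)
  have nn: "\<And>s y. (s, y) \<in> set l \<Longrightarrow> 0 \<le> s \<and> y \<in> X" and sum: "r + (\<Sum>(s, y)\<leftarrow>l. s) \<le> 1"
    using assms by (auto simp: subconvex_def)
  have "0 \<le> (\<Sum>(s, y)\<leftarrow>l. s)" using nn by (intro sum_list_nonneg) auto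
  with sum show r1: "r \<le> 1" by simp
  have eq: "(\<Sum>(s, y)\<leftarrow>map (\<lambda>(s, y). (s / (1 - r), y)) l'. s) = (\<Sum>(s, y)\<leftarrow>l'. s) / (1 - r)" for l'
    by (induction l') (auto simp: add_divide_distrib)
  have "(\<Sum>(s, y)\<leftarrow>l. s) / (1 - r) \<le> 1"
    using sum r1 by (cases "r = 1") (auto simp: field_simps)
  then show "subconvex X (map (\<lambda>(s, y). (s / (1 - r), y)) l)"
    using nn r1 unfolding subconvex_def eq by auto
qed

definition convex_closed :: "('a, 'm) convex_order_scheme \<Rightarrow> bool" where
  "convex_closed K \<longleftrightarrow> bot K \<in> carrier K \<and>
    (\<forall>r\<in>{0..1}. \<forall>x\<in>carrier K. \<forall>y\<in>carrier K. conv K r x y \<in> carrier K)"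

lemma convex_sum_closed:
  assumes "convex_closed K" "subconvex (carrier K) l"
  shows "convex_sum K l \<in> carrier K"
  using assms
proof (induction K l rule: convex_sum.induct)
  case (2 K r x l)
  then show ?case using subconvex_Cons[OF "2.prems"(2)] by (simp add: convex_closed_def)
qed (simp add: convex_closed_def)

lemma member_le_sum_list_real:
  fixes s :: real
  shows "\<lbrakk>s \<in> set l; \<And>t. t \<in> set l \<Longrightarrow> 0 \<le> t\<rbrakk> \<Longrightarrow> s \<le> sum_list l"
  by (induction l) (auto intro: add_increasing add_increasing2 sum_list_nonneg)

text \<open>An affine functional undoes the renormalisation in \<open>convex_sum\<close>: each
  factor 1 - r cancels the corresponding division.\<close>

lemma convex_sum_affine:
  fixes f :: "'a \<Rightarrow> real"
  assumes "convex_closed K" "subconvex (carrier K) l" "f (bot K) = 0"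
    and "\<And>r x y. \<lbrakk>r \<in> {0..1}; x \<in> carrier K; y \<in> carrier K\<rbrakk> \<Longrightarrow> f (conv K r x y) = r * f x + (1 - r) * f y"
  shows "f (convex_sum K l) = (\<Sum>(r, x)\<leftarrow>l. r * f x)"
  using assms
proof (induction K l rule: convex_sum.induct)
  case (2 K r x l)
  note s = subconvex_Cons[OF "2.prems"(2)]
  let ?l = "map (\<lambda>(s, y). (s / (1 - r), y)) l"
  have "f (convex_sum K ((r, x) # l)) = r * f x + (1 - r) * f (convex_sum K ?l)"
    using "2.prems"(4)[of r x "convex_sum K ?l"] s convex_sum_closed[OF "2.prems"(1) s(4)] by simp
  also have "f (convex_sum K ?l) = (\<Sum>(r, x)\<leftarrow>?l. r * f x)"
    by (rule "2.IH") (use "2.prems" s in auto)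
  also have "(1 - r) * \<dots> = (\<Sum>(r, x)\<leftarrow>l. r * f x)"
  proof (cases "r = 1")
    case True
    \<comment> \<open>Here the divisions are by zero and nothing cancels, but the remaining weights
      are nonnegative with sum at most 0, so they all vanish.\<close>
    have nn: "\<And>s y. (s, y) \<in> set l \<Longrightarrow> 0 \<le> s" and sum0: "(\<Sum>(s, y)\<leftarrow>l. s) \<le> 0"
      using "2.prems"(2) True by (auto simp: subconvex_def)
    have "s = 0" if "(s, y) \<in> set l" for s y
    proof -
      have "s \<in> set (map fst l)" "\<And>s. s \<in> set (map fst l) \<Longrightarrow> 0 \<le> s" using that nn by force+
      then have "s \<le> sum_list (map fst l)" by (rule member_le_sum_list_real)
      also have "\<dots> \<le> 0" using sum0 by (simp add: case_prod_unfold)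
      finally show ?thesis using nn[OF that] by simp
    qed
    then have "(\<Sum>(r, x)\<leftarrow>l. r * f x) = (\<Sum>(r, x)\<leftarrow>l. 0)"
      by (intro arg_cong[of _ _ sum_list] map_cong) auto
    with True show ?thesis by (simp add: case_prod_unfold)
  next
    case False
    then show ?thesis by (induction l) (auto simp: field_simps)
  qed
  finally show ?case by simp
qed simp

lemma convex_linear_convex_sum:
  assumes "convex_linear K L h" "convex_closed K" "subconvex (carrier K) l"
  shows "h (convex_sum K l) = convex_sum L (map (\<lambda>(r, x). (r, h x)) l)"
  using assms
proof (induction K l rule: convex_sum.induct)
  case (2 K r x l)
  note s = subconvex_Cons[OF "2.prems"(3)]
  let ?l = "map (\<lambda>(s, y). (s / (1 - r), y)) l"
  have "h (convex_sum K ((r, x) # l)) = conv L r (h x) (h (convex_sum K ?l))"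
    using "2.prems"(1) s convex_sum_closed[OF "2.prems"(2) s(4)] by (simp add: convex_linear_def)
  also have "h (convex_sum K ?l) = convex_sum L (map (\<lambda>(r, x). (r, h x)) ?l)"
    by (rule "2.IH") (use "2.prems" s in auto)
  finally show ?case by (simp add: case_prod_unfold comp_def)
qed (simp add: convex_linear_def)

section \<open>Convexity of the set of valuations\<close>

lemma conv_M_apply:
  "U \<in> scott_opens D \<Longrightarrow> conv (M_dcpo D) r \<nu> \<xi> U = r * \<nu> U + (1 - r) * \<xi> U"
  by (simp add: M_dcpo_def)

lemma val_conv_mono:
  assumes "r \<in> {0..1}" "val_le D \<nu> \<nu>'" "val_le D \<xi> \<xi>'"
  shows "val_le D (conv (M_dcpo D) r \<nu> \<xi>) (conv (M_dcpo D) r \<nu>' \<xi>')"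
  using assms by (auto simp: val_le_def conv_M_apply intro!: add_mono mult_left_mono)

lemma val_conv_in_valuations:
  assumes r: "r \<in> {0..1}" and \<nu>: "\<nu> \<in> valuations D" and \<xi>: "\<xi> \<in> valuations D"
  shows "conv (M_dcpo D) r \<nu> \<xi> \<in> valuations D"
  unfolding valuations_iff
proof (intro conjI ballI allI impI)
  show "conv (M_dcpo D) r \<nu> \<xi> \<in> extensional (scott_opens D)" by (simp add: M_dcpo_def)
  show "0 \<le> conv (M_dcpo D) r \<nu> \<xi> U" if "U \<in> scott_opens D" for U
    using that r valuation_nonneg[OF \<nu> that] valuation_nonneg[OF \<xi> that] by (simp add: conv_M_apply)
  show "conv (M_dcpo D) r \<nu> \<xi> U \<le> 1" if "U \<in> scott_opens D" for U
    using that r valuation_le_1[OF \<nu> that] valuation_le_1[OF \<xi> that]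
    by (simp add: conv_M_apply convex_bound_le)
  show "conv (M_dcpo D) r \<nu> \<xi> U \<le> conv (M_dcpo D) r \<nu> \<xi> V"
    if "U \<in> scott_opens D" "V \<in> scott_opens D" "U \<subseteq> V" for U V
    using that r valuation_mono[OF \<nu> that] valuation_mono[OF \<xi> that]
    by (auto simp: conv_M_apply intro!: add_mono mult_left_mono)
  show "conv (M_dcpo D) r \<nu> \<xi> {} = 0"
    using valuation_empty[OF \<nu>] valuation_empty[OF \<xi>] by (simp add: conv_M_apply scott_opens_empty)
  show "conv (M_dcpo D) r \<nu> \<xi> U + conv (M_dcpo D) r \<nu> \<xi> V =
      conv (M_dcpo D) r \<nu> \<xi> (U \<union> V) + conv (M_dcpo D) r \<nu> \<xi> (U \<inter> V)"
    if U: "U \<in> scott_opens D" and V: "V \<in> scott_opens D" for U V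
  proof -
    have "r * (\<nu> U + \<nu> V) + (1 - r) * (\<xi> U + \<xi> V) =
        r * (\<nu> (U \<union> V) + \<nu> (U \<inter> V)) + (1 - r) * (\<xi> (U \<union> V) + \<xi> (U \<inter> V))"
      using valuation_modular[OF \<nu> U V] valuation_modular[OF \<xi> U V] by simp
    then show ?thesis
      using U V by (simp add: conv_M_apply scott_opens_Un scott_opens_Int algebra_simps)
  qed
next
  fix W and e :: real assume W: "directed (opens_order D) W" and e: "e > 0"
  have WO: "\<And>U. U \<in> W \<Longrightarrow> U \<in> scott_opens D" using directed_subset[OF W] by (auto simp: opens_order_def)
  have UO: "\<Union>W \<in> scott_opens D" using scott_opens_Union WO by blast
  obtain U where U: "U \<in> W" "\<nu> (\<Union>W) < \<nu> U + e" using valuation_continuous[OF \<nu> W e] by blast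
  obtain V where V: "V \<in> W" "\<xi> (\<Union>W) < \<xi> V + e" using valuation_continuous[OF \<xi> W e] by blast
  obtain Z where Z: "Z \<in> W" "U \<subseteq> Z" "V \<subseteq> Z"
    using directed_upper[OF W U(1) V(1)] by (auto simp: opens_order_def)
  have "\<nu> (\<Union>W) < \<nu> Z + e" "\<xi> (\<Union>W) < \<xi> Z + e"
    using U V valuation_mono[OF \<nu> WO[OF U(1)] WO[OF Z(1)] Z(2)] valuation_mono[OF \<xi> WO[OF V(1)] WO[OF Z(1)] Z(3)]
    by linarith+
  then have "r * (\<nu> (\<Union>W) - \<nu> Z) + (1 - r) * (\<xi> (\<Union>W) - \<xi> Z) < e"
    using r by (intro convex_bound_lt) auto
  then show "\<exists>U\<in>W. conv (M_dcpo D) r \<nu> \<xi> (\<Union>W) < conv (M_dcpo D) r \<nu> \<xi> U + e"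
    using Z(1) WO UO by (intro bexI[of _ Z]) (simp_all add: conv_M_apply algebra_simps)
qed

lemma val_directed_image:
  assumes "val_directed D S" "\<And>\<nu>. \<nu> \<in> S \<Longrightarrow> h \<nu> \<in> valuations E"
    and "\<And>\<nu> \<xi>. \<lbrakk>\<nu> \<in> S; \<xi> \<in> S; val_le D \<nu> \<xi>\<rbrakk> \<Longrightarrow> val_le E (h \<nu>) (h \<xi>)"
  shows "val_directed E (h ` S)"
proof -
  have "directed (V_dcpo E) (h ` S)"
    by (rule directed_image[OF assms(1)[folded val_directed_V]]) (use assms(2,3) in auto)
  then show ?thesis by (simp add: val_directed_V)
qed

lemma val_conv_sup:
  assumes r: "r \<in> {0..1}" and dS: "val_directed D S" and s: "val_sup D S s" and \<xi>: "\<xi> \<in> valuations D"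
  shows "val_directed D ((\<lambda>\<nu>. conv (M_dcpo D) r \<nu> \<xi>) ` S)"
    and "val_sup D ((\<lambda>\<nu>. conv (M_dcpo D) r \<nu> \<xi>) ` S) (conv (M_dcpo D) r s \<xi>)"
proof -
  have SV: "\<And>\<nu>. \<nu> \<in> S \<Longrightarrow> \<nu> \<in> valuations D" using dS by (auto simp: val_directed_def)
  show "val_directed D ((\<lambda>\<nu>. conv (M_dcpo D) r \<nu> \<xi>) ` S)"
    by (rule val_directed_image[OF dS]) (use val_conv_in_valuations[OF r SV \<xi>] val_conv_mono[OF r _ val_le_refl] in auto)
  show "val_sup D ((\<lambda>\<nu>. conv (M_dcpo D) r \<nu> \<xi>) ` S) (conv (M_dcpo D) r s \<xi>)"
    unfolding val_sup_def
  proof (intro conjI ballI allI impI)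
    show "conv (M_dcpo D) r s \<xi> \<in> valuations D"
      using val_conv_in_valuations[OF r _ \<xi>] s by (simp add: val_sup_def)
    fix \<zeta> assume "\<zeta> \<in> (\<lambda>\<nu>. conv (M_dcpo D) r \<nu> \<xi>) ` S"
    then obtain \<nu> where "\<nu> \<in> S" "\<zeta> = conv (M_dcpo D) r \<nu> \<xi>" by blast
    then show "val_le D \<zeta> (conv (M_dcpo D) r s \<xi>)"
      using val_conv_mono[OF r _ val_le_refl, of D \<nu> s] s by (simp add: val_sup_def)
  next
    fix U and e :: real assume U: "U \<in> scott_opens D" and e: "e > 0"
    then obtain \<nu> where \<nu>: "\<nu> \<in> S" "s U < \<nu> U + e" using s unfolding val_sup_def by blast
    have "r * (s U - \<nu> U) + (1 - r) * 0 < e"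
      by (rule convex_bound_lt) (use \<nu> e r in auto)
    then have "conv (M_dcpo D) r s \<xi> U < conv (M_dcpo D) r \<nu> \<xi> U + e"
      using U by (simp add: conv_M_apply algebra_simps)
    with \<nu>(1) show "\<exists>\<zeta>\<in>(\<lambda>\<nu>. conv (M_dcpo D) r \<nu> \<xi>) ` S. conv (M_dcpo D) r s \<xi> U < \<zeta> U + e"
      by blast
  qed
qed

lemma conv_M_commute: "conv (M_dcpo D) r \<nu> \<xi> = conv (M_dcpo D) (1 - r) \<xi> \<nu>"
  by (simp add: M_dcpo_def add.commute)

lemma conv_simple_valuation:
  assumes r: "r \<in> {0..1}" and k: "subconvex (carrier D) k" and l: "subconvex (carrier D) l"
  shows "\<exists>m. subconvex (carrier D) m \<and>
    conv (M_dcpo D) r (simple_valuation D k) (simple_valuation D l) = simple_valuation D m"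
proof -
  define scale where "scale c = map (\<lambda>(s, x :: 'a). (c * s, x))" for c :: real
  let ?m = "scale r k @ scale (1 - r) l"
  have mass: "(\<Sum>(s, x)\<leftarrow>scale c j. s) = c * (\<Sum>(s, x)\<leftarrow>j. s)" for c j
    unfolding scale_def by (induction j) (auto simp: algebra_simps)
  have app: "(\<Sum>(s, x)\<leftarrow>scale c j. if x \<in> U then s else 0) = c * (\<Sum>(s, x)\<leftarrow>j. if x \<in> U then s else 0)" for c j U
    unfolding scale_def by (induction j) (auto simp: algebra_simps)
  have "r * (\<Sum>(s, x)\<leftarrow>k. s) + (1 - r) * (\<Sum>(s, x)\<leftarrow>l. s) \<le> 1"
    using subconvexD(3)[OF k] subconvexD(3)[OF l] r by (intro convex_bound_le) auto
  then have "(\<Sum>(s, x)\<leftarrow>?m. s) \<le> 1" by (simp add: mass)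
  moreover have "0 \<le> s \<and> x \<in> carrier D" if "(s, x) \<in> set ?m" for s x
    using that subconvexD(1,2)[OF k] subconvexD(1,2)[OF l] r by (auto simp: scale_def)
  ultimately have "subconvex (carrier D) ?m" unfolding subconvex_def by blast
  moreover have "conv (M_dcpo D) r (simple_valuation D k) (simple_valuation D l) = simple_valuation D ?m"
  proof (rule extensionalityI[of _ "scott_opens D"])
    show "conv (M_dcpo D) r (simple_valuation D k) (simple_valuation D l) U = simple_valuation D ?m U"
      if "U \<in> scott_opens D" for U
      using that by (simp add: conv_M_apply simple_valuation_apply app)
  qed (simp_all add: M_dcpo_def simple_valuation_def)
  ultimately show ?thesis by blast
qed

text \<open>Induction is possible in one argument at a time: the first runs over the left argument
  with a simple right one, the second over the right argument with an arbitrary left one.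
  \<open>conv_M_commute\<close> lets the continuity lemma for the left argument serve both.\<close>

lemma conv_in_M:
  assumes r: "r \<in> {0..1}" and \<nu>: "\<nu> \<in> M_carrier D" and \<xi>: "\<xi> \<in> M_carrier D"
  shows "conv (M_dcpo D) r \<nu> \<xi> \<in> M_carrier D"
proof -
  note MV = subsetD[OF M_carrier_subset]
  have simple: "conv (M_dcpo D) r' \<nu> (simple_valuation D l) \<in> M_carrier D"
    if r': "r' \<in> {0..1}" and "\<nu> \<in> M_carrier D" and l: "subconvex (carrier D) l" for \<nu> l r'
    using that(2)
  proof (induction rule: M_carrier_induct)
    case (simple k)
    then show ?case using conv_simple_valuation[OF r' simple l] simple_valuation_in_M by metis
  next
    case (sup S s)
    show ?case
      by (rule val_sup_in_M[OF _ val_conv_sup[OF r' sup(2,3) simple_valuation_in_valuations[OF l]]])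
        (use sup(4) in blast)
  qed
  have simple': "conv (M_dcpo D) r \<nu> (simple_valuation D l) \<in> M_carrier D" if "subconvex (carrier D) l" for l
    by (rule simple[OF r \<nu> that])
  have r1: "1 - r \<in> {0..1}" using r by simp
  show ?thesis
    using \<xi> unfolding conv_M_commute[of D r \<nu>]
  proof (induction rule: M_carrier_induct)
    case (simple l)
    then show ?case using simple' conv_M_commute[of D r \<nu>] by metis
  next
    case (sup S s)
    show ?case
      by (rule val_sup_in_M[OF _ val_conv_sup[OF r1 sup(2,3) MV[OF \<nu>]]]) (use sup(4) in blast)
  qed
qed

lemma bot_M_eq: "bot (M_dcpo D) = simple_valuation D []"
  by (simp add: M_dcpo_def simple_valuation_def)

lemma convex_closed_M: "convex_closed (M_dcpo D)"
  unfolding convex_closed_def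
proof (intro conjI ballI)
  show "bot (M_dcpo D) \<in> carrier (M_dcpo D)"
    using simple_valuation_in_M[of D "[]"] by (simp add: bot_M_eq subconvex_def)
qed (use conv_in_M in simp)

lemma convex_sum_M_apply:
  assumes "subconvex (M_carrier D) l" "U \<in> scott_opens D"
  shows "convex_sum (M_dcpo D) l U = (\<Sum>(r, \<nu>)\<leftarrow>l. r * \<nu> U)"
  using convex_sum_affine[OF convex_closed_M, of D l "\<lambda>\<nu>. \<nu> U"] assms
  by (simp add: conv_M_apply bot_M_eq simple_valuation_apply)

lemma dirac_eq_simple: "dirac D x = simple_valuation D [(1, x)]"
  by (rule extensionalityI[of _ "scott_opens D"])
    (auto simp: simple_valuation_apply dirac_apply simple_valuation_def dirac_def)

lemma dirac_in_M: "x \<in> carrier D \<Longrightarrow> dirac D x \<in> M_carrier D"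
  unfolding dirac_eq_simple by (rule simple_valuation_in_M) (simp add: subconvex_def)

text \<open>Expresses a simple valuation by the operations that a linear map preserves, so that
  linearity together with the unit law determines its image.\<close>

lemma simple_valuation_convex_sum:
  assumes "subconvex (carrier D) l"
  shows "simple_valuation D l = convex_sum (M_dcpo D) (map (\<lambda>(r, x). (r, dirac D x)) l)"
    and "subconvex (M_carrier D) (map (\<lambda>(r, x). (r, dirac D x)) l)"
proof -
  show s: "subconvex (M_carrier D) (map (\<lambda>(r, x). (r, dirac D x)) l)"
    using assms dirac_in_M by (fastforce simp: subconvex_def case_prod_unfold comp_def)
  have "convex_sum (M_dcpo D) (map (\<lambda>(r, x). (r, dirac D x)) l) \<in> M_carrier D"
    using convex_sum_closed[OF convex_closed_M] s by simp
  then have "convex_sum (M_dcpo D) (map (\<lambda>(r, x). (r, dirac D x)) l) \<in> valuations D"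
    using M_carrier_subset by blast
  then show "simple_valuation D l = convex_sum (M_dcpo D) (map (\<lambda>(r, x). (r, dirac D x)) l)"
  proof (intro extensionalityI[of _ "scott_opens D"] valuation_extensional)
    fix U assume U: "U \<in> scott_opens D"
    show "simple_valuation D l U = convex_sum (M_dcpo D) (map (\<lambda>(r, x). (r, dirac D x)) l) U"
      unfolding convex_sum_M_apply[OF s U] using U
      by (simp add: simple_valuation_def comp_def case_prod_unfold)
  qed (rule simple_valuation_in_valuations[OF assms])
qed

section \<open>The monad operations on directed suprema\<close>

lemma val_sup_eqI:
  assumes "val_sup D S t" "g \<in> extensional (scott_opens D)"
    and "\<And>\<nu> U. \<lbrakk>\<nu> \<in> S; U \<in> scott_opens D\<rbrakk> \<Longrightarrow> \<nu> U \<le> g U"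
    and "\<And>U e. \<lbrakk>U \<in> scott_opens D; e > 0\<rbrakk> \<Longrightarrow> \<exists>\<nu>\<in>S. g U < \<nu> U + e"
  shows "g = t"
proof (rule extensionalityI[OF assms(2)])
  show "t \<in> extensional (scott_opens D)" using assms(1) by (simp add: val_sup_def valuation_extensional)
  fix U assume U: "U \<in> scott_opens D"
  show "g U = t U"
  proof (rule antisym)
    show "g U \<le> t U"
    proof (rule real_le_epsI)
      fix e :: real assume "e > 0"
      then obtain \<nu> where "\<nu> \<in> S" "g U < \<nu> U + e" using assms(4)[OF U] by blast
      with assms(1) U show "g U < t U + e" by (force simp: val_sup_def val_le_def)
    qed
    show "t U \<le> g U"
    proof (rule real_le_epsI)
      fix e :: real assume "e > 0"
      then obtain \<nu> where "\<nu> \<in> S" "t U < \<nu> U + e" using assms(1) U unfolding val_sup_def by blast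
      with assms(3)[of \<nu> U] U show "t U < g U + e" by force
    qed
  qed
qed

lemma M_map_in_valuations:
  assumes h: "scott_continuous D E h" and \<nu>: "\<nu> \<in> valuations D"
  shows "M_map D E h \<nu> \<in> valuations E"
proof -
  let ?p = "\<lambda>U. {x \<in> carrier D. h x \<in> U}"
  note open_p = scott_continuous_preimage[OF h]
  have app: "M_map D E h \<nu> U = \<nu> (?p U)" if "U \<in> scott_opens E" for U
    using that by (simp add: M_map_def)
  have cont: "\<exists>U\<in>W. M_map D E h \<nu> (\<Union>W) < M_map D E h \<nu> U + e"
    if W: "directed (opens_order E) W" and e: "e > 0" for W e
  proof -
    have WO: "W \<subseteq> scott_opens E" using directed_subset[OF W] by (simp add: opens_order_def)
    have "directed (opens_order D) (?p ` W)"
      by (rule directed_image[OF W]) (use WO open_p in \<open>auto simp: opens_order_def\<close>)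
    then obtain U where U: "U \<in> W" "\<nu> (\<Union>(?p ` W)) < \<nu> (?p U) + e"
      using valuation_continuous[OF \<nu> _ e] by blast
    have "\<Union>(?p ` W) = ?p (\<Union>W)" by blast
    then show ?thesis
      using U app[of U] app[OF scott_opens_Union[OF WO]] WO by (intro bexI[of _ U]) auto
  qed
  have un: "?p (U \<union> V) = ?p U \<union> ?p V" and int: "?p (U \<inter> V) = ?p U \<inter> ?p V" for U V by auto
  show ?thesis
    unfolding valuations_iff
  proof (intro conjI ballI allI impI)
    show "M_map D E h \<nu> \<in> extensional (scott_opens E)" by (simp add: M_map_def)
    show "M_map D E h \<nu> {} = 0" by (simp add: app scott_opens_empty valuation_empty[OF \<nu>])
    show "M_map D E h \<nu> U \<le> M_map D E h \<nu> V" if "U \<in> scott_opens E" "V \<in> scott_opens E" "U \<subseteq> V" for U V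
      using that valuation_mono[OF \<nu> open_p[OF that(1)] open_p[OF that(2)]] by (auto simp: app)
    show "M_map D E h \<nu> U + M_map D E h \<nu> V = M_map D E h \<nu> (U \<union> V) + M_map D E h \<nu> (U \<inter> V)"
      if "U \<in> scott_opens E" "V \<in> scott_opens E" for U V
      using that valuation_modular[OF \<nu> open_p[OF that(1)] open_p[OF that(2)]]
      by (simp only: app scott_opens_Un scott_opens_Int un int)
  qed (use cont valuation_nonneg[OF \<nu>] valuation_le_1[OF \<nu>] open_p in \<open>simp_all add: app\<close>)
qed

lemma M_map_sup:
  assumes h: "scott_continuous D E h" and dS: "val_directed D S" and s: "val_sup D S s"
  shows "val_directed E (M_map D E h ` S)" and "val_sup E (M_map D E h ` S) (M_map D E h s)"
proof -
  note open_p = scott_continuous_preimage[OF h]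
  have SV: "\<And>\<nu>. \<nu> \<in> S \<Longrightarrow> \<nu> \<in> valuations D" using dS by (auto simp: val_directed_def)
  have mono: "val_le E (M_map D E h \<nu>) (M_map D E h \<xi>)" if "val_le D \<nu> \<xi>" for \<nu> \<xi>
    using that open_p by (auto simp: val_le_def M_map_def)
  show "val_directed E (M_map D E h ` S)"
    by (rule val_directed_image[OF dS]) (use SV M_map_in_valuations[OF h] mono in auto)
  show "val_sup E (M_map D E h ` S) (M_map D E h s)"
    unfolding val_sup_def
  proof (intro conjI ballI allI impI)
    show "M_map D E h s \<in> valuations E" using M_map_in_valuations[OF h] s by (simp add: val_sup_def)
    show "val_le E \<nu> (M_map D E h s)" if "\<nu> \<in> M_map D E h ` S" for \<nu>
      using that s mono by (auto simp: val_sup_def)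
    show "\<exists>\<nu>\<in>M_map D E h ` S. M_map D E h s U < \<nu> U + e" if "U \<in> scott_opens E" "e > 0" for U e
      using that open_p[OF that(1)] s by (simp add: val_sup_def M_map_def)
  qed
qed

lemma M_map_simple:
  assumes h: "scott_continuous D E h" and l: "subconvex (carrier D) l"
  shows "M_map D E h (simple_valuation D l) = simple_valuation E (map (\<lambda>(r, x). (r, h x)) l)"
proof (rule extensionalityI[of _ "scott_opens E"])
  fix U assume U: "U \<in> scott_opens E"
  have "(\<Sum>(r, x)\<leftarrow>l. if x \<in> {x \<in> carrier D. h x \<in> U} then r else 0) = (\<Sum>(r, x)\<leftarrow>l. if h x \<in> U then r else 0)"
    by (intro arg_cong[of _ _ sum_list] map_cong refl) (use subconvexD(2)[OF l] in auto)
  then show "M_map D E h (simple_valuation D l) U = simple_valuation E (map (\<lambda>(r, x). (r, h x)) l) U"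
    using U scott_continuous_preimage[OF h U]
    by (simp add: M_map_def simple_valuation_apply comp_def case_prod_unfold cong: if_cong)
qed (simp_all add: M_map_def simple_valuation_def)

lemma subconvex_map:
  assumes "subconvex X l" "\<And>x. x \<in> X \<Longrightarrow> h x \<in> Y"
  shows "subconvex Y (map (\<lambda>(r, x). (r, h x)) l)"
  using assms by (fastforce simp: subconvex_def case_prod_unfold comp_def)

lemma M_map_in_M:
  assumes h: "scott_continuous D E h" and "\<nu> \<in> M_carrier D"
  shows "M_map D E h \<nu> \<in> M_carrier E"
  using assms(2)
proof (induction rule: M_carrier_induct)
  case (simple l)
  then show ?case
    unfolding M_map_simple[OF h simple]
    by (intro simple_valuation_in_M subconvex_map[OF simple] scott_continuous_closed[OF h])
next
  case (sup S s)
  then show ?case using val_sup_in_M[OF _ M_map_sup[OF h sup(2,3)]] by blast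
qed

lemma scott_continuous_M_eval:
  assumes "U \<in> scott_opens D"
  shows "scott_continuous (M_dcpo D) unit_interval (\<lambda>\<nu>. \<nu> U)"
  unfolding scott_continuous_unit_interval_iff
proof (intro conjI ballI allI impI)
  fix S s and e :: real assume *: "directed (M_dcpo D) S \<and> is_lub (M_dcpo D) s S" "e > 0"
  then have "val_sup D S s" using is_lub_M_dcpo[of D S s] by blast
  then show "\<exists>\<nu>\<in>S. s U < \<nu> U + e" using assms *(2) by (simp add: val_sup_def)
next
  fix \<nu> assume "\<nu> \<in> carrier (M_dcpo D)"
  then have "\<nu> \<in> valuations D" using M_carrier_subset[of D] by auto
  then show "0 \<le> \<nu> U" "\<nu> U \<le> 1" using valuation_nonneg[OF _ assms] valuation_le_1[OF _ assms] by blast+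
qed (use assms in \<open>auto simp: val_le_def\<close>)

lemma M_mult_apply:
  "U \<in> scott_opens D \<Longrightarrow> M_mult D \<Xi> U = val_integral (M_dcpo D) (\<lambda>\<nu>. \<nu> U) \<Xi>"
  by (simp add: M_mult_def)

lemma M_mult_simple:
  assumes "subconvex (M_carrier D) l"
  shows "M_mult D (simple_valuation (M_dcpo D) l) = convex_sum (M_dcpo D) l"
proof (rule extensionalityI[of _ "scott_opens D"])
  have "convex_sum (M_dcpo D) l \<in> valuations D"
    using convex_sum_closed[OF convex_closed_M, of D l] assms M_carrier_subset[of D] by auto
  then show "convex_sum (M_dcpo D) l \<in> extensional (scott_opens D)" by (rule valuation_extensional)
  show "M_mult D (simple_valuation (M_dcpo D) l) U = convex_sum (M_dcpo D) l U" if "U \<in> scott_opens D" for U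
    using val_integral_simple[OF scott_continuous_M_eval[OF that], of l] assms that
    by (simp add: M_mult_apply convex_sum_M_apply)
qed (simp add: M_mult_def)

lemma M_mult_mono:
  assumes "\<Xi> \<in> valuations (M_dcpo D)" "\<Xi>' \<in> valuations (M_dcpo D)" "val_le (M_dcpo D) \<Xi> \<Xi>'"
  shows "val_le D (M_mult D \<Xi>) (M_mult D \<Xi>')"
  using val_integral_mono[OF scott_continuous_M_eval assms] by (simp add: val_le_def M_mult_apply)

text \<open>That \<open>M_mult D s\<close> is a valuation is not verified directly. The images have
  a pointwise supremum, and \<open>val_integral_sup\<close>, applied to the evaluations at open
  sets, shows that \<open>M_mult D s\<close> has the same values.\<close>

lemma M_mult_sup:
  assumes dS: "val_directed (M_dcpo D) S" and s: "val_sup (M_dcpo D) S s"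
    and SM: "\<And>\<Xi>. \<Xi> \<in> S \<Longrightarrow> M_mult D \<Xi> \<in> M_carrier D"
  shows "val_directed D (M_mult D ` S)" and "val_sup D (M_mult D ` S) (M_mult D s)"
proof -
  have SV: "\<And>\<Xi>. \<Xi> \<in> S \<Longrightarrow> \<Xi> \<in> valuations (M_dcpo D)" using dS by (auto simp: val_directed_def)
  have sV: "s \<in> valuations (M_dcpo D)" using s by (simp add: val_sup_def)
  show dir: "val_directed D (M_mult D ` S)"
    by (rule val_directed_image[OF dS]) (use SV SM M_carrier_subset[of D] M_mult_mono[OF SV SV] in auto)
  obtain t where t: "val_sup D (M_mult D ` S) t" using val_sup_exists[OF dir] by blast
  have "M_mult D s = t"
  proof (rule val_sup_eqI[OF t])
    show "M_mult D s \<in> extensional (scott_opens D)" by (simp add: M_mult_def)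
    show "\<nu> U \<le> M_mult D s U" if "\<nu> \<in> M_mult D ` S" "U \<in> scott_opens D" for \<nu> U
      using that M_mult_mono[OF SV sV] s by (auto simp: val_sup_def val_le_def)
    show "\<exists>\<nu>\<in>M_mult D ` S. M_mult D s U < \<nu> U + e" if "U \<in> scott_opens D" "e > 0" for U e
      using val_integral_sup[OF scott_continuous_M_eval[OF that(1)] dS s that(2)] that(1)
      by (simp add: M_mult_apply)
  qed
  with t show "val_sup D (M_mult D ` S) (M_mult D s)" by simp
qed

lemma M_mult_in_M:
  assumes "\<Xi> \<in> M_carrier (M_dcpo D)"
  shows "M_mult D \<Xi> \<in> M_carrier D"
  using assms
proof (induction rule: M_carrier_induct)
  case (simple l)
  then show ?case
    using convex_sum_closed[OF convex_closed_M, of D l] by (simp add: M_mult_simple)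
next
  case (sup S s)
  show ?case
    by (rule val_sup_in_M[OF _ M_mult_sup[OF sup(2,3)]]) (use sup(4) in auto)
qed

section \<open>Linear maps out of the valuation monad\<close>

lemma linear_simple_valuation:
  assumes "convex_linear (M_dcpo K) K \<beta>" "\<And>x. x \<in> carrier K \<Longrightarrow> \<beta> (dirac K x) = x" "subconvex (carrier K) l"
  shows "\<beta> (simple_valuation K l) = convex_sum K l"
proof -
  have "\<beta> (simple_valuation K l) = convex_sum K (map (\<lambda>(r, \<nu>). (r, \<beta> \<nu>)) (map (\<lambda>(r, x). (r, dirac K x)) l))"
    unfolding simple_valuation_convex_sum(1)[OF assms(3)]
    using convex_linear_convex_sum[OF assms(1) convex_closed_M] simple_valuation_convex_sum(2)[OF assms(3)]
    by simp
  also have "map (\<lambda>(r, \<nu>). (r, \<beta> \<nu>)) (map (\<lambda>(r, x). (r, dirac K x)) l) = l"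
    unfolding map_map by (rule map_idI) (use subconvexD(2)[OF assms(3)] assms(2) in auto)
  finally show ?thesis .
qed

lemma scott_continuous_M_sup:
  assumes "scott_continuous (M_dcpo D) E \<beta>" "S \<subseteq> M_carrier D" "val_directed D S" "val_sup D S s"
  shows "is_lub E (\<beta> s) (\<beta> ` S)"
  using assms by (intro scott_continuous_lub[OF assms(1)]) (simp_all add: directed_M_iff is_lub_M_dcpo)

text \<open>Linearity and the unit law force the value at a simple valuation to be the convex sum;
  continuity passes agreement on to directed suprema.\<close>

lemma linear_continuous_unique:
  assumes po: "partial_order K"
    and \<beta>: "scott_continuous (M_dcpo K) K \<beta>" "convex_linear (M_dcpo K) K \<beta>"
      "\<And>x. x \<in> carrier K \<Longrightarrow> \<beta> (dirac K x) = x"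
    and \<gamma>: "scott_continuous (M_dcpo K) K \<gamma>" "convex_linear (M_dcpo K) K \<gamma>"
      "\<And>x. x \<in> carrier K \<Longrightarrow> \<gamma> (dirac K x) = x"
    and "\<nu> \<in> M_carrier K"
  shows "\<beta> \<nu> = \<gamma> \<nu>"
  using assms(8)
proof (induction rule: M_carrier_induct)
  case (simple l)
  have "\<beta> (simple_valuation K l) = convex_sum K l"
    by (rule linear_simple_valuation[OF \<beta>(2) _ simple]) (rule \<beta>(3))
  moreover have "\<gamma> (simple_valuation K l) = convex_sum K l"
    by (rule linear_simple_valuation[OF \<gamma>(2) _ simple]) (rule \<gamma>(3))
  ultimately show ?case by simp
next
  case (sup S s)
  then have "\<beta> ` S = \<gamma> ` S" by auto
  with scott_continuous_M_sup[OF \<beta>(1) sup(1-3)] scott_continuous_M_sup[OF \<gamma>(1) sup(1-3)]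
  show ?case using partial_order_lub_unique[OF po] by simp
qed

section \<open>Barycentres from order-determining functionals, and approximation of
  valuations\<close>

section \<open>Barycentres by integration\<close>

text \<open>A Kegelspitze is a dcpo with a compatible convex structure. No barycentric equations are
  listed: \<open>functional_ext\<close> reduces equations in K to equations between real
  numbers.\<close>

locale functional_kegelspitze =
  fixes K :: "('a, 'm) convex_order_scheme" and \<Phi> :: "('a \<Rightarrow> real) set"
  assumes dcpo: "dcpo K" and closed: "convex_closed K"
    and cont: "f \<in> \<Phi> \<Longrightarrow> scott_continuous K unit_interval f"
    and affine: "\<lbrakk>f \<in> \<Phi>; r \<in> {0..1}; x \<in> carrier K; y \<in> carrier K\<rbrakk> \<Longrightarrow> f (conv K r x y) = r * f x + (1 - r) * f y"
    and strict: "f \<in> \<Phi> \<Longrightarrow> f (bot K) = 0"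
    and order_determining: "\<lbrakk>x \<in> carrier K; y \<in> carrier K; \<And>f. f \<in> \<Phi> \<Longrightarrow> f x \<le> f y\<rbrakk> \<Longrightarrow> x \<sqsubseteq>\<^bsub>K\<^esub> y"
begin

lemma po: "partial_order K"
  using dcpo by (simp add: dcpo_def)

lemma functional_mono: "\<lbrakk>f \<in> \<Phi>; x \<in> carrier K; y \<in> carrier K; x \<sqsubseteq>\<^bsub>K\<^esub> y\<rbrakk> \<Longrightarrow> f x \<le> f y"
  using cont[of f] unfolding scott_continuous_unit_interval_iff by blast

lemma functional_ext:
  assumes "x \<in> carrier K" "y \<in> carrier K" "\<And>f. f \<in> \<Phi> \<Longrightarrow> f x = f y"
  shows "x = y"
proof (rule partial_order_antisym[OF po])
  show "x \<sqsubseteq>\<^bsub>K\<^esub> y" by (rule order_determining) (simp_all add: assms)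
  show "y \<sqsubseteq>\<^bsub>K\<^esub> x" by (rule order_determining) (simp_all add: assms)
qed (fact assms)+

text \<open>In the supremum step the barycentres of the members of S are directed, because their
  functionals are integrals and integrals are monotone. Their supremum is the barycentre of s since
  both f and the integral of f commute with the supremum.\<close>

lemma barycentre_exists:
  assumes "\<nu> \<in> M_carrier K"
  shows "\<exists>x\<in>carrier K. \<forall>f\<in>\<Phi>. f x = val_integral K f \<nu>"
  using assms
proof (induction rule: M_carrier_induct)
  case (simple l)
  have "f (convex_sum K l) = val_integral K f (simple_valuation K l)" if "f \<in> \<Phi>" for f
    using convex_sum_affine[OF closed simple strict[OF that] affine[OF that]]
      val_integral_simple[OF cont[OF that] simple] by simp
  then show ?case using convex_sum_closed[OF closed simple] by blast
next
  case (sup S s)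
  from sup(4) obtain b where b: "\<And>\<nu>. \<nu> \<in> S \<Longrightarrow> b \<nu> \<in> carrier K"
    "\<And>\<nu> f. \<lbrakk>\<nu> \<in> S; f \<in> \<Phi>\<rbrakk> \<Longrightarrow> f (b \<nu>) = val_integral K f \<nu>" by metis
  have SV: "\<And>\<nu>. \<nu> \<in> S \<Longrightarrow> \<nu> \<in> valuations K" using sup(2) by (auto simp: val_directed_def)
  have sV: "s \<in> valuations K" and ub: "\<And>\<nu>. \<nu> \<in> S \<Longrightarrow> val_le K \<nu> s" using sup(3) by (auto simp: val_sup_def)
  have dir: "directed K (b ` S)"
  proof (rule directed_image)
    show "directed (V_dcpo K) S" using sup(2) by (simp add: val_directed_V)
    show "b \<nu> \<sqsubseteq>\<^bsub>K\<^esub> b \<xi>" if "\<nu> \<in> S" "\<xi> \<in> S" "\<nu> \<sqsubseteq>\<^bsub>V_dcpo K\<^esub> \<xi>" for \<nu> \<xi>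
    proof (rule order_determining)
      show "f (b \<nu>) \<le> f (b \<xi>)" if f: "f \<in> \<Phi>" for f
        using val_integral_mono[OF cont[OF f] SV[OF \<open>\<nu> \<in> S\<close>] SV[OF \<open>\<xi> \<in> S\<close>]]
          b(2)[OF \<open>\<nu> \<in> S\<close> f] b(2)[OF \<open>\<xi> \<in> S\<close> f] \<open>\<nu> \<sqsubseteq>\<^bsub>V_dcpo K\<^esub> \<xi>\<close> by simp
    qed (use b that in auto)
  qed (use b in auto)
  then obtain x where x: "is_lub K x (b ` S)" using dcpo by (auto simp: dcpo_def)
  then have xK: "x \<in> carrier K" and xub: "\<And>\<nu>. \<nu> \<in> S \<Longrightarrow> b \<nu> \<sqsubseteq>\<^bsub>K\<^esub> x"
    unfolding directed_is_lub_iff[OF dir] by auto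
  have "f x = val_integral K f s" if f: "f \<in> \<Phi>" for f
  proof (rule antisym)
    show "f x \<le> val_integral K f s"
    proof (rule real_le_epsI)
      fix e :: real assume "e > 0"
      then have "\<exists>y\<in>b ` S. f x < f y + e"
        using cont[OF f] dir x unfolding scott_continuous_unit_interval_iff by blast
      then obtain \<nu> where \<nu>: "\<nu> \<in> S" "f x < f (b \<nu>) + e" by blast
      then show "f x < val_integral K f s + e"
        using b(2)[OF \<nu>(1) f] val_integral_mono[OF cont[OF f] SV[OF \<nu>(1)] sV ub[OF \<nu>(1)]] by linarith
    qed
    show "val_integral K f s \<le> f x"
    proof (rule real_le_epsI)
      fix e :: real assume "e > 0"
      then obtain \<nu> where \<nu>: "\<nu> \<in> S" "val_integral K f s < val_integral K f \<nu> + e"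
        using val_integral_sup[OF cont[OF f] sup(2,3)] by blast
      then show "val_integral K f s < f x + e"
        using b(2)[OF \<nu>(1) f] functional_mono[OF f b(1)[OF \<nu>(1)] xK xub[OF \<nu>(1)]] by linarith
    qed
  qed
  with xK show ?case by blast
qed

text \<open>The choice is unique by \<open>functional_ext\<close>. The restriction to
  \<open>M_carrier K\<close> makes the map extensional, the form in which it is unique as a
  function.\<close>

definition barycentre :: "('a set \<Rightarrow> real) \<Rightarrow> 'a" where
  "barycentre = (\<lambda>\<nu>\<in>M_carrier K. SOME x. x \<in> carrier K \<and> (\<forall>f\<in>\<Phi>. f x = val_integral K f \<nu>))"

lemma barycentre_props:
  assumes "\<nu> \<in> M_carrier K"
  shows barycentre_closed: "barycentre \<nu> \<in> carrier K"
    and barycentre_integral: "f \<in> \<Phi> \<Longrightarrow> f (barycentre \<nu>) = val_integral K f \<nu>"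
proof -
  have "\<exists>x. x \<in> carrier K \<and> (\<forall>f\<in>\<Phi>. f x = val_integral K f \<nu>)"
    using barycentre_exists[OF assms] by blast
  from someI_ex[OF this]
  have "barycentre \<nu> \<in> carrier K \<and> (\<forall>f\<in>\<Phi>. f (barycentre \<nu>) = val_integral K f \<nu>)"
    unfolding barycentre_def restrict_apply'[OF assms] .
  then show "barycentre \<nu> \<in> carrier K" "f \<in> \<Phi> \<Longrightarrow> f (barycentre \<nu>) = val_integral K f \<nu>"
    by blast+
qed

lemma barycentre_continuous: "scott_continuous (M_dcpo K) K barycentre"
proof (rule scott_continuous_M_I)
  show mono: "barycentre \<nu> \<sqsubseteq>\<^bsub>K\<^esub> barycentre \<xi>"
    if "\<nu> \<in> M_carrier K" "\<xi> \<in> M_carrier K" "val_le K \<nu> \<xi>" for \<nu> \<xi>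
  proof (rule order_determining)
    show "f (barycentre \<nu>) \<le> f (barycentre \<xi>)" if f: "f \<in> \<Phi>" for f
      using val_integral_mono[OF cont[OF f], of \<nu> \<xi>] \<open>\<nu> \<in> M_carrier K\<close> \<open>\<xi> \<in> M_carrier K\<close> \<open>val_le K \<nu> \<xi>\<close>
        M_carrier_subset[of K] by (auto simp: barycentre_integral f)
  qed (use that barycentre_closed in auto)
  fix S s
  assume S: "S \<subseteq> M_carrier K" "val_directed K S" "val_sup K S s" "s \<in> M_carrier K" "directed K (barycentre ` S)"
  show "is_lub K (barycentre s) (barycentre ` S)"
    unfolding directed_is_lub_iff[OF S(5)]
  proof (intro conjI ballI impI)
    show "x \<sqsubseteq>\<^bsub>K\<^esub> barycentre s" if "x \<in> barycentre ` S" for x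
      using that mono S by (auto simp: val_sup_def)
    fix u assume u: "u \<in> carrier K" "\<forall>x\<in>barycentre ` S. x \<sqsubseteq>\<^bsub>K\<^esub> u"
    show "barycentre s \<sqsubseteq>\<^bsub>K\<^esub> u"
    proof (rule order_determining[OF barycentre_closed[OF S(4)] u(1)])
      fix f assume f: "f \<in> \<Phi>"
      show "f (barycentre s) \<le> f u"
      proof (rule real_le_epsI)
        fix e :: real assume "e > 0"
        then obtain \<nu> where \<nu>: "\<nu> \<in> S" "val_integral K f s < val_integral K f \<nu> + e"
          using val_integral_sup[OF cont[OF f] S(2,3)] by blast
        have "\<nu> \<in> M_carrier K" using \<nu>(1) S(1) by blast
        moreover have "barycentre \<nu> \<sqsubseteq>\<^bsub>K\<^esub> u" using u(2) \<nu>(1) by blast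
        ultimately show "f (barycentre s) < f u + e"
          using \<nu>(2) functional_mono[OF f barycentre_closed u(1)] barycentre_integral[OF _ f] S(4) by force
      qed
    qed
  qed (use barycentre_closed S(4) in simp)
qed (rule barycentre_closed)

lemma barycentre_linear: "convex_linear (M_dcpo K) K barycentre"
  unfolding convex_linear_def M_dcpo_simps
proof (intro conjI ballI)
  have sub: "subconvex (carrier K) []" by (simp add: subconvex_def)
  show "barycentre (bot (M_dcpo K)) = bot K"
    unfolding bot_M_eq
  proof (rule functional_ext)
    show "f (barycentre (simple_valuation K [])) = f (bot K)" if "f \<in> \<Phi>" for f
      using that val_integral_simple[OF cont[OF that] sub]
      by (simp add: barycentre_integral simple_valuation_in_M sub strict)
  qed (use barycentre_closed simple_valuation_in_M[OF sub] closed in \<open>auto simp: convex_closed_def\<close>)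
  fix r :: real and \<nu> \<xi> assume r: "r \<in> {0..1}" and \<nu>: "\<nu> \<in> M_carrier K" and \<xi>: "\<xi> \<in> M_carrier K"
  note b = barycentre_closed[OF \<nu>] barycentre_closed[OF \<xi>] and V = subsetD[OF M_carrier_subset]
  show "barycentre (conv (M_dcpo K) r \<nu> \<xi>) = conv K r (barycentre \<nu>) (barycentre \<xi>)"
  proof (rule functional_ext)
    show "conv K r (barycentre \<nu>) (barycentre \<xi>) \<in> carrier K" using closed r b by (simp add: convex_closed_def)
    show "f (barycentre (conv (M_dcpo K) r \<nu> \<xi>)) = f (conv K r (barycentre \<nu>) (barycentre \<xi>))" if f: "f \<in> \<Phi>" for f
      using val_integral_conv[OF cont[OF f] V[OF \<nu>] V[OF \<xi>]] affine[OF f r b] f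
      by (simp add: barycentre_integral conv_in_M[OF r \<nu> \<xi>] \<nu> \<xi>)
  qed (use barycentre_closed conv_in_M[OF r \<nu> \<xi>] in simp)
qed

lemma barycentre_dirac:
  assumes "x \<in> carrier K" shows "barycentre (dirac K x) = x"
proof (rule functional_ext)
  have sub: "subconvex (carrier K) [(1, x)]" using assms by (simp add: subconvex_def)
  show "f (barycentre (dirac K x)) = f x" if "f \<in> \<Phi>" for f
    using that val_integral_simple[OF cont[OF that] sub] dirac_in_M[OF assms]
    by (simp add: barycentre_integral flip: dirac_eq_simple)
qed (use assms barycentre_closed[OF dirac_in_M[OF assms]] in auto)

text \<open>For a simple \<Xi> with weights r_i at valuations \<nu>_i, both sides equal the convex
  sum of the barycentres of the \<nu>_i: the left side by the unit law after mapping, the right side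
  by linearity. Both sides commute with directed suprema.\<close>

lemma barycentre_algebra: "EM_algebra K barycentre"
  unfolding EM_algebra_def
proof (intro conjI ballI)
  note M_cont = barycentre_continuous
  fix \<Xi> assume "\<Xi> \<in> carrier (M_dcpo (M_dcpo K))"
  then have "\<Xi> \<in> M_carrier (M_dcpo K)" by simp
  then show "barycentre (M_map (M_dcpo K) K barycentre \<Xi>) = barycentre (M_mult K \<Xi>)"
  proof (induction rule: M_carrier_induct)
    case (simple l)
    then have l: "subconvex (M_carrier K) l" by simp
    have "barycentre (M_map (M_dcpo K) K barycentre (simple_valuation (M_dcpo K) l)) =
        convex_sum K (map (\<lambda>(r, \<nu>). (r, barycentre \<nu>)) l)"
      unfolding M_map_simple[OF M_cont simple]
      by (rule linear_simple_valuation[OF barycentre_linear])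
        (auto intro: subconvex_map[OF l] simp: barycentre_closed barycentre_dirac)
    also have "\<dots> = barycentre (convex_sum (M_dcpo K) l)"
      using convex_linear_convex_sum[OF barycentre_linear convex_closed_M simple] by simp
    finally show ?case by (simp add: M_mult_simple[OF l])
  next
    case (sup S s)
    note SM = subsetD[OF sup(1)]
    note map = M_map_sup[OF M_cont sup(2,3)]
    note mult = M_mult_sup[OF sup(2,3) M_mult_in_M[OF SM]]
    have "is_lub K (barycentre (M_map (M_dcpo K) K barycentre s)) (barycentre ` M_map (M_dcpo K) K barycentre ` S)"
      using M_map_in_M[OF M_cont SM] by (intro scott_continuous_M_sup[OF M_cont _ map]) blast
    moreover have "is_lub K (barycentre (M_mult K s)) (barycentre ` M_mult K ` S)"
      using M_mult_in_M[OF SM] by (intro scott_continuous_M_sup[OF M_cont _ mult]) blast+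
    moreover have "barycentre ` M_map (M_dcpo K) K barycentre ` S = barycentre ` M_mult K ` S"
      unfolding image_image by (rule image_cong) (use sup(4) in auto)
    ultimately show ?case using partial_order_lub_unique[OF po] by metis
  qed
qed (use dcpo barycentre_continuous barycentre_dirac in auto)

end

section \<open>Continuity of the valuation monad\<close>

lemma sum_list_as_sum:
  fixes g :: "real \<Rightarrow> 'a \<Rightarrow> real"
  shows "(\<Sum>(r, x)\<leftarrow>l. g r x) = (\<Sum>i<length l. g (fst (l ! i)) (snd (l ! i)))"
  by (simp add: sum_list_sum_nth case_prod_unfold atLeast0LessThan)

text \<open>Moving the points down makes them robust against suprema in D, and lowering the weights
  by a factor c < 1 makes the values robust against suprema of reals; both are needed for a
  way-below relation.\<close>

lemma approximable_simple_valuation: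
  assumes po: "partial_order D" and dom: "\<And>x. x \<in> carrier D \<Longrightarrow> approximable D (carrier D) x"
    and l: "subconvex (carrier D) l"
  shows "approximable (M_dcpo D) (simple_valuation D ` {l. subconvex (carrier D) l}) (simple_valuation D l)"
proof -
  let ?n = "length l"
  define r where "r i = fst (l ! i)" for i
  define x where "x i = snd (l ! i)" for i
  have rx: "(r i, x i) \<in> set l" if "i < ?n" for i using that by (simp add: r_def x_def)
  have r0: "0 \<le> r i" and xD: "x i \<in> carrier D" if "i < ?n" for i
    using subconvexD(1,2)[OF l rx[OF that]] by simp_all
  have mass: "(\<Sum>i<?n. r i) \<le> 1" using subconvexD(3)[OF l] by (simp add: sum_list_as_sum r_def)
  have "\<forall>i<?n. \<exists>T. directed D T \<and> is_lub D (x i) T \<and> (\<forall>d\<in>T. way_below D d (x i))"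
    using dom xD unfolding approximable_def by blast
  then obtain T where T: "\<And>i. i < ?n \<Longrightarrow> directed D (T i)" "\<And>i. i < ?n \<Longrightarrow> is_lub D (x i) (T i)"
    "\<And>i d. \<lbrakk>i < ?n; d \<in> T i\<rbrakk> \<Longrightarrow> way_below D d (x i)" by metis
  have TD: "d \<in> carrier D" if "i < ?n" "d \<in> T i" for i d using T(3)[OF that] by (simp add: way_below_def)
  define a where "a c y = map (\<lambda>i. (c * r i, y i)) [0..<?n]" for c :: real and y :: "nat \<Rightarrow> 'a"
  define ok where "ok c y \<longleftrightarrow> 0 \<le> c \<and> c < 1 \<and> (\<forall>i<?n. y i \<in> T i)" for c :: real and y
  let ?s = "simple_valuation D l"
  let ?A = "{simple_valuation D (a c y) | c y. ok c y}"
  have s_app: "?s U = (\<Sum>i<?n. if x i \<in> U then r i else 0)" if "U \<in> scott_opens D" for U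
    unfolding simple_valuation_apply[OF that] sum_list_as_sum r_def x_def ..
  have a_app: "simple_valuation D (a c y) U = (\<Sum>i<?n. if y i \<in> U then c * r i else 0)" if "U \<in> scott_opens D" for c y U
    unfolding simple_valuation_apply[OF that] sum_list_as_sum by (simp add: a_def cong: if_cong)
  have a_sub: "subconvex (carrier D) (a c y)" if "ok c y" for c y
  proof -
    have "c * (\<Sum>i<?n. r i) \<le> 1 * 1"
      by (rule mult_mono) (use that mass r0 in \<open>auto simp: ok_def intro: sum_nonneg\<close>)
    then have "(\<Sum>(r, x)\<leftarrow>a c y. r) \<le> 1" unfolding sum_list_as_sum by (simp add: a_def sum_distrib_left)
    then show ?thesis using that r0 TD by (auto simp: subconvex_def a_def ok_def)
  qed
  have a_mono: "val_le D (simple_valuation D (a c y)) (simple_valuation D (a d z))"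
    if "ok c y" "ok d z" "c \<le> d" "\<And>i. i < ?n \<Longrightarrow> y i \<sqsubseteq>\<^bsub>D\<^esub> z i" for c d y z
    unfolding val_le_def
  proof
    fix U assume U: "U \<in> scott_opens D"
    show "simple_valuation D (a c y) U \<le> simple_valuation D (a d z) U"
      unfolding a_app[OF U]
    proof (rule sum_mono)
      fix i assume "i \<in> {..<?n}"
      then have i: "i < ?n" by simp
      have "z i \<in> carrier D" using TD[OF i] that(2) i by (simp add: ok_def)
      then have "y i \<in> U \<Longrightarrow> z i \<in> U" using scott_opens_up[OF U _ _ that(4)[OF i]] by blast
      then show "(if y i \<in> U then c * r i else 0) \<le> (if z i \<in> U then d * r i else 0)"
        using that(1-3) r0[OF i] by (auto simp: ok_def mult_right_mono)
    qed
  qed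
  have up: "\<exists>\<zeta>\<in>?A. val_le D (simple_valuation D (a c y)) \<zeta> \<and> val_le D (simple_valuation D (a d z)) \<zeta>"
    if ok: "ok c y" "ok d z" for c d y z
  proof -
    have "\<exists>w\<in>T i. y i \<sqsubseteq>\<^bsub>D\<^esub> w \<and> z i \<sqsubseteq>\<^bsub>D\<^esub> w" if "i < ?n" for i
      using directed_upper[OF T(1)[OF that], of "y i" "z i"] ok that unfolding ok_def by metis
    then obtain w where w: "\<And>i. i < ?n \<Longrightarrow> w i \<in> T i \<and> y i \<sqsubseteq>\<^bsub>D\<^esub> w i \<and> z i \<sqsubseteq>\<^bsub>D\<^esub> w i" by metis
    have okw: "ok (max c d) w" using ok w by (auto simp: ok_def)
    show ?thesis
      by (rule bexI[of _ "simple_valuation D (a (max c d) w)"])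
        (use a_mono[OF ok(1) okw] a_mono[OF ok(2) okw] w okw in auto)
  qed
  have "T i \<noteq> {}" if "i < ?n" for i using T(1)[OF that] by (simp add: directed_def)
  then have "\<forall>i<?n. \<exists>d. d \<in> T i" by blast
  then have "\<exists>y. \<forall>i<?n. y i \<in> T i" by metis
  then obtain y0 where "ok 0 y0" by (auto simp: ok_def)
  then have dirA: "directed (M_dcpo D) ?A"
    unfolding directed_def using up simple_valuation_in_M[OF a_sub] by auto
  then have dA: "val_directed D ?A" by (simp add: directed_M_iff)
  have wb: "way_below (M_dcpo D) (simple_valuation D (a c y)) ?s" if ok: "ok c y" for c y
    unfolding way_below_def
  proof (intro conjI allI impI)
    show "simple_valuation D (a c y) \<in> carrier (M_dcpo D)" using simple_valuation_in_M[OF a_sub[OF ok]] by simp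
    show "?s \<in> carrier (M_dcpo D)" using simple_valuation_in_M[OF l] by simp
    fix S t assume "directed (M_dcpo D) S \<and> is_lub (M_dcpo D) t S \<and> ?s \<sqsubseteq>\<^bsub>M_dcpo D\<^esub> t"
    then have S: "directed (M_dcpo D) S" and t: "val_sup D S t" and st: "val_le D ?s t"
      using is_lub_M_dcpo by auto
    have SV: "\<And>\<nu>. \<nu> \<in> S \<Longrightarrow> \<nu> \<in> valuations D" using S by (auto simp: directed_M_iff val_directed_def)
    \<comment> \<open>\<open>UJ J\<close> contains \<open>x i\<close> for each i in J, as
      \<open>y i\<close> is way below \<open>x i\<close>, and lies inside every open set that
      contains \<open>y i\<close> for all i in J. So these finitely many sets stand in for all open
      sets.\<close>
    define UJ where "UJ J = (\<Union>i\<in>J. {z. way_below D (y i) z})" for J :: "nat set"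
    have UJ_open: "UJ J \<in> scott_opens D" for J
      unfolding UJ_def using scott_open_way_above[OF po dom] by (intro scott_opens_Union) blast
    have "\<exists>\<nu>\<in>S. (\<Sum>i\<in>J. c * r i) \<le> \<nu> (UJ J)" if J: "J \<subseteq> {..<?n}" for J
    proof -
      let ?R = "\<Sum>i\<in>J. r i"
      have Jr: "0 \<le> r i" if "i \<in> J" for i using r0 J that by blast
      have "?R = (\<Sum>i\<in>J. if x i \<in> UJ J then r i else 0)"
      proof (rule sum.cong[OF refl])
        fix i assume i: "i \<in> J"
        then have "i < ?n" using J by blast
        then have "way_below D (y i) (x i)" using T(3) ok by (simp add: ok_def)
        with i show "r i = (if x i \<in> UJ J then r i else 0)" by (auto simp: UJ_def)
      qed
      also have "\<dots> \<le> ?s (UJ J)"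
        unfolding s_app[OF UJ_open] by (rule sum_mono2) (use J r0 in auto)
      also have "\<dots> \<le> t (UJ J)" using val_leD[OF st UJ_open] .
      finally have R: "?R \<le> t (UJ J)" .
      show ?thesis
      proof (cases "?R = 0")
        case True
        obtain \<nu> where "\<nu> \<in> S" using S by (auto simp: directed_def)
        then show ?thesis
          using True valuation_nonneg[OF SV UJ_open] by (auto simp flip: sum_distrib_left)
      next
        case False
        then have "?R > 0" using sum_nonneg[of J r] Jr by fastforce
        \<comment> \<open>The slack: t has mass at least R on \<open>UJ J\<close>, so a member of S
          that comes within (1 - c) R of t reaches c R there.\<close>
        then have "(1 - c) * ?R > 0" using ok by (simp add: ok_def)
        then obtain \<nu> where \<nu>: "\<nu> \<in> S" "t (UJ J) < \<nu> (UJ J) + (1 - c) * ?R"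
          using t UJ_open[of J] unfolding val_sup_def by blast
        then have "c * ?R \<le> \<nu> (UJ J)" using R by (simp add: algebra_simps)
        with \<nu>(1) show ?thesis by (auto simp: sum_distrib_left)
      qed
    qed
    then obtain \<nu> where \<nu>: "\<And>J. J \<subseteq> {..<?n} \<Longrightarrow> \<nu> J \<in> S \<and> (\<Sum>i\<in>J. c * r i) \<le> \<nu> J (UJ J)" by metis
    have "\<exists>\<xi>\<in>S. \<forall>\<zeta>\<in>\<nu> ` Pow {..<?n}. \<zeta> \<sqsubseteq>\<^bsub>M_dcpo D\<^esub> \<xi>"
      by (rule directed_finite_upper[OF partial_order_M S]) (use \<nu> in auto)
    then obtain \<xi> where \<xi>: "\<xi> \<in> S" "\<And>J. J \<subseteq> {..<?n} \<Longrightarrow> val_le D (\<nu> J) \<xi>" by auto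
    have "val_le D (simple_valuation D (a c y)) \<xi>"
      unfolding val_le_def
    proof
      fix U assume U: "U \<in> scott_opens D"
      define J where "J = {i \<in> {..<?n}. y i \<in> U}"
      have J: "J \<subseteq> {..<?n}" by (auto simp: J_def)
      have "UJ J \<subseteq> U"
      proof
        fix z assume "z \<in> UJ J"
        then obtain i where i: "i \<in> J" "way_below D (y i) z" by (auto simp: UJ_def)
        then show "z \<in> U"
          using scott_opens_up[OF U, of "y i" z] way_below_imp_le[OF po i(2)] by (auto simp: J_def way_below_def)
      qed
      have "simple_valuation D (a c y) U = (\<Sum>i\<in>J. c * r i)"
        unfolding a_app[OF U] J_def by (rule sum.inter_filter[symmetric]) simp
      also have "\<dots> \<le> \<nu> J (UJ J)" using \<nu>[OF J] by simp
      also have "\<dots> \<le> \<xi> (UJ J)" using val_leD[OF \<xi>(2)[OF J] UJ_open] .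
      also have "\<dots> \<le> \<xi> U" using valuation_mono[OF SV[OF \<xi>(1)] UJ_open U \<open>UJ J \<subseteq> U\<close>] .
      finally show "simple_valuation D (a c y) U \<le> \<xi> U" .
    qed
    with \<xi>(1) show "\<exists>\<xi>\<in>S. simple_valuation D (a c y) \<sqsubseteq>\<^bsub>M_dcpo D\<^esub> \<xi>" by auto
  qed
  have "val_sup D ?A ?s"
    unfolding val_sup_def
  proof (intro conjI ballI allI impI)
    show "?s \<in> valuations D" by (rule simple_valuation_in_valuations[OF l])
    show "val_le D \<nu> ?s" if "\<nu> \<in> ?A" for \<nu>
      using that way_below_imp_le[OF partial_order_M wb] by auto
    fix U and e :: real assume U: "U \<in> scott_opens D" and e: "e > 0"
    have "\<exists>d\<in>T i. x i \<in> U \<longrightarrow> d \<in> U" if "i < ?n" for i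
      using scott_opens_lub[OF U T(1)[OF that] T(2)[OF that]] T(1)[OF that] unfolding directed_def by blast
    then obtain y where y: "\<And>i. i < ?n \<Longrightarrow> y i \<in> T i \<and> (x i \<in> U \<longrightarrow> y i \<in> U)" by metis
    \<comment> \<open>The total mass is at most 1, so scaling by c loses at most 1 - c, which is
      below e. The maximum keeps c nonnegative for large e.\<close>
    define c where "c = max 0 (1 - e / 2)"
    have ok: "ok c y" using y e by (auto simp: ok_def c_def)
    let ?V = "\<Sum>i<?n. if y i \<in> U then r i else 0"
    have "?s U \<le> ?V" unfolding s_app[OF U] by (rule sum_mono) (use y r0 in auto)
    moreover have "?V \<le> (\<Sum>i<?n. r i)" by (rule sum_mono) (use r0 in auto)
    then have "?V \<le> 1" using mass by simp
    then have "(1 - c) * ?V \<le> (1 - c) * 1" using ok by (intro mult_left_mono) (auto simp: ok_def)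
    moreover have "1 - c < e" using e by (auto simp: c_def)
    moreover have "simple_valuation D (a c y) U = c * ?V"
      unfolding a_app[OF U] sum_distrib_left by (rule sum.cong) auto
    ultimately have "?s U < simple_valuation D (a c y) U + e" by (simp add: algebra_simps)
    with ok show "\<exists>\<nu>\<in>?A. ?s U < \<nu> U + e" by blast
  qed
  then have "is_lub (M_dcpo D) ?s ?A" using is_lub_M_dcpo[OF dirA] by simp
  moreover have "?A \<subseteq> simple_valuation D ` {l. subconvex (carrier D) l}" using a_sub by blast
  ultimately show ?thesis using dirA wb unfolding approximable_def by blast
qed

lemma approximable_M:
  assumes po: "partial_order D" and dom: "\<And>x. x \<in> carrier D \<Longrightarrow> approximable D (carrier D) x"
    and "\<nu> \<in> M_carrier D"
  shows "approximable (M_dcpo D) (simple_valuation D ` {l. subconvex (carrier D) l}) \<nu>"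
  using assms(3)
proof (induction rule: M_carrier_induct)
  case (simple l)
  show ?case by (rule approximable_simple_valuation[OF po dom simple])
next
  case (sup S s)
  then have "directed (M_dcpo D) S" by (simp add: directed_M_iff)
  then show ?case
    using sup(3,4) by (intro approximable_directed_lub[OF partial_order_M]) (auto simp: is_lub_M_dcpo)
qed

lemma linear_continuous_is_barycentre_map:
  assumes po: "partial_order K" and dom: "\<And>x. x \<in> carrier K \<Longrightarrow> approximable K (carrier K) x"
    and closed: "convex_closed K"
    and \<beta>: "scott_continuous (M_dcpo K) K \<beta>" "convex_linear (M_dcpo K) K \<beta>"
      "\<And>x. x \<in> carrier K \<Longrightarrow> \<beta> (dirac K x) = x"
  shows "is_barycentre_map K \<beta>"
  unfolding is_barycentre_map_def
proof
  fix \<nu> assume "\<nu> \<in> carrier (M_dcpo K)"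
  then have \<nu>: "\<nu> \<in> M_carrier K" by simp
  let ?X = "{convex_sum K l | l. subconvex (carrier K) l \<and> way_below (M_dcpo K) (simple_valuation K l) \<nu>}"
  obtain S where S: "S \<subseteq> simple_valuation K ` {l. subconvex (carrier K) l}" "directed (M_dcpo K) S"
    "is_lub (M_dcpo K) \<nu> S" "\<forall>d\<in>S. way_below (M_dcpo K) d \<nu>"
    using approximable_M[OF po dom \<nu>] unfolding approximable_def by blast
  have simple: "\<beta> (simple_valuation K l) = convex_sum K l" if "subconvex (carrier K) l" for l
    by (rule linear_simple_valuation[OF \<beta>(2) _ that]) (rule \<beta>(3))
  have lub: "is_lub K (\<beta> \<nu>) (\<beta> ` S)" by (rule scott_continuous_lub[OF \<beta>(1) S(2,3)])
  have dir: "directed K (\<beta> ` S)" by (rule scott_continuous_directed[OF \<beta>(1) S(2)])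
  have XK: "?X \<subseteq> carrier K" using convex_sum_closed[OF closed] by blast
  show "is_lub K (\<beta> \<nu>) ?X"
    unfolding is_lub_iff[OF XK]
  proof (intro conjI ballI impI)
    show "\<beta> \<nu> \<in> carrier K" using scott_continuous_closed[OF \<beta>(1)] \<nu> by simp
    fix y assume "y \<in> ?X"
    then obtain l where l: "y = convex_sum K l" "subconvex (carrier K) l"
      "way_below (M_dcpo K) (simple_valuation K l) \<nu>" by blast
    then show "y \<sqsubseteq>\<^bsub>K\<^esub> \<beta> \<nu>"
      using scott_continuous_mono[OF \<beta>(1) _ _ way_below_imp_le[OF partial_order_M l(3)]]
        simple_valuation_in_M[OF l(2)] \<nu> simple[OF l(2)] by simp
  next
    fix u assume u: "u \<in> carrier K" "\<forall>y\<in>?X. y \<sqsubseteq>\<^bsub>K\<^esub> u"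
    have "\<beta> s \<in> ?X" if "s \<in> S" for s
      using S(1,4) that simple by fastforce
    then show "\<beta> \<nu> \<sqsubseteq>\<^bsub>K\<^esub> u"
      using lub u unfolding directed_is_lub_iff[OF dir] by blast
  qed
qed

theorem (in functional_kegelspitze) barycentre_unique_algebra:
  assumes dom: "\<And>x. x \<in> carrier K \<Longrightarrow> approximable K (carrier K) x"
  shows "(\<exists>!\<beta>. \<beta> \<in> extensional (carrier (M_dcpo K)) \<and> scott_continuous (M_dcpo K) K \<beta> \<and>
      convex_linear (M_dcpo K) K \<beta> \<and> EM_algebra K \<beta>) \<and>
    (\<forall>\<beta>. scott_continuous (M_dcpo K) K \<beta> \<and> convex_linear (M_dcpo K) K \<beta> \<and> EM_algebra K \<beta> \<longrightarrow>
      is_barycentre_map K \<beta>)"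
proof (intro conjI allI impI ex1I)
  show "barycentre \<in> extensional (carrier (M_dcpo K))" by (simp add: barycentre_def)
  show "scott_continuous (M_dcpo K) K barycentre" by (rule barycentre_continuous)
  show "convex_linear (M_dcpo K) K barycentre" by (rule barycentre_linear)
  show "EM_algebra K barycentre" by (rule barycentre_algebra)
next
  fix \<beta>
  assume \<beta>: "\<beta> \<in> extensional (carrier (M_dcpo K)) \<and> scott_continuous (M_dcpo K) K \<beta> \<and>
      convex_linear (M_dcpo K) K \<beta> \<and> EM_algebra K \<beta>"
  show "\<beta> = barycentre"
  proof (rule extensionalityI[of _ "carrier (M_dcpo K)"])
    show "barycentre \<in> extensional (carrier (M_dcpo K))" by (simp add: barycentre_def)
    fix \<nu> assume "\<nu> \<in> carrier (M_dcpo K)"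
    then show "\<beta> \<nu> = barycentre \<nu>"
      using \<beta> linear_continuous_unique[OF po _ _ _ barycentre_continuous barycentre_linear barycentre_dirac, of \<beta> \<nu>]
      by (simp add: EM_algebra_def)
  qed (use \<beta> in simp)
next
  fix \<beta> assume "scott_continuous (M_dcpo K) K \<beta> \<and> convex_linear (M_dcpo K) K \<beta> \<and> EM_algebra K \<beta>"
  then show "is_barycentre_map K \<beta>"
    by (intro linear_continuous_is_barycentre_map[OF po dom closed]) (auto simp: EM_algebra_def)
qed

section \<open>Positivity of finite complex matrices and limits along directed sets\<close>

section \<open>Positive semidefinite kernels\<close>

text \<open>Functions of two indices stand for matrices, so that index sets of pairs (matrix index,
  block index) need no renumbering.\<close>

definition sesq :: "'s set \<Rightarrow> ('s \<Rightarrow> 's \<Rightarrow> complex) \<Rightarrow> ('s \<Rightarrow> complex) \<Rightarrow> ('s \<Rightarrow> complex) \<Rightarrow> complex" where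
  "sesq S P v w = (\<Sum>s\<in>S. \<Sum>t\<in>S. cnj (v s) * P s t * w t)"

text \<open>Nonnegativity in the order of the complex numbers includes being real; hence hermitian
  symmetry is a consequence and not a separate requirement.\<close>

definition psd :: "'s set \<Rightarrow> ('s \<Rightarrow> 's \<Rightarrow> complex) \<Rightarrow> bool" where
  "psd S P \<longleftrightarrow> (\<forall>v. 0 \<le> sesq S P v v)"

definition unit_vec_at :: "'s \<Rightarrow> 's \<Rightarrow> complex" where
  "unit_vec_at a = (\<lambda>s. if s = a then 1 else 0)"

lemma sesq_cong:
  assumes "\<And>s t. \<lbrakk>s \<in> S; t \<in> S\<rbrakk> \<Longrightarrow> P s t = P' s t" "\<And>s. s \<in> S \<Longrightarrow> v s = v' s" "\<And>s. s \<in> S \<Longrightarrow> w s = w' s"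
  shows "sesq S P v w = sesq S P' v' w'"
  unfolding sesq_def by (intro sum.cong refl) (use assms in auto)

lemma psd_cong: "(\<And>s t. \<lbrakk>s \<in> S; t \<in> S\<rbrakk> \<Longrightarrow> P s t = P' s t) \<Longrightarrow> psd S P \<longleftrightarrow> psd S P'"
  unfolding psd_def by (simp add: sesq_cong[of S P P'])

lemma sesq_add: "sesq S (\<lambda>s t. P s t + Q s t) v w = sesq S P v w + sesq S Q v w"
  by (simp add: sesq_def algebra_simps sum.distrib)

lemma sesq_diff: "sesq S (\<lambda>s t. P s t - Q s t) v w = sesq S P v w - sesq S Q v w"
  by (simp add: sesq_def algebra_simps sum_subtractf)

lemma sesq_scale: "sesq S (\<lambda>s t. c * P s t) v w = c * sesq S P v w"
  by (simp add: sesq_def sum_distrib_left algebra_simps)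

lemma sesq_sum: "sesq S (\<lambda>s t. \<Sum>k\<in>I. P k s t) v w = (\<Sum>k\<in>I. sesq S (P k) v w)"
  by (induction I rule: infinite_finite_induct) (simp_all add: sesq_add, simp_all add: sesq_def)

lemma sesq_add_left: "sesq S P (\<lambda>s. v s + c * v' s) w = sesq S P v w + cnj c * sesq S P v' w"
  by (simp add: sesq_def algebra_simps sum.distrib sum_distrib_left)

lemma sesq_add_right: "sesq S P v (\<lambda>s. w s + c * w' s) = sesq S P v w + c * sesq S P v w'"
  by (simp add: sesq_def algebra_simps sum.distrib sum_distrib_left)

lemma sesq_scale_left: "sesq S P (\<lambda>s. c * v s) w = cnj c * sesq S P v w"
  by (simp add: sesq_def sum_distrib_left algebra_simps)

lemma sesq_scale_right: "sesq S P v (\<lambda>s. c * w s) = c * sesq S P v w"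
  by (simp add: sesq_def sum_distrib_left algebra_simps)

lemma sesq_unit_left:
  assumes "finite S" "a \<in> S"
  shows "sesq S P (unit_vec_at a) w = (\<Sum>t\<in>S. P a t * w t)"
proof -
  have "sesq S P (unit_vec_at a) w = (\<Sum>s\<in>S. if s = a then (\<Sum>t\<in>S. P a t * w t) else 0)"
    unfolding sesq_def unit_vec_at_def by (intro sum.cong) auto
  then show ?thesis using assms by (simp add: sum.delta)
qed

lemma sesq_unit:
  assumes "finite S" "a \<in> S" "b \<in> S"
  shows "sesq S P (unit_vec_at a) (unit_vec_at b) = P a b"
  unfolding sesq_unit_left[OF assms(1,2)] using assms
  by (simp add: unit_vec_at_def if_distrib[of "(*) _"] sum.delta cong: if_cong)

lemma sesq_insert:
  assumes "finite S" "a \<notin> S"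
  shows "sesq (insert a S) P v w = cnj (v a) * P a a * w a + cnj (v a) * (\<Sum>t\<in>S. P a t * w t)
    + (\<Sum>s\<in>S. cnj (v s) * P s a) * w a + sesq S P v w"
  using assms by (simp add: sesq_def sum.distrib sum_distrib_left sum_distrib_right algebra_simps)

lemma complex_nonneg_iff: "0 \<le> z \<longleftrightarrow> 0 \<le> Re z \<and> Im z = 0"
  by (auto simp: less_eq_complex_def)

lemma psdD: "psd S P \<Longrightarrow> 0 \<le> Re (sesq S P v v)" "psd S P \<Longrightarrow> Im (sesq S P v v) = 0"
  by (auto simp: psd_def complex_nonneg_iff)

lemma sesq_quadratic_add:
  "sesq S P (\<lambda>s. v s + c * w s) (\<lambda>s. v s + c * w s) =
    sesq S P v v + c * sesq S P v w + cnj c * sesq S P w v + cnj c * c * sesq S P w w"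
  by (simp add: sesq_add_left sesq_add_right algebra_simps)

lemma sesq_polarization:
  "4 * sesq S P v w =
    sesq S P (\<lambda>s. v s + 1 * w s) (\<lambda>s. v s + 1 * w s) - sesq S P (\<lambda>s. v s + (-1) * w s) (\<lambda>s. v s + (-1) * w s)
    - \<i> * sesq S P (\<lambda>s. v s + \<i> * w s) (\<lambda>s. v s + \<i> * w s)
    + \<i> * sesq S P (\<lambda>s. v s + (-\<i>) * w s) (\<lambda>s. v s + (-\<i>) * w s)"
  unfolding sesq_quadratic_add by (simp add: algebra_simps)

text \<open>The real-valued form at v + w settles the imaginary part, and at v + i w the real
  part.\<close>

lemma sesq_hermitian:
  assumes "\<And>v. Im (sesq S P v v) = 0"
  shows "sesq S P w v = cnj (sesq S P v w)"
proof (rule complex_eqI)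
  show "Im (sesq S P w v) = Im (cnj (sesq S P v w))"
    using assms[of "\<lambda>s. v s + 1 * w s"] assms[of v] assms[of w] unfolding sesq_quadratic_add by simp
  show "Re (sesq S P w v) = Re (cnj (sesq S P v w))"
    using assms[of "\<lambda>s. v s + \<i> * w s"] assms[of v] assms[of w] unfolding sesq_quadratic_add by simp
qed

lemma psd_hermitian:
  assumes "psd S P" "finite S" "s \<in> S" "t \<in> S"
  shows "P t s = cnj (P s t)"
  using sesq_hermitian[of S P "unit_vec_at t" "unit_vec_at s"] psdD(2)[OF assms(1)]
    sesq_unit[OF assms(2)] assms(3,4) by simp

text \<open>The arithmetic-mean version of the Cauchy-Schwarz inequality. It is free of square roots
  and follows from nonnegativity at a single vector.\<close>

lemma psd_cauchy_schwarz:
  assumes "psd S P"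
  shows "2 * cmod (sesq S P v w) \<le> Re (sesq S P v v) + Re (sesq S P w w)"
proof (cases "sesq S P v w = 0")
  case True
  then show ?thesis using psdD(1)[OF assms] by simp
next
  case False
  let ?z = "sesq S P v w"
  \<comment> \<open>The phase that turns the cross term c * z into -|z|.\<close>
  define c where "c = - cnj ?z / cmod ?z"
  have cz: "c * ?z = - cmod ?z"
  proof -
    have "?z * cnj ?z = cmod ?z * cmod ?z" by (metis complex_norm_square of_real_mult power2_eq_square)
    then show ?thesis using False by (simp add: c_def field_simps)
  qed
  have cc: "cnj c * c = 1"
  proof -
    have "cmod c = 1" using False by (simp add: c_def norm_divide)
    then show ?thesis by (metis complex_norm_square mult.commute of_real_1 power_one)
  qed
  have "0 \<le> Re (sesq S P (\<lambda>s. v s + c * w s) (\<lambda>s. v s + c * w s))" by (rule psdD(1)[OF assms])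
  also have "\<dots> = Re (sesq S P v v) + Re (c * ?z) + Re (cnj (c * ?z)) + Re (sesq S P w w)"
    unfolding sesq_quadratic_add cc sesq_hermitian[OF psdD(2)[OF assms], of w v] by simp
  finally show ?thesis unfolding cz by simp
qed

text \<open>Where the form vanishes at e_a, scaling e_a by r scales the cross term but costs nothing
  on the right of the Cauchy-Schwarz inequality.\<close>

lemma psd_zero_diagonal:
  assumes P: "psd S P" and S: "finite S" "a \<in> S" "t \<in> S" and 0: "P a a = 0"
  shows "P a t = 0" "P t a = 0"
proof -
  have "cmod (P a t) \<le> 0"
  proof (rule ccontr)
    assume "\<not> ?thesis"
    then have pos: "cmod (P a t) > 0" by simp
    \<comment> \<open>With this r the inequality reads 2 P_tt \<le> P_tt, which forces P_tt \<le> 0;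
      the unscaled inequality then contradicts a nonzero P_at.\<close>
    define r where "r = Re (P t t) / cmod (P a t)"
    have r: "0 \<le> r" using psdD(1)[OF P, of "unit_vec_at t"] sesq_unit[OF S(1) S(3,3)] pos by (simp add: r_def)
    have "sesq S P (\<lambda>s. of_real r * unit_vec_at a s) (\<lambda>s. of_real r * unit_vec_at a s) = 0"
      by (simp add: sesq_scale_left sesq_scale_right sesq_unit S 0)
    moreover have "sesq S P (\<lambda>s. of_real r * unit_vec_at a s) (unit_vec_at t) = of_real r * P a t"
      by (simp add: sesq_scale_left sesq_unit S)
    moreover have "sesq S P (unit_vec_at t) (unit_vec_at t) = P t t" by (simp add: sesq_unit S)
    ultimately have le: "2 * cmod (of_real r * P a t) \<le> Re (P t t)"
      using psd_cauchy_schwarz[OF P, of "\<lambda>s. of_real r * unit_vec_at a s" "unit_vec_at t"] by simp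
    have "cmod (of_real r * P a t) = r * cmod (P a t)" using r by (simp add: norm_mult)
    also have "\<dots> = Re (P t t)" using pos by (simp add: r_def)
    finally have "cmod (of_real r * P a t) = Re (P t t)" .
    with le have tt: "Re (P t t) \<le> 0" by simp
    have "2 * cmod (P a t) \<le> Re (P t t)"
      using psd_cauchy_schwarz[OF P, of "unit_vec_at a" "unit_vec_at t"] by (simp add: sesq_unit S 0)
    with tt pos show False by simp
  qed
  then show "P a t = 0" by simp
  then show "P t a = 0" using psd_hermitian[OF P S(1,2,3)] by simp
qed

lemma psd_diagonal_nonneg: "\<lbrakk>psd S P; finite S; a \<in> S\<rbrakk> \<Longrightarrow> 0 \<le> Re (P a a) \<and> Im (P a a) = 0"
  using psdD[of S P "unit_vec_at a"] by (simp add: sesq_unit)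

text \<open>The compression of a form along $v \mapsto v - \bigl(\sum_t l_t v_t\bigr) e_a$; for
  $l_t = P_{at} / P_{aa}$ this is the Schur complement.\<close>

definition compression :: "'s \<Rightarrow> ('s \<Rightarrow> complex) \<Rightarrow> ('s \<Rightarrow> 's \<Rightarrow> complex) \<Rightarrow> 's \<Rightarrow> 's \<Rightarrow> complex" where
  "compression a l P s t = P s t - P s a * l t - cnj (l s) * P a t + cnj (l s) * l t * P a a"

text \<open>For l equal to row a of P divided by a nonzero P_aa, the lifted vector is P-orthogonal
  to e_a. This makes the Schur complement the restriction of P to a complement of e_a.\<close>

definition lift_vec :: "'s set \<Rightarrow> 's \<Rightarrow> ('s \<Rightarrow> complex) \<Rightarrow> ('s \<Rightarrow> complex) \<Rightarrow> 's \<Rightarrow> complex" where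
  "lift_vec S a l v = v(a := - (\<Sum>t\<in>S. l t * v t))"

lemma sesq_compression:
  assumes "finite S" "a \<notin> S"
  shows "sesq S (compression a l P) v w = sesq (insert a S) P (lift_vec S a l v) (lift_vec S a l w)"
proof -
  let ?L = "\<Sum>t\<in>S. l t * w t" and ?M = "\<Sum>t\<in>S. l t * v t"
  have up: "sesq S P (lift_vec S a l v) (lift_vec S a l w) = sesq S P v w"
    by (rule sesq_cong) (use assms in \<open>auto simp: lift_vec_def\<close>)
  have ne: "(lift_vec S a l u) s = u s" if "s \<in> S" for u s using that assms by (auto simp: lift_vec_def)
  have a: "lift_vec S a l u a = - (\<Sum>t\<in>S. l t * u t)" for u by (simp add: lift_vec_def)
  have "sesq S (compression a l P) v w = sesq S P v w - (\<Sum>s\<in>S. cnj (v s) * P s a) * ?L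
      - cnj ?M * (\<Sum>t\<in>S. P a t * w t) + cnj ?M * P a a * ?L"
    unfolding sesq_def compression_def cnj_sum
    by (simp add: algebra_simps sum.distrib sum_subtractf sum_product sum_distrib_left sum_distrib_right)
  then show ?thesis
    unfolding sesq_insert[OF assms] up a by (simp add: ne algebra_simps cong: sum.cong)
qed

lemma psd_compression:
  assumes "finite S" "a \<notin> S" "psd (insert a S) P"
  shows "psd S (compression a l P)"
  using assms(3) unfolding psd_def sesq_compression[OF assms(1,2)] by blast

lemma lift_vec_decomp:
  assumes "a \<notin> S" "s \<in> insert a S"
  shows "v s = lift_vec S a l v s + (v a + (\<Sum>t\<in>S. l t * v t)) * unit_vec_at a s"
  using assms by (auto simp: lift_vec_def unit_vec_at_def)

lemma psd_subset:
  fixes P :: "'a \<Rightarrow> 'a \<Rightarrow> complex"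
  assumes "finite S" "T \<subseteq> S" "psd S P"
  shows "psd T P"
  unfolding psd_def
proof
  fix v :: "'a \<Rightarrow> complex"
  let ?v = "\<lambda>s. if s \<in> T then v s else 0"
  have "sesq S P ?v ?v = (\<Sum>s\<in>S. if s \<in> T then (\<Sum>t\<in>S. if t \<in> T then cnj (v s) * P s t * v t else 0) else 0)"
    unfolding sesq_def by (intro sum.cong refl) (auto intro!: sum.cong)
  also have "\<dots> = sesq T P v v"
    unfolding sesq_def using assms by (simp add: sum.inter_restrict[symmetric] Int_absorb1 cong: if_cong)
  finally show "0 \<le> sesq T P v v" using assms(3) by (metis psd_def)
qed

text \<open>A rank-one term built from row a accounts for that row and column, and the Schur
  complement on S is factored by induction. The factor has the same index set as P, which is what
  the square witness in \<open>matrix_positive\<close> requires.\<close>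

theorem psd_cholesky:
  assumes "finite S" "psd S P"
  shows "\<exists>X. \<forall>s\<in>S. \<forall>t\<in>S. P s t = (\<Sum>u\<in>S. cnj (X u s) * X u t)"
  using assms
proof (induction S arbitrary: P)
  case (insert a S)
  note fin = insert.hyps(1) and aS = insert.hyps(2) and P = insert.prems
  define d where "d = Re (P a a)"
  have fin': "finite (insert a S)" using fin by simp
  have Paa: "P a a = of_real d" and d0: "0 \<le> d"
    using psd_diagonal_nonneg[OF P, of a] fin by (auto simp: d_def complex_eq_iff)
  have zero: "P a t = 0 \<and> P t a = 0" if "d = 0" "t \<in> insert a S" for t
    using psd_zero_diagonal[OF P fin' _ that(2), of a] that(1) Paa by auto
  have herm: "P t s = cnj (P s t)" if "s \<in> insert a S" "t \<in> insert a S" for s t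
    using psd_hermitian[OF P fin' that] .
  define l where "l t = P a t / of_real d" for t
  obtain X where X: "\<forall>s\<in>S. \<forall>t\<in>S. compression a l P s t = (\<Sum>u\<in>S. cnj (X u s) * X u t)"
    using insert.IH[OF psd_compression[OF fin aS P]] by blast
  \<comment> \<open>For d = 0 the division by zero yields a zero row, which is right because row and
    column a of P vanish in that case.\<close>
  define Y where "Y u s = (if u = a then P a s / of_real (sqrt d) else if s = a then 0 else X u s)" for u s
  have dd: "complex_of_real (sqrt d) * complex_of_real (sqrt d) = of_real d"
    using d0 by (metis of_real_mult real_sqrt_mult_self abs_of_nonneg)
  have "P s t = (\<Sum>u\<in>insert a S. cnj (Y u s) * Y u t)" if s: "s \<in> insert a S" and t: "t \<in> insert a S" for s t
  proof -
    have eq: "(\<Sum>u\<in>insert a S. cnj (Y u s) * Y u t) = P s a * P a t / of_real d + (\<Sum>u\<in>S. cnj (Y u s) * Y u t)"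
      using fin aS herm[of a s] s dd by (simp add: Y_def)
    show ?thesis
    proof (cases "s = a \<or> t = a")
      case True
      have "(\<Sum>u\<in>S. cnj (Y u s) * Y u t) = 0" by (rule sum.neutral) (use True aS in \<open>auto simp: Y_def\<close>)
      then show ?thesis unfolding eq using True zero[OF _ s] zero[OF _ t] Paa by (cases "d = 0") auto
    next
      case False
      then have st: "s \<in> S" "t \<in> S" using s t by auto
      have "(\<Sum>u\<in>S. cnj (Y u s) * Y u t) = (\<Sum>u\<in>S. cnj (X u s) * X u t)"
        by (rule sum.cong) (use False aS in \<open>auto simp: Y_def\<close>)
      also have "\<dots> = compression a l P s t" using X st by simp
      also have "\<dots> = P s t - P s a * P a t / of_real d"
        using herm[of a s] st Paa zero[of s] zero[of t]
        by (cases "d = 0") (auto simp: compression_def l_def field_simps)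
      finally show ?thesis unfolding eq by simp
    qed
  qed
  then show ?case by blast
qed simp

lemma psd_gram: "psd S (\<lambda>s t. \<Sum>u\<in>I. cnj (X u s) * X u t)"
proof -
  have "sesq S (\<lambda>s t. cnj (X u s) * X u t) v v = cnj (\<Sum>t\<in>S. X u t * v t) * (\<Sum>t\<in>S. X u t * v t)" for u v
    unfolding sesq_def cnj_sum sum_product by (simp add: mult_ac)
  moreover have "0 \<le> cnj z * z" for z :: complex
    by (simp add: complex_nonneg_iff)
  ultimately show ?thesis unfolding psd_def sesq_sum by (metis (no_types, lifting) sum_nonneg)
qed

lemma psd_diff_iff:
  assumes "psd S P" "psd S Q"
  shows "psd S (\<lambda>s t. P s t - Q s t) \<longleftrightarrow> (\<forall>v. Re (sesq S Q v v) \<le> Re (sesq S P v v))"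
  using psdD(2)[OF assms(1)] psdD(2)[OF assms(2)]
  unfolding psd_def sesq_diff complex_nonneg_iff by simp

text \<open>\<open>Z\<close> may be singular: where it vanishes, so does $R_x$. The induction splits off one
  coordinate, and the parallelogram inequality absorbs the cross terms.\<close>

theorem psd_eventually_le:
  assumes "finite S" "\<And>s t. \<lbrakk>s \<in> S; t \<in> S\<rbrakk> \<Longrightarrow> ((\<lambda>x. R x s t) \<longlongrightarrow> 0) F"
    and "\<forall>\<^sub>F x in F. psd S (R x)" "\<forall>\<^sub>F x in F. psd S (\<lambda>s t. Z s t - R x s t)"
    and "psd S Z" "e > 0"
  shows "\<forall>\<^sub>F x in F. psd S (\<lambda>s t. of_real e * Z s t - R x s t)"
  using assms
proof (induction S arbitrary: R Z e)
  case empty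
  then show ?case by (simp add: psd_def sesq_def)
next
  case (insert a S)
  note fin = insert.hyps(1) and aS = insert.hyps(2) and lim = insert.prems(1) and Z = insert.prems(4) and e = insert.prems(5)
  have fin': "finite (insert a S)" using fin by simp
  define d where "d = Re (Z a a)"
  have Zaa: "Z a a = of_real d" and d0: "0 \<le> d"
    using psd_diagonal_nonneg[OF Z fin', of a] by (auto simp: d_def complex_eq_iff)
  have eZ: "psd (insert a S) (\<lambda>s t. of_real e * Z s t)"
    using Z e by (simp add: psd_def sesq_scale complex_nonneg_iff)
  show ?case
  proof (cases "d = 0")
    case True
    have "\<forall>\<^sub>F x in F. psd S (\<lambda>s t. of_real e * Z s t - R x s t)"
    proof (rule insert.IH)
      show "\<forall>\<^sub>F x in F. psd S (R x)" using insert.prems(2)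
        by eventually_elim (rule psd_subset[OF fin', OF subset_insertI])
      show "\<forall>\<^sub>F x in F. psd S (\<lambda>s t. Z s t - R x s t)" using insert.prems(3)
        by eventually_elim (rule psd_subset[OF fin', OF subset_insertI])
      show "psd S Z" by (rule psd_subset[OF fin' subset_insertI Z])
    qed (use lim e in auto)
    with insert.prems(2,3) show ?thesis
    proof eventually_elim
      case (elim x)
      have Zz: "Z a t = 0 \<and> Z t a = 0" if "t \<in> insert a S" for t
        using psd_zero_diagonal[OF Z fin' insertI1 that] Zaa True by simp
      \<comment> \<open>R and Z - R are both positive semidefinite and Z_aa = 0, so the diagonal
        entry of R is squeezed to 0, its row and column vanish, and only the form on S is
        left.\<close>
      have "0 \<le> Re (R x a a)" "Re (R x a a) \<le> 0" "Im (R x a a) = 0"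
        using psd_diagonal_nonneg[OF elim(1) fin' insertI1] psd_diagonal_nonneg[OF elim(2) fin' insertI1] Zaa True by auto
      then have "R x a a = 0" by (simp add: complex_eq_iff)
      then have Rz: "R x a t = 0 \<and> R x t a = 0" if "t \<in> insert a S" for t
        using psd_zero_diagonal[OF elim(1) fin' insertI1 that] by simp
      have "sesq (insert a S) (\<lambda>s t. of_real e * Z s t - R x s t) v v = sesq S (\<lambda>s t. of_real e * Z s t - R x s t) v v" for v
        unfolding sesq_insert[OF fin aS] by (simp add: Zz Rz)
      then show ?case using elim(3) by (simp add: psd_def)
    qed
  next
    case False
    then have d: "d > 0" using d0 by simp
    define l where "l t = Z a t / of_real d" for t
    have Rlim: "((\<lambda>x. R x a a) \<longlongrightarrow> 0) F" by (rule lim) auto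
    then have "((\<lambda>x. Re (R x a a)) \<longlongrightarrow> 0) F" using tendsto_Re by fastforce
    \<comment> \<open>Coordinate a and its complement each receive the error e/2, since the
      parallelogram inequality below doubles both contributions.\<close>
    then have small: "\<forall>\<^sub>F x in F. Re (R x a a) < e * d / 2"
      by (rule order_tendstoD) (use d e in simp)
    have "\<forall>\<^sub>F x in F. psd S (\<lambda>s t. of_real (e/2) * compression a l Z s t - compression a l (R x) s t)"
    proof (rule insert.IH)
      show "((\<lambda>x. compression a l (R x) s t) \<longlongrightarrow> 0) F" if "s \<in> S" "t \<in> S" for s t
        unfolding compression_def
        by (rule tendsto_eq_intros lim insertI1 insertI2 that refl | simp)+
      show "\<forall>\<^sub>F x in F. psd S (compression a l (R x))" using insert.prems(2)
        by eventually_elim (rule psd_compression[OF fin aS])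
      show "\<forall>\<^sub>F x in F. psd S (\<lambda>s t. compression a l Z s t - compression a l (R x) s t)" using insert.prems(3)
      proof eventually_elim
        case (elim x)
        then have "psd S (compression a l (\<lambda>s t. Z s t - R x s t))" by (rule psd_compression[OF fin aS])
        moreover have "compression a l (\<lambda>s t. Z s t - R x s t) = (\<lambda>s t. compression a l Z s t - compression a l (R x) s t)"
          by (intro ext) (simp add: compression_def algebra_simps)
        ultimately show ?case by simp
      qed
      show "psd S (compression a l Z)" by (rule psd_compression[OF fin aS Z])
    qed (use e in auto)
    with insert.prems(2) small show ?thesis
    proof eventually_elim
      case (elim x)
      have "Re (sesq (insert a S) (R x) v v) \<le> Re (sesq (insert a S) (\<lambda>s t. of_real e * Z s t) v v)" for v
      proof -
        let ?S = "insert a S"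
        define b where "b = v a + (\<Sum>t\<in>S. l t * v t)"
        let ?T = "lift_vec S a l v" and ?u = "unit_vec_at a"
        have v: "sesq ?S P v v = sesq ?S P (\<lambda>s. ?T s + b * ?u s) (\<lambda>s. ?T s + b * ?u s)" for P
          by (rule sesq_cong) (use lift_vec_decomp[OF aS] in \<open>auto simp: b_def\<close>)
        have uu: "sesq ?S P ?u ?u = P a a" for P using fin by (simp add: sesq_unit)
        \<comment> \<open>The choice of l makes the lifted vector Z-orthogonal to e_a, so Z has no
          cross terms in the decomposition of v. R has them, and they need a separate
          argument.\<close>
        have "sesq ?S Z ?u ?T = Z a a * ?T a + (\<Sum>t\<in>S. Z a t * ?T t)"
          using fin aS by (simp add: sesq_unit_left)
        also have "(\<Sum>t\<in>S. Z a t * ?T t) = (\<Sum>t\<in>S. Z a t * v t)"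
          by (rule sum.cong) (use aS in \<open>auto simp: lift_vec_def\<close>)
        also have "Z a a * ?T a = - (\<Sum>t\<in>S. Z a t * v t)"
          using d by (simp add: lift_vec_def l_def Zaa sum_distrib_left)
        finally have uT: "sesq ?S Z ?u ?T = 0" by simp
        have Tu: "sesq ?S Z ?T ?u = 0" using sesq_hermitian[OF psdD(2)[OF Z], of ?T ?u] uT by simp
        have bb: "cnj b * b = of_real ((cmod b)\<^sup>2)" using complex_norm_square[of b] by (simp add: mult.commute)
        have Zv: "Re (sesq ?S Z v v) = Re (sesq ?S Z ?T ?T) + (cmod b)\<^sup>2 * d"
          unfolding v[of Z] sesq_quadratic_add uu uT Tu bb Zaa by simp
        have expand: "Re (sesq ?S (R x) (\<lambda>s. ?T s + c * ?u s) (\<lambda>s. ?T s + c * ?u s)) =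
            Re (sesq ?S (R x) ?T ?T) + Re (c * sesq ?S (R x) ?T ?u) + Re (cnj c * sesq ?S (R x) ?u ?T)
              + (cmod c)\<^sup>2 * Re (R x a a)" for c
        proof -
          have "cnj c * c = of_real ((cmod c)\<^sup>2)" using complex_norm_square[of c] by (simp add: mult.commute)
          then show ?thesis unfolding sesq_quadratic_add uu by simp
        qed
        have neg: "Re (- b * z) = - Re (b * z)" "Re (cnj (- b) * z) = - Re (cnj b * z)" for z by simp_all
        \<comment> \<open>Nonnegativity at the reflected vector T - b e_a bounds the cross terms, so
          the form of R at T + b e_a is at most twice the sum of its values at T and at b
          e_a.\<close>
        have "0 \<le> Re (sesq ?S (R x) (\<lambda>s. ?T s + (- b) * ?u s) (\<lambda>s. ?T s + (- b) * ?u s))"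
          by (rule psdD(1)[OF elim(1)])
        note this[unfolded expand norm_minus_cancel neg]
        then have "Re (sesq ?S (R x) v v) \<le> 2 * Re (sesq ?S (R x) ?T ?T) + 2 * ((cmod b)\<^sup>2 * Re (R x a a))"
          unfolding v[of "R x"] expand by linarith
        also have "(cmod b)\<^sup>2 * Re (R x a a) \<le> (cmod b)\<^sup>2 * (e * d / 2)"
          using elim(2) by (intro mult_left_mono) auto
        also have "Re (sesq ?S (R x) ?T ?T) \<le> e / 2 * Re (sesq ?S Z ?T ?T)"
          using psdD(1)[OF elim(3), of v]
          unfolding sesq_diff sesq_scale sesq_compression[OF fin aS] by simp
        finally show ?thesis unfolding sesq_scale using Zv by (simp add: algebra_simps)
      qed
      then show ?case using psd_diff_iff[OF eZ elim(1)] by simp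
    qed
  qed
qed

lemma psd_reindex:
  assumes "inj_on f S"
  shows "psd (f ` S) P \<longleftrightarrow> psd S (\<lambda>s t. P (f s) (f t))"
proof -
  have *: "sesq (f ` S) P v w = sesq S (\<lambda>s t. P (f s) (f t)) (v \<circ> f) (w \<circ> f)" for v w
    unfolding sesq_def by (simp add: sum.reindex[OF assms] comp_def)
  have "\<exists>v'. sesq S (\<lambda>s t. P (f s) (f t)) v v = sesq S (\<lambda>s t. P (f s) (f t)) (v' \<circ> f) (v' \<circ> f)" for v
    by (rule exI[of _ "v \<circ> inv_into S f"], rule sesq_cong) (use assms in auto)
  then show ?thesis unfolding psd_def * by metis
qed

section \<open>Bounded kernels\<close>

text \<open>Rescaling v and w shows that this agrees, up to a constant, with a bound on the operator
  norm. A sum of squares in place of a product of norms keeps square roots out of all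
  estimates.\<close>

definition bounded_kernel :: "'s set \<Rightarrow> ('s \<Rightarrow> 's \<Rightarrow> complex) \<Rightarrow> real \<Rightarrow> bool" where
  "bounded_kernel S P c \<longleftrightarrow>
    (\<forall>v w. cmod (sesq S P v w) \<le> c * ((\<Sum>s\<in>S. (cmod (v s))\<^sup>2) + (\<Sum>s\<in>S. (cmod (w s))\<^sup>2)))"

lemma bounded_kernel_add:
  assumes "bounded_kernel S P c" "bounded_kernel S Q d"
  shows "bounded_kernel S (\<lambda>s t. P s t + Q s t) (c + d)"
  unfolding bounded_kernel_def sesq_add
proof (intro allI)
  fix v w
  show "cmod (sesq S P v w + sesq S Q v w) \<le> (c + d) * ((\<Sum>s\<in>S. (cmod (v s))\<^sup>2) + (\<Sum>s\<in>S. (cmod (w s))\<^sup>2))"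
    using assms[unfolded bounded_kernel_def, rule_format, of v w]
      norm_triangle_ineq[of "sesq S P v w" "sesq S Q v w"]
    by (simp add: distrib_right)
qed

lemma bounded_kernel_scale:
  assumes "bounded_kernel S P c"
  shows "bounded_kernel S (\<lambda>s t. r * P s t) (cmod r * c)"
  unfolding bounded_kernel_def sesq_scale norm_mult mult.assoc
  using assms by (auto simp: bounded_kernel_def intro!: mult_left_mono)

lemma bounded_kernel_mono:
  assumes "bounded_kernel S P c" "c \<le> d" shows "bounded_kernel S P d"
  unfolding bounded_kernel_def
proof (intro allI)
  fix v w
  have "c * ((\<Sum>s\<in>S. (cmod (v s))\<^sup>2) + (\<Sum>s\<in>S. (cmod (w s))\<^sup>2)) \<le> d * ((\<Sum>s\<in>S. (cmod (v s))\<^sup>2) + (\<Sum>s\<in>S. (cmod (w s))\<^sup>2))"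
    using assms(2) by (intro mult_right_mono add_nonneg_nonneg sum_nonneg) auto
  with assms(1) show "cmod (sesq S P v w) \<le> d * ((\<Sum>s\<in>S. (cmod (v s))\<^sup>2) + (\<Sum>s\<in>S. (cmod (w s))\<^sup>2))"
    using order_trans unfolding bounded_kernel_def by blast
qed

lemma bounded_kernel_cong:
  "(\<And>s t. \<lbrakk>s \<in> S; t \<in> S\<rbrakk> \<Longrightarrow> P s t = P' s t) \<Longrightarrow> bounded_kernel S P c \<longleftrightarrow> bounded_kernel S P' c"
  unfolding bounded_kernel_def by (simp add: sesq_cong[of S P P'])

text \<open>For positive semidefinite kernels the Cauchy-Schwarz inequality reduces the bound to the
  diagonal v = w.\<close>

lemma bounded_kernel_psd:
  assumes "psd S P" "\<And>v. Re (sesq S P v v) \<le> c * (\<Sum>s\<in>S. (cmod (v s))\<^sup>2)"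
  shows "bounded_kernel S P c"
  unfolding bounded_kernel_def
proof (intro allI)
  fix v w
  show "cmod (sesq S P v w) \<le> c * ((\<Sum>s\<in>S. (cmod (v s))\<^sup>2) + (\<Sum>s\<in>S. (cmod (w s))\<^sup>2))"
    using psd_cauchy_schwarz[OF assms(1), of v w] assms(2)[of v] assms(2)[of w] norm_ge_zero[of "sesq S P v w"]
    unfolding distrib_left by linarith
qed

lemma tendsto_sesq:
  assumes "\<And>s t. \<lbrakk>s \<in> S; t \<in> S\<rbrakk> \<Longrightarrow> ((\<lambda>x. P x s t) \<longlongrightarrow> Q s t) F"
  shows "((\<lambda>x. sesq S (P x) v w) \<longlongrightarrow> sesq S Q v w) F"
  unfolding sesq_def by (intro tendsto_sum tendsto_mult tendsto_const assms)

lemma bounded_kernel_limit: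
  assumes "\<And>s t. \<lbrakk>s \<in> S; t \<in> S\<rbrakk> \<Longrightarrow> ((\<lambda>x. P x s t) \<longlongrightarrow> Q s t) F" "\<not> trivial_limit F"
    and "\<forall>\<^sub>F x in F. bounded_kernel S (P x) c"
  shows "bounded_kernel S Q c"
  unfolding bounded_kernel_def
proof (intro allI)
  fix v w
  have "((\<lambda>x. cmod (sesq S (P x) v w)) \<longlongrightarrow> cmod (sesq S Q v w)) F"
    by (intro tendsto_norm tendsto_sesq assms(1))
  then show "cmod (sesq S Q v w) \<le> c * ((\<Sum>s\<in>S. (cmod (v s))\<^sup>2) + (\<Sum>s\<in>S. (cmod (w s))\<^sup>2))"
    by (rule tendsto_upperbound) (use assms(2,3) in \<open>auto simp: bounded_kernel_def elim!: eventually_mono\<close>)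
qed

text \<open>Defined for an arbitrary function q, because it is applied to pointwise limits of
  quadratic forms before these are known to come from a kernel.\<close>

definition polar :: "(('s \<Rightarrow> complex) \<Rightarrow> complex) \<Rightarrow> 's \<Rightarrow> 's \<Rightarrow> complex" where
  "polar q s t = (q (\<lambda>u. unit_vec_at s u + 1 * unit_vec_at t u) - q (\<lambda>u. unit_vec_at s u + (-1) * unit_vec_at t u)
    - \<i> * q (\<lambda>u. unit_vec_at s u + \<i> * unit_vec_at t u) + \<i> * q (\<lambda>u. unit_vec_at s u + (-\<i>) * unit_vec_at t u)) / 4"

lemma kernel_polar:
  assumes "finite S" "s \<in> S" "t \<in> S"
  shows "P s t = polar (\<lambda>v. sesq S P v v) s t"
  unfolding polar_def sesq_polarization[symmetric] using sesq_unit[OF assms] by simp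

lemma tendsto_polar:
  assumes "\<And>v. ((\<lambda>x. q x v) \<longlongrightarrow> l v) F"
  shows "((\<lambda>x. polar (q x) s t) \<longlongrightarrow> polar l s t) F"
  unfolding polar_def
  by (intro tendsto_divide tendsto_add tendsto_diff tendsto_mult tendsto_const assms) simp

lemma tendsto_kernel_polarization:
  assumes "finite S" "\<And>v. ((\<lambda>x. sesq S (P x) v v) \<longlongrightarrow> q v) F" "s \<in> S" "t \<in> S"
  shows "((\<lambda>x. P x s t) \<longlongrightarrow> polar q s t) F"
proof -
  have "(\<lambda>x. P x s t) = (\<lambda>x. polar (\<lambda>v. sesq S (P x) v v) s t)"
    by (rule ext) (rule kernel_polar[OF assms(1,3,4)])
  then show ?thesis using tendsto_polar[OF assms(2)] by simp
qed

lemma tendsto_kernel_polarization_to: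
  assumes "finite S" "\<And>v. ((\<lambda>x. sesq S (P x) v v) \<longlongrightarrow> sesq S Q v v) F" "s \<in> S" "t \<in> S"
  shows "((\<lambda>x. P x s t) \<longlongrightarrow> Q s t) F"
  using tendsto_kernel_polarization[OF assms] kernel_polar[OF assms(1,3,4), of Q] by simp

section \<open>Convergence along directed sets\<close>

text \<open>The tails of S as a filter base, so that limit theorems for filters apply to directed
  suprema.\<close>

definition dir_filter :: "('a, 'm) gorder_scheme \<Rightarrow> 'a set \<Rightarrow> 'a filter" where
  "dir_filter D S = (INF s\<in>S. principal {t \<in> S. s \<sqsubseteq>\<^bsub>D\<^esub> t})"

lemma eventually_dir_filter:
  assumes "partial_order D" "directed D S"
  shows "eventually P (dir_filter D S) \<longleftrightarrow> (\<exists>s\<in>S. \<forall>t\<in>S. s \<sqsubseteq>\<^bsub>D\<^esub> t \<longrightarrow> P t)"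
  unfolding dir_filter_def
proof (subst eventually_INF_base)
  show "S \<noteq> {}" using assms(2) by (simp add: directed_def)
  fix a b assume ab: "a \<in> S" "b \<in> S"
  obtain z where z: "z \<in> S" "a \<sqsubseteq>\<^bsub>D\<^esub> z" "b \<sqsubseteq>\<^bsub>D\<^esub> z" using directed_upper[OF assms(2) ab] .
  have C: "\<And>x. x \<in> S \<Longrightarrow> x \<in> carrier D" using directed_subset[OF assms(2)] by blast
  have "a \<sqsubseteq>\<^bsub>D\<^esub> t \<and> b \<sqsubseteq>\<^bsub>D\<^esub> t" if "t \<in> S" "z \<sqsubseteq>\<^bsub>D\<^esub> t" for t
    using partial_order_trans[OF assms(1) z(2) that(2)] partial_order_trans[OF assms(1) z(3) that(2)] ab z that C by simp
  with z(1) show "\<exists>x\<in>S. principal {t \<in> S. x \<sqsubseteq>\<^bsub>D\<^esub> t} \<le> inf (principal {t \<in> S. a \<sqsubseteq>\<^bsub>D\<^esub> t}) (principal {t \<in> S. b \<sqsubseteq>\<^bsub>D\<^esub> t})"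
    by (intro bexI[of _ z]) auto
qed (auto simp: eventually_principal)

lemma dir_filter_nontrivial:
  assumes "partial_order D" "directed D S"
  shows "\<not> trivial_limit (dir_filter D S)"
proof
  assume "trivial_limit (dir_filter D S)"
  then have "eventually (\<lambda>_. False) (dir_filter D S)" by simp
  then obtain s where "s \<in> S" "\<forall>t\<in>S. \<not> s \<sqsubseteq>\<^bsub>D\<^esub> t" unfolding eventually_dir_filter[OF assms] by blast
  then show False using partial_order_refl[OF assms(1)] directed_subset[OF assms(2)] by blast
qed

lemma eventually_dir_filter_ge:
  assumes "partial_order D" "directed D S" "s \<in> S"
  shows "\<forall>\<^sub>F t in dir_filter D S. t \<in> S \<and> s \<sqsubseteq>\<^bsub>D\<^esub> t"
  unfolding eventually_dir_filter[OF assms(1,2)] using assms(3) by blast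

lemma tendsto_dir_filter_mono:
  fixes g :: "'a \<Rightarrow> real"
  assumes po: "partial_order D" and S: "directed D S"
    and mono: "\<And>s t. \<lbrakk>s \<in> S; t \<in> S; s \<sqsubseteq>\<^bsub>D\<^esub> t\<rbrakk> \<Longrightarrow> g s \<le> g t"
    and ub: "\<And>s. s \<in> S \<Longrightarrow> g s \<le> c"
  shows "(g \<longlongrightarrow> (SUP s\<in>S. g s)) (dir_filter D S)"
proof (rule tendstoI)
  fix e :: real assume e: "e > 0"
  have ne: "S \<noteq> {}" using S by (simp add: directed_def)
  have bdd: "bdd_above (g ` S)" using ub by (intro bdd_aboveI[of _ c]) auto
  have "\<exists>s\<in>S. (SUP s\<in>S. g s) - e < g s"
    using less_cSUP_iff[OF ne bdd, of "(SUP s\<in>S. g s) - e"] e by simp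
  then obtain s where s: "s \<in> S" "(SUP s\<in>S. g s) - e < g s" by blast
  show "\<forall>\<^sub>F x in dir_filter D S. dist (g x) (SUP s\<in>S. g s) < e"
    using eventually_dir_filter_ge[OF po S s(1)]
  proof eventually_elim
    case (elim t)
    then have "g s \<le> g t" "g t \<le> (SUP s\<in>S. g s)"
      using mono[OF s(1)] cSUP_upper[OF _ bdd] by auto
    with s(2) show ?case by (simp add: dist_real_def)
  qed
qed

lemma tendsto_dir_filter_mono_bounds:
  fixes g :: "'a \<Rightarrow> real"
  assumes po: "partial_order D" and S: "directed D S"
    and mono: "\<And>s t. \<lbrakk>s \<in> S; t \<in> S; s \<sqsubseteq>\<^bsub>D\<^esub> t\<rbrakk> \<Longrightarrow> g s \<le> g t"
    and lim: "(g \<longlongrightarrow> L) (dir_filter D S)"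
  shows "s \<in> S \<Longrightarrow> g s \<le> L" and "e > 0 \<Longrightarrow> \<exists>s\<in>S. L < g s + e"
proof -
  show "g s \<le> L" if "s \<in> S"
    by (rule tendsto_lowerbound[OF lim _ dir_filter_nontrivial[OF po S]])
      (use eventually_dir_filter_ge[OF po S that] mono that in \<open>auto elim!: eventually_mono\<close>)
  show "\<exists>s\<in>S. L < g s + e" if "e > 0"
  proof -
    have "\<forall>\<^sub>F s in dir_filter D S. L - e < g s" by (rule order_tendstoD[OF lim]) (use that in simp)
    then obtain s where "s \<in> S" "\<forall>t\<in>S. s \<sqsubseteq>\<^bsub>D\<^esub> t \<longrightarrow> L - e < g t"
      unfolding eventually_dir_filter[OF po S] by blast
    then show ?thesis
      using partial_order_refl[OF po] directed_subset[OF S] by (intro bexI[of _ s]) (auto simp: algebra_simps)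
  qed
qed

section \<open>Algebras in matrix coordinates and completely positive maps between them\<close>

section \<open>Algebras of bounded families of matrices\<close>

text \<open>Describes the algebra by coordinates alone. \<open>ent_bounded\<close> and
  \<open>ent_exists\<close> together say that exactly the families bounded uniformly over the blocks
  occur, which is the content of an l-infinity product.\<close>

locale block_algebra = star_algebra A for A :: "'a star_alg" (structure) +
  fixes I :: "'i set" and n :: "'i \<Rightarrow> nat" and ent :: "'a \<Rightarrow> 'i \<Rightarrow> nat \<Rightarrow> nat \<Rightarrow> complex"
  assumes ent_eqI: "\<lbrakk>x \<in> carrier A; y \<in> carrier A; \<And>i p q. \<lbrakk>i \<in> I; p < n i; q < n i\<rbrakk> \<Longrightarrow> ent x i p q = ent y i p q\<rbrakk> \<Longrightarrow> x = y"
    and ent_add: "\<lbrakk>x \<in> carrier A; y \<in> carrier A; i \<in> I; p < n i; q < n i\<rbrakk> \<Longrightarrow> ent (x \<oplus> y) i p q = ent x i p q + ent y i p q"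
    and ent_smult: "\<lbrakk>x \<in> carrier A; i \<in> I; p < n i; q < n i\<rbrakk> \<Longrightarrow> ent (z \<odot> x) i p q = z * ent x i p q"
    and ent_mult: "\<lbrakk>x \<in> carrier A; y \<in> carrier A; i \<in> I; p < n i; q < n i\<rbrakk> \<Longrightarrow> ent (x \<otimes> y) i p q = (\<Sum>r<n i. ent x i p r * ent y i r q)"
    and ent_star: "\<lbrakk>x \<in> carrier A; i \<in> I; p < n i; q < n i\<rbrakk> \<Longrightarrow> ent (star A x) i p q = cnj (ent x i q p)"
    and ent_one: "\<lbrakk>i \<in> I; p < n i; q < n i\<rbrakk> \<Longrightarrow> ent \<one> i p q = (if p = q then 1 else 0)"
    and ent_bounded: "x \<in> carrier A \<Longrightarrow> \<exists>c. \<forall>i\<in>I. bounded_kernel {..<n i} (ent x i) c"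
    and ent_exists: "(\<And>i. i \<in> I \<Longrightarrow> bounded_kernel {..<n i} (f i) c) \<Longrightarrow>
      \<exists>x\<in>carrier A. \<forall>i\<in>I. \<forall>p<n i. \<forall>q<n i. ent x i p q = f i p q"
begin

lemma smult_closed' [simp, intro]: "x \<in> carrier A \<Longrightarrow> c \<odot> x \<in> carrier A"
  using smult_closed by (simp add: complex_ring_def)

lemma ent_zero: "\<lbrakk>i \<in> I; p < n i; q < n i\<rbrakk> \<Longrightarrow> ent \<zero> i p q = 0"
  using ent_add[of "\<zero>" "\<zero>" i p q] by simp

lemma ent_uminus: "\<lbrakk>x \<in> carrier A; i \<in> I; p < n i; q < n i\<rbrakk> \<Longrightarrow> ent (\<ominus> x) i p q = - ent x i p q"
  using ent_add[of x "\<ominus> x" i p q] by (simp add: r_neg ent_zero eq_neg_iff_add_eq_0 add.commute)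

lemma ent_minus: "\<lbrakk>x \<in> carrier A; y \<in> carrier A; i \<in> I; p < n i; q < n i\<rbrakk> \<Longrightarrow> ent (x \<ominus> y) i p q = ent x i p q - ent y i p q"
  by (simp add: a_minus_def ent_add ent_uminus)

lemma ent_finsum:
  assumes "i \<in> I" "p < n i" "q < n i" "finite T" "\<And>k. k \<in> T \<Longrightarrow> f k \<in> carrier A"
  shows "ent (\<Oplus>k\<in>T. f k) i p q = (\<Sum>k\<in>T. ent (f k) i p q)"
  using assms(4,5)
proof (induction T)
  case (insert a T)
  then have "(\<Oplus>k\<in>insert a T. f k) = f a \<oplus> (\<Oplus>k\<in>T. f k)" by (intro finsum_insert) auto
  moreover have "(\<Oplus>k\<in>T. f k) \<in> carrier A" using insert.prems by (intro finsum_closed) auto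
  ultimately show ?case using insert assms(1-3) by (simp add: ent_add)
qed (use assms ent_zero in simp)

abbreviation form :: "'a \<Rightarrow> 'i \<Rightarrow> (nat \<Rightarrow> complex) \<Rightarrow> complex" where
  "form x i v \<equiv> sesq {..<n i} (ent x i) v v"

lemma form_add: "\<lbrakk>x \<in> carrier A; y \<in> carrier A; i \<in> I\<rbrakk> \<Longrightarrow> form (x \<oplus> y) i v = form x i v + form y i v"
  unfolding sesq_add[symmetric] by (rule sesq_cong) (auto simp: ent_add)

lemma form_minus: "\<lbrakk>x \<in> carrier A; y \<in> carrier A; i \<in> I\<rbrakk> \<Longrightarrow> form (x \<ominus> y) i v = form x i v - form y i v"
  unfolding sesq_diff[symmetric] by (rule sesq_cong) (auto simp: ent_minus)

lemma form_smult: "\<lbrakk>x \<in> carrier A; i \<in> I\<rbrakk> \<Longrightarrow> form (c \<odot> x) i v = c * form x i v"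
  unfolding sesq_scale[symmetric] by (rule sesq_cong) (auto simp: ent_smult)

lemma form_one:
  assumes "i \<in> I" shows "form \<one> i v = of_real (\<Sum>p<n i. (cmod (v p))\<^sup>2)"
proof -
  have "form \<one> i v = (\<Sum>p<n i. cnj (v p) * v p)"
    unfolding sesq_def
  proof (rule sum.cong[OF refl])
    fix p assume p: "p \<in> {..<n i}"
    have "(\<Sum>q<n i. cnj (v p) * ent \<one> i p q * v q) = (\<Sum>q<n i. if q = p then cnj (v p) * v q else 0)"
      by (rule sum.cong) (use p assms in \<open>auto simp: ent_one\<close>)
    then show "(\<Sum>q<n i. cnj (v p) * ent \<one> i p q * v q) = cnj (v p) * v p"
      using p by simp
  qed
  also have "\<dots> = of_real (\<Sum>p<n i. (cmod (v p))\<^sup>2)"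
    by (simp add: complex_norm_square mult.commute flip: of_real_power)
  finally show ?thesis .
qed

lemma form_selfadjoint:
  assumes "x \<in> carrier A" "star A x = x" "i \<in> I"
  shows "Im (form x i v) = 0"
proof -
  have herm: "cnj (ent x i p q) = ent x i q p" if "p < n i" "q < n i" for p q
    using ent_star[OF assms(1,3) that(2,1)] assms(2) by simp
  have "cnj (form x i v) = (\<Sum>p<n i. \<Sum>q<n i. cnj (v q) * ent x i q p * v p)"
    unfolding sesq_def cnj_sum
  proof (intro sum.cong refl)
    fix p q assume "p \<in> {..<n i}" "q \<in> {..<n i}"
    then show "cnj (cnj (v p) * ent x i p q * v q) = cnj (v q) * ent x i q p * v p"
      using herm[of p q] by simp
  qed
  also have "\<dots> = form x i v" unfolding sesq_def by (rule sum.swap)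
  finally show ?thesis by (simp add: complex_eq_iff)
qed

lemma bounded_limit_exists:
  assumes "\<not> trivial_limit F" "\<And>i p q. \<lbrakk>i \<in> I; p < n i; q < n i\<rbrakk> \<Longrightarrow> ((\<lambda>s. ent (x s) i p q) \<longlongrightarrow> f i p q) F"
    and "\<And>i. i \<in> I \<Longrightarrow> \<forall>\<^sub>F s in F. bounded_kernel {..<n i} (ent (x s) i) c"
  shows "\<exists>a\<in>carrier A. \<forall>i\<in>I. \<forall>p<n i. \<forall>q<n i. ent a i p q = f i p q"
proof (rule ent_exists)
  show "bounded_kernel {..<n i} (f i) c" if "i \<in> I" for i
    by (rule bounded_kernel_limit[OF _ assms(1) assms(3)[OF that]]) (use assms(2) that in auto)
qed

subsection \<open>Positivity\<close>

text \<open>Block i of a matrix over A, read as one scalar matrix whose rows and columns are indexed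
  by pairs.\<close>

definition mker :: "(nat \<Rightarrow> nat \<Rightarrow> 'a) \<Rightarrow> 'i \<Rightarrow> nat \<times> nat \<Rightarrow> nat \<times> nat \<Rightarrow> complex" where
  "mker a i = (\<lambda>(k, p) (l, q). ent (a k l) i p q)"

lemma matrix_positive_gram:
  assumes "matrix_positive A N a"
  shows "\<forall>k<N. \<forall>l<N. a k l \<in> carrier A"
    and "\<exists>x. \<forall>i\<in>I. \<forall>k<N. \<forall>l<N. \<forall>p<n i. \<forall>q<n i.
      ent (a k l) i p q = (\<Sum>u<N. \<Sum>r<n i. cnj (ent (x u k) i r p) * ent (x u l) i r q)"
proof -
  from assms obtain x where x: "\<And>u k. \<lbrakk>u < N; k < N\<rbrakk> \<Longrightarrow> x u k \<in> carrier A"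
    and a: "\<And>k l. \<lbrakk>k < N; l < N\<rbrakk> \<Longrightarrow> a k l = (\<Oplus>u\<in>{..<N}. star A (x u k) \<otimes> x u l)"
    unfolding matrix_positive_def by blast
  have "a k l \<in> carrier A" if "k < N" "l < N" for k l
    unfolding a[OF that] by (rule finsum_closed) (use x that star_closed in auto)
  then show "\<forall>k<N. \<forall>l<N. a k l \<in> carrier A" by blast
  have "ent (a k l) i p q = (\<Sum>u<N. \<Sum>r<n i. cnj (ent (x u k) i r p) * ent (x u l) i r q)"
    if "i \<in> I" "k < N" "l < N" "p < n i" "q < n i" for i k l p q
  proof -
    have "ent (a k l) i p q = (\<Sum>u<N. ent (star A (x u k) \<otimes> x u l) i p q)"
      unfolding a[OF that(2,3)] by (rule ent_finsum) (use x that star_closed in auto)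
    also have "\<dots> = (\<Sum>u<N. \<Sum>r<n i. cnj (ent (x u k) i r p) * ent (x u l) i r q)"
      by (rule sum.cong[OF refl]) (use x that star_closed in \<open>simp add: ent_mult ent_star\<close>)
    finally show ?thesis .
  qed
  then show "\<exists>x. \<forall>i\<in>I. \<forall>k<N. \<forall>l<N. \<forall>p<n i. \<forall>q<n i.
      ent (a k l) i p q = (\<Sum>u<N. \<Sum>r<n i. cnj (ent (x u k) i r p) * ent (x u l) i r q)" by blast
qed

text \<open>The converse factors each block by \<open>psd_cholesky\<close>. The factors are chosen
  independently, so it has to be shown that they are bounded uniformly over I and thus assemble to
  elements of A; column l of a factor X is controlled by the entry \<open>a l l\<close> of X^* X,
  which is bounded.\<close>

lemma matrix_positive_iff:
  "matrix_positive A N a \<longleftrightarrow> (\<forall>k<N. \<forall>l<N. a k l \<in> carrier A) \<and> (\<forall>i\<in>I. psd ({..<N} \<times> {..<n i}) (mker a i))"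
proof (intro iffI conjI allI impI ballI)
  assume pos: "matrix_positive A N a"
  show "a k l \<in> carrier A" if "k < N" "l < N" for k l
    using matrix_positive_gram(1)[OF pos] that by blast
  fix i assume i: "i \<in> I"
  obtain x where x: "\<And>k l p q. \<lbrakk>k < N; l < N; p < n i; q < n i\<rbrakk> \<Longrightarrow>
      ent (a k l) i p q = (\<Sum>u<N. \<Sum>r<n i. cnj (ent (x u k) i r p) * ent (x u l) i r q)"
    using matrix_positive_gram(2)[OF pos] i by blast
  define X where "X = (\<lambda>(u, r) (k, p). ent (x u k) i r p)"
  have "psd ({..<N} \<times> {..<n i}) (\<lambda>s t. \<Sum>u\<in>{..<N} \<times> {..<n i}. cnj (X u s) * X u t)" by (rule psd_gram)
  then show "psd ({..<N} \<times> {..<n i}) (mker a i)"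
    by (rule iffD1[OF psd_cong, rotated])
      (auto simp: mker_def X_def x sum.cartesian_product case_prod_unfold)
next
  assume R: "(\<forall>k<N. \<forall>l<N. a k l \<in> carrier A) \<and> (\<forall>i\<in>I. psd ({..<N} \<times> {..<n i}) (mker a i))"
  then have aC: "\<And>k l. \<lbrakk>k < N; l < N\<rbrakk> \<Longrightarrow> a k l \<in> carrier A" by blast
  let ?S = "\<lambda>i. {..<N} \<times> {..<n i}"
  have "\<forall>i\<in>I. \<exists>X. \<forall>s\<in>?S i. \<forall>t\<in>?S i. mker a i s t = (\<Sum>u\<in>?S i. cnj (X u s) * X u t)"
    using R by (intro ballI psd_cholesky) auto
  from bchoice[OF this]
  obtain X where X: "\<And>i s t. \<lbrakk>i \<in> I; s \<in> ?S i; t \<in> ?S i\<rbrakk> \<Longrightarrow> mker a i s t = (\<Sum>u\<in>?S i. cnj (X i u s) * X i u t)"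
    by blast
  define good where "good u l x \<longleftrightarrow> x \<in> carrier A \<and> (\<forall>i\<in>I. \<forall>r<n i. \<forall>q<n i. ent x i r q = X i (u, r) (l, q))" for u l x
  have "\<exists>x. good u l x" if u: "u < N" and l: "l < N" for u l
  proof -
    obtain c where c: "\<And>i. i \<in> I \<Longrightarrow> bounded_kernel {..<n i} (ent (a l l) i) c"
      using ent_bounded[OF aC[OF l l]] by blast
    have "\<exists>x\<in>carrier A. \<forall>i\<in>I. \<forall>r<n i. \<forall>q<n i. ent x i r q = X i (u, r) (l, q)"
    proof (rule ent_exists[of "\<lambda>i r q. X i (u, r) (l, q)" "max 1 c"])
      fix i assume i: "i \<in> I"
      show "bounded_kernel {..<n i} (\<lambda>r q. X i (u, r) (l, q)) (max 1 c)"
        unfolding bounded_kernel_def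
      proof (intro allI)
        fix v w :: "nat \<Rightarrow> complex"
        define Y where "Y t = (\<Sum>q<n i. X i t (l, q) * w q)" for t
        let ?V = "\<Sum>r<n i. (cmod (v r))\<^sup>2" and ?W = "\<Sum>q<n i. (cmod (w q))\<^sup>2"
        have W0: "0 \<le> ?W" and V0: "0 \<le> ?V" by (auto intro: sum_nonneg)
        \<comment> \<open>The value at w of the form of \<open>a l l\<close> is the squared norm of
          the image of w under column l of the factor.\<close>
        have "form (a l l) i w = (\<Sum>t\<in>?S i. cnj (Y t) * Y t)"
        proof -
          have "form (a l l) i w = sesq {..<n i} (\<lambda>p q. \<Sum>t\<in>?S i. cnj (X i t (l, p)) * X i t (l, q)) w w"
            by (rule sesq_cong) (use X[OF i, of "(l, _)" "(l, _)"] l in \<open>auto simp: mker_def\<close>)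
          also have "\<dots> = (\<Sum>t\<in>?S i. cnj (Y t) * Y t)"
            unfolding sesq_sum Y_def cnj_sum sum_product sesq_def
            by (intro sum.cong refl) (simp add: mult_ac)
          finally show ?thesis .
        qed
        also have "\<dots> = of_real (\<Sum>t\<in>?S i. (cmod (Y t))\<^sup>2)"
          by (simp add: complex_norm_square mult.commute flip: of_real_power)
        finally have "(\<Sum>t\<in>?S i. (cmod (Y t))\<^sup>2) \<le> cmod (form (a l l) i w)"
          by (simp only: norm_of_real abs_ge_self)
        also have "\<dots> \<le> c * (?W + ?W)" using c[OF i] unfolding bounded_kernel_def by blast
        finally have Y: "(\<Sum>t\<in>?S i. (cmod (Y t))\<^sup>2) \<le> c * (?W + ?W)" .
        \<comment> \<open>A single block row u is part of the whole column and inherits its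
          bound.\<close>
        have "(\<Sum>r<n i. (cmod (Y (u, r)))\<^sup>2) = (\<Sum>t\<in>Pair u ` {..<n i}. (cmod (Y t))\<^sup>2)"
          by (simp add: sum.reindex inj_on_def)
        also have "\<dots> \<le> (\<Sum>t\<in>?S i. (cmod (Y t))\<^sup>2)"
          by (rule sum_mono2) (use u in auto)
        finally have Yu: "(\<Sum>r<n i. (cmod (Y (u, r)))\<^sup>2) \<le> c * (?W + ?W)" using Y by simp
        have "sesq {..<n i} (\<lambda>r q. X i (u, r) (l, q)) v w = (\<Sum>r<n i. cnj (v r) * Y (u, r))"
          by (simp add: sesq_def Y_def sum_distrib_left mult.assoc)
        then have "cmod (sesq {..<n i} (\<lambda>r q. X i (u, r) (l, q)) v w) \<le> (\<Sum>r<n i. cmod (v r) * cmod (Y (u, r)))"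
          by (simp add: norm_mult order_trans[OF norm_sum])
        also have "\<dots> \<le> (\<Sum>r<n i. ((cmod (v r))\<^sup>2 + (cmod (Y (u, r)))\<^sup>2) / 2)"
        proof (rule sum_mono)
          show "cmod (v r) * cmod (Y (u, r)) \<le> ((cmod (v r))\<^sup>2 + (cmod (Y (u, r)))\<^sup>2) / 2" for r
            using sum_squares_bound[of "cmod (v r)" "cmod (Y (u, r))"] by simp
        qed
        also have "\<dots> = (?V + (\<Sum>r<n i. (cmod (Y (u, r)))\<^sup>2)) / 2"
          by (simp add: sum_divide_distrib[symmetric] sum.distrib)
        also have "\<dots> \<le> ?V + c * ?W" using Yu V0 by (simp add: field_simps)
        also have "\<dots> \<le> max 1 c * (?V + ?W)"
          using V0 W0 mult_right_mono[of 1 "max 1 c" ?V] mult_right_mono[of c "max 1 c" ?W]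
          by (simp add: distrib_left)
        finally show "cmod (sesq {..<n i} (\<lambda>r q. X i (u, r) (l, q)) v w) \<le> max 1 c * (?V + ?W)" .
      qed
    qed
    then show ?thesis unfolding good_def by blast
  qed
  note ex = this
  define x where "x u l = (SOME y. good u l y)" for u l
  have good_x: "good u l (x u l)" if "u < N" "l < N" for u l
    unfolding x_def by (rule someI_ex[OF ex[OF that]])
  have x: "x u l \<in> carrier A" "\<lbrakk>i \<in> I; r < n i; q < n i\<rbrakk> \<Longrightarrow> ent (x u l) i r q = X i (u, r) (l, q)"
    if "u < N" "l < N" for u l i r q
    using good_x[OF that] by (simp_all add: good_def)
  have "a k l = (\<Oplus>u\<in>{..<N}. star A (x u k) \<otimes> x u l)" if kl: "k < N" "l < N" for k l
  proof (rule ent_eqI[OF aC[OF kl]])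
    show "(\<Oplus>u\<in>{..<N}. star A (x u k) \<otimes> x u l) \<in> carrier A"
      by (rule finsum_closed) (use x(1) kl star_closed in auto)
    fix i p q assume ipq: "i \<in> I" "p < n i" "q < n i"
    have "ent (\<Oplus>u\<in>{..<N}. star A (x u k) \<otimes> x u l) i p q = (\<Sum>u<N. ent (star A (x u k) \<otimes> x u l) i p q)"
      by (rule ent_finsum) (use x(1) kl ipq star_closed in auto)
    also have "\<dots> = (\<Sum>u<N. \<Sum>r<n i. cnj (X i (u, r) (k, p)) * X i (u, r) (l, q))"
      by (rule sum.cong[OF refl]) (use x kl ipq star_closed in \<open>simp add: ent_mult ent_star\<close>)
    also have "\<dots> = mker a i (k, p) (l, q)"
      using X[OF ipq(1), of "(k, p)" "(l, q)"] kl ipq by (simp add: sum.cartesian_product case_prod_unfold)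
    finally show "ent (a k l) i p q = ent (\<Oplus>u\<in>{..<N}. star A (x u k) \<otimes> x u l) i p q" by (simp add: mker_def)
  qed
  then show "matrix_positive A N a" unfolding matrix_positive_def using x(1) by blast
qed

definition positive :: "'a \<Rightarrow> bool" where
  "positive x \<longleftrightarrow> x \<in> carrier A \<and> (\<forall>i\<in>I. psd {..<n i} (ent x i))"

lemma matrix_positive_1: "matrix_positive A 1 (\<lambda>_ _. x) \<longleftrightarrow> positive x"
proof -
  have "psd ({..<1} \<times> {..<n i}) (mker (\<lambda>_ _. x) i) \<longleftrightarrow> psd {..<n i} (ent x i)" for i
  proof -
    have "{..<1::nat} \<times> {..<n i} = Pair 0 ` {..<n i}" by auto
    then show ?thesis using psd_reindex[of "Pair 0" "{..<n i}" "mker (\<lambda>_ _. x) i"] by (simp add: inj_on_def mker_def)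
  qed
  then show ?thesis unfolding matrix_positive_iff positive_def by auto
qed

text \<open>The square root needed here is the 1 by 1 case of the factorisation of positive
  matrices.\<close>

lemma alg_le_iff_positive:
  assumes "x \<in> carrier A" "y \<in> carrier A"
  shows "alg_le A x y \<longleftrightarrow> positive (y \<ominus> x)"
proof -
  have sC: "star A z \<otimes> z \<in> carrier A" if "z \<in> carrier A" for z using that star_closed by simp
  have "matrix_positive A 1 (\<lambda>_ _. y \<ominus> x) \<longleftrightarrow> alg_le A x y"
  proof
    assume "matrix_positive A 1 (\<lambda>_ _. y \<ominus> x)"
    then obtain z where z: "z 0 (0::nat) \<in> carrier A" "y \<ominus> x = (\<Oplus>k\<in>{..<1::nat}. star A (z k 0) \<otimes> z k 0)"
      unfolding matrix_positive_def by force
    have "{..<1::nat} = {0}" by auto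
    then have "y \<ominus> x = star A (z 0 0) \<otimes> z 0 0"
      using z sC[OF z(1)] finsum_insert[of "{}" 0 "\<lambda>k. star A (z k 0) \<otimes> z k 0"] by simp
    with z(1) show "alg_le A x y" unfolding alg_le_def by blast
  next
    assume "alg_le A x y"
    then obtain z where z: "z \<in> carrier A" "y \<ominus> x = star A z \<otimes> z" unfolding alg_le_def by blast
    have "{..<1::nat} = {0}" by auto
    then have "y \<ominus> x = (\<Oplus>k\<in>{..<1::nat}. star A z \<otimes> z)"
      using z sC[OF z(1)] finsum_insert[of "{}" "0::nat" "\<lambda>_. star A z \<otimes> z"] by simp
    with z(1) show "matrix_positive A 1 (\<lambda>_ _. y \<ominus> x)"
      unfolding matrix_positive_def by (intro exI[of _ "\<lambda>_ _. z"]) simp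
  qed
  then show ?thesis unfolding matrix_positive_1 by simp
qed

lemma alg_le_iff:
  assumes "x \<in> carrier A" "y \<in> carrier A"
  shows "alg_le A x y \<longleftrightarrow> (\<forall>i\<in>I. \<forall>v. 0 \<le> form y i v - form x i v)"
  unfolding alg_le_iff_positive[OF assms] positive_def psd_def using assms by (simp add: form_minus)

lemma positive_carrier: "positive x \<Longrightarrow> x \<in> carrier A"
  by (simp add: positive_def)

lemma positive_form: "\<lbrakk>positive x; i \<in> I\<rbrakk> \<Longrightarrow> 0 \<le> form x i v"
  by (simp add: positive_def psd_def)

lemma positiveI: "\<lbrakk>x \<in> carrier A; \<And>i v. i \<in> I \<Longrightarrow> 0 \<le> form x i v\<rbrakk> \<Longrightarrow> positive x"
  by (simp add: positive_def psd_def)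

lemma form_bound:
  assumes "x \<in> carrier A"
  shows "\<exists>c\<ge>0. \<forall>i\<in>I. \<forall>v. cmod (form x i v) \<le> c * (\<Sum>p<n i. (cmod (v p))\<^sup>2)"
proof -
  obtain c where c: "\<And>i. i \<in> I \<Longrightarrow> bounded_kernel {..<n i} (ent x i) c" using ent_bounded[OF assms] by blast
  have "cmod (form x i v) \<le> 2 * max 0 c * (\<Sum>p<n i. (cmod (v p))\<^sup>2)" if i: "i \<in> I" for i v
  proof -
    have "bounded_kernel {..<n i} (ent x i) (max 0 c)" by (rule bounded_kernel_mono[OF c[OF i]]) simp
    then show ?thesis unfolding bounded_kernel_def by (auto dest!: spec[of _ v])
  qed
  then show ?thesis by (intro exI[of _ "2 * max 0 c"]) simp
qed

lemma positive_self_adjoint: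
  assumes "positive x" shows "star A x = x"
proof (rule ent_eqI)
  show "ent (star A x) i p q = ent x i p q" if "i \<in> I" "p < n i" "q < n i" for i p q
    using that assms psd_hermitian[of "{..<n i}" "ent x i" q p] by (simp add: positive_def ent_star)
qed (use assms star_closed in \<open>auto simp: positive_def\<close>)

lemma positive_one: "positive \<one>"
  by (rule positiveI) (auto simp: form_one complex_nonneg_iff sum_nonneg)

text \<open>Real and imaginary part are self-adjoint, and a self-adjoint s is the difference of s +
  c 1, positive for large c, and c 1. Statements linear in b thus need checking only at positive b,
  where monotonicity is available.\<close>

lemma positive_span_induct [consumes 1, case_names positive add smult]:
  assumes b: "b \<in> carrier A"
    and pos: "\<And>x. positive x \<Longrightarrow> P x"
    and add: "\<And>x y. \<lbrakk>x \<in> carrier A; y \<in> carrier A; P x; P y\<rbrakk> \<Longrightarrow> P (x \<oplus> y)"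
    and smult: "\<And>c x. \<lbrakk>x \<in> carrier A; P x\<rbrakk> \<Longrightarrow> P (c \<odot> x)"
  shows "P b"
proof -
  have sa: "P s" if s: "s \<in> carrier A" "star A s = s" for s
  proof -
    obtain c where c: "\<And>i v. i \<in> I \<Longrightarrow> cmod (form s i v) \<le> c * (\<Sum>p<n i. (cmod (v p))\<^sup>2)"
      using form_bound[OF s(1)] by blast
    let ?t = "s \<oplus> of_real c \<odot> \<one>"
    have "positive ?t"
    proof (rule positiveI)
      fix i v assume i: "i \<in> I"
      show "0 \<le> form ?t i v"
        using form_selfadjoint[OF s i, of v] c[OF i, of v] abs_Re_le_cmod[of "form s i v"] s(1) i
        by (simp add: form_add form_smult form_one complex_nonneg_iff)
    qed (use s in auto)
    then have "P ?t" by (rule pos)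
    moreover have "P (of_real (- c) \<odot> \<one>)" by (rule smult[OF one_closed pos[OF positive_one]])
    ultimately have "P (?t \<oplus> of_real (- c) \<odot> \<one>)" using s by (intro add[of ?t]) simp_all
    moreover have "?t \<oplus> of_real (- c) \<odot> \<one> = s"
      by (rule ent_eqI) (use s in \<open>auto simp: ent_add ent_smult\<close>)
    ultimately show ?thesis by simp
  qed
  let ?re = "(1/2) \<odot> (b \<oplus> star A b)" and ?im = "(-\<i>/2) \<odot> (b \<ominus> star A b)"
  have C: "?re \<in> carrier A" "?im \<in> carrier A" using b star_closed by auto
  have "star A ?re = ?re"
  proof (rule ent_eqI)
    fix i p q assume "i \<in> I" "p < n i" "q < n i"
    then show "ent (star A ?re) i p q = ent ?re i p q"
      using b star_closed[OF b] C by (simp add: ent_star ent_smult ent_add add.commute)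
  qed (use C star_closed in simp_all)
  moreover have "star A ?im = ?im"
  proof (rule ent_eqI)
    fix i p q assume "i \<in> I" "p < n i" "q < n i"
    then show "ent (star A ?im) i p q = ent ?im i p q"
      using b star_closed[OF b] C by (simp add: ent_star ent_smult ent_minus algebra_simps)
  qed (use C star_closed in simp_all)
  ultimately have "P ?re" "P ?im" using sa C by simp_all
  then have "P (?re \<oplus> \<i> \<odot> ?im)" by (intro add[OF C(1) smult_closed'[OF C(2)]] smult[OF C(2)])
  moreover have "?re \<oplus> \<i> \<odot> ?im = b"
  proof (rule ent_eqI)
    fix i p q assume i: "i \<in> I" "p < n i" "q < n i"
    have "ent (?re \<oplus> \<i> \<odot> ?im) i p q = ent ?re i p q + \<i> * ent ?im i p q"
      by (simp only: ent_add[OF C(1) smult_closed'[OF C(2)] i] ent_smult[OF C(2) i])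
    also have "\<dots> = ent b i p q"
      using b star_closed[OF b] i by (simp add: ent_smult ent_add ent_minus field_simps)
    finally show "ent (?re \<oplus> \<i> \<odot> ?im) i p q = ent b i p q" .
  qed (rule a_closed[OF C(1) smult_closed'[OF C(2)]] b)+
  ultimately show ?thesis by simp
qed

subsection \<open>Suprema of self-adjoint elements\<close>

abbreviation SA :: "'a gorder" where "SA \<equiv> self_adjoint_order A"

lemma SA_simps [simp]:
  "x \<in> carrier SA \<longleftrightarrow> x \<in> carrier A \<and> star A x = x" "x \<sqsubseteq>\<^bsub>SA\<^esub> y \<longleftrightarrow> alg_le A x y" "x .=\<^bsub>SA\<^esub> y \<longleftrightarrow> x = y"
  by (simp_all add: self_adjoint_order_def)

lemma alg_le_Re:
  assumes "x \<in> carrier SA" "y \<in> carrier SA"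
  shows "alg_le A x y \<longleftrightarrow> (\<forall>i\<in>I. \<forall>v. Re (form x i v) \<le> Re (form y i v))"
  using assms by (simp add: alg_le_iff complex_nonneg_iff form_selfadjoint)

lemma form_eqI:
  assumes "x \<in> carrier A" "y \<in> carrier A" "\<And>i v. i \<in> I \<Longrightarrow> form x i v = form y i v"
  shows "x = y"
proof (rule ent_eqI[OF assms(1,2)])
  fix i p q assume "i \<in> I" "p < n i" "q < n i"
  then show "ent x i p q = ent y i p q"
    using kernel_polar[of "{..<n i}" p q "ent x i"] kernel_polar[of "{..<n i}" p q "ent y i"] assms(3) by simp
qed

lemma partial_order_SA: "partial_order SA"
proof (rule partial_orderI)
  fix x y assume xy: "x \<in> carrier SA" "y \<in> carrier SA" "x \<sqsubseteq>\<^bsub>SA\<^esub> y" "y \<sqsubseteq>\<^bsub>SA\<^esub> x"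
  then have "form x i v = form y i v" if "i \<in> I" for i v
    using that alg_le_Re[OF xy(1,2)] alg_le_Re[OF xy(2,1)] form_selfadjoint[of x i v] form_selfadjoint[of y i v]
    by (auto simp: complex_eq_iff intro: antisym)
  with xy show "x = y" by (intro form_eqI) auto
next
  fix x assume "x \<in> carrier SA"
  then show "x \<sqsubseteq>\<^bsub>SA\<^esub> x" using alg_le_Re[of x x] by simp
next
  fix x y z assume xyz: "x \<in> carrier SA" "y \<in> carrier SA" "z \<in> carrier SA" "x \<sqsubseteq>\<^bsub>SA\<^esub> y" "y \<sqsubseteq>\<^bsub>SA\<^esub> z"
  have 1: "\<forall>i\<in>I. \<forall>v. Re (form x i v) \<le> Re (form y i v)" using alg_le_Re[OF xyz(1,2)] xyz(4) by simp
  have 2: "\<forall>i\<in>I. \<forall>v. Re (form y i v) \<le> Re (form z i v)" using alg_le_Re[OF xyz(2,3)] xyz(5) by simp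
  have "Re (form x i v) \<le> Re (form z i v)" if "i \<in> I" for i v
    by (rule order_trans[OF 1[rule_format, OF that] 2[rule_format, OF that]])
  then show "x \<sqsubseteq>\<^bsub>SA\<^esub> z" using alg_le_Re[OF xyz(1,3)] by simp
qed simp

lemma SA_lubI:
  assumes T: "directed SA T" and t: "t \<in> carrier SA" and ub: "\<And>s. s \<in> T \<Longrightarrow> alg_le A s t"
    and eps: "\<And>i v e. \<lbrakk>i \<in> I; e > 0\<rbrakk> \<Longrightarrow> \<exists>s\<in>T. Re (form t i v) < Re (form s i v) + e"
  shows "is_lub SA t T"
  unfolding directed_is_lub_iff[OF T]
proof (intro conjI ballI impI)
  fix u assume u: "u \<in> carrier SA" "\<forall>s\<in>T. s \<sqsubseteq>\<^bsub>SA\<^esub> u"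
  have "Re (form t i v) \<le> Re (form u i v)" if i: "i \<in> I" for i v
  proof (rule real_le_epsI)
    fix e :: real assume "e > 0"
    then obtain s where s: "s \<in> T" "Re (form t i v) < Re (form s i v) + e" using eps[OF i] by blast
    then have "s \<in> carrier SA" "alg_le A s u" using u directed_subset[OF T] by auto
    then have "Re (form s i v) \<le> Re (form u i v)" using alg_le_Re[OF _ u(1)] i by blast
    with s show "Re (form t i v) < Re (form u i v) + e" by linarith
  qed
  then show "t \<sqsubseteq>\<^bsub>SA\<^esub> u" using alg_le_Re[OF t u(1)] by simp
qed (use t ub in auto)

text \<open>Bounded monotone convergence of self-adjoint operators: each quadratic form has a limit,
  polarization gives limits of the entries, and these are the entries of an element of A because the
  family is eventually bounded uniformly over the blocks.\<close>

lemma SA_lub_exists: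
  assumes T: "directed SA T" and t: "t \<in> carrier SA" "\<And>s. s \<in> T \<Longrightarrow> alg_le A s t"
  shows "\<exists>L. L \<in> carrier SA \<and> (\<forall>s\<in>T. alg_le A s L) \<and> (\<forall>i\<in>I. \<forall>v. \<forall>e>0. \<exists>s\<in>T. Re (form L i v) < Re (form s i v) + e)"
proof -
  let ?F = "dir_filter SA T"
  note po = partial_order_SA
  have TC: "s \<in> carrier SA" if "s \<in> T" for s using directed_subset[OF T] that by blast
  have mono: "Re (form s i v) \<le> Re (form s' i v)" if "i \<in> I" "s \<in> T" "s' \<in> T" "s \<sqsubseteq>\<^bsub>SA\<^esub> s'" for i v s s'
    using alg_le_Re[OF TC[OF that(2)] TC[OF that(3)]] that by simp
  have le_t: "Re (form s i v) \<le> Re (form t i v)" if "i \<in> I" "s \<in> T" for i v s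
    using alg_le_Re[OF TC[OF that(2)] t(1)] t(2) that by simp
  define q where "q i v = complex_of_real (SUP s\<in>T. Re (form s i v))" for i v
  obtain t0 where t0: "t0 \<in> T" using T by (auto simp: directed_def)
  have ev: "\<forall>\<^sub>F s in ?F. s \<in> T \<and> t0 \<sqsubseteq>\<^bsub>SA\<^esub> s" by (rule eventually_dir_filter_ge[OF po T t0])
  have limRe: "((\<lambda>s. Re (form s i v)) \<longlongrightarrow> (SUP s\<in>T. Re (form s i v))) ?F" if "i \<in> I" for i v
    by (rule tendsto_dir_filter_mono[OF po T, of _ "Re (form t i v)"]) (use mono le_t that in auto)
  have lim: "((\<lambda>s. form s i v) \<longlongrightarrow> q i v) ?F" if i: "i \<in> I" for i v
  proof (rule Lim_transform_eventually)
    show "((\<lambda>s. complex_of_real (Re (form s i v))) \<longlongrightarrow> q i v) ?F"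
      unfolding q_def by (rule tendsto_of_real[OF limRe[OF i]])
    show "\<forall>\<^sub>F s in ?F. complex_of_real (Re (form s i v)) = form s i v"
      using ev by eventually_elim (use TC form_selfadjoint i in \<open>auto simp: complex_eq_iff\<close>)
  qed
  have lim_ent: "((\<lambda>s. ent s i p r) \<longlongrightarrow> polar (q i) p r) ?F" if "i \<in> I" "p < n i" "r < n i" for i p r
    by (rule tendsto_kernel_polarization[OF finite_lessThan lim[OF that(1)]]) (use that in auto)
  obtain c where c: "\<And>i v. i \<in> I \<Longrightarrow> cmod (form (t \<ominus> t0) i v) \<le> c * (\<Sum>p<n i. (cmod (v p))\<^sup>2)"
  proof -
    have "t \<ominus> t0 \<in> carrier A" using TC[OF t0] t(1) by simp
    from form_bound[OF this] show thesis using that by blast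
  qed
  obtain c0 where c0: "\<And>i. i \<in> I \<Longrightarrow> bounded_kernel {..<n i} (ent t0 i) c0"
  proof -
    have "t0 \<in> carrier A" using TC[OF t0] by simp
    from ent_bounded[OF this] show thesis using that by blast
  qed
  \<comment> \<open>Members of T need not be positive, so the bound is obtained for s - t0, which
    lies between 0 and t - t0, and then t0 is added back.\<close>
  have "\<forall>\<^sub>F s in ?F. bounded_kernel {..<n i} (ent s i) (c0 + c)" if i: "i \<in> I" for i
    using ev
  proof eventually_elim
    case (elim s)
    then have s: "s \<in> carrier SA" and s0: "s \<in> carrier A" "t0 \<in> carrier A" "t \<in> carrier A" using TC t0 t by auto
    have pos: "positive (s \<ominus> t0)" using elim s0 by (simp flip: alg_le_iff_positive)
    have "bounded_kernel {..<n i} (ent (s \<ominus> t0) i) c"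
    proof (rule bounded_kernel_psd)
      show "psd {..<n i} (ent (s \<ominus> t0) i)" using pos i by (simp add: positive_def)
      fix v
      have "Re (form (s \<ominus> t0) i v) \<le> Re (form (t \<ominus> t0) i v)"
        using le_t[OF i, of s v] elim s0 i by (simp add: form_minus)
      also have "\<dots> \<le> c * (\<Sum>p<n i. (cmod (v p))\<^sup>2)" using c[OF i, of v] complex_Re_le_cmod order_trans by blast
      finally show "Re (form (s \<ominus> t0) i v) \<le> c * (\<Sum>p<n i. (cmod (v p))\<^sup>2)" .
    qed
    from bounded_kernel_add[OF c0[OF i] this]
    show ?case by (rule iffD1[OF bounded_kernel_cong, rotated]) (use s0 i in \<open>auto simp: ent_minus\<close>)
  qed
  from bounded_limit_exists[OF dir_filter_nontrivial[OF po T] lim_ent this]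
  obtain L where L: "L \<in> carrier A" "\<And>i p r. \<lbrakk>i \<in> I; p < n i; r < n i\<rbrakk> \<Longrightarrow> ent L i p r = polar (q i) p r"
    by blast
  have lim_L: "((\<lambda>s. ent s i p r) \<longlongrightarrow> ent L i p r) ?F" if "i \<in> I" "p < n i" "r < n i" for i p r
    using lim_ent[OF that] L(2)[OF that] by simp
  have formL: "Re (form L i v) = (SUP s\<in>T. Re (form s i v))" if i: "i \<in> I" for i v
  proof -
    have "((\<lambda>s. form s i v) \<longlongrightarrow> form L i v) ?F" by (rule tendsto_sesq) (use lim_L i in auto)
    then have "form L i v = q i v" by (rule tendsto_unique[OF dir_filter_nontrivial[OF po T] _ lim[OF i]])
    then show ?thesis by (simp add: q_def)
  qed
  have "star A L = L"
  proof (rule ent_eqI)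
    fix i p r assume ipr: "i \<in> I" "p < n i" "r < n i"
    have "((\<lambda>s. cnj (ent s i r p)) \<longlongrightarrow> cnj (ent L i r p)) ?F" by (rule tendsto_cnj[OF lim_L]) (use ipr in auto)
    moreover have "\<forall>\<^sub>F s in ?F. cnj (ent s i r p) = ent s i p r"
      using ev
    proof eventually_elim
      case (elim s)
      then show ?case using TC[of s] ent_star[of s i p r] ipr by simp
    qed
    ultimately have "((\<lambda>s. ent s i p r) \<longlongrightarrow> cnj (ent L i r p)) ?F" by (rule Lim_transform_eventually)
    then have "cnj (ent L i r p) = ent L i p r"
      by (rule tendsto_unique[OF dir_filter_nontrivial[OF po T] _ lim_L[OF ipr]])
    then show "ent (star A L) i p r = ent L i p r" using ent_star[OF L(1) ipr] by simp
  qed (use L star_closed in auto)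
  then have LSA: "L \<in> carrier SA" using L by simp
  have lims: "((\<lambda>s. Re (form s i v)) \<longlongrightarrow> Re (form L i v)) ?F" if "i \<in> I" for i v
    unfolding formL[OF that] by (rule limRe[OF that])
  have "alg_le A s L" if s: "s \<in> T" for s
    unfolding alg_le_Re[OF TC[OF s] LSA]
  proof (intro ballI allI)
    show "Re (form s i v) \<le> Re (form L i v)" if "i \<in> I" for i v
      by (rule tendsto_dir_filter_mono_bounds(1)[OF po T mono[OF that] lims[OF that] s])
  qed
  moreover have "\<exists>s\<in>T. Re (form L i v) < Re (form s i v) + e" if "i \<in> I" "e > 0" for i v e
    by (rule tendsto_dir_filter_mono_bounds(2)[OF po T mono[OF that(1)] lims[OF that(1)] that(2)])
  ultimately show ?thesis using LSA by blast
qed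

text \<open>Least upper bounds are computed in every quadratic form separately: an abstract one must
  coincide with the element constructed in \<open>SA_lub_exists\<close>.\<close>

lemma SA_lub_iff:
  assumes T: "directed SA T"
  shows "is_lub SA t T \<longleftrightarrow> t \<in> carrier SA \<and> (\<forall>s\<in>T. alg_le A s t) \<and>
    (\<forall>i\<in>I. \<forall>v. \<forall>e>0. \<exists>s\<in>T. Re (form t i v) < Re (form s i v) + e)"
proof
  assume lub: "is_lub SA t T"
  then have t: "t \<in> carrier SA" "\<And>s. s \<in> T \<Longrightarrow> alg_le A s t" unfolding directed_is_lub_iff[OF T] by auto
  obtain L where L: "L \<in> carrier SA" "\<forall>s\<in>T. alg_le A s L"
    "\<forall>i\<in>I. \<forall>v. \<forall>e>0. \<exists>s\<in>T. Re (form L i v) < Re (form s i v) + e" using SA_lub_exists[OF T t] by blast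
  have "is_lub SA L T" by (rule SA_lubI[OF T L(1)]) (use L in auto)
  then have "t = L" by (rule partial_order_lub_unique[OF partial_order_SA lub])
  with L show "t \<in> carrier SA \<and> (\<forall>s\<in>T. alg_le A s t) \<and>
    (\<forall>i\<in>I. \<forall>v. \<forall>e>0. \<exists>s\<in>T. Re (form t i v) < Re (form s i v) + e)" by simp
qed (use SA_lubI[OF T] in blast)

subsection \<open>Central truncations\<close>

text \<open>Multiplication by the central projection onto the blocks in F, introduced through its
  entries.\<close>

definition cut :: "'i set \<Rightarrow> 'a \<Rightarrow> 'a" where
  "cut F x = (SOME y. y \<in> carrier A \<and> (\<forall>i\<in>I. \<forall>p<n i. \<forall>q<n i. ent y i p q = (if i \<in> F then ent x i p q else 0)))"

lemma cut_props:
  assumes "x \<in> carrier A"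
  shows cut_closed: "cut F x \<in> carrier A"
    and ent_cut: "\<lbrakk>i \<in> I; p < n i; q < n i\<rbrakk> \<Longrightarrow> ent (cut F x) i p q = (if i \<in> F then ent x i p q else 0)"
proof -
  obtain c where c: "\<And>i. i \<in> I \<Longrightarrow> bounded_kernel {..<n i} (ent x i) c" using ent_bounded[OF assms] by blast
  have "\<exists>y\<in>carrier A. \<forall>i\<in>I. \<forall>p<n i. \<forall>q<n i. ent y i p q = (if i \<in> F then ent x i p q else 0)"
  proof (rule ent_exists)
    fix i assume i: "i \<in> I"
    have 1: "bounded_kernel {..<n i} (ent x i) (max 0 c)" by (rule bounded_kernel_mono[OF c[OF i]]) simp
    have 0: "bounded_kernel {..<n i} (\<lambda>p q. 0) (max 0 c)"
      unfolding bounded_kernel_def sesq_def by (auto intro!: mult_nonneg_nonneg add_nonneg_nonneg sum_nonneg)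
    show "bounded_kernel {..<n i} (\<lambda>p q. if i \<in> F then ent x i p q else 0) (max 0 c)" using 0 1 by (cases "i \<in> F") auto
  qed
  then have "\<exists>y. y \<in> carrier A \<and> (\<forall>i\<in>I. \<forall>p<n i. \<forall>q<n i. ent y i p q = (if i \<in> F then ent x i p q else 0))" by blast
  from someI_ex[OF this, folded cut_def]
  show "cut F x \<in> carrier A" "\<lbrakk>i \<in> I; p < n i; q < n i\<rbrakk> \<Longrightarrow> ent (cut F x) i p q = (if i \<in> F then ent x i p q else 0)"
    by blast+
qed

lemma form_cut:
  assumes "x \<in> carrier A" "i \<in> I"
  shows "form (cut F x) i v = (if i \<in> F then form x i v else 0)"
proof -
  have "form (cut F x) i v = sesq {..<n i} (\<lambda>p q. if i \<in> F then ent x i p q else 0) v v"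
    by (rule sesq_cong) (use assms in \<open>auto simp: ent_cut\<close>)
  then show ?thesis by (auto simp: sesq_def)
qed

lemma cut_add: "\<lbrakk>x \<in> carrier A; y \<in> carrier A\<rbrakk> \<Longrightarrow> cut F (x \<oplus> y) = cut F x \<oplus> cut F y"
  by (rule ent_eqI) (auto simp: cut_closed ent_cut ent_add)

lemma cut_smult: "x \<in> carrier A \<Longrightarrow> cut F (c \<odot> x) = c \<odot> cut F x"
  by (rule ent_eqI) (auto simp: cut_closed ent_cut ent_smult)

lemma cut_star: "x \<in> carrier A \<Longrightarrow> star A (cut F x) = cut F (star A x)"
  by (rule ent_eqI) (auto simp: cut_closed ent_cut ent_star star_closed)

lemma cut_compl: "x \<in> carrier A \<Longrightarrow> cut F x \<oplus> cut (- F) x = x"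
  by (rule ent_eqI) (auto simp: cut_closed ent_cut ent_add)

lemma matrix_positive_cut:
  assumes "matrix_positive A N a"
  shows "matrix_positive A N (\<lambda>k l. cut F (a k l))"
proof -
  have C: "\<And>k l. \<lbrakk>k < N; l < N\<rbrakk> \<Longrightarrow> a k l \<in> carrier A" and P: "\<And>i. i \<in> I \<Longrightarrow> psd ({..<N} \<times> {..<n i}) (mker a i)"
    using assms unfolding matrix_positive_iff by auto
  have "psd ({..<N} \<times> {..<n i}) (mker (\<lambda>k l. cut F (a k l)) i)" if i: "i \<in> I" for i
  proof (cases "i \<in> F")
    case True
    show ?thesis
      by (rule iffD1[OF psd_cong P[OF i]]) (use True i C in \<open>auto simp: mker_def ent_cut\<close>)
  next
    case False
    have "psd ({..<N} \<times> {..<n i}) (\<lambda>_ _. 0)" by (simp add: psd_def sesq_def)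
    then show ?thesis
      by (rule iffD1[OF psd_cong, rotated]) (use False i C in \<open>auto simp: mker_def ent_cut\<close>)
  qed
  then show ?thesis unfolding matrix_positive_iff using C cut_closed by blast
qed

end

section \<open>Completely positive maps between block algebras\<close>

context block_algebra
begin

lemma self_adjoint_shift:
  assumes s: "s \<in> carrier A" "star A s = s"
  shows "\<exists>c::real. positive (s \<oplus> of_real c \<odot> \<one>)"
proof -
  obtain c where c: "\<And>i v. i \<in> I \<Longrightarrow> cmod (form s i v) \<le> c * (\<Sum>p<n i. (cmod (v p))\<^sup>2)"
    using form_bound[OF s(1)] by blast
  have "positive (s \<oplus> of_real c \<odot> \<one>)"
  proof (rule positiveI)
    fix i v assume i: "i \<in> I"
    show "0 \<le> form (s \<oplus> of_real c \<odot> \<one>) i v"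
      using form_selfadjoint[OF s i, of v] c[OF i, of v] abs_Re_le_cmod[of "form s i v"] s(1) i
      by (simp add: form_add form_smult form_one complex_nonneg_iff)
  qed (use s in auto)
  then show ?thesis ..
qed

lemma minus_eq_smult: "\<lbrakk>x \<in> carrier A; y \<in> carrier A\<rbrakk> \<Longrightarrow> x \<ominus> y = x \<oplus> (-1) \<odot> y"
  by (rule ent_eqI) (simp_all add: ent_minus ent_add ent_smult)

lemma ent_le_bounded_kernel:
  assumes "bounded_kernel {..<n i} (ent x i) c" "p < n i" "q < n i"
  shows "cmod (ent x i p q) \<le> 2 * c"
proof -
  have unit: "(\<Sum>r<n i. (cmod (unit_vec_at p r))\<^sup>2) = 1" if "p < n i" for p
  proof -
    have "(\<Sum>r<n i. (cmod (unit_vec_at p r))\<^sup>2) = (\<Sum>r<n i. if r = p then 1 else 0)"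
      by (rule sum.cong) (auto simp: unit_vec_at_def)
    then show ?thesis using that by simp
  qed
  have "cmod (sesq {..<n i} (ent x i) (unit_vec_at p) (unit_vec_at q)) \<le> c * (1 + 1)"
    using assms(1)[unfolded bounded_kernel_def, rule_format, of "unit_vec_at p" "unit_vec_at q"]
    by (simp only: unit[OF assms(2)] unit[OF assms(3)])
  then show ?thesis using sesq_unit[of "{..<n i}" p q] assms(2,3) by simp
qed

lemma positive_bounded_by_one:
  assumes "positive b"
  shows "\<exists>c\<ge>0. positive (of_real c \<odot> \<one> \<ominus> b)"
proof -
  have b: "b \<in> carrier A" "star A b = b" using assms positive_carrier positive_self_adjoint by auto
  obtain c where c: "c \<ge> 0" "\<And>i v. i \<in> I \<Longrightarrow> cmod (form b i v) \<le> c * (\<Sum>p<n i. (cmod (v p))\<^sup>2)"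
    using form_bound[OF b(1)] by blast
  have "positive (of_real c \<odot> \<one> \<ominus> b)"
  proof (rule positiveI)
    fix i v assume i: "i \<in> I"
    show "0 \<le> form (of_real c \<odot> \<one> \<ominus> b) i v"
      using form_selfadjoint[OF b i, of v] c(2)[OF i, of v] abs_Re_le_cmod[of "form b i v"] b(1) i
      by (simp add: form_minus form_smult form_one complex_nonneg_iff)
  qed (use b in auto)
  with c(1) show ?thesis by blast
qed

end

locale block_pair = A: block_algebra A I n entA + B: block_algebra B J m entB
  for A :: "'a star_alg" and I :: "'i set" and n entA and B :: "'b star_alg" and J :: "'j set" and m entB
begin

definition linear_map :: "('b \<Rightarrow> 'a) \<Rightarrow> bool" where
  "linear_map \<phi> \<longleftrightarrow> \<phi> \<in> carrier B \<rightarrow> carrier A \<and>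
    (\<forall>x\<in>carrier B. \<forall>y\<in>carrier B. \<phi> (x \<oplus>\<^bsub>B\<^esub> y) = \<phi> x \<oplus>\<^bsub>A\<^esub> \<phi> y) \<and>
    (\<forall>c. \<forall>x\<in>carrier B. \<phi> (c \<odot>\<^bsub>B\<^esub> x) = c \<odot>\<^bsub>A\<^esub> \<phi> x)"

lemma linear_mapD:
  assumes "linear_map \<phi>"
  shows linear_map_closed: "x \<in> carrier B \<Longrightarrow> \<phi> x \<in> carrier A"
    and linear_map_add: "\<lbrakk>x \<in> carrier B; y \<in> carrier B\<rbrakk> \<Longrightarrow> \<phi> (x \<oplus>\<^bsub>B\<^esub> y) = \<phi> x \<oplus>\<^bsub>A\<^esub> \<phi> y"
    and linear_map_smult: "x \<in> carrier B \<Longrightarrow> \<phi> (c \<odot>\<^bsub>B\<^esub> x) = c \<odot>\<^bsub>A\<^esub> \<phi> x"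
  using assms unfolding linear_map_def by blast+

lemma linear_map_minus:
  assumes "linear_map \<phi>" "x \<in> carrier B" "y \<in> carrier B"
  shows "\<phi> (x \<ominus>\<^bsub>B\<^esub> y) = \<phi> x \<ominus>\<^bsub>A\<^esub> \<phi> y"
  using linear_map_closed[OF assms(1)] assms
  by (simp add: B.minus_eq_smult A.minus_eq_smult linear_map_add linear_map_smult)

text \<open>The scalar test of the overview: the form of the matrix \<open>\<phi> (b k l)\<close> in
  block i at the vector v. Complete positivity says that it is nonnegative for every positive
  b.\<close>

definition mf :: "('b \<Rightarrow> 'a) \<Rightarrow> nat \<Rightarrow> (nat \<Rightarrow> nat \<Rightarrow> 'b) \<Rightarrow> 'i \<Rightarrow> (nat \<times> nat \<Rightarrow> complex) \<Rightarrow> complex" where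
  "mf \<phi> N b i v = sesq ({..<N} \<times> {..<n i}) (A.mker (\<lambda>k l. \<phi> (b k l)) i) v v"

lemma matrix_positive_closed: "\<lbrakk>matrix_positive B N b; k < N; l < N\<rbrakk> \<Longrightarrow> b k l \<in> carrier B"
  using B.matrix_positive_gram(1) by blast

lemma completely_positive_iff:
  "completely_positive B A \<phi> \<longleftrightarrow> linear_map \<phi> \<and>
    (\<forall>N b. matrix_positive B N b \<longrightarrow> (\<forall>i\<in>I. \<forall>v. 0 \<le> mf \<phi> N b i v))"
proof -
  have "matrix_positive A N (\<lambda>k l. \<phi> (b k l)) \<longleftrightarrow> (\<forall>i\<in>I. \<forall>v. 0 \<le> mf \<phi> N b i v)"
    if "linear_map \<phi>" "matrix_positive B N b" for N b
  proof -
    have "\<forall>k<N. \<forall>l<N. \<phi> (b k l) \<in> carrier A"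
      using linear_map_closed[OF that(1)] matrix_positive_closed[OF that(2)] by simp
    then show ?thesis unfolding A.matrix_positive_iff psd_def mf_def by simp
  qed
  note eq = this
  have "completely_positive B A \<phi> \<longleftrightarrow> linear_map \<phi> \<and>
      (\<forall>N b. matrix_positive B N b \<longrightarrow> matrix_positive A N (\<lambda>k l. \<phi> (b k l)))"
    unfolding completely_positive_def linear_map_def by (simp only: conj_assoc)
  also have "\<dots> \<longleftrightarrow> linear_map \<phi> \<and> (\<forall>N b. matrix_positive B N b \<longrightarrow> (\<forall>i\<in>I. \<forall>v. 0 \<le> mf \<phi> N b i v))"
    by (rule conj_cong[OF refl]) (simp add: eq)
  finally show ?thesis .
qed

lemma mf_diff:
  assumes "linear_map \<phi>" "linear_map \<psi>" "matrix_positive B N b" "i \<in> I"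
  shows "mf (\<lambda>b. \<psi> b \<ominus>\<^bsub>A\<^esub> \<phi> b) N b i v = mf \<psi> N b i v - mf \<phi> N b i v"
  unfolding mf_def sesq_diff[symmetric]
  by (rule sesq_cong)
    (use linear_map_closed[OF assms(1)] linear_map_closed[OF assms(2)] matrix_positive_closed[OF assms(3)] assms(4)
      in \<open>auto simp: A.mker_def A.ent_minus\<close>)

lemma linear_map_diff:
  assumes "linear_map \<phi>" "linear_map \<psi>"
  shows "linear_map (\<lambda>b. \<psi> b \<ominus>\<^bsub>A\<^esub> \<phi> b)"
proof -
  note C = linear_map_closed[OF assms(1)] linear_map_closed[OF assms(2)]
  have "\<psi> (x \<oplus>\<^bsub>B\<^esub> y) \<ominus>\<^bsub>A\<^esub> \<phi> (x \<oplus>\<^bsub>B\<^esub> y) = (\<psi> x \<ominus>\<^bsub>A\<^esub> \<phi> x) \<oplus>\<^bsub>A\<^esub> (\<psi> y \<ominus>\<^bsub>A\<^esub> \<phi> y)"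
    if "x \<in> carrier B" "y \<in> carrier B" for x y
    by (rule A.ent_eqI) (use C that assms in \<open>simp_all add: linear_map_add A.ent_minus A.ent_add\<close>)
  moreover have "\<psi> (c \<odot>\<^bsub>B\<^esub> x) \<ominus>\<^bsub>A\<^esub> \<phi> (c \<odot>\<^bsub>B\<^esub> x) = c \<odot>\<^bsub>A\<^esub> (\<psi> x \<ominus>\<^bsub>A\<^esub> \<phi> x)" if "x \<in> carrier B" for c x
    by (rule A.ent_eqI) (use C that assms in \<open>simp_all add: linear_map_smult A.ent_minus A.ent_smult algebra_simps\<close>)
  ultimately show ?thesis using C unfolding linear_map_def by auto
qed

lemma completely_positive_linear: "completely_positive B A \<phi> \<Longrightarrow> linear_map \<phi>"
  by (simp add: completely_positive_iff)

lemma completely_positive_positive: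
  assumes "completely_positive B A \<phi>" "B.positive b"
  shows "A.positive (\<phi> b)"
proof -
  have "matrix_positive B 1 (\<lambda>_ _. b)" using B.matrix_positive_1[of b] assms(2) by simp
  then have "matrix_positive A 1 (\<lambda>_ _. \<phi> b)" using assms(1) unfolding completely_positive_def by blast
  then show ?thesis using A.matrix_positive_1[of "\<phi> b"] by simp
qed

text \<open>Positivity of the map gives information at positive elements only; a self-adjoint b is
  reached by adding a multiple of the unit and subtracting its image again.\<close>

lemma completely_positive_self_adjoint:
  assumes \<phi>: "completely_positive B A \<phi>" and b: "b \<in> carrier B.SA"
  shows "\<phi> b \<in> carrier A.SA"
proof -
  note lin = completely_positive_linear[OF \<phi>]
  have bC: "b \<in> carrier B" "star B b = b" using b by auto
  obtain c :: real where c: "B.positive (b \<oplus>\<^bsub>B\<^esub> of_real c \<odot>\<^bsub>B\<^esub> \<one>\<^bsub>B\<^esub>)" using B.self_adjoint_shift[OF bC] by blast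
  let ?p = "b \<oplus>\<^bsub>B\<^esub> of_real c \<odot>\<^bsub>B\<^esub> \<one>\<^bsub>B\<^esub>"
  have pos: "A.positive (\<phi> ?p)" "A.positive (\<phi> \<one>\<^bsub>B\<^esub>)"
    using completely_positive_positive[OF \<phi>] c B.positive_one by auto
  then have sa: "star A (\<phi> ?p) = \<phi> ?p" "star A (\<phi> \<one>\<^bsub>B\<^esub>) = \<phi> \<one>\<^bsub>B\<^esub>" and C: "\<phi> ?p \<in> carrier A" "\<phi> \<one>\<^bsub>B\<^esub> \<in> carrier A"
    using A.positive_self_adjoint A.positive_carrier by auto
  have eq: "\<phi> ?p = \<phi> b \<oplus>\<^bsub>A\<^esub> of_real c \<odot>\<^bsub>A\<^esub> \<phi> \<one>\<^bsub>B\<^esub>"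
    using bC by (simp add: linear_map_add[OF lin] linear_map_smult[OF lin])
  have \<phi>b: "\<phi> b \<in> carrier A" using linear_map_closed[OF lin bC(1)] .
  have "star A (\<phi> b) = \<phi> b"
  proof (rule A.ent_eqI)
    fix i p q assume i: "i \<in> I" "p < n i" "q < n i"
    have e: "entA (\<phi> b) i r s = entA (\<phi> ?p) i r s - of_real c * entA (\<phi> \<one>\<^bsub>B\<^esub>) i r s" if "r < n i" "s < n i" for r s
      unfolding eq using \<phi>b C(2) i(1) that by (simp add: A.ent_add A.ent_smult)
    have h: "cnj (entA x i q p) = entA x i p q" if "x \<in> carrier A" "star A x = x" for x
      using A.ent_star[OF that(1) i] that(2) by simp
    show "entA (star A (\<phi> b)) i p q = entA (\<phi> b) i p q"
      unfolding A.ent_star[OF \<phi>b i] e[OF i(2,3)] e[OF i(3,2)] using h[OF C(1) sa(1)] h[OF C(2) sa(2)] by simp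
  qed (use \<phi>b A.star_closed in auto)
  then show ?thesis using \<phi>b by simp
qed

lemma completely_positive_mono:
  assumes \<phi>: "completely_positive B A \<phi>" and "x \<in> carrier B" "y \<in> carrier B" "alg_le B x y"
  shows "alg_le A (\<phi> x) (\<phi> y)"
proof -
  note lin = completely_positive_linear[OF \<phi>]
  have "B.positive (y \<ominus>\<^bsub>B\<^esub> x)" using assms B.alg_le_iff_positive by simp
  from completely_positive_positive[OF \<phi> this] show ?thesis
    using linear_map_minus[OF lin] linear_map_closed[OF lin] assms A.alg_le_iff_positive by simp
qed

lemma completely_positive_form_mono:
  assumes \<phi>: "completely_positive B A \<phi>" and xy: "x \<in> carrier B.SA" "y \<in> carrier B.SA" "alg_le B x y" and i: "i \<in> I"
  shows "Re (A.form (\<phi> x) i v) \<le> Re (A.form (\<phi> y) i v)"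
proof -
  have "alg_le A (\<phi> x) (\<phi> y)" by (rule completely_positive_mono[OF \<phi>]) (use xy in auto)
  then show ?thesis
    using A.alg_le_Re[OF completely_positive_self_adjoint[OF \<phi> xy(1)] completely_positive_self_adjoint[OF \<phi> xy(2)]] i by simp
qed

lemma completely_positive_directed:
  assumes \<phi>: "completely_positive B A \<phi>" and T: "directed B.SA T"
  shows "directed A.SA (\<phi> ` T)"
proof (rule directed_image[OF T])
  have TC: "\<And>s. s \<in> T \<Longrightarrow> s \<in> carrier B.SA" using directed_subset[OF T] by blast
  show "\<phi> \<in> T \<rightarrow> carrier A.SA" using completely_positive_self_adjoint[OF \<phi>] TC by blast
  show "\<phi> x \<sqsubseteq>\<^bsub>A.SA\<^esub> \<phi> y" if "x \<in> T" "y \<in> T" "x \<sqsubseteq>\<^bsub>B.SA\<^esub> y" for x y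
    using completely_positive_mono[OF \<phi>, of x y] TC[OF that(1)] TC[OF that(2)] that(3) by simp
qed

text \<open>By \<open>SA_lub_iff\<close> normality is a statement about one real number at a time,
  which is easy to combine with limits of maps.\<close>

lemma normal_map_iff:
  assumes \<phi>: "completely_positive B A \<phi>"
  shows "normal_map B A \<phi> \<longleftrightarrow> (\<forall>T t. directed B.SA T \<and> is_lub B.SA t T \<longrightarrow>
    (\<forall>i\<in>I. \<forall>v. \<forall>e>0. \<exists>s\<in>T. Re (A.form (\<phi> t) i v) < Re (A.form (\<phi> s) i v) + e))"
proof (intro iffI allI impI)
  fix T t assume norm: "normal_map B A \<phi>" and T: "directed B.SA T \<and> is_lub B.SA t T"
  then have "is_lub A.SA (\<phi> t) (\<phi> ` T)"
    unfolding normal_map_def using scott_continuous_lub[of B.SA A.SA \<phi> T t] by blast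
  then show "\<forall>i\<in>I. \<forall>v. \<forall>e>0. \<exists>s\<in>T. Re (A.form (\<phi> t) i v) < Re (A.form (\<phi> s) i v) + e"
    using A.SA_lub_iff[OF completely_positive_directed[OF \<phi>]] T by simp
next
  assume R: "\<forall>T t. directed B.SA T \<and> is_lub B.SA t T \<longrightarrow>
    (\<forall>i\<in>I. \<forall>v. \<forall>e>0. \<exists>s\<in>T. Re (A.form (\<phi> t) i v) < Re (A.form (\<phi> s) i v) + e)"
  show "normal_map B A \<phi>"
    unfolding normal_map_def scott_continuous_def
  proof (intro conjI ballI allI impI)
    show "\<phi> \<in> carrier B.SA \<rightarrow> carrier A.SA" using completely_positive_self_adjoint[OF \<phi>] by blast
    show "\<phi> x \<sqsubseteq>\<^bsub>A.SA\<^esub> \<phi> y" if "x \<in> carrier B.SA" "y \<in> carrier B.SA" "x \<sqsubseteq>\<^bsub>B.SA\<^esub> y" for x y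
      using completely_positive_mono[OF \<phi>, of x y] that by simp
    fix T t assume Tt: "directed B.SA T \<and> is_lub B.SA t T"
    then have T: "directed B.SA T" by blast
    have t: "t \<in> carrier B.SA" "\<And>s. s \<in> T \<Longrightarrow> alg_le B s t"
      using Tt B.SA_lub_iff[OF T, of t] by auto
    show "is_lub A.SA (\<phi> t) (\<phi> ` T)"
      unfolding A.SA_lub_iff[OF completely_positive_directed[OF \<phi> T]]
    proof (intro conjI)
      show "\<phi> t \<in> carrier A.SA" by (rule completely_positive_self_adjoint[OF \<phi> t(1)])
      show "\<forall>s\<in>\<phi> ` T. alg_le A s (\<phi> t)"
      proof
        fix x assume "x \<in> \<phi> ` T"
        then obtain s where s: "s \<in> T" "x = \<phi> s" by blast
        have "s \<in> carrier B" using s directed_subset[OF T] by auto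
        then show "alg_le A x (\<phi> t)" using completely_positive_mono[OF \<phi> _ _ t(2)[OF s(1)]] s(2) t(1) by simp
      qed
      show "\<forall>i\<in>I. \<forall>v. \<forall>e>0. \<exists>s\<in>\<phi> ` T. Re (A.form (\<phi> t) i v) < Re (A.form s i v) + e"
        using R[rule_format, OF Tt] by simp
    qed
  qed
qed

section \<open>Q(A,B) as a dcpo with enough functionals\<close>

subsection \<open>The order on normal completely positive subunital maps\<close>

abbreviation Q :: "('b \<Rightarrow> 'a) convex_order" where "Q \<equiv> Q_dcpo A B"

lemma Q_carrier_iff:
  "\<phi> \<in> carrier Q \<longleftrightarrow> \<phi> \<in> extensional (carrier B) \<and> completely_positive B A \<phi> \<and> normal_map B A \<phi> \<and>
    alg_le A (\<phi> \<one>\<^bsub>B\<^esub>) \<one>\<^bsub>A\<^esub>"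
  by (simp add: Q_dcpo_def)

lemma QD:
  assumes "\<phi> \<in> carrier Q"
  shows Q_cp: "completely_positive B A \<phi>" and Q_lin: "linear_map \<phi>" and Q_ext: "\<phi> \<in> extensional (carrier B)"
    and Q_mf: "\<lbrakk>matrix_positive B N b; i \<in> I\<rbrakk> \<Longrightarrow> 0 \<le> mf \<phi> N b i v"
    and Q_normal: "\<lbrakk>directed B.SA T; is_lub B.SA t T; i \<in> I; e > 0\<rbrakk> \<Longrightarrow>
      \<exists>s\<in>T. Re (A.form (\<phi> t) i w) < Re (A.form (\<phi> s) i w) + e"
    and Q_subunital: "i \<in> I \<Longrightarrow> Re (A.form (\<phi> \<one>\<^bsub>B\<^esub>) i w) \<le> (\<Sum>p<n i. (cmod (w p))\<^sup>2)"
proof -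
  show cp: "completely_positive B A \<phi>" and "\<phi> \<in> extensional (carrier B)" using assms by (auto simp: Q_carrier_iff)
  then show lin: "linear_map \<phi>" by (intro completely_positive_linear)
  show "0 \<le> mf \<phi> N b i v" if "matrix_positive B N b" "i \<in> I"
    using cp that unfolding completely_positive_iff by blast
  show "\<exists>s\<in>T. Re (A.form (\<phi> t) i w) < Re (A.form (\<phi> s) i w) + e"
    if "directed B.SA T" "is_lub B.SA t T" "i \<in> I" "e > 0"
    using assms that normal_map_iff[OF cp] unfolding Q_carrier_iff by blast
  have "alg_le A (\<phi> \<one>\<^bsub>B\<^esub>) \<one>\<^bsub>A\<^esub>" using assms by (simp add: Q_carrier_iff)
  then show "Re (A.form (\<phi> \<one>\<^bsub>B\<^esub>) i w) \<le> (\<Sum>p<n i. (cmod (w p))\<^sup>2)" if "i \<in> I"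
    using that linear_map_closed[OF lin] by (simp add: A.alg_le_iff A.form_one complex_nonneg_iff)
qed

lemma QI:
  assumes ext: "\<phi> \<in> extensional (carrier B)" and lin: "linear_map \<phi>"
    and mf: "\<And>N b i v. \<lbrakk>matrix_positive B N b; i \<in> I\<rbrakk> \<Longrightarrow> 0 \<le> mf \<phi> N b i v"
    and norm: "\<And>T t i v e. \<lbrakk>directed B.SA T; is_lub B.SA t T; i \<in> I; e > 0\<rbrakk> \<Longrightarrow>
      \<exists>s\<in>T. Re (A.form (\<phi> t) i v) < Re (A.form (\<phi> s) i v) + e"
    and sub: "\<And>i v. i \<in> I \<Longrightarrow> Re (A.form (\<phi> \<one>\<^bsub>B\<^esub>) i v) \<le> (\<Sum>p<n i. (cmod (v p))\<^sup>2)"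
  shows "\<phi> \<in> carrier Q"
proof -
  have cp: "completely_positive B A \<phi>" unfolding completely_positive_iff using lin mf by blast
  have "normal_map B A \<phi>" unfolding normal_map_iff[OF cp] using norm by blast
  moreover have "\<phi> \<one>\<^bsub>B\<^esub> \<in> carrier A.SA" "\<one>\<^bsub>A\<^esub> \<in> carrier A.SA"
    using completely_positive_self_adjoint[OF cp, of "\<one>\<^bsub>B\<^esub>"] A.positive_self_adjoint[OF A.positive_one]
      B.positive_self_adjoint[OF B.positive_one] by auto
  then have "alg_le A (\<phi> \<one>\<^bsub>B\<^esub>) \<one>\<^bsub>A\<^esub>" using sub by (simp add: A.alg_le_Re A.form_one)
  ultimately show ?thesis using ext cp by (simp add: Q_carrier_iff)
qed

lemma mf_real: "\<lbrakk>\<phi> \<in> carrier Q; matrix_positive B N b; i \<in> I\<rbrakk> \<Longrightarrow> Im (mf \<phi> N b i v) = 0"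
  using Q_mf complex_nonneg_iff by blast

text \<open>For fixed positive b the number \<open>mf\<close> is additive in the map, so complete
  positivity of a difference becomes a family of inequalities between reals.\<close>

lemma Q_le_iff:
  assumes "\<phi> \<in> carrier Q" "\<psi> \<in> carrier Q"
  shows "\<phi> \<sqsubseteq>\<^bsub>Q\<^esub> \<psi> \<longleftrightarrow> (\<forall>N b. matrix_positive B N b \<longrightarrow> (\<forall>i\<in>I. \<forall>v. Re (mf \<phi> N b i v) \<le> Re (mf \<psi> N b i v)))"
proof -
  have "\<phi> \<sqsubseteq>\<^bsub>Q\<^esub> \<psi> \<longleftrightarrow> completely_positive B A (\<lambda>b. \<psi> b \<ominus>\<^bsub>A\<^esub> \<phi> b)" by (simp add: Q_dcpo_def)
  also have "\<dots> \<longleftrightarrow> (\<forall>N b. matrix_positive B N b \<longrightarrow> (\<forall>i\<in>I. \<forall>v. 0 \<le> mf (\<lambda>b. \<psi> b \<ominus>\<^bsub>A\<^esub> \<phi> b) N b i v))"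
    using linear_map_diff[OF Q_lin[OF assms(1)] Q_lin[OF assms(2)]] by (simp add: completely_positive_iff)
  also have "\<dots> \<longleftrightarrow> (\<forall>N b. matrix_positive B N b \<longrightarrow> (\<forall>i\<in>I. \<forall>v. Re (mf \<phi> N b i v) \<le> Re (mf \<psi> N b i v)))"
    using mf_diff[OF Q_lin[OF assms(1)] Q_lin[OF assms(2)]] mf_real[OF assms(1)] mf_real[OF assms(2)]
    by (simp add: complex_nonneg_iff)
  finally show ?thesis .
qed

lemma Q_le_form:
  assumes "\<phi> \<in> carrier Q" "\<psi> \<in> carrier Q" "\<phi> \<sqsubseteq>\<^bsub>Q\<^esub> \<psi>" "B.positive b" "i \<in> I"
  shows "Re (A.form (\<phi> b) i v) \<le> Re (A.form (\<psi> b) i v)"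
proof -
  have "completely_positive B A (\<lambda>b. \<psi> b \<ominus>\<^bsub>A\<^esub> \<phi> b)" using assms(3) by (simp add: Q_dcpo_def)
  from completely_positive_positive[OF this assms(4)] have "A.positive (\<psi> b \<ominus>\<^bsub>A\<^esub> \<phi> b)" .
  from A.positive_form[OF this assms(5), of v] show ?thesis
    using linear_map_closed[OF Q_lin[OF assms(1)]] linear_map_closed[OF Q_lin[OF assms(2)]]
      B.positive_carrier[OF assms(4)] assms(5) by (simp add: A.form_minus complex_nonneg_iff)
qed

lemma Q_form_real: "\<lbrakk>\<phi> \<in> carrier Q; B.positive b; i \<in> I\<rbrakk> \<Longrightarrow> Im (A.form (\<phi> b) i v) = 0"
  using A.positive_form[OF completely_positive_positive[OF Q_cp]] by (simp add: complex_nonneg_iff)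

lemma partial_order_Q: "partial_order Q"
proof (rule partial_orderI)
  show "x .=\<^bsub>Q\<^esub> y \<longleftrightarrow> x = y" for x y by (simp add: Q_dcpo_def)
  show "x \<sqsubseteq>\<^bsub>Q\<^esub> x" if "x \<in> carrier Q" for x using Q_le_iff[OF that that] by simp
next
  fix x y assume x: "x \<in> carrier Q" and y: "y \<in> carrier Q" and xy: "x \<sqsubseteq>\<^bsub>Q\<^esub> y" and yx: "y \<sqsubseteq>\<^bsub>Q\<^esub> x"
  note lx = Q_lin[OF x] and ly = Q_lin[OF y]
  show "x = y"
  proof (rule extensionalityI[OF Q_ext[OF x] Q_ext[OF y]])
    fix b assume "b \<in> carrier B"
    then show "x b = y b"
    proof (induction rule: B.positive_span_induct)
      case (positive b)
      show ?case
      proof (rule A.form_eqI)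
        show "A.form (x b) i v = A.form (y b) i v" if "i \<in> I" for i v
          using Q_le_form[OF x y xy positive that] Q_le_form[OF y x yx positive that]
            Q_form_real[OF x positive that] Q_form_real[OF y positive that]
          by (simp add: complex_eq_iff order_antisym)
      qed (use linear_map_closed[OF lx] linear_map_closed[OF ly] B.positive_carrier[OF positive] in auto)
    qed (simp_all add: linear_map_add[OF lx] linear_map_add[OF ly] linear_map_smult[OF lx] linear_map_smult[OF ly])
  qed
next
  fix x y z assume xyz: "x \<in> carrier Q" "y \<in> carrier Q" "z \<in> carrier Q" "x \<sqsubseteq>\<^bsub>Q\<^esub> y" "y \<sqsubseteq>\<^bsub>Q\<^esub> z"
  have 1: "\<forall>N b. matrix_positive B N b \<longrightarrow> (\<forall>i\<in>I. \<forall>v. Re (mf x N b i v) \<le> Re (mf y N b i v))"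
    using Q_le_iff[OF xyz(1,2)] xyz(4) by simp
  have 2: "\<forall>N b. matrix_positive B N b \<longrightarrow> (\<forall>i\<in>I. \<forall>v. Re (mf y N b i v) \<le> Re (mf z N b i v))"
    using Q_le_iff[OF xyz(2,3)] xyz(5) by simp
  have "Re (mf x N b i v) \<le> Re (mf z N b i v)" if "matrix_positive B N b" "i \<in> I" for N b i v
    by (rule order_trans[OF 1[rule_format, OF that] 2[rule_format, OF that]])
  then show "x \<sqsubseteq>\<^bsub>Q\<^esub> z" using Q_le_iff[OF xyz(1,3)] by simp
qed

text \<open>From 0 \<le> b \<le> c 1 follows 0 \<le> \<open>\<phi> b\<close> \<le> c
  \<open>\<phi> \<one>\<close> \<le> c 1, a bound that depends neither on the map nor on the block.
  It lets pointwise limits of maps land in A.\<close>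

lemma Q_uniform_bound:
  assumes "b \<in> carrier B"
  shows "\<exists>C. \<forall>\<phi>\<in>carrier Q. \<forall>i\<in>I. bounded_kernel {..<n i} (entA (\<phi> b) i) C"
  using assms
proof (induction rule: B.positive_span_induct)
  case (positive b)
  note bC = B.positive_carrier[OF positive]
  obtain c where c: "c \<ge> 0" "B.positive (of_real c \<odot>\<^bsub>B\<^esub> \<one>\<^bsub>B\<^esub> \<ominus>\<^bsub>B\<^esub> b)" using B.positive_bounded_by_one[OF positive] by blast
  have "bounded_kernel {..<n i} (entA (\<phi> b) i) c" if \<phi>: "\<phi> \<in> carrier Q" and i: "i \<in> I" for \<phi> i
  proof (rule bounded_kernel_psd)
    note lin = Q_lin[OF \<phi>] and cp = Q_cp[OF \<phi>]
    show "psd {..<n i} (entA (\<phi> b) i)"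
      using completely_positive_positive[OF cp positive] i by (simp add: A.positive_def)
    fix v
    have "A.positive (\<phi> (of_real c \<odot>\<^bsub>B\<^esub> \<one>\<^bsub>B\<^esub> \<ominus>\<^bsub>B\<^esub> b))" by (rule completely_positive_positive[OF cp c(2)])
    also have "\<phi> (of_real c \<odot>\<^bsub>B\<^esub> \<one>\<^bsub>B\<^esub> \<ominus>\<^bsub>B\<^esub> b) = of_real c \<odot>\<^bsub>A\<^esub> \<phi> \<one>\<^bsub>B\<^esub> \<ominus>\<^bsub>A\<^esub> \<phi> b"
      using bC by (simp add: linear_map_minus[OF lin] linear_map_smult[OF lin])
    finally have "0 \<le> A.form (of_real c \<odot>\<^bsub>A\<^esub> \<phi> \<one>\<^bsub>B\<^esub> \<ominus>\<^bsub>A\<^esub> \<phi> b) i v" by (rule A.positive_form[OF _ i])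
    then have "Re (A.form (\<phi> b) i v) \<le> c * Re (A.form (\<phi> \<one>\<^bsub>B\<^esub>) i v)"
      using linear_map_closed[OF lin] bC i by (simp add: A.form_minus A.form_smult complex_nonneg_iff)
    also have "\<dots> \<le> c * (\<Sum>p<n i. (cmod (v p))\<^sup>2)"
      by (rule mult_left_mono[OF Q_subunital[OF \<phi> i] c(1)])
    finally show "Re (A.form (\<phi> b) i v) \<le> c * (\<Sum>p<n i. (cmod (v p))\<^sup>2)" .
  qed
  then show ?case by blast
next
  case (add x y)
  then obtain C D where CD: "\<And>\<phi> i. \<lbrakk>\<phi> \<in> carrier Q; i \<in> I\<rbrakk> \<Longrightarrow> bounded_kernel {..<n i} (entA (\<phi> x) i) C"
    "\<And>\<phi> i. \<lbrakk>\<phi> \<in> carrier Q; i \<in> I\<rbrakk> \<Longrightarrow> bounded_kernel {..<n i} (entA (\<phi> y) i) D" by blast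
  have "bounded_kernel {..<n i} (entA (\<phi> (x \<oplus>\<^bsub>B\<^esub> y)) i) (C + D)" if "\<phi> \<in> carrier Q" "i \<in> I" for \<phi> i
    by (rule iffD1[OF bounded_kernel_cong bounded_kernel_add[OF CD(1)[OF that] CD(2)[OF that]]])
      (use that add.hyps linear_map_closed[OF Q_lin[OF that(1)]] in \<open>simp add: linear_map_add[OF Q_lin[OF that(1)]] A.ent_add\<close>)
  then show ?case by blast
next
  case (smult c x)
  then obtain C where C: "\<And>\<phi> i. \<lbrakk>\<phi> \<in> carrier Q; i \<in> I\<rbrakk> \<Longrightarrow> bounded_kernel {..<n i} (entA (\<phi> x) i) C" by blast
  have "bounded_kernel {..<n i} (entA (\<phi> (c \<odot>\<^bsub>B\<^esub> x)) i) (cmod c * C)" if "\<phi> \<in> carrier Q" "i \<in> I" for \<phi> i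
    by (rule iffD1[OF bounded_kernel_cong bounded_kernel_scale[OF C[OF that]]])
      (use that smult.hyps linear_map_closed[OF Q_lin[OF that(1)]] in \<open>simp add: linear_map_smult[OF Q_lin[OF that(1)]] A.ent_smult\<close>)
  then show ?case by blast
qed

subsection \<open>Directed suprema\<close>

text \<open>The supremum is the entrywise limit. The convergence is part of the conclusion because
  the comparison of Choi matrices needs it, not just the order-theoretic supremum.\<close>

lemma Q_directed_lub:
  assumes S: "directed Q S"
  shows "\<exists>\<Phi>. is_lub Q \<Phi> S \<and> (\<forall>b\<in>carrier B. \<forall>i\<in>I. \<forall>p<n i. \<forall>q<n i.
    ((\<lambda>\<phi>. entA (\<phi> b) i p q) \<longlongrightarrow> entA (\<Phi> b) i p q) (dir_filter Q S))"
proof -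
  let ?F = "dir_filter Q S"
  note po = partial_order_Q
  have SQ: "\<phi> \<in> carrier Q" if "\<phi> \<in> S" for \<phi> using directed_subset[OF S] that by blast
  have nt: "\<not> trivial_limit ?F" by (rule dir_filter_nontrivial[OF po S])
  obtain \<phi>0 where \<phi>0: "\<phi>0 \<in> S" using S by (auto simp: directed_def)
  have evS: "\<forall>\<^sub>F \<phi> in ?F. \<phi> \<in> S"
    using eventually_dir_filter_ge[OF po S \<phi>0] by eventually_elim simp
  \<comment> \<open>At positive b the forms increase along S and are bounded, so they converge;
    linearity spreads this to all b.\<close>
  have conv: "\<exists>l. \<forall>i\<in>I. \<forall>p<n i. \<forall>q<n i. ((\<lambda>\<phi>. entA (\<phi> b) i p q) \<longlongrightarrow> l i p q) ?F" if "b \<in> carrier B" for b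
    using that
  proof (induction rule: B.positive_span_induct)
    case (positive b)
    obtain C where C: "\<And>\<phi> i. \<lbrakk>\<phi> \<in> carrier Q; i \<in> I\<rbrakk> \<Longrightarrow> bounded_kernel {..<n i} (entA (\<phi> b) i) C"
      using Q_uniform_bound[OF B.positive_carrier[OF positive]] by blast
    define l where "l i v = complex_of_real (SUP \<phi>\<in>S. Re (A.form (\<phi> b) i v))" for i v
    have lim: "((\<lambda>\<phi>. A.form (\<phi> b) i v) \<longlongrightarrow> l i v) ?F" if i: "i \<in> I" for i v
    proof (rule Lim_transform_eventually)
      let ?c = "C * ((\<Sum>s<n i. (cmod (v s))\<^sup>2) + (\<Sum>s<n i. (cmod (v s))\<^sup>2))"
      show "((\<lambda>\<phi>. complex_of_real (Re (A.form (\<phi> b) i v))) \<longlongrightarrow> l i v) ?F"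
        unfolding l_def
      proof (rule tendsto_of_real[OF tendsto_dir_filter_mono[OF po S, of _ ?c]])
        show "Re (A.form (\<phi> b) i v) \<le> Re (A.form (\<psi> b) i v)" if "\<phi> \<in> S" "\<psi> \<in> S" "\<phi> \<sqsubseteq>\<^bsub>Q\<^esub> \<psi>" for \<phi> \<psi>
          by (rule Q_le_form[OF SQ[OF that(1)] SQ[OF that(2)] that(3) positive i])
        show "Re (A.form (\<phi> b) i v) \<le> ?c" if "\<phi> \<in> S" for \<phi>
          using C[OF SQ[OF that] i, unfolded bounded_kernel_def, rule_format, of v v]
            complex_Re_le_cmod[of "A.form (\<phi> b) i v"] by linarith
      qed
      show "\<forall>\<^sub>F \<phi> in ?F. complex_of_real (Re (A.form (\<phi> b) i v)) = A.form (\<phi> b) i v"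
        using evS by eventually_elim (use SQ Q_form_real[OF _ positive i] in \<open>auto simp: complex_eq_iff\<close>)
    qed
    have "((\<lambda>\<phi>. entA (\<phi> b) i p q) \<longlongrightarrow> polar (l i) p q) ?F" if "i \<in> I" "p < n i" "q < n i" for i p q
      by (rule tendsto_kernel_polarization[OF finite_lessThan lim[OF that(1)]]) (use that in auto)
    then show ?case by (intro exI[of _ "\<lambda>i p q. polar (l i) p q"] ballI allI impI)
  next
    case (add x y)
    then obtain k l where kl: "\<forall>i\<in>I. \<forall>p<n i. \<forall>q<n i. ((\<lambda>\<phi>. entA (\<phi> x) i p q) \<longlongrightarrow> k i p q) ?F"
      "\<forall>i\<in>I. \<forall>p<n i. \<forall>q<n i. ((\<lambda>\<phi>. entA (\<phi> y) i p q) \<longlongrightarrow> l i p q) ?F" by blast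
    have "((\<lambda>\<phi>. entA (\<phi> (x \<oplus>\<^bsub>B\<^esub> y)) i p q) \<longlongrightarrow> k i p q + l i p q) ?F" if "i \<in> I" "p < n i" "q < n i" for i p q
    proof (rule Lim_transform_eventually)
      show "((\<lambda>\<phi>. entA (\<phi> x) i p q + entA (\<phi> y) i p q) \<longlongrightarrow> k i p q + l i p q) ?F"
        by (rule tendsto_add) (use kl that in simp_all)
      show "\<forall>\<^sub>F \<phi> in ?F. entA (\<phi> x) i p q + entA (\<phi> y) i p q = entA (\<phi> (x \<oplus>\<^bsub>B\<^esub> y)) i p q"
        using evS
      proof eventually_elim
        case (elim \<phi>)
        note lin = Q_lin[OF SQ[OF elim]]
        show ?case using linear_map_closed[OF lin] add.hyps that by (simp add: linear_map_add[OF lin] A.ent_add)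
      qed
    qed
    then show ?case by (intro exI[of _ "\<lambda>i p q. k i p q + l i p q"] ballI allI impI)
  next
    case (smult c x)
    then obtain l where l: "\<forall>i\<in>I. \<forall>p<n i. \<forall>q<n i. ((\<lambda>\<phi>. entA (\<phi> x) i p q) \<longlongrightarrow> l i p q) ?F" by blast
    have "((\<lambda>\<phi>. entA (\<phi> (c \<odot>\<^bsub>B\<^esub> x)) i p q) \<longlongrightarrow> c * l i p q) ?F" if "i \<in> I" "p < n i" "q < n i" for i p q
    proof (rule Lim_transform_eventually)
      show "((\<lambda>\<phi>. c * entA (\<phi> x) i p q) \<longlongrightarrow> c * l i p q) ?F"
        by (rule tendsto_mult[OF tendsto_const]) (use l that in simp)
      show "\<forall>\<^sub>F \<phi> in ?F. c * entA (\<phi> x) i p q = entA (\<phi> (c \<odot>\<^bsub>B\<^esub> x)) i p q"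
        using evS
      proof eventually_elim
        case (elim \<phi>)
        note lin = Q_lin[OF SQ[OF elim]]
        show ?case using linear_map_closed[OF lin] smult.hyps that by (simp add: linear_map_smult[OF lin] A.ent_smult)
      qed
    qed
    then show ?case by (intro exI[of _ "\<lambda>i p q. c * l i p q"] ballI allI impI)
  qed
  define good where "good b a \<longleftrightarrow> a \<in> carrier A \<and> (\<forall>i\<in>I. \<forall>p<n i. \<forall>q<n i. ((\<lambda>\<phi>. entA (\<phi> b) i p q) \<longlongrightarrow> entA a i p q) ?F)" for b a
  have good_ex: "\<exists>a. good b a" if b: "b \<in> carrier B" for b
  proof -
    obtain l where l: "\<And>i p q. \<lbrakk>i \<in> I; p < n i; q < n i\<rbrakk> \<Longrightarrow> ((\<lambda>\<phi>. entA (\<phi> b) i p q) \<longlongrightarrow> l i p q) ?F"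
      using conv[OF b] by blast
    obtain C where C: "\<And>\<phi> i. \<lbrakk>\<phi> \<in> carrier Q; i \<in> I\<rbrakk> \<Longrightarrow> bounded_kernel {..<n i} (entA (\<phi> b) i) C"
      using Q_uniform_bound[OF b] by blast
    have "\<forall>\<^sub>F \<phi> in ?F. bounded_kernel {..<n i} (entA (\<phi> b) i) C" if "i \<in> I" for i
      using evS by eventually_elim (rule C[OF SQ that])
    from A.bounded_limit_exists[OF nt l this]
    obtain a where "a \<in> carrier A" "\<forall>i\<in>I. \<forall>p<n i. \<forall>q<n i. entA a i p q = l i p q" by blast
    then have "good b a" using l by (simp add: good_def)
    then show ?thesis by blast
  qed
  define \<Phi> where "\<Phi> = (\<lambda>b\<in>carrier B. SOME a. good b a)"
  have good: "good b (\<Phi> b)" if "b \<in> carrier B" for b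
    unfolding \<Phi>_def restrict_apply'[OF that] by (rule someI_ex[OF good_ex[OF that]])
  have \<Phi>C: "\<Phi> b \<in> carrier A" if "b \<in> carrier B" for b using good[OF that] by (simp add: good_def)
  have lim: "((\<lambda>\<phi>. entA (\<phi> b) i p q) \<longlongrightarrow> entA (\<Phi> b) i p q) ?F"
    if "b \<in> carrier B" "i \<in> I" "p < n i" "q < n i" for b i p q using good[OF that(1)] that by (simp add: good_def)
  have lin: "linear_map \<Phi>"
    unfolding linear_map_def
  proof (intro conjI ballI allI)
    fix x y assume xy: "x \<in> carrier B" "y \<in> carrier B"
    show "\<Phi> (x \<oplus>\<^bsub>B\<^esub> y) = \<Phi> x \<oplus>\<^bsub>A\<^esub> \<Phi> y"
    proof (rule A.ent_eqI)
      fix i p q assume i: "i \<in> I" "p < n i" "q < n i"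
      have "((\<lambda>\<phi>. entA (\<phi> x) i p q + entA (\<phi> y) i p q) \<longlongrightarrow> entA (\<Phi> x) i p q + entA (\<Phi> y) i p q) ?F"
        by (intro tendsto_add lim xy i)
      moreover have "\<forall>\<^sub>F \<phi> in ?F. entA (\<phi> x) i p q + entA (\<phi> y) i p q = entA (\<phi> (x \<oplus>\<^bsub>B\<^esub> y)) i p q"
        using evS
      proof eventually_elim
        case (elim \<phi>)
        note lin = Q_lin[OF SQ[OF elim]]
        show ?case using linear_map_closed[OF lin] xy i by (simp add: linear_map_add[OF lin] A.ent_add)
      qed
      ultimately have "((\<lambda>\<phi>. entA (\<phi> (x \<oplus>\<^bsub>B\<^esub> y)) i p q) \<longlongrightarrow> entA (\<Phi> x) i p q + entA (\<Phi> y) i p q) ?F"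
        by (rule Lim_transform_eventually)
      from tendsto_unique[OF nt this lim[OF B.a_closed[OF xy] i]]
      show "entA (\<Phi> (x \<oplus>\<^bsub>B\<^esub> y)) i p q = entA (\<Phi> x \<oplus>\<^bsub>A\<^esub> \<Phi> y) i p q" using \<Phi>C xy i by (simp add: A.ent_add)
    qed (use \<Phi>C xy in simp_all)
  next
    fix c x assume x: "x \<in> carrier B"
    show "\<Phi> (c \<odot>\<^bsub>B\<^esub> x) = c \<odot>\<^bsub>A\<^esub> \<Phi> x"
    proof (rule A.ent_eqI)
      fix i p q assume i: "i \<in> I" "p < n i" "q < n i"
      have "((\<lambda>\<phi>. c * entA (\<phi> x) i p q) \<longlongrightarrow> c * entA (\<Phi> x) i p q) ?F"
        by (intro tendsto_mult tendsto_const lim x i)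
      moreover have "\<forall>\<^sub>F \<phi> in ?F. c * entA (\<phi> x) i p q = entA (\<phi> (c \<odot>\<^bsub>B\<^esub> x)) i p q"
        using evS
      proof eventually_elim
        case (elim \<phi>)
        note lin = Q_lin[OF SQ[OF elim]]
        show ?case using linear_map_closed[OF lin] x i by (simp add: linear_map_smult[OF lin] A.ent_smult)
      qed
      ultimately have "((\<lambda>\<phi>. entA (\<phi> (c \<odot>\<^bsub>B\<^esub> x)) i p q) \<longlongrightarrow> c * entA (\<Phi> x) i p q) ?F"
        by (rule Lim_transform_eventually)
      from tendsto_unique[OF nt this lim[OF B.smult_closed'[OF x] i]]
      show "entA (\<Phi> (c \<odot>\<^bsub>B\<^esub> x)) i p q = entA (c \<odot>\<^bsub>A\<^esub> \<Phi> x) i p q" using \<Phi>C x i by (simp add: A.ent_smult)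
    qed (use \<Phi>C x in simp_all)
  qed (use \<Phi>C in blast)
  have lim_mf: "((\<lambda>\<phi>. mf \<phi> N b i v) \<longlongrightarrow> mf \<Phi> N b i v) ?F" if "matrix_positive B N b" "i \<in> I" for N b i v
    unfolding mf_def
  proof (rule tendsto_sesq)
    fix s t assume "s \<in> {..<N} \<times> {..<n i}" "t \<in> {..<N} \<times> {..<n i}"
    then show "((\<lambda>\<phi>. A.mker (\<lambda>k l. \<phi> (b k l)) i s t) \<longlongrightarrow> A.mker (\<lambda>k l. \<Phi> (b k l)) i s t) ?F"
      using lim[OF matrix_positive_closed[OF that(1)] that(2)] by (auto simp: A.mker_def)
  qed
  have lim_form: "((\<lambda>\<phi>. Re (A.form (\<phi> b) i v)) \<longlongrightarrow> Re (A.form (\<Phi> b) i v)) ?F" if "b \<in> carrier B" "i \<in> I" for b i v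
    by (intro tendsto_Re tendsto_sesq) (use lim that in auto)
  have mf_mono: "Re (mf \<phi> N b i v) \<le> Re (mf \<Phi> N b i v)" if "\<phi> \<in> S" "matrix_positive B N b" "i \<in> I" for \<phi> N b i v
  proof (rule tendsto_dir_filter_mono_bounds(1)[OF po S _ tendsto_Re[OF lim_mf[OF that(2,3)]] that(1)])
    show "Re (mf \<phi> N b i v) \<le> Re (mf \<psi> N b i v)" if "\<phi> \<in> S" "\<psi> \<in> S" "\<phi> \<sqsubseteq>\<^bsub>Q\<^esub> \<psi>" for \<phi> \<psi>
      using Q_le_iff[OF SQ[OF that(1)] SQ[OF that(2)]] that(3) \<open>matrix_positive B N b\<close> \<open>i \<in> I\<close> by simp
  qed
  have \<Phi>Q: "\<Phi> \<in> carrier Q"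
  proof (rule QI)
    show "\<Phi> \<in> extensional (carrier B)" by (simp add: \<Phi>_def)
    show "linear_map \<Phi>" by (rule lin)
    show mf0: "0 \<le> mf \<Phi> N b i v" if Nb: "matrix_positive B N b" "i \<in> I" for N b i v
    proof -
      have "0 \<le> Re (mf \<Phi> N b i v)"
        using mf_mono[OF \<phi>0 Nb, of v] Q_mf[OF SQ[OF \<phi>0] Nb, of v] by (simp add: complex_nonneg_iff)
      moreover have "((\<lambda>\<phi>. Im (mf \<phi> N b i v)) \<longlongrightarrow> 0) ?F"
        by (rule tendsto_eventually) (use evS mf_real[OF SQ Nb] in \<open>auto elim: eventually_mono\<close>)
      then have "Im (mf \<Phi> N b i v) = 0" by (rule tendsto_unique[OF nt tendsto_Im[OF lim_mf[OF Nb]]])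
      ultimately show ?thesis by (simp add: complex_nonneg_iff)
    qed
    show "Re (A.form (\<Phi> \<one>\<^bsub>B\<^esub>) i v) \<le> (\<Sum>p<n i. (cmod (v p))\<^sup>2)" if i: "i \<in> I" for i v
    proof (rule tendsto_upperbound[OF lim_form[OF B.one_closed i] _ nt])
      show "\<forall>\<^sub>F \<phi> in ?F. Re (A.form (\<phi> \<one>\<^bsub>B\<^esub>) i v) \<le> (\<Sum>p<n i. (cmod (v p))\<^sup>2)"
        using evS by eventually_elim (rule Q_subunital[OF SQ i])
    qed
    fix T t i v and e :: real
    assume T: "directed B.SA T" and t: "is_lub B.SA t T" and i: "i \<in> I" and e: "e > 0"
    have cp: "completely_positive B A \<Phi>" unfolding completely_positive_iff using lin mf0 by blast
    obtain t0 where t0: "t0 \<in> T" using T by (auto simp: directed_def)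
    have TSA: "\<And>s. s \<in> T \<Longrightarrow> s \<in> carrier B.SA" using directed_subset[OF T] by blast
    have tSA: "t \<in> carrier B.SA" and tub: "\<And>s. s \<in> T \<Longrightarrow> alg_le B s t" using t B.SA_lub_iff[OF T] by auto
    have e2: "e / 2 > 0" using e by simp
    \<comment> \<open>Normality of the limit is an exchange of two suprema. Only values at positive
      elements increase with the map, so the argument compares differences from a fixed t0: a map in
      S within e/2 of the limit at t - t0 is chosen first, and its own normality then supplies
      s.\<close>
    let ?d = "t \<ominus>\<^bsub>B\<^esub> t0"
    have dC: "?d \<in> carrier B" using tSA TSA[OF t0] by simp
    have dpos: "B.positive ?d" using tub[OF t0] tSA TSA[OF t0] by (simp add: B.alg_le_iff_positive)
    have mono_form: "Re (A.form (\<phi> x) i v) \<le> Re (A.form (\<Phi> x) i v)" if "B.positive x" "\<phi> \<in> S" for \<phi> x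
    proof (rule tendsto_dir_filter_mono_bounds(1)[OF po S _ lim_form[OF B.positive_carrier[OF that(1)] i] that(2)])
      show "Re (A.form (\<phi> x) i v) \<le> Re (A.form (\<psi> x) i v)" if "\<phi> \<in> S" "\<psi> \<in> S" "\<phi> \<sqsubseteq>\<^bsub>Q\<^esub> \<psi>" for \<phi> \<psi>
        by (rule Q_le_form[OF SQ[OF that(1)] SQ[OF that(2)] that(3) \<open>B.positive x\<close> i])
    qed
    have "\<exists>\<phi>\<in>S. Re (A.form (\<Phi> ?d) i v) < Re (A.form (\<phi> ?d) i v) + e / 2"
    proof (rule tendsto_dir_filter_mono_bounds(2)[OF po S _ lim_form[OF dC i] e2])
      show "Re (A.form (\<phi> ?d) i v) \<le> Re (A.form (\<psi> ?d) i v)" if "\<phi> \<in> S" "\<psi> \<in> S" "\<phi> \<sqsubseteq>\<^bsub>Q\<^esub> \<psi>" for \<phi> \<psi>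
        by (rule Q_le_form[OF SQ[OF that(1)] SQ[OF that(2)] that(3) dpos i])
    qed
    then obtain \<phi> where \<phi>: "\<phi> \<in> S" "Re (A.form (\<Phi> ?d) i v) < Re (A.form (\<phi> ?d) i v) + e / 2" by blast
    note \<phi>Q = SQ[OF \<phi>(1)] and \<phi>lin = Q_lin[OF SQ[OF \<phi>(1)]]
    obtain s1 where s1: "s1 \<in> T" "Re (A.form (\<phi> t) i v) < Re (A.form (\<phi> s1) i v) + e / 2"
      using Q_normal[OF \<phi>Q T t i e2] by blast
    obtain s where s: "s \<in> T" "s1 \<sqsubseteq>\<^bsub>B.SA\<^esub> s" "t0 \<sqsubseteq>\<^bsub>B.SA\<^esub> s" using directed_upper[OF T s1(1) t0] .
    have "Re (A.form (\<phi> s1) i v) \<le> Re (A.form (\<phi> s) i v)"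
      by (rule completely_positive_form_mono[OF Q_cp[OF \<phi>Q] TSA[OF s1(1)] TSA[OF s(1)] _ i]) (use s in simp)
    moreover have "Re (A.form (\<phi> (s \<ominus>\<^bsub>B\<^esub> t0)) i v) \<le> Re (A.form (\<Phi> (s \<ominus>\<^bsub>B\<^esub> t0)) i v)"
      by (rule mono_form[OF _ \<phi>(1)]) (use s TSA[OF s(1)] TSA[OF t0] in \<open>simp add: B.alg_le_iff_positive\<close>)
    moreover have minus: "Re (A.form (\<psi> (x \<ominus>\<^bsub>B\<^esub> t0)) i v) = Re (A.form (\<psi> x) i v) - Re (A.form (\<psi> t0) i v)"
      if "linear_map \<psi>" "x \<in> carrier B" for \<psi> x
      using linear_map_closed[OF that(1)] that TSA[OF t0] i by (simp add: linear_map_minus A.form_minus)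
    ultimately have "Re (A.form (\<Phi> t) i v) < Re (A.form (\<Phi> s) i v) + e"
      using \<phi>(2) s1(2) minus[OF \<phi>lin, of s] minus[OF lin, of s] minus[OF \<phi>lin, of t] minus[OF lin, of t] TSA[OF s(1)] tSA
      by simp
    with s(1) show "\<exists>s\<in>T. Re (A.form (\<Phi> t) i v) < Re (A.form (\<Phi> s) i v) + e" by blast
  qed
  have "is_lub Q \<Phi> S"
    unfolding directed_is_lub_iff[OF S]
  proof (intro conjI ballI impI)
    show "\<phi> \<sqsubseteq>\<^bsub>Q\<^esub> \<Phi>" if "\<phi> \<in> S" for \<phi> unfolding Q_le_iff[OF SQ[OF that] \<Phi>Q] using mf_mono[OF that] by simp
    fix u assume u: "u \<in> carrier Q" "\<forall>\<phi>\<in>S. \<phi> \<sqsubseteq>\<^bsub>Q\<^esub> u"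
    have "Re (mf \<Phi> N b i v) \<le> Re (mf u N b i v)" if Nb: "matrix_positive B N b" "i \<in> I" for N b i v
    proof (rule tendsto_upperbound[OF tendsto_Re[OF lim_mf[OF Nb]] _ nt])
      show "\<forall>\<^sub>F \<phi> in ?F. Re (mf \<phi> N b i v) \<le> Re (mf u N b i v)"
        using evS
      proof eventually_elim
        case (elim \<phi>)
        then show ?case using Q_le_iff[OF SQ[OF elim] u(1)] u(2) Nb by simp
      qed
    qed
    then show "\<Phi> \<sqsubseteq>\<^bsub>Q\<^esub> u" unfolding Q_le_iff[OF \<Phi>Q u(1)] by simp
  qed (rule \<Phi>Q)
  with lim show ?thesis by blast
qed

lemma dcpo_Q: "dcpo Q"
  using partial_order_Q Q_directed_lub unfolding dcpo_def by blast

lemma Q_lub_limit: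
  assumes S: "directed Q S" and lub: "is_lub Q \<Phi> S" and "b \<in> carrier B" "i \<in> I" "p < n i" "q < n i"
  shows "((\<lambda>\<phi>. entA (\<phi> b) i p q) \<longlongrightarrow> entA (\<Phi> b) i p q) (dir_filter Q S)"
proof -
  obtain \<Psi> where \<Psi>: "is_lub Q \<Psi> S" "\<forall>b\<in>carrier B. \<forall>i\<in>I. \<forall>p<n i. \<forall>q<n i.
    ((\<lambda>\<phi>. entA (\<phi> b) i p q) \<longlongrightarrow> entA (\<Psi> b) i p q) (dir_filter Q S)" using Q_directed_lub[OF S] by blast
  have "\<Psi> = \<Phi>" by (rule partial_order_lub_unique[OF partial_order_Q \<Psi>(1) lub])
  with \<Psi>(2) assms(3-6) show ?thesis by simp
qed

lemma Q_lub_limit_mf: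
  assumes S: "directed Q S" and lub: "is_lub Q \<Phi> S" and Nb: "matrix_positive B N b" and i: "i \<in> I"
  shows "((\<lambda>\<phi>. mf \<phi> N b i v) \<longlongrightarrow> mf \<Phi> N b i v) (dir_filter Q S)"
  unfolding mf_def
proof (rule tendsto_sesq)
  fix s t assume "s \<in> {..<N} \<times> {..<n i}" "t \<in> {..<N} \<times> {..<n i}"
  then show "((\<lambda>\<phi>. A.mker (\<lambda>k l. \<phi> (b k l)) i s t) \<longlongrightarrow> A.mker (\<lambda>k l. \<Phi> (b k l)) i s t) (dir_filter Q S)"
    using Q_lub_limit[OF S lub matrix_positive_closed[OF Nb] i] by (auto simp: A.mker_def)
qed

lemma mf_cong:
  assumes "\<And>k l. \<lbrakk>k < N; l < N\<rbrakk> \<Longrightarrow> \<phi> (b k l) = \<psi> (b' k l)"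
  shows "mf \<phi> N b i v = mf \<psi> N b' i v"
  unfolding mf_def by (rule sesq_cong) (use assms in \<open>auto simp: A.mker_def\<close>)

lemma mf_add:
  assumes "\<And>k l. \<lbrakk>k < N; l < N\<rbrakk> \<Longrightarrow> \<psi> (b k l) \<in> carrier A" "\<And>k l. \<lbrakk>k < N; l < N\<rbrakk> \<Longrightarrow> \<psi>' (b' k l) \<in> carrier A"
    and "\<And>k l. \<lbrakk>k < N; l < N\<rbrakk> \<Longrightarrow> \<phi> (d k l) = \<psi> (b k l) \<oplus>\<^bsub>A\<^esub> \<psi>' (b' k l)" "i \<in> I"
  shows "mf \<phi> N d i v = mf \<psi> N b i v + mf \<psi>' N b' i v"
  unfolding mf_def sesq_add[symmetric]
  by (rule sesq_cong) (use assms in \<open>auto simp: A.mker_def A.ent_add\<close>)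

section \<open>Evaluation functionals\<close>

lemma mf_uniform_bound:
  assumes Nb: "matrix_positive B N b" and i: "i \<in> I"
  shows "\<exists>C>0. \<forall>\<phi>\<in>carrier Q. Re (mf \<phi> N b i v) \<le> C"
proof -
  have "\<forall>kl\<in>{..<N} \<times> {..<N}. \<exists>C. \<forall>\<phi>\<in>carrier Q. \<forall>i\<in>I. bounded_kernel {..<n i} (entA (\<phi> (b (fst kl) (snd kl))) i) C"
    using Q_uniform_bound[OF matrix_positive_closed[OF Nb]] by auto
  from bchoice[OF this] obtain C where
    C: "\<forall>kl\<in>{..<N} \<times> {..<N}. \<forall>\<phi>\<in>carrier Q. \<forall>i\<in>I. bounded_kernel {..<n i} (entA (\<phi> (b (fst kl) (snd kl))) i) (C kl)" ..
  let ?S = "{..<N} \<times> {..<n i}"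
  define M where "M = (\<Sum>s\<in>?S. \<Sum>t\<in>?S. cmod (v s) * (2 * C (fst s, fst t)) * cmod (v t))"
  have "Re (mf \<phi> N b i v) \<le> max 1 M" if \<phi>: "\<phi> \<in> carrier Q" for \<phi>
  proof -
    have "Re (mf \<phi> N b i v) \<le> cmod (mf \<phi> N b i v)" by (rule complex_Re_le_cmod)
    also have "\<dots> \<le> (\<Sum>s\<in>?S. cmod (\<Sum>t\<in>?S. cnj (v s) * A.mker (\<lambda>k l. \<phi> (b k l)) i s t * v t))"
      unfolding mf_def sesq_def by (rule norm_sum)
    also have "\<dots> \<le> (\<Sum>s\<in>?S. \<Sum>t\<in>?S. cmod (cnj (v s) * A.mker (\<lambda>k l. \<phi> (b k l)) i s t * v t))"
      by (rule sum_mono) (rule norm_sum)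
    also have "\<dots> \<le> M"
      unfolding M_def
    proof (intro sum_mono)
      fix s t assume st: "s \<in> ?S" "t \<in> ?S"
      have "bounded_kernel {..<n i} (entA (\<phi> (b (fst s) (fst t))) i) (C (fst s, fst t))"
        using C[rule_format, of "(fst s, fst t)", OF _ \<phi> i] st by auto
      then have "cmod (A.mker (\<lambda>k l. \<phi> (b k l)) i s t) \<le> 2 * C (fst s, fst t)"
        using A.ent_le_bounded_kernel[of i "\<phi> (b (fst s) (fst t))" "C (fst s, fst t)" "snd s" "snd t"] st
        by (auto simp: A.mker_def case_prod_unfold)
      then show "cmod (cnj (v s) * A.mker (\<lambda>k l. \<phi> (b k l)) i s t * v t) \<le> cmod (v s) * (2 * C (fst s, fst t)) * cmod (v t)"
        unfolding norm_mult complex_mod_cnj by (intro mult_right_mono mult_left_mono) auto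
    qed
    finally show ?thesis by simp
  qed
  then show ?thesis by (intro exI[of _ "max 1 M"]) simp
qed

text \<open>The bound C, which exists by \<open>mf_uniform_bound\<close>, only normalises the values
  to [0,1]; scaling does not affect which inequalities the functionals detect.\<close>

definition functionals :: "(('b \<Rightarrow> 'a) \<Rightarrow> real) set" where
  "functionals = {\<lambda>\<phi>. Re (mf \<phi> N b i v) / C | N b i v C. matrix_positive B N b \<and> i \<in> I \<and> C > 0 \<and>
    (\<forall>\<phi>\<in>carrier Q. Re (mf \<phi> N b i v) \<le> C)}"

lemma conv_Q_apply: "b \<in> carrier B \<Longrightarrow>
  conv Q r \<phi> \<psi> b = (of_real r \<odot>\<^bsub>A\<^esub> \<phi> b) \<oplus>\<^bsub>A\<^esub> (of_real (1 - r) \<odot>\<^bsub>A\<^esub> \<psi> b)"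
  by (simp add: Q_dcpo_def)

lemma mf_conv:
  assumes "\<phi> \<in> carrier Q" "\<psi> \<in> carrier Q" "matrix_positive B N b" "i \<in> I"
  shows "mf (conv Q r \<phi> \<psi>) N b i v = of_real r * mf \<phi> N b i v + of_real (1 - r) * mf \<psi> N b i v"
proof -
  note C = linear_map_closed[OF Q_lin[OF assms(1)] matrix_positive_closed[OF assms(3)]]
    linear_map_closed[OF Q_lin[OF assms(2)] matrix_positive_closed[OF assms(3)]]
  show ?thesis
    unfolding mf_def sesq_scale[symmetric] sesq_add[symmetric]
    by (rule sesq_cong)
      (use C assms(4) in \<open>auto simp: A.mker_def conv_Q_apply matrix_positive_closed[OF assms(3)] A.ent_add A.ent_smult\<close>)
qed

lemma form_conv:
  assumes "\<phi> \<in> carrier Q" "\<psi> \<in> carrier Q" "b \<in> carrier B" "i \<in> I"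
  shows "Re (A.form (conv Q r \<phi> \<psi> b) i v) = r * Re (A.form (\<phi> b) i v) + (1 - r) * Re (A.form (\<psi> b) i v)"
  using linear_map_closed[OF Q_lin[OF assms(1)] assms(3)] linear_map_closed[OF Q_lin[OF assms(2)] assms(3)] assms(3,4)
  by (simp add: conv_Q_apply A.form_add A.form_smult)

lemma conv_in_Q:
  assumes r: "r \<in> {0..1}" and \<phi>: "\<phi> \<in> carrier Q" and \<psi>: "\<psi> \<in> carrier Q"
  shows "conv Q r \<phi> \<psi> \<in> carrier Q"
proof (rule QI)
  note C = linear_map_closed[OF Q_lin[OF \<phi>]] linear_map_closed[OF Q_lin[OF \<psi>]]
  show "conv Q r \<phi> \<psi> \<in> extensional (carrier B)" by (simp add: Q_dcpo_def)
  show "linear_map (conv Q r \<phi> \<psi>)"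
    unfolding linear_map_def
  proof (intro conjI ballI allI)
    show "conv Q r \<phi> \<psi> \<in> carrier B \<rightarrow> carrier A" using C by (auto simp: conv_Q_apply)
    fix x y assume xy: "x \<in> carrier B" "y \<in> carrier B"
    show "conv Q r \<phi> \<psi> (x \<oplus>\<^bsub>B\<^esub> y) = conv Q r \<phi> \<psi> x \<oplus>\<^bsub>A\<^esub> conv Q r \<phi> \<psi> y"
      by (rule A.ent_eqI) (use C xy in \<open>simp_all add: conv_Q_apply linear_map_add[OF Q_lin[OF \<phi>]]
        linear_map_add[OF Q_lin[OF \<psi>]] A.ent_add A.ent_smult algebra_simps\<close>)
  next
    fix c x assume x: "x \<in> carrier B"
    show "conv Q r \<phi> \<psi> (c \<odot>\<^bsub>B\<^esub> x) = c \<odot>\<^bsub>A\<^esub> conv Q r \<phi> \<psi> x"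
      by (rule A.ent_eqI) (use C x in \<open>simp_all add: conv_Q_apply linear_map_smult[OF Q_lin[OF \<phi>]]
        linear_map_smult[OF Q_lin[OF \<psi>]] A.ent_add A.ent_smult algebra_simps\<close>)
  qed
  show "0 \<le> mf (conv Q r \<phi> \<psi>) N b i v" if "matrix_positive B N b" "i \<in> I" for N b i v
    using Q_mf[OF \<phi> that, of v] Q_mf[OF \<psi> that, of v] r mf_conv[OF \<phi> \<psi> that, of r v]
    by (simp add: complex_nonneg_iff)
  show "Re (A.form (conv Q r \<phi> \<psi> \<one>\<^bsub>B\<^esub>) i v) \<le> (\<Sum>p<n i. (cmod (v p))\<^sup>2)" if i: "i \<in> I" for i v
    unfolding form_conv[OF \<phi> \<psi> B.one_closed i]
    by (rule convex_bound_le) (use Q_subunital[OF \<phi> i] Q_subunital[OF \<psi> i] r in auto)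
  fix T t i v and e :: real
  assume T: "directed B.SA T" and t: "is_lub B.SA t T" and i: "i \<in> I" and e: "e > 0"
  have TSA: "\<And>s. s \<in> T \<Longrightarrow> s \<in> carrier B.SA" using directed_subset[OF T] by blast
  have tC: "t \<in> carrier B" using t B.SA_lub_iff[OF T, of t] by auto
  obtain s1 where s1: "s1 \<in> T" "Re (A.form (\<phi> t) i v) < Re (A.form (\<phi> s1) i v) + e" using Q_normal[OF \<phi> T t i e] by blast
  obtain s2 where s2: "s2 \<in> T" "Re (A.form (\<psi> t) i v) < Re (A.form (\<psi> s2) i v) + e" using Q_normal[OF \<psi> T t i e] by blast
  obtain s where s: "s \<in> T" "s1 \<sqsubseteq>\<^bsub>B.SA\<^esub> s" "s2 \<sqsubseteq>\<^bsub>B.SA\<^esub> s" using directed_upper[OF T s1(1) s2(1)] .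
  have "Re (A.form (\<phi> s1) i v) \<le> Re (A.form (\<phi> s) i v)"
    by (rule completely_positive_form_mono[OF Q_cp[OF \<phi>] TSA[OF s1(1)] TSA[OF s(1)] _ i]) (use s in simp)
  moreover have "Re (A.form (\<psi> s2) i v) \<le> Re (A.form (\<psi> s) i v)"
    by (rule completely_positive_form_mono[OF Q_cp[OF \<psi>] TSA[OF s2(1)] TSA[OF s(1)] _ i]) (use s in simp)
  ultimately have "r * (Re (A.form (\<phi> t) i v) - Re (A.form (\<phi> s) i v)) +
      (1 - r) * (Re (A.form (\<psi> t) i v) - Re (A.form (\<psi> s) i v)) < e"
    by (intro convex_bound_lt) (use s1(2) s2(2) r in auto)
  moreover have "s \<in> carrier B" using TSA[OF s(1)] by simp
  ultimately have "Re (A.form (conv Q r \<phi> \<psi> t) i v) < Re (A.form (conv Q r \<phi> \<psi> s) i v) + e"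
    using tC i by (simp add: form_conv[OF \<phi> \<psi>] algebra_simps)
  with s(1) show "\<exists>s\<in>T. Re (A.form (conv Q r \<phi> \<psi> t) i v) < Re (A.form (conv Q r \<phi> \<psi> s) i v) + e" by blast
qed

lemma bot_Q_apply: "b \<in> carrier B \<Longrightarrow> bot Q b = \<zero>\<^bsub>A\<^esub>"
  by (simp add: Q_dcpo_def)

lemma form_zero: "i \<in> I \<Longrightarrow> A.form \<zero>\<^bsub>A\<^esub> i v = 0"
  unfolding sesq_def by (simp add: A.ent_zero)

lemma mf_bot: "\<lbrakk>matrix_positive B N b; i \<in> I\<rbrakk> \<Longrightarrow> mf (bot Q) N b i v = 0"
  unfolding mf_def sesq_def
  by (intro sum.neutral ballI) (auto simp: A.mker_def bot_Q_apply matrix_positive_closed A.ent_zero)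

lemma bot_in_Q: "bot Q \<in> carrier Q"
proof (rule QI)
  show "bot Q \<in> extensional (carrier B)" by (simp add: Q_dcpo_def)
  show "linear_map (bot Q)"
    unfolding linear_map_def
  proof (intro conjI ballI allI)
    show "bot Q (c \<odot>\<^bsub>B\<^esub> x) = c \<odot>\<^bsub>A\<^esub> bot Q x" if "x \<in> carrier B" for c x
      by (rule A.ent_eqI) (use that in \<open>simp_all add: bot_Q_apply A.ent_smult A.ent_zero\<close>)
  qed (simp_all add: bot_Q_apply)
  show "0 \<le> mf (bot Q) N b i v" if "matrix_positive B N b" "i \<in> I" for N b i v using mf_bot[OF that] by simp
  show "Re (A.form (bot Q \<one>\<^bsub>B\<^esub>) i v) \<le> (\<Sum>p<n i. (cmod (v p))\<^sup>2)" if "i \<in> I" for i v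
    using that by (simp add: bot_Q_apply form_zero sum_nonneg)
  fix T t i v and e :: real
  assume T: "directed B.SA T" and t: "is_lub B.SA t T" and i: "i \<in> I" and e: "e > 0"
  obtain s where s: "s \<in> T" using T by (auto simp: directed_def)
  have "s \<in> carrier B" "t \<in> carrier B" using s directed_subset[OF T] t B.SA_lub_iff[OF T, of t] by auto
  then show "\<exists>s\<in>T. Re (A.form (bot Q t) i v) < Re (A.form (bot Q s) i v) + e"
    using s e i by (intro bexI[of _ s]) (simp_all add: bot_Q_apply form_zero)
qed

lemma functional_kegelspitze_Q: "functional_kegelspitze Q functionals"
proof
  show "dcpo Q" by (rule dcpo_Q)
  show "convex_closed Q" unfolding convex_closed_def using bot_in_Q conv_in_Q by blast
  fix f assume "f \<in> functionals"
  then obtain N b i v C where f: "f = (\<lambda>\<phi>. Re (mf \<phi> N b i v) / C)" and Nb: "matrix_positive B N b" and i: "i \<in> I"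
    and C: "C > 0" and le: "\<forall>\<phi>\<in>carrier Q. Re (mf \<phi> N b i v) \<le> C" unfolding functionals_def by blast
  show "f (bot Q) = 0" by (simp add: f mf_bot[OF Nb i])
  show "f (conv Q r x y) = r * f x + (1 - r) * f y" if "r \<in> {0..1}" "x \<in> carrier Q" "y \<in> carrier Q" for r x y
    unfolding f mf_conv[OF that(2,3) Nb i] by (simp add: add_divide_distrib)
  have mono: "Re (mf x N b i v) \<le> Re (mf y N b i v)" if "x \<in> carrier Q" "y \<in> carrier Q" "x \<sqsubseteq>\<^bsub>Q\<^esub> y" for x y
    using Q_le_iff[OF that(1,2)] that(3) Nb i by simp
  show "scott_continuous Q unit_interval f"
    unfolding scott_continuous_unit_interval_iff
  proof (intro conjI ballI allI impI)
    show "0 \<le> f x" if "x \<in> carrier Q" for x using Q_mf[OF that Nb i, of v] C by (simp add: f complex_nonneg_iff)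
    show "f x \<le> 1" if "x \<in> carrier Q" for x using le that C by (simp add: f)
    show "f x \<le> f y" if "x \<in> carrier Q" "y \<in> carrier Q" "x \<sqsubseteq>\<^bsub>Q\<^esub> y" for x y
      unfolding f using mono[OF that] C by (simp add: divide_right_mono)
    fix S s and e :: real assume S: "directed Q S \<and> is_lub Q s S" and e: "e > 0"
    then have dS: "directed Q S" by simp
    have SQ: "\<And>x. x \<in> S \<Longrightarrow> x \<in> carrier Q" using directed_subset[OF dS] by blast
    have "C * e > 0" using C e by simp
    have "\<exists>x\<in>S. Re (mf s N b i v) < Re (mf x N b i v) + C * e"
      by (rule tendsto_dir_filter_mono_bounds(2)[OF partial_order_Q dS mono[OF SQ SQ] tendsto_Re[OF Q_lub_limit_mf[OF dS _ Nb i]] \<open>C * e > 0\<close>])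
        (use S in auto)
    then show "\<exists>x\<in>S. f s < f x + e" unfolding f using C by (simp add: field_simps)
  qed
next
  fix x y assume x: "x \<in> carrier Q" and y: "y \<in> carrier Q" and le: "\<And>f. f \<in> functionals \<Longrightarrow> f x \<le> f y"
  have "Re (mf x N b i v) \<le> Re (mf y N b i v)" if Nb: "matrix_positive B N b" "i \<in> I" for N b i v
  proof -
    obtain C where C: "C > 0" "\<forall>\<phi>\<in>carrier Q. Re (mf \<phi> N b i v) \<le> C" using mf_uniform_bound[OF Nb] by blast
    then have "(\<lambda>\<phi>. Re (mf \<phi> N b i v) / C) \<in> functionals" unfolding functionals_def using Nb by blast
    from le[OF this] show ?thesis using C(1) by (simp add: divide_le_cancel)
  qed
  then show "x \<sqsubseteq>\<^bsub>Q\<^esub> y" unfolding Q_le_iff[OF x y] by blast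
qed

section \<open>Continuity of Q(A,B) by truncation to finitely many blocks\<close>

section \<open>Truncated maps\<close>

text \<open>Both sides have to be cut: Choi matrices are indexed by pairs of a block of A and a
  block of B, and with F and G finite only finitely many pairs remain.\<close>

definition trunc :: "'i set \<Rightarrow> 'j set \<Rightarrow> real \<Rightarrow> ('b \<Rightarrow> 'a) \<Rightarrow> 'b \<Rightarrow> 'a" where
  "trunc F G c \<phi> = (\<lambda>b\<in>carrier B. of_real c \<odot>\<^bsub>A\<^esub> A.cut F (\<phi> (B.cut G b)))"

lemma positive_cut:
  assumes "B.positive b"
  shows "B.positive (B.cut G b)" "B.positive (b \<ominus>\<^bsub>B\<^esub> B.cut G b)"
proof -
  note bC = B.positive_carrier[OF assms]
  show "B.positive (B.cut G b)"
    by (rule B.positiveI) (use bC B.cut_closed B.form_cut B.positive_form[OF assms] in auto)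
  show "B.positive (b \<ominus>\<^bsub>B\<^esub> B.cut G b)"
    by (rule B.positiveI) (use bC B.cut_closed B.form_cut B.form_minus B.positive_form[OF assms] in auto)
qed

lemma cut_SA: "b \<in> carrier B.SA \<Longrightarrow> B.cut G b \<in> carrier B.SA"
  by (simp add: B.cut_closed B.cut_star)

lemma form_trunc:
  assumes "\<phi> \<in> carrier Q" "b \<in> carrier B" "i \<in> I"
  shows "Re (A.form (trunc F G c \<phi> b) i v) = (if i \<in> F then c * Re (A.form (\<phi> (B.cut G b)) i v) else 0)"
  using assms linear_map_closed[OF Q_lin[OF assms(1)] B.cut_closed[OF assms(2)]]
  by (simp add: trunc_def A.form_smult A.cut_closed A.form_cut)

lemma mf_trunc:
  assumes "\<phi> \<in> carrier Q" "matrix_positive B N b" "i \<in> I"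
  shows "mf (trunc F G c \<phi>) N b i v = (if i \<in> F then of_real c * mf \<phi> N (\<lambda>k l. B.cut G (b k l)) i v else 0)"
proof -
  have C: "b k l \<in> carrier B" "\<phi> (B.cut G (b k l)) \<in> carrier A" if "k < N" "l < N" for k l
    using matrix_positive_closed[OF assms(2) that] linear_map_closed[OF Q_lin[OF assms(1)] B.cut_closed] by auto
  show ?thesis
  proof (cases "i \<in> F")
    case True
    have "mf (trunc F G c \<phi>) N b i v = sesq ({..<N} \<times> {..<n i})
        (\<lambda>s t. of_real c * A.mker (\<lambda>k l. \<phi> (B.cut G (b k l))) i s t) v v"
      unfolding mf_def
      by (rule sesq_cong) (use C assms(3) True in \<open>auto simp: A.mker_def trunc_def A.ent_smult A.cut_closed A.ent_cut\<close>)
    then show ?thesis using True by (simp add: sesq_scale mf_def)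
  next
    case False
    have "mf (trunc F G c \<phi>) N b i v = sesq ({..<N} \<times> {..<n i}) (\<lambda>s t. 0) v v"
      unfolding mf_def
      by (rule sesq_cong) (use C assms(3) False in \<open>auto simp: A.mker_def trunc_def A.ent_smult A.cut_closed A.ent_cut\<close>)
    then show ?thesis using False by (simp add: sesq_def)
  qed
qed

lemma mf_cut_le:
  assumes \<phi>: "\<phi> \<in> carrier Q" and Nb: "matrix_positive B N b" and i: "i \<in> I"
  shows "Re (mf \<phi> N (\<lambda>k l. B.cut G (b k l)) i v) \<le> Re (mf \<phi> N b i v)"
proof -
  note lin = Q_lin[OF \<phi>] and C = matrix_positive_closed[OF Nb]
  have "mf \<phi> N b i v = mf \<phi> N (\<lambda>k l. B.cut G (b k l)) i v + mf \<phi> N (\<lambda>k l. B.cut (- G) (b k l)) i v"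
  proof (rule mf_add)
    show "\<phi> (b k l) = \<phi> (B.cut G (b k l)) \<oplus>\<^bsub>A\<^esub> \<phi> (B.cut (- G) (b k l))" if "k < N" "l < N" for k l
      using linear_map_add[OF lin B.cut_closed[OF C[OF that], of G] B.cut_closed[OF C[OF that], of "- G"]]
        B.cut_compl[OF C[OF that], of G] by simp
  qed (use linear_map_closed[OF lin] B.cut_closed C i in auto)
  then show ?thesis using Q_mf[OF \<phi> B.matrix_positive_cut[OF Nb] i, of "- G" v] by (simp add: complex_nonneg_iff)
qed

lemma trunc_in_Q:
  assumes \<phi>: "\<phi> \<in> carrier Q" and c: "0 \<le> c" "c \<le> 1"
  shows "trunc F G c \<phi> \<in> carrier Q"
proof (rule QI)
  note lin = Q_lin[OF \<phi>]
  have C: "\<phi> (B.cut G b) \<in> carrier A" if "b \<in> carrier B" for b using linear_map_closed[OF lin B.cut_closed[OF that]] .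
  show "trunc F G c \<phi> \<in> extensional (carrier B)" by (simp add: trunc_def)
  show "linear_map (trunc F G c \<phi>)"
    unfolding linear_map_def
  proof (intro conjI ballI allI)
    show "trunc F G c \<phi> \<in> carrier B \<rightarrow> carrier A" using C A.cut_closed by (auto simp: trunc_def)
    fix x y assume xy: "x \<in> carrier B" "y \<in> carrier B"
    show "trunc F G c \<phi> (x \<oplus>\<^bsub>B\<^esub> y) = trunc F G c \<phi> x \<oplus>\<^bsub>A\<^esub> trunc F G c \<phi> y"
      by (rule A.ent_eqI) (use C xy in \<open>simp_all add: trunc_def B.cut_add B.cut_closed linear_map_add[OF lin]
        A.cut_add A.cut_closed A.ent_add A.ent_smult algebra_simps\<close>)
  next
    fix d x assume x: "x \<in> carrier B"
    show "trunc F G c \<phi> (d \<odot>\<^bsub>B\<^esub> x) = d \<odot>\<^bsub>A\<^esub> trunc F G c \<phi> x"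
      by (rule A.ent_eqI) (use C x in \<open>simp_all add: trunc_def B.cut_smult B.cut_closed linear_map_smult[OF lin]
        A.cut_smult A.cut_closed A.ent_smult\<close>)
  qed
  show "0 \<le> mf (trunc F G c \<phi>) N b i v" if "matrix_positive B N b" "i \<in> I" for N b i v
    using mf_trunc[OF \<phi> that, of F G c v] Q_mf[OF \<phi> B.matrix_positive_cut[OF that(1)] that(2), of G v] c
    by (simp add: complex_nonneg_iff)
  show "Re (A.form (trunc F G c \<phi> \<one>\<^bsub>B\<^esub>) i v) \<le> (\<Sum>p<n i. (cmod (v p))\<^sup>2)" if i: "i \<in> I" for i v
  proof -
    have pos: "B.positive (B.cut G \<one>\<^bsub>B\<^esub>)" "B.positive (\<one>\<^bsub>B\<^esub> \<ominus>\<^bsub>B\<^esub> B.cut G \<one>\<^bsub>B\<^esub>)"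
      using positive_cut[OF B.positive_one] by auto
    note cp = Q_cp[OF \<phi>]
    have "0 \<le> Re (A.form (\<phi> (B.cut G \<one>\<^bsub>B\<^esub>)) i v)"
      using A.positive_form[OF completely_positive_positive[OF cp pos(1)] i] by (simp add: complex_nonneg_iff)
    then have "c * Re (A.form (\<phi> (B.cut G \<one>\<^bsub>B\<^esub>)) i v) \<le> Re (A.form (\<phi> (B.cut G \<one>\<^bsub>B\<^esub>)) i v)"
      using c by (simp add: mult_left_le_one_le)
    also have "\<dots> \<le> Re (A.form (\<phi> \<one>\<^bsub>B\<^esub>) i v)"
      using A.positive_form[OF completely_positive_positive[OF cp pos(2)] i, of v] linear_map_closed[OF lin] C i
      by (simp add: linear_map_minus[OF lin] B.cut_closed A.form_minus complex_nonneg_iff)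
    also have "\<dots> \<le> (\<Sum>p<n i. (cmod (v p))\<^sup>2)" by (rule Q_subunital[OF \<phi> i])
    finally show ?thesis by (simp add: form_trunc[OF \<phi> B.one_closed i] sum_nonneg)
  qed
  fix T t i v and e :: real
  assume T: "directed B.SA T" and t: "is_lub B.SA t T" and i: "i \<in> I" and e: "e > 0"
  have TSA: "\<And>s. s \<in> T \<Longrightarrow> s \<in> carrier B.SA" using directed_subset[OF T] by blast
  have tSA: "t \<in> carrier B.SA" and tub: "\<And>s. s \<in> T \<Longrightarrow> alg_le B s t"
    and teps: "\<And>j w e. \<lbrakk>j \<in> J; e > 0\<rbrakk> \<Longrightarrow> \<exists>s\<in>T. Re (B.form t j w) < Re (B.form s j w) + e"
    using t B.SA_lub_iff[OF T, of t] by auto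
  obtain s0 where s0: "s0 \<in> T" using T by (auto simp: directed_def)
  have cut_mono: "alg_le B (B.cut G x) (B.cut G y)" if "x \<in> carrier B.SA" "y \<in> carrier B.SA" "alg_le B x y" for x y
    using that B.alg_le_Re[OF that(1,2)] unfolding B.alg_le_Re[OF cut_SA[OF that(1)] cut_SA[OF that(2)]]
    by (simp add: B.form_cut)
  have dT: "directed B.SA (B.cut G ` T)"
    by (rule directed_image[OF T]) (use cut_SA[OF TSA] cut_mono[OF TSA TSA] in auto)
  \<comment> \<open>In each block the form of a cut element is either unchanged or zero, so the
    epsilon condition for suprema carries over.\<close>
  have "is_lub B.SA (B.cut G t) (B.cut G ` T)"
  proof (rule B.SA_lubI[OF dT cut_SA[OF tSA]])
    show "alg_le B x (B.cut G t)" if "x \<in> B.cut G ` T" for x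
      using that cut_mono[OF TSA tSA tub] by auto
    show "\<exists>s\<in>B.cut G ` T. Re (B.form (B.cut G t) j w) < Re (B.form s j w) + e" if j: "j \<in> J" and "e > 0" for j w e
    proof (cases "j \<in> G")
      case True
      obtain s where s: "s \<in> T" "Re (B.form t j w) < Re (B.form s j w) + e" using teps[OF j \<open>e > 0\<close>] by blast
      show ?thesis
        by (rule bexI[of _ "B.cut G s"]) (use s True j tSA TSA[OF s(1)] in \<open>auto simp: B.form_cut\<close>)
    next
      case False
      then show ?thesis using s0 j tSA TSA[OF s0] \<open>e > 0\<close> by (auto simp: B.form_cut intro!: bexI[of _ s0])
    qed
  qed
  then obtain s where s: "s \<in> T" "Re (A.form (\<phi> (B.cut G t)) i v) < Re (A.form (\<phi> (B.cut G s)) i v) + e"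
    using Q_normal[OF \<phi> dT _ i e] by blast
  let ?X = "Re (A.form (\<phi> (B.cut G t)) i v)" and ?Y = "Re (A.form (\<phi> (B.cut G s)) i v)"
  \<comment> \<open>As a convex combination of two numbers below e; this covers c = 0 without a case
    split.\<close>
  have "c * (?X - ?Y) + (1 - c) * 0 < e"
    by (rule convex_bound_lt) (use s(2) c e in auto)
  then have "c * ?X < c * ?Y + e" by (simp add: algebra_simps)
  then have "Re (A.form (trunc F G c \<phi> t) i v) < Re (A.form (trunc F G c \<phi> s) i v) + e"
    using form_trunc[OF \<phi> _ i] tSA TSA[OF s(1)] e by simp
  with s(1) show "\<exists>s\<in>T. Re (A.form (trunc F G c \<phi> t) i v) < Re (A.form (trunc F G c \<phi> s) i v) + e" by blast
qed

lemma trunc_mono: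
  assumes \<phi>: "\<phi> \<in> carrier Q" and c: "0 \<le> c" "c \<le> d" "d \<le> 1" and FG: "F \<subseteq> F'" "G \<subseteq> G'"
  shows "trunc F G c \<phi> \<sqsubseteq>\<^bsub>Q\<^esub> trunc F' G' d \<phi>"
proof -
  have Q: "trunc F G c \<phi> \<in> carrier Q" "trunc F' G' d \<phi> \<in> carrier Q" using trunc_in_Q[OF \<phi>] c by auto
  show ?thesis
    unfolding Q_le_iff[OF Q]
  proof (intro allI impI ballI)
    fix N b i v assume Nb: "matrix_positive B N b" and i: "i \<in> I"
    let ?m = "\<lambda>G. Re (mf \<phi> N (\<lambda>k l. B.cut G (b k l)) i v)"
    have nn: "0 \<le> ?m G" for G using Q_mf[OF \<phi> B.matrix_positive_cut[OF Nb] i] by (simp add: complex_nonneg_iff)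
    have "mf \<phi> N (\<lambda>k l. B.cut G (b k l)) i v = mf \<phi> N (\<lambda>k l. B.cut G (B.cut G' (b k l))) i v"
    proof (rule mf_cong)
      fix k l assume kl: "k < N" "l < N"
      have "B.cut G (b k l) = B.cut G (B.cut G' (b k l))"
        by (rule B.ent_eqI) (use matrix_positive_closed[OF Nb kl] FG(2) in \<open>auto simp: B.cut_closed B.ent_cut\<close>)
      then show "\<phi> (B.cut G (b k l)) = \<phi> (B.cut G (B.cut G' (b k l)))" by simp
    qed
    then have "?m G \<le> ?m G'" using mf_cut_le[OF \<phi> B.matrix_positive_cut[OF Nb] i] by simp
    then have "c * ?m G \<le> d * ?m G'" using c nn by (intro mult_mono) auto
    moreover have "0 \<le> d * ?m G'" using c nn by simp
    ultimately show "Re (mf (trunc F G c \<phi>) N b i v) \<le> Re (mf (trunc F' G' d \<phi>) N b i v)"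
      using FG(1) by (auto simp: mf_trunc[OF \<phi> Nb i])
  qed
qed

text \<open>Normality at work: the finite truncations of a positive b form a directed set with
  supremum b. Everything else is linear in b.\<close>

lemma cut_limit:
  assumes \<phi>: "\<phi> \<in> carrier Q" and b: "b \<in> carrier B"
  shows "\<forall>i\<in>I. \<forall>p<n i. \<forall>q<n i. ((\<lambda>G. entA (\<phi> (B.cut G b)) i p q) \<longlongrightarrow> entA (\<phi> b) i p q) (finite_subsets_at_top J)"
  using b
proof (induction rule: B.positive_span_induct)
  case (positive b)
  note cp = Q_cp[OF \<phi>]
  note bC = B.positive_carrier[OF positive]
  have bSA: "b \<in> carrier B.SA" using bC B.positive_self_adjoint[OF positive] by simp
  let ?T = "(\<lambda>G. B.cut G b) ` {G. finite G \<and> G \<subseteq> J}"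
  have mono: "alg_le B (B.cut G b) (B.cut G' b)" if "G \<subseteq> G'" for G G'
    unfolding B.alg_le_Re[OF cut_SA[OF bSA] cut_SA[OF bSA]]
    using that B.positive_form[OF positive] bC by (auto simp: B.form_cut complex_nonneg_iff)
  have le_b: "alg_le B (B.cut G b) b" for G
    using positive_cut(2)[OF positive, of G] bC by (simp add: B.alg_le_iff_positive B.cut_closed)
  have dT: "directed B.SA ?T"
    unfolding directed_def
  proof (intro conjI ballI)
    show "?T \<subseteq> carrier B.SA" using cut_SA[OF bSA] by blast
    show "?T \<noteq> {}" by blast
    fix x y assume "x \<in> ?T" "y \<in> ?T"
    then obtain G G' where G: "finite G" "G \<subseteq> J" "x = B.cut G b" "finite G'" "G' \<subseteq> J" "y = B.cut G' b" by blast
    then have "B.cut (G \<union> G') b \<in> ?T" by blast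
    moreover have "x \<sqsubseteq>\<^bsub>B.SA\<^esub> B.cut (G \<union> G') b" "y \<sqsubseteq>\<^bsub>B.SA\<^esub> B.cut (G \<union> G') b"
      using mono[of G "G \<union> G'"] mono[of G' "G \<union> G'"] G by auto
    ultimately show "\<exists>z\<in>?T. x \<sqsubseteq>\<^bsub>B.SA\<^esub> z \<and> y \<sqsubseteq>\<^bsub>B.SA\<^esub> z" by blast
  qed
  have lub: "is_lub B.SA b ?T"
  proof (rule B.SA_lubI[OF dT bSA])
    show "alg_le B s b" if "s \<in> ?T" for s using that le_b by blast
    \<comment> \<open>Truncating to the single block j already reproduces the form of b in that
      block.\<close>
    show "\<exists>s\<in>?T. Re (B.form b j w) < Re (B.form s j w) + e" if "j \<in> J" "e > 0" for j w e
      by (rule bexI[of _ "B.cut {j} b"]) (use that bC in \<open>auto simp: B.form_cut\<close>)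
  qed
  have lim: "((\<lambda>G. A.form (\<phi> (B.cut G b)) i v) \<longlongrightarrow> A.form (\<phi> b) i v) (finite_subsets_at_top J)" if i: "i \<in> I" for i v
  proof (rule tendstoI)
    fix e :: real assume e: "e > 0"
    obtain G where G: "finite G" "G \<subseteq> J" "Re (A.form (\<phi> b) i v) < Re (A.form (\<phi> (B.cut G b)) i v) + e"
      using Q_normal[OF \<phi> dT lub i e] by blast
    show "\<forall>\<^sub>F G in finite_subsets_at_top J. dist (A.form (\<phi> (B.cut G b)) i v) (A.form (\<phi> b) i v) < e"
      unfolding eventually_finite_subsets_at_top
    proof (intro exI[of _ G] conjI allI impI)
      fix H assume H: "finite H \<and> G \<subseteq> H \<and> H \<subseteq> J"
      have "Re (A.form (\<phi> (B.cut G b)) i v) \<le> Re (A.form (\<phi> (B.cut H b)) i v)"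
        by (rule completely_positive_form_mono[OF cp cut_SA[OF bSA] cut_SA[OF bSA] mono i]) (use H in simp)
      moreover have "Re (A.form (\<phi> (B.cut H b)) i v) \<le> Re (A.form (\<phi> b) i v)"
        by (rule completely_positive_form_mono[OF cp cut_SA[OF bSA] bSA le_b i])
      moreover have "Im (A.form (\<phi> (B.cut H b)) i v) = 0" "Im (A.form (\<phi> b) i v) = 0"
        using Q_form_real[OF \<phi> _ i] positive_cut(1)[OF positive] positive by auto
      then have "A.form (\<phi> (B.cut H b)) i v - A.form (\<phi> b) i v = of_real (Re (A.form (\<phi> (B.cut H b)) i v) - Re (A.form (\<phi> b) i v))"
        by (simp add: complex_eq_iff)
      ultimately show "dist (A.form (\<phi> (B.cut H b)) i v) (A.form (\<phi> b) i v) < e"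
        unfolding dist_norm using G(3) by (simp only: norm_of_real)
    qed (use G in auto)
  qed
  show ?case
  proof (intro ballI allI impI)
    fix i p q assume i: "i \<in> I" "p < n i" "q < n i"
    show "((\<lambda>G. entA (\<phi> (B.cut G b)) i p q) \<longlongrightarrow> entA (\<phi> b) i p q) (finite_subsets_at_top J)"
      by (rule tendsto_kernel_polarization_to[OF finite_lessThan lim[OF i(1)]]) (use i in auto)
  qed
next
  case (add x y)
  note lin = Q_lin[OF \<phi>] and C = linear_map_closed[OF Q_lin[OF \<phi>]]
  show ?case
  proof (intro ballI allI impI)
    fix i p q assume i: "i \<in> I" "p < n i" "q < n i"
    have "entA (\<phi> (B.cut G (x \<oplus>\<^bsub>B\<^esub> y))) i p q = entA (\<phi> (B.cut G x)) i p q + entA (\<phi> (B.cut G y)) i p q" for G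
      using add.hyps i C by (simp add: B.cut_add B.cut_closed linear_map_add[OF lin] A.ent_add)
    moreover have "entA (\<phi> (x \<oplus>\<^bsub>B\<^esub> y)) i p q = entA (\<phi> x) i p q + entA (\<phi> y) i p q"
      using add.hyps i C by (simp add: linear_map_add[OF lin] A.ent_add)
    moreover have "((\<lambda>G. entA (\<phi> (B.cut G x)) i p q + entA (\<phi> (B.cut G y)) i p q) \<longlongrightarrow> entA (\<phi> x) i p q + entA (\<phi> y) i p q) (finite_subsets_at_top J)"
      by (rule tendsto_add) (use add.IH i in simp_all)
    ultimately show "((\<lambda>G. entA (\<phi> (B.cut G (x \<oplus>\<^bsub>B\<^esub> y))) i p q) \<longlongrightarrow> entA (\<phi> (x \<oplus>\<^bsub>B\<^esub> y)) i p q) (finite_subsets_at_top J)"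
      by simp
  qed
next
  case (smult c x)
  note lin = Q_lin[OF \<phi>] and C = linear_map_closed[OF Q_lin[OF \<phi>]]
  show ?case
  proof (intro ballI allI impI)
    fix i p q assume i: "i \<in> I" "p < n i" "q < n i"
    have "entA (\<phi> (B.cut G (c \<odot>\<^bsub>B\<^esub> x))) i p q = c * entA (\<phi> (B.cut G x)) i p q" for G
      using smult.hyps i C by (simp add: B.cut_smult B.cut_closed linear_map_smult[OF lin] A.ent_smult)
    moreover have "entA (\<phi> (c \<odot>\<^bsub>B\<^esub> x)) i p q = c * entA (\<phi> x) i p q"
      using smult.hyps i C by (simp add: linear_map_smult[OF lin] A.ent_smult)
    moreover have "((\<lambda>G. c * entA (\<phi> (B.cut G x)) i p q) \<longlongrightarrow> c * entA (\<phi> x) i p q) (finite_subsets_at_top J)"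
      by (rule tendsto_mult[OF tendsto_const]) (use smult.IH i in simp)
    ultimately show "((\<lambda>G. entA (\<phi> (B.cut G (c \<odot>\<^bsub>B\<^esub> x))) i p q) \<longlongrightarrow> entA (\<phi> (c \<odot>\<^bsub>B\<^esub> x)) i p q) (finite_subsets_at_top J)"
      by simp
  qed
qed

end

section \<open>Truncated maps are way below\<close>

text \<open>The form of X^* P X at v is the form of P at X v.\<close>

lemma sesq_congruence:
  "sesq S (\<lambda>s t. \<Sum>g\<in>T. \<Sum>h\<in>T. cnj (X g s) * P g h * X h t) v v =
    sesq T P (\<lambda>g. \<Sum>s\<in>S. X g s * v s) (\<lambda>g. \<Sum>s\<in>S. X g s * v s)"
proof -
  have "sesq S (\<lambda>s t. \<Sum>g\<in>T. \<Sum>h\<in>T. cnj (X g s) * P g h * X h t) v v =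
      (\<Sum>g\<in>T. \<Sum>h\<in>T. sesq S (\<lambda>s t. cnj (X g s) * P g h * X h t) v v)"
    by (simp add: sesq_sum)
  also have "\<dots> = (\<Sum>g\<in>T. \<Sum>h\<in>T. cnj (\<Sum>s\<in>S. X g s * v s) * P g h * (\<Sum>s\<in>S. X h s * v s))"
  proof (intro sum.cong refl)
    fix g h
    have "cnj (\<Sum>s\<in>S. X g s * v s) * P g h * (\<Sum>s\<in>S. X h s * v s) =
        (\<Sum>s\<in>S. cnj (X g s * v s)) * (\<Sum>t\<in>S. P g h * (X h t * v t))"
      by (simp add: sum_distrib_left mult.assoc)
    also have "\<dots> = sesq S (\<lambda>s t. cnj (X g s) * P g h * X h t) v v"
      unfolding sum_product sesq_def by (simp add: mult_ac)
    finally show "sesq S (\<lambda>s t. cnj (X g s) * P g h * X h t) v v =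
        cnj (\<Sum>s\<in>S. X g s * v s) * P g h * (\<Sum>s\<in>S. X h s * v s)" by simp
  qed
  finally show ?thesis by (simp add: sesq_def)
qed

context block_algebra
begin

definition matrix_unit :: "'i \<Rightarrow> nat \<Rightarrow> nat \<Rightarrow> 'a" where
  "matrix_unit i q r = (SOME x. x \<in> carrier A \<and> (\<forall>i'\<in>I. \<forall>p<n i'. \<forall>p'<n i'.
    ent x i' p p' = (if i' = i \<and> p = q \<and> p' = r then 1 else 0)))"

lemma matrix_unit_props:
  assumes "q < n i" "r < n i"
  shows matrix_unit_closed: "matrix_unit i q r \<in> carrier A"
    and ent_matrix_unit: "\<lbrakk>i' \<in> I; p < n i'; p' < n i'\<rbrakk> \<Longrightarrow>
      ent (matrix_unit i q r) i' p p' = (if i' = i \<and> p = q \<and> p' = r then 1 else 0)"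
proof -
  have "\<exists>x\<in>carrier A. \<forall>i'\<in>I. \<forall>p<n i'. \<forall>p'<n i'. ent x i' p p' = (if i' = i \<and> p = q \<and> p' = r then 1 else 0)"
  proof (rule ent_exists)
    fix i' assume "i' \<in> I"
    show "bounded_kernel {..<n i'} (\<lambda>p p'. if i' = i \<and> p = q \<and> p' = r then 1 else 0) 1"
      unfolding bounded_kernel_def
    proof (intro allI)
      fix v w :: "nat \<Rightarrow> complex"
      let ?V = "\<Sum>p<n i'. (cmod (v p))\<^sup>2" and ?W = "\<Sum>p<n i'. (cmod (w p))\<^sup>2"
      let ?s = "sesq {..<n i'} (\<lambda>p p'. if i' = i \<and> p = q \<and> p' = r then 1 else 0) v w"
      have VW: "0 \<le> ?V" "0 \<le> ?W" by (auto intro: sum_nonneg)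
      show "cmod ?s \<le> 1 * (?V + ?W)"
      proof (cases "i' = i")
        case True
        have "?s = (\<Sum>p<n i'. \<Sum>p'<n i'. if p = q then if p' = r then cnj (v p) * w p' else 0 else 0)"
          unfolding sesq_def by (intro sum.cong refl) (use True in auto)
        also have "\<dots> = (\<Sum>p<n i'. if p = q then (\<Sum>p'<n i'. if p' = r then cnj (v p) * w p' else 0) else 0)"
          by (rule sum.cong[OF refl]) simp
        also have "\<dots> = cnj (v q) * w r" using assms True by simp
        finally have "cmod ?s = cmod (v q) * cmod (w r)" by (simp add: norm_mult)
        also have "\<dots> \<le> (cmod (v q))\<^sup>2 + (cmod (w r))\<^sup>2"
          using sum_squares_bound[of "cmod (v q)" "cmod (w r)"] mult_nonneg_nonneg[OF norm_ge_zero[of "v q"] norm_ge_zero[of "w r"]]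
          by linarith
        also have "(cmod (v q))\<^sup>2 \<le> ?V"
          by (rule member_le_sum[of q "{..<n i'}" "\<lambda>p. (cmod (v p))\<^sup>2"]) (use assms True in auto)
        also have "(cmod (w r))\<^sup>2 \<le> ?W"
          by (rule member_le_sum[of r "{..<n i'}" "\<lambda>p. (cmod (w p))\<^sup>2"]) (use assms True in auto)
        finally show ?thesis by simp
      next
        case False
        then show ?thesis using VW by (simp add: sesq_def)
      qed
    qed
  qed
  then have "\<exists>x. x \<in> carrier A \<and> (\<forall>i'\<in>I. \<forall>p<n i'. \<forall>p'<n i'. ent x i' p p' = (if i' = i \<and> p = q \<and> p' = r then 1 else 0))" by blast
  from someI_ex[OF this, folded matrix_unit_def]
  show "matrix_unit i q r \<in> carrier A" "\<lbrakk>i' \<in> I; p < n i'; p' < n i'\<rbrakk> \<Longrightarrow>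
      ent (matrix_unit i q r) i' p p' = (if i' = i \<and> p = q \<and> p' = r then 1 else 0)"
    by blast+
qed

text \<open>The matrix of matrix units is rank one: it is the Gram kernel of the unnormalised
  maximally entangled vector, the sum of all e_q tensor e_q. In the other blocks it
  vanishes.\<close>

lemma matrix_positive_units: "matrix_positive A (n i) (matrix_unit i)"
  unfolding matrix_positive_iff
proof (intro conjI allI impI ballI)
  fix i' assume i': "i' \<in> I"
  define X :: "unit \<Rightarrow> nat \<times> nat \<Rightarrow> complex" where "X u s = (if i' = i \<and> fst s = snd s then 1 else 0)" for u s
  have "psd ({..<n i} \<times> {..<n i'}) (\<lambda>s t. \<Sum>u\<in>{()}. cnj (X u s) * X u t)" by (rule psd_gram)
  then show "psd ({..<n i} \<times> {..<n i'}) (mker (matrix_unit i) i')"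
    by (rule iffD1[OF psd_cong, rotated]) (use i' in \<open>auto simp: mker_def X_def ent_matrix_unit\<close>)
qed (rule matrix_unit_closed)

lemma cut_finsum_units:
  assumes b: "b \<in> carrier A" and F: "finite F" "F \<subseteq> I"
  shows "cut F b = (\<Oplus>k\<in>(SIGMA i:F. {..<n i} \<times> {..<n i}).
    ent b (fst k) (fst (snd k)) (snd (snd k)) \<odot> matrix_unit (fst k) (fst (snd k)) (snd (snd k)))"
    (is "_ = (\<Oplus>k\<in>?U. ?c k \<odot> ?E k)")
proof (rule ent_eqI)
  have U: "finite ?U" using F(1) by simp
  have C: "?c k \<odot> ?E k \<in> carrier A" if "k \<in> ?U" for k using that matrix_unit_closed by auto
  show "(\<Oplus>k\<in>?U. ?c k \<odot> ?E k) \<in> carrier A" by (rule finsum_closed) (use C in blast)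
  fix i p q assume i: "i \<in> I" "p < n i" "q < n i"
  have "ent (\<Oplus>k\<in>?U. ?c k \<odot> ?E k) i p q = (\<Sum>k\<in>?U. ent (?c k \<odot> ?E k) i p q)"
    by (rule ent_finsum[OF i U C])
  also have "\<dots> = (\<Sum>k\<in>?U. if k = (i, p, q) then ent b i p q else 0)"
    by (rule sum.cong) (use i in \<open>auto simp: ent_smult matrix_unit_closed ent_matrix_unit split: if_splits\<close>)
  also have "\<dots> = (if i \<in> F then ent b i p q else 0)" using U i by (simp add: sum.delta)
  finally show "ent (cut F b) i p q = ent (\<Oplus>k\<in>?U. ?c k \<odot> ?E k) i p q" using ent_cut[OF b i] by simp
qed (rule cut_closed[OF b])

end

context block_pair
begin

lemma linear_map_zero: "linear_map \<phi> \<Longrightarrow> \<phi> \<zero>\<^bsub>B\<^esub> = \<zero>\<^bsub>A\<^esub>"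
proof -
  assume lin: "linear_map \<phi>"
  have "\<phi> (\<zero>\<^bsub>B\<^esub> \<ominus>\<^bsub>B\<^esub> \<zero>\<^bsub>B\<^esub>) = \<phi> \<zero>\<^bsub>B\<^esub> \<ominus>\<^bsub>A\<^esub> \<phi> \<zero>\<^bsub>B\<^esub>" by (rule linear_map_minus[OF lin]) simp_all
  then show ?thesis using linear_map_closed[OF lin, of "\<zero>\<^bsub>B\<^esub>"] by (simp add: A.r_neg B.r_neg a_minus_def)
qed

lemma ent_linear_map_finsum:
  assumes lin: "linear_map \<phi>" and i: "i \<in> I" "p < n i" "q < n i"
    and "finite U" "\<And>k. k \<in> U \<Longrightarrow> f k \<in> carrier B"
  shows "entA (\<phi> (\<Oplus>\<^bsub>B\<^esub>k\<in>U. f k)) i p q = (\<Sum>k\<in>U. entA (\<phi> (f k)) i p q)"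
  using assms(5,6)
proof (induction U)
  case empty
  then show ?case using i by (simp add: linear_map_zero[OF lin] A.ent_zero)
next
  case (insert a U)
  then have "(\<Oplus>\<^bsub>B\<^esub>k\<in>insert a U. f k) = f a \<oplus>\<^bsub>B\<^esub> (\<Oplus>\<^bsub>B\<^esub>k\<in>U. f k)" by (intro B.finsum_insert) auto
  moreover have "(\<Oplus>\<^bsub>B\<^esub>k\<in>U. f k) \<in> carrier B" using insert.prems by (intro B.finsum_closed) auto
  ultimately show ?case
    using insert linear_map_closed[OF lin] i by (simp add: linear_map_add[OF lin] A.ent_add)
qed

lemma ent_linear_map_cut:
  assumes lin: "linear_map \<phi>" and i: "i \<in> I" "p < n i" "q < n i" and b: "b \<in> carrier B" and G: "finite G" "G \<subseteq> J"
  shows "entA (\<phi> (B.cut G b)) i p q =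
    (\<Sum>j\<in>G. \<Sum>r<m j. \<Sum>s<m j. entB b j r s * entA (\<phi> (B.matrix_unit j r s)) i p q)"
proof -
  let ?U = "SIGMA j:G. {..<m j} \<times> {..<m j}"
  let ?t = "\<lambda>j r s. entB b j r s * entA (\<phi> (B.matrix_unit j r s)) i p q"
  have U: "finite ?U" using G(1) by simp
  have "entA (\<phi> (B.cut G b)) i p q = (\<Sum>k\<in>?U. entA (\<phi> (entB b (fst k) (fst (snd k)) (snd (snd k)) \<odot>\<^bsub>B\<^esub>
      B.matrix_unit (fst k) (fst (snd k)) (snd (snd k)))) i p q)"
    unfolding B.cut_finsum_units[OF b G]
    by (rule ent_linear_map_finsum[OF lin i U]) (use B.matrix_unit_closed in auto)
  also have "\<dots> = (\<Sum>k\<in>?U. ?t (fst k) (fst (snd k)) (snd (snd k)))"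
    by (rule sum.cong)
      (use i linear_map_closed[OF lin] B.matrix_unit_closed in \<open>auto simp: linear_map_smult[OF lin] A.ent_smult\<close>)
  also have "\<dots> = (\<Sum>j\<in>G. \<Sum>rs\<in>{..<m j} \<times> {..<m j}. ?t j (fst rs) (snd rs))"
    using G(1) by (subst sum.Sigma) (auto simp: case_prod_unfold)
  also have "\<dots> = (\<Sum>j\<in>G. \<Sum>r<m j. \<Sum>s<m j. ?t j r s)"
    by (simp add: sum.cartesian_product case_prod_unfold)
  finally show ?thesis .
qed

text \<open>Choi's theorem, blockwise: with $b = x^* x$, the form of \<open>\<phi>\<close> on the truncation of \<open>b\<close> to
  finitely many blocks is a sum of values of the Choi forms of \<open>\<phi>\<close>, at vectors that do not
  depend on \<open>\<phi>\<close>.\<close>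

lemma mf_cut_choi:
  assumes Nb: "matrix_positive B N b" and i: "i \<in> I" and G: "finite G" "G \<subseteq> J"
  shows "\<exists>w. \<forall>\<phi>. linear_map \<phi> \<longrightarrow> mf \<phi> N (\<lambda>k l. B.cut G (b k l)) i v =
    (\<Sum>j\<in>G. \<Sum>u<N. \<Sum>p<m j. mf \<phi> (m j) (B.matrix_unit j) i (w j u p))"
proof -
  obtain x where x: "\<forall>j\<in>J. \<forall>k<N. \<forall>l<N. \<forall>q<m j. \<forall>r<m j.
      entB (b k l) j q r = (\<Sum>u<N. \<Sum>p<m j. cnj (entB (x u k) j p q) * entB (x u l) j p r)"
    using B.matrix_positive_gram(2)[OF Nb] by blast
  let ?S = "{..<N} \<times> {..<n i}" and ?T = "\<lambda>j. {..<m j} \<times> {..<n i}"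
  \<comment> \<open>Row p of block j of the entries x u k, tensored with the identity on block i of
    A. It depends on b only, so the resulting vectors w serve all maps at once.\<close>
  define X where "X j u p g s = (if snd g = snd s then entB (x u (fst s)) j p (fst g) else 0)"
    for j u p and g s :: "nat \<times> nat"
  define w where "w j u p g = (\<Sum>s\<in>?S. X j u p g s * v s)" for j u p g
  have "mf \<phi> N (\<lambda>k l. B.cut G (b k l)) i v =
    (\<Sum>j\<in>G. \<Sum>u<N. \<Sum>p<m j. mf \<phi> (m j) (B.matrix_unit j) i (w j u p))" if lin: "linear_map \<phi>" for \<phi>
  proof -
    let ?P = "\<lambda>j. A.mker (\<lambda>q r. \<phi> (B.matrix_unit j q r)) i"
    have ker: "A.mker (\<lambda>k l. \<phi> (B.cut G (b k l))) i s t =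
        (\<Sum>j\<in>G. \<Sum>u<N. \<Sum>p<m j. \<Sum>g\<in>?T j. \<Sum>h\<in>?T j. cnj (X j u p g s) * ?P j g h * X j u p h t)"
      if s: "s \<in> ?S" and t: "t \<in> ?S" for s t
    proof -
      obtain k a l c where st: "s = (k, a)" "t = (l, c)" by (cases s, cases t) auto
      have kl: "k < N" "l < N" "a < n i" "c < n i" using s t st by auto
      have "A.mker (\<lambda>k l. \<phi> (B.cut G (b k l))) i s t = (\<Sum>j\<in>G. \<Sum>q<m j. \<Sum>r<m j.
          entB (b k l) j q r * entA (\<phi> (B.matrix_unit j q r)) i a c)"
        using ent_linear_map_cut[OF lin i kl(3,4) matrix_positive_closed[OF Nb kl(1,2)] G] by (simp add: A.mker_def st)
      also have "\<dots> = (\<Sum>j\<in>G. \<Sum>u<N. \<Sum>p<m j. \<Sum>g\<in>?T j. \<Sum>h\<in>?T j. cnj (X j u p g s) * ?P j g h * X j u p h t)"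
      proof (rule sum.cong[OF refl])
        fix j assume "j \<in> G"
        then have j: "j \<in> J" using G(2) by blast
        let ?e = "\<lambda>q r. entA (\<phi> (B.matrix_unit j q r)) i a c"
        let ?z = "\<lambda>u p q r. cnj (entB (x u k) j p q) * ?e q r * entB (x u l) j p r"
        have inner: "(\<Sum>g\<in>?T j. \<Sum>h\<in>?T j. cnj (X j u p g s) * ?P j g h * X j u p h t) = (\<Sum>q<m j. \<Sum>r<m j. ?z u p q r)" for u p
        proof -
          have "(\<Sum>g\<in>?T j. \<Sum>h\<in>?T j. cnj (X j u p g s) * ?P j g h * X j u p h t) =
              (\<Sum>q<m j. \<Sum>a1<n i. \<Sum>r<m j. \<Sum>a2<n i. cnj (X j u p (q, a1) s) * ?P j (q, a1) (r, a2) * X j u p (r, a2) t)"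
            by (simp only: sum.cartesian_product')
          also have "\<dots> = (\<Sum>q<m j. \<Sum>a1<n i. \<Sum>r<m j. \<Sum>a2<n i. if a1 = a then if a2 = c then ?z u p q r else 0 else 0)"
            by (intro sum.cong refl) (auto simp: X_def st A.mker_def)
          also have "\<dots> = (\<Sum>q<m j. \<Sum>a1<n i. if a1 = a then (\<Sum>r<m j. \<Sum>a2<n i. if a2 = c then ?z u p q r else 0) else 0)"
            by (intro sum.cong refl) auto
          also have "\<dots> = (\<Sum>q<m j. \<Sum>r<m j. ?z u p q r)" using kl by simp
          finally show ?thesis .
        qed
        have "(\<Sum>q<m j. \<Sum>r<m j. entB (b k l) j q r * ?e q r) = (\<Sum>q<m j. \<Sum>r<m j. \<Sum>u<N. \<Sum>p<m j. ?z u p q r)"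
        proof (intro sum.cong refl)
          fix q r assume "q \<in> {..<m j}" "r \<in> {..<m j}"
          then have "entB (b k l) j q r = (\<Sum>u<N. \<Sum>p<m j. cnj (entB (x u k) j p q) * entB (x u l) j p r)"
            using x j kl by simp
          then show "entB (b k l) j q r * ?e q r = (\<Sum>u<N. \<Sum>p<m j. ?z u p q r)"
            by (simp add: sum_distrib_left sum_distrib_right mult_ac)
        qed
        also have "\<dots> = (\<Sum>q<m j. \<Sum>u<N. \<Sum>r<m j. \<Sum>p<m j. ?z u p q r)"
          by (rule sum.cong[OF refl]) (rule sum.swap)
        also have "\<dots> = (\<Sum>u<N. \<Sum>q<m j. \<Sum>r<m j. \<Sum>p<m j. ?z u p q r)" by (rule sum.swap)
        also have "\<dots> = (\<Sum>u<N. \<Sum>q<m j. \<Sum>p<m j. \<Sum>r<m j. ?z u p q r)"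
          by (rule sum.cong[OF refl], rule sum.cong[OF refl], rule sum.swap)
        also have "\<dots> = (\<Sum>u<N. \<Sum>p<m j. \<Sum>q<m j. \<Sum>r<m j. ?z u p q r)"
          by (rule sum.cong[OF refl], rule sum.swap)
        finally show "(\<Sum>q<m j. \<Sum>r<m j. entB (b k l) j q r * ?e q r) =
            (\<Sum>u<N. \<Sum>p<m j. \<Sum>g\<in>?T j. \<Sum>h\<in>?T j. cnj (X j u p g s) * ?P j g h * X j u p h t)"
          by (simp only: inner)
      qed
      finally show ?thesis .
    qed
    have "mf \<phi> N (\<lambda>k l. B.cut G (b k l)) i v = sesq ?S (\<lambda>s t. \<Sum>j\<in>G. \<Sum>u<N. \<Sum>p<m j.
        \<Sum>g\<in>?T j. \<Sum>h\<in>?T j. cnj (X j u p g s) * ?P j g h * X j u p h t) v v"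
      unfolding mf_def by (rule sesq_cong) (use ker in auto)
    also have "\<dots> = (\<Sum>j\<in>G. \<Sum>u<N. \<Sum>p<m j. sesq ?S (\<lambda>s t. \<Sum>g\<in>?T j. \<Sum>h\<in>?T j.
        cnj (X j u p g s) * ?P j g h * X j u p h t) v v)"
      by (simp only: sesq_sum)
    also have "\<dots> = (\<Sum>j\<in>G. \<Sum>u<N. \<Sum>p<m j. mf \<phi> (m j) (B.matrix_unit j) i (w j u p))"
      unfolding sesq_congruence mf_def w_def ..
    finally show ?thesis .
  qed
  then show ?thesis by blast
qed

text \<open>For each pair (i, j) in F times G the Choi matrices along S eventually dominate c times
  that of s. Finitely many eventual statements hold simultaneously for some member of S, and
  \<open>mf_cut_choi\<close> extends the inequality from Choi matrices to all positive b.\<close>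

lemma trunc_way_below:
  assumes Z: "Z \<in> carrier Q" and F: "finite F" "F \<subseteq> I" and G: "finite G" "G \<subseteq> J" and c: "0 \<le> c" "c < 1"
  shows "way_below Q (trunc F G c Z) Z"
  unfolding way_below_def
proof (intro conjI allI impI)
  show tQ: "trunc F G c Z \<in> carrier Q" using trunc_in_Q[OF Z] c by simp
  fix S s assume "directed Q S \<and> is_lub Q s S \<and> Z \<sqsubseteq>\<^bsub>Q\<^esub> s"
  then have S: "directed Q S" and lub: "is_lub Q s S" and Zs: "Z \<sqsubseteq>\<^bsub>Q\<^esub> s" by auto
  have sQ: "s \<in> carrier Q" and ub: "\<And>\<phi>. \<phi> \<in> S \<Longrightarrow> \<phi> \<sqsubseteq>\<^bsub>Q\<^esub> s" using lub directed_is_lub_iff[OF S, of s] by auto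
  have SQ: "\<And>\<phi>. \<phi> \<in> S \<Longrightarrow> \<phi> \<in> carrier Q" using directed_subset[OF S] by blast
  let ?F = "dir_filter Q S"
  obtain \<phi>0 where \<phi>0: "\<phi>0 \<in> S" using S by (auto simp: directed_def)
  have evS: "\<forall>\<^sub>F \<phi> in ?F. \<phi> \<in> S"
    using eventually_dir_filter_ge[OF partial_order_Q S \<phi>0] by eventually_elim simp
  let ?K = "\<lambda>\<phi> i j. A.mker (\<lambda>q r. \<phi> (B.matrix_unit j q r)) i"
  \<comment> \<open>With error R = K_s - K_\<phi> and e = 1 - c, the kernel in question is K_\<phi>
    - c K_s, written in the shape of \<open>psd_eventually_le\<close>.\<close>
  have choi: "\<forall>\<^sub>F \<phi> in ?F. psd ({..<m j} \<times> {..<n i}) (\<lambda>g h. of_real (1 - c) * ?K s i j g h - (?K s i j g h - ?K \<phi> i j g h))"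
    if i: "i \<in> I" and j: "j \<in> J" for i j
  proof (rule psd_eventually_le)
    note units = B.matrix_positive_units[of j]
    have psd: "psd ({..<m j} \<times> {..<n i}) (?K \<phi> i j)" if "\<phi> \<in> carrier Q" for \<phi>
      using Q_mf[OF that units i] by (simp add: psd_def mf_def)
    show "psd ({..<m j} \<times> {..<n i}) (?K s i j)" by (rule psd[OF sQ])
    show "\<forall>\<^sub>F \<phi> in ?F. psd ({..<m j} \<times> {..<n i}) (\<lambda>g h. ?K s i j g h - (?K s i j g h - ?K \<phi> i j g h))"
      using evS by eventually_elim (use psd SQ in simp)
    show "\<forall>\<^sub>F \<phi> in ?F. psd ({..<m j} \<times> {..<n i}) (\<lambda>g h. ?K s i j g h - ?K \<phi> i j g h)"
      using evS
    proof eventually_elim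
      case (elim \<phi>)
      have "Re (mf \<phi> (m j) (B.matrix_unit j) i v) \<le> Re (mf s (m j) (B.matrix_unit j) i v)" for v
        using Q_le_iff[OF SQ[OF elim] sQ] ub[OF elim] units i by simp
      then show ?case using psd_diff_iff[OF psd[OF sQ] psd[OF SQ[OF elim]]] by (simp add: mf_def)
    qed
    show "((\<lambda>\<phi>. ?K s i j g h - ?K \<phi> i j g h) \<longlongrightarrow> 0) ?F"
      if g: "g \<in> {..<m j} \<times> {..<n i}" "h \<in> {..<m j} \<times> {..<n i}" for g h
    proof -
      have "((\<lambda>\<phi>. ?K \<phi> i j g h) \<longlongrightarrow> ?K s i j g h) ?F"
        using Q_lub_limit[OF S lub B.matrix_unit_closed i] g by (auto simp: A.mker_def)
      from tendsto_diff[OF tendsto_const[of "?K s i j g h"] this] show ?thesis by simp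
    qed
  qed (use c in auto)
  have "\<forall>\<^sub>F \<phi> in ?F. \<forall>ij\<in>F \<times> G. psd ({..<m (snd ij)} \<times> {..<n (fst ij)}) (\<lambda>g h. of_real (1 - c) * ?K s (fst ij) (snd ij) g h
      - (?K s (fst ij) (snd ij) g h - ?K \<phi> (fst ij) (snd ij) g h))"
  proof (rule eventually_ball_finite)
    show "finite (F \<times> G)" using F G by simp
  qed (use choi F G in auto)
  with evS have "\<forall>\<^sub>F \<phi> in ?F. \<phi> \<in> S \<and> (\<forall>i\<in>F. \<forall>j\<in>G. psd ({..<m j} \<times> {..<n i})
      (\<lambda>g h. of_real (1 - c) * ?K s i j g h - (?K s i j g h - ?K \<phi> i j g h)))"
    by eventually_elim simp
  from eventually_happens'[OF dir_filter_nontrivial[OF partial_order_Q S] this]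
  obtain \<phi> where \<phi>: "\<phi> \<in> S" and ge: "\<And>i j. \<lbrakk>i \<in> F; j \<in> G\<rbrakk> \<Longrightarrow> psd ({..<m j} \<times> {..<n i})
      (\<lambda>g h. of_real (1 - c) * ?K s i j g h - (?K s i j g h - ?K \<phi> i j g h))" by blast
  note \<phi>Q = SQ[OF \<phi>]
  have "Re (mf (trunc F G c Z) N b i v) \<le> Re (mf \<phi> N b i v)" if Nb: "matrix_positive B N b" and i: "i \<in> I" for N b i v
  proof (cases "i \<in> F")
    case True
    let ?b = "\<lambda>k l. B.cut G (b k l)"
    obtain w where w: "\<And>\<phi>. linear_map \<phi> \<Longrightarrow> mf \<phi> N ?b i v =
        (\<Sum>j\<in>G. \<Sum>u<N. \<Sum>p<m j. mf \<phi> (m j) (B.matrix_unit j) i (w j u p))"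
      using mf_cut_choi[OF Nb i G] by blast
    have block: "c * Re (mf s (m j) (B.matrix_unit j) i y) \<le> Re (mf \<phi> (m j) (B.matrix_unit j) i y)" if "j \<in> G" for j y
      using psdD(1)[OF ge[OF True that], of y] unfolding sesq_diff sesq_scale mf_def by (simp add: algebra_simps)
    have "Re (mf (trunc F G c Z) N b i v) = c * Re (mf Z N ?b i v)"
      using True by (simp add: mf_trunc[OF Z Nb i])
    also have "\<dots> \<le> c * Re (mf s N ?b i v)"
      using Q_le_iff[OF Z sQ] Zs B.matrix_positive_cut[OF Nb, of G] i c by (intro mult_left_mono) auto
    also have "\<dots> = (\<Sum>j\<in>G. \<Sum>u<N. \<Sum>p<m j. c * Re (mf s (m j) (B.matrix_unit j) i (w j u p)))"
      unfolding w[OF Q_lin[OF sQ]] by (simp add: sum_distrib_left)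
    also have "\<dots> \<le> (\<Sum>j\<in>G. \<Sum>u<N. \<Sum>p<m j. Re (mf \<phi> (m j) (B.matrix_unit j) i (w j u p)))"
      by (intro sum_mono block)
    also have "\<dots> = Re (mf \<phi> N ?b i v)" unfolding w[OF Q_lin[OF \<phi>Q]] by simp
    also have "\<dots> \<le> Re (mf \<phi> N b i v)" by (rule mf_cut_le[OF \<phi>Q Nb i])
    finally show ?thesis .
  next
    case False
    then show ?thesis using mf_trunc[OF Z Nb i] Q_mf[OF \<phi>Q Nb i, of v] by (simp add: complex_nonneg_iff)
  qed
  then have "trunc F G c Z \<sqsubseteq>\<^bsub>Q\<^esub> \<phi>" unfolding Q_le_iff[OF tQ \<phi>Q] by blast
  with \<phi> show "\<exists>d\<in>S. trunc F G c Z \<sqsubseteq>\<^bsub>Q\<^esub> d" by blast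
qed (rule Z)

text \<open>Recovering Z from its truncations uses two limits: c tends to 1 for fixed G, and then G
  exhausts J by \<open>cut_limit\<close>.\<close>

theorem approximable_Q:
  assumes Z: "Z \<in> carrier Q"
  shows "approximable Q (carrier Q) Z"
proof -
  let ?D = "{trunc F G c Z | F G c. finite F \<and> F \<subseteq> I \<and> finite G \<and> G \<subseteq> J \<and> 0 \<le> c \<and> c < 1}"
  have DQ: "?D \<subseteq> carrier Q" using trunc_in_Q[OF Z] by auto
  have wb: "\<forall>d\<in>?D. way_below Q d Z" using trunc_way_below[OF Z] by blast
  have dir: "directed Q ?D"
    unfolding directed_def
  proof (intro conjI ballI)
    show "?D \<subseteq> carrier Q" by (rule DQ)
    have "trunc {} {} 0 Z \<in> ?D" by force
    then show "?D \<noteq> {}" by blast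
    fix x y assume "x \<in> ?D" "y \<in> ?D"
    then obtain F G c F' G' c' where x: "x = trunc F G c Z" "finite F" "F \<subseteq> I" "finite G" "G \<subseteq> J" "0 \<le> c" "c < 1"
      and y: "y = trunc F' G' c' Z" "finite F'" "F' \<subseteq> I" "finite G'" "G' \<subseteq> J" "0 \<le> c'" "c' < 1" by blast
    let ?z = "trunc (F \<union> F') (G \<union> G') (max c c') Z"
    have "?z \<in> ?D" using x y by (intro CollectI exI[of _ "F \<union> F'"] exI[of _ "G \<union> G'"] exI[of _ "max c c'"]) simp
    moreover have "x \<sqsubseteq>\<^bsub>Q\<^esub> ?z" unfolding x(1) by (rule trunc_mono[OF Z]) (use x y in auto)
    moreover have "y \<sqsubseteq>\<^bsub>Q\<^esub> ?z" unfolding y(1) by (rule trunc_mono[OF Z]) (use x y in auto)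
    ultimately show "\<exists>z\<in>?D. x \<sqsubseteq>\<^bsub>Q\<^esub> z \<and> y \<sqsubseteq>\<^bsub>Q\<^esub> z" by blast
  qed
  have "is_lub Q Z ?D"
    unfolding directed_is_lub_iff[OF dir]
  proof (intro conjI ballI impI)
    show "d \<sqsubseteq>\<^bsub>Q\<^esub> Z" if "d \<in> ?D" for d using way_below_imp_le[OF partial_order_Q] wb that by blast
    fix u assume u: "u \<in> carrier Q" "\<forall>d\<in>?D. d \<sqsubseteq>\<^bsub>Q\<^esub> u"
    have "Re (mf Z N b i v) \<le> Re (mf u N b i v)" if Nb: "matrix_positive B N b" and i: "i \<in> I" for N b i v
    proof -
      \<comment> \<open>A test in block i sees only that block, so F = {i} is large enough; the
        inequality for all 0 < c < 1 gives the one without c.\<close>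
      have fin: "Re (mf Z N (\<lambda>k l. B.cut G (b k l)) i v) \<le> Re (mf u N b i v)" if G: "finite G" "G \<subseteq> J" for G
      proof (rule field_le_mult_one_interval)
        fix c :: real assume c: "0 < c" "c < 1"
        have t: "trunc {i} G c Z \<in> ?D" using G c i by (intro CollectI exI[of _ "{i}"] exI[of _ G] exI[of _ c]) simp
        then have "trunc {i} G c Z \<sqsubseteq>\<^bsub>Q\<^esub> u" "trunc {i} G c Z \<in> carrier Q" using u(2) DQ by blast+
        then have "Re (mf (trunc {i} G c Z) N b i v) \<le> Re (mf u N b i v)" using Q_le_iff[OF _ u(1)] Nb i by simp
        then show "c * Re (mf Z N (\<lambda>k l. B.cut G (b k l)) i v) \<le> Re (mf u N b i v)" by (simp add: mf_trunc[OF Z Nb i])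
      qed
      have "((\<lambda>G. mf Z N (\<lambda>k l. B.cut G (b k l)) i v) \<longlongrightarrow> mf Z N b i v) (finite_subsets_at_top J)"
        unfolding mf_def
      proof (rule tendsto_sesq)
        fix s t assume "s \<in> {..<N} \<times> {..<n i}" "t \<in> {..<N} \<times> {..<n i}"
        then show "((\<lambda>G. A.mker (\<lambda>k l. Z (B.cut G (b k l))) i s t) \<longlongrightarrow> A.mker (\<lambda>k l. Z (b k l)) i s t) (finite_subsets_at_top J)"
          using cut_limit[OF Z matrix_positive_closed[OF Nb]] i by (auto simp: A.mker_def)
      qed
      from tendsto_upperbound[OF tendsto_Re[OF this], of "Re (mf u N b i v)"]
      show ?thesis using fin by (auto simp: eventually_finite_subsets_at_top_weakI)
    qed
    then show "Z \<sqsubseteq>\<^bsub>Q\<^esub> u" unfolding Q_le_iff[OF Z u(1)] by blast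
  qed (rule Z)
  with dir wb DQ show ?thesis unfolding approximable_def by blast
qed

end

section \<open>Passage from the l-infinity product of matrix algebras to coordinates\<close>

section \<open>Hereditarily atomic algebras\<close>

lemma mat_adjoint_index:
  assumes "a \<in> carrier_mat k l" "p < l" "q < k"
  shows "mat_adjoint a $$ (p, q) = cnj (a $$ (q, p))"
  using assms by (simp add: mat_adjoint_def mat_of_rows_index)

lemma mult_mat_vec_index_sum:
  fixes a :: "complex mat"
  assumes "a \<in> carrier_mat k l" "v \<in> carrier_vec l" "p < k"
  shows "vec_index (a *\<^sub>v v) p = (\<Sum>q<l. a $$ (p, q) * vec_index v q)"
  using assms by (simp add: scalar_prod_def atLeast0LessThan)

lemma op_norm_le_iff:
  assumes a: "a \<in> carrier_mat k k" and c: "0 \<le> c"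
  shows "op_norm_le a c \<longleftrightarrow> (\<forall>w. (\<Sum>p<k. (cmod (\<Sum>q<k. a $$ (p, q) * w q))\<^sup>2) \<le> c\<^sup>2 * (\<Sum>q<k. (cmod (w q))\<^sup>2))"
proof -
  have eq: "L2_set (\<lambda>p. cmod (vec_index (a *\<^sub>v v) p)) {..<dim_row a} \<le> c * L2_set (\<lambda>q. cmod (vec_index v q)) {..<dim_col a} \<longleftrightarrow>
      (\<Sum>p<k. (cmod (\<Sum>q<k. a $$ (p, q) * vec_index v q))\<^sup>2) \<le> c\<^sup>2 * (\<Sum>q<k. (cmod (vec_index v q))\<^sup>2)"
    if "v \<in> carrier_vec k" for v
  proof -
    have "L2_set (\<lambda>p. cmod (vec_index (a *\<^sub>v v) p)) {..<dim_row a} = sqrt (\<Sum>p<k. (cmod (\<Sum>q<k. a $$ (p, q) * vec_index v q))\<^sup>2)"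
    proof -
      have "(\<Sum>p<k. (cmod (vec_index (a *\<^sub>v v) p))\<^sup>2) = (\<Sum>p<k. (cmod (\<Sum>q<k. a $$ (p, q) * vec_index v q))\<^sup>2)"
        by (rule sum.cong[OF refl]) (simp only: lessThan_iff mult_mat_vec_index_sum[OF a that])
      then show ?thesis unfolding L2_set_def using a by (simp only: carrier_matD)
    qed
    moreover have "c * L2_set (\<lambda>q. cmod (vec_index v q)) {..<dim_col a} = sqrt (c\<^sup>2 * (\<Sum>q<k. (cmod (vec_index v q))\<^sup>2))"
      unfolding L2_set_def using a c by (simp add: real_sqrt_mult)
    ultimately show ?thesis by simp
  qed
  show ?thesis
  proof
    assume L: "op_norm_le a c"
    show "\<forall>w. (\<Sum>p<k. (cmod (\<Sum>q<k. a $$ (p, q) * w q))\<^sup>2) \<le> c\<^sup>2 * (\<Sum>q<k. (cmod (w q))\<^sup>2)"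
    proof
      fix w :: "nat \<Rightarrow> complex"
      have "vec k w \<in> carrier_vec (dim_col a)" using a by simp
      with L eq[of "vec k w"] a show "(\<Sum>p<k. (cmod (\<Sum>q<k. a $$ (p, q) * w q))\<^sup>2) \<le> c\<^sup>2 * (\<Sum>q<k. (cmod (w q))\<^sup>2)"
        unfolding op_norm_le_def by simp
    qed
  next
    assume R: "\<forall>w. (\<Sum>p<k. (cmod (\<Sum>q<k. a $$ (p, q) * w q))\<^sup>2) \<le> c\<^sup>2 * (\<Sum>q<k. (cmod (w q))\<^sup>2)"
    show "op_norm_le a c"
      unfolding op_norm_le_def
    proof
      fix v :: "complex Matrix.vec" assume "v \<in> carrier_vec (dim_col a)"
      then have "v \<in> carrier_vec k" using a by simp
      from eq[OF this] show "L2_set (\<lambda>p. cmod (vec_index (a *\<^sub>v v) p)) {..<dim_row a} \<le> c * L2_set (\<lambda>q. cmod (vec_index v q)) {..<dim_col a}"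
        using R by simp
    qed
  qed
qed

lemma op_norm_le_mono:
  assumes "op_norm_le a c" "c \<le> d" shows "op_norm_le a d"
  unfolding op_norm_le_def
proof
  fix v :: "complex Matrix.vec" assume "v \<in> carrier_vec (dim_col a)"
  then have "L2_set (\<lambda>k. cmod (vec_index (a *\<^sub>v v) k)) {..<dim_row a} \<le> c * L2_set (\<lambda>k. cmod (vec_index v k)) {..<dim_col a}"
    using assms(1) by (simp add: op_norm_le_def)
  also have "\<dots> \<le> d * L2_set (\<lambda>k. cmod (vec_index v k)) {..<dim_col a}"
    using assms(2) by (intro mult_right_mono) (auto simp: L2_set_nonneg)
  finally show "L2_set (\<lambda>k. cmod (vec_index (a *\<^sub>v v) k)) {..<dim_row a} \<le> d * L2_set (\<lambda>k. cmod (vec_index v k)) {..<dim_col a}" .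
qed

lemma sesq_as_sum: "sesq S P v w = (\<Sum>s\<in>S. cnj (v s) * (\<Sum>t\<in>S. P s t * w t))"
  by (simp add: sesq_def sum_distrib_left mult.assoc)

text \<open>With y = a w the pairing of v and y is at most |v|^2 + |y|^2, and the norm bound
  controls |y|^2. The maximum with 0 is there because \<open>op_norm_le\<close> does not state that
  c is nonnegative.\<close>

lemma op_norm_le_imp_bounded_kernel:
  assumes a: "a \<in> carrier_mat k k" and "op_norm_le a c"
  shows "bounded_kernel {..<k} (\<lambda>p q. a $$ (p, q)) (1 + (max 0 c)\<^sup>2)"
  unfolding bounded_kernel_def
proof (intro allI)
  fix v w :: "nat \<Rightarrow> complex"
  let ?d = "max 0 c"
  define y where "y p = (\<Sum>q<k. a $$ (p, q) * w q)" for p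
  let ?V = "\<Sum>p<k. (cmod (v p))\<^sup>2" and ?W = "\<Sum>p<k. (cmod (w p))\<^sup>2" and ?Y = "\<Sum>p<k. (cmod (y p))\<^sup>2"
  have VW: "0 \<le> ?V" "0 \<le> ?W" by (auto intro: sum_nonneg)
  have Y: "?Y \<le> ?d\<^sup>2 * ?W"
    using op_norm_le_iff[OF a, of ?d] op_norm_le_mono[OF assms(2), of ?d] by (simp add: y_def)
  have "cmod (sesq {..<k} (\<lambda>p q. a $$ (p, q)) v w) = cmod (\<Sum>p<k. cnj (v p) * y p)"
    by (simp add: sesq_as_sum y_def)
  also have "\<dots> \<le> (\<Sum>p<k. cmod (cnj (v p) * y p))" by (rule norm_sum)
  also have "\<dots> \<le> (\<Sum>p<k. (cmod (v p))\<^sup>2 + (cmod (y p))\<^sup>2)"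
  proof (rule sum_mono)
    fix p
    show "cmod (cnj (v p) * y p) \<le> (cmod (v p))\<^sup>2 + (cmod (y p))\<^sup>2"
      unfolding norm_mult complex_mod_cnj
      using sum_squares_bound[of "cmod (v p)" "cmod (y p)"] mult_nonneg_nonneg[OF norm_ge_zero[of "v p"] norm_ge_zero[of "y p"]]
      by linarith
  qed
  also have "\<dots> = ?V + ?Y" by (rule sum.distrib)
  also have "\<dots> \<le> (1 + ?d\<^sup>2) * (?V + ?W)"
    using Y VW mult_nonneg_nonneg[OF zero_le_power2[of ?d] VW(1)] unfolding distrib_left distrib_right mult_1 by linarith
  finally show "cmod (sesq {..<k} (\<lambda>p q. a $$ (p, q)) v w) \<le> (1 + ?d\<^sup>2) * (?V + ?W)" .
qed

text \<open>Testing the bound of a kernel on the pair $(\frac{1}{2d} P w, w)$ bounds $P w$.\<close>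

lemma bounded_kernel_imp_op_norm_le:
  assumes "bounded_kernel {..<k} P c"
  shows "op_norm_le (mat k k (\<lambda>(p, q). P p q)) (2 * max 1 c)"
proof -
  define d where "d = max 1 c"
  have d: "d \<ge> 1" "bounded_kernel {..<k} P d" using bounded_kernel_mono[OF assms] by (auto simp: d_def)
  have "(\<Sum>p<k. (cmod (\<Sum>q<k. P p q * w q))\<^sup>2) \<le> (2 * d)\<^sup>2 * (\<Sum>q<k. (cmod (w q))\<^sup>2)" for w
  proof -
    define y where "y p = (\<Sum>q<k. P p q * w q)" for p
    let ?W = "\<Sum>p<k. (cmod (w p))\<^sup>2" and ?Y = "\<Sum>p<k. (cmod (y p))\<^sup>2"
    \<comment> \<open>With Y = |P w|^2 and W = |w|^2 the kernel bound reads r Y \<le> d (r^2 Y + W).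
      At r = 1 / (2 d) the Y on the right is half of that on the left and can be absorbed, leaving Y
      \<le> 4 d^2 W.\<close>
    define r where "r = 1 / (2 * d)"
    have r: "r > 0" using d by (simp add: r_def)
    have "sesq {..<k} P (\<lambda>p. of_real r * y p) w = (\<Sum>p<k. of_real (r * (cmod (y p))\<^sup>2))"
      unfolding sesq_as_sum
    proof (rule sum.cong[OF refl])
      fix p
      have "cnj (of_real r * y p) * y p = of_real r * (y p * cnj (y p))" by (simp add: mult_ac)
      also have "\<dots> = of_real (r * (cmod (y p))\<^sup>2)" using complex_norm_square[of "y p"] by simp
      finally show "cnj (of_real r * y p) * (\<Sum>q<k. P p q * w q) = of_real (r * (cmod (y p))\<^sup>2)"
        by (simp only: y_def)
    qed
    also have "\<dots> = of_real (r * ?Y)" by (simp add: sum_distrib_left)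
    finally have "cmod (sesq {..<k} P (\<lambda>p. of_real r * y p) w) = r * ?Y"
      using r by (simp add: sum_nonneg abs_mult del: of_real_mult)
    moreover have "(\<Sum>p<k. (cmod (of_real r * y p))\<^sup>2) = r\<^sup>2 * ?Y"
      by (simp add: norm_mult power_mult_distrib sum_distrib_left)
    ultimately have "r * ?Y \<le> d * (r\<^sup>2 * ?Y + ?W)"
      using d(2)[unfolded bounded_kernel_def, rule_format, of "\<lambda>p. of_real r * y p" w] by simp
    then have "?Y / (2 * d) \<le> ?Y / (4 * d) + d * ?W"
      using d(1) by (simp add: r_def field_simps power2_eq_square)
    then have "?Y \<le> (2 * d)\<^sup>2 * ?W" using d(1) by (simp add: field_simps power2_eq_square)
    then show ?thesis by (simp add: y_def)
  qed
  then show ?thesis using d(1) op_norm_le_iff[of "mat k k (\<lambda>(p, q). P p q)" k "2 * d"] by (simp add: d_def)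
qed

text \<open>Injectivity of h makes the entries determine the element, and surjectivity realises
  every bounded family. The two conversions between \<open>op_norm_le\<close> and
  \<open>bounded_kernel\<close> keep the bound uniform over I.\<close>

lemma star_iso_block_algebra:
  assumes A: "star_algebra A" and iso: "star_iso A (linf_matrix_product I n) h"
  shows "block_algebra A I n (\<lambda>x i p q. h x i $$ (p, q))"
proof -
  interpret star_algebra A by fact
  let ?L = "linf_matrix_product I n"
  have bij: "bij_betw h (carrier A) (carrier ?L)" and hom: "h \<in> Ring.ring_hom A ?L"
    and smult: "\<And>c x. x \<in> carrier A \<Longrightarrow> h (c \<odot>\<^bsub>A\<^esub> x) = c \<odot>\<^bsub>?L\<^esub> h x"
    and star: "\<And>x. x \<in> carrier A \<Longrightarrow> h (star A x) = star ?L (h x)"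
    using iso by (auto simp: star_iso_def)
  have L: "carrier ?L = {a \<in> (\<Pi>\<^sub>E i\<in>I. carrier_mat (n i) (n i)). \<exists>c. \<forall>i\<in>I. op_norm_le (a i) c}"
    by (simp add: linf_matrix_product_def)
  have hL: "h x \<in> carrier ?L" if "x \<in> carrier A" for x using bij that by (auto simp: bij_betw_def)
  have hE: "h x \<in> (\<Pi>\<^sub>E i\<in>I. carrier_mat (n i) (n i))" if "x \<in> carrier A" for x using hL[OF that] by (simp add: L)
  have hM: "h x i \<in> carrier_mat (n i) (n i)" if "x \<in> carrier A" "i \<in> I" for x i using hE[OF that(1)] that(2) by (auto simp: PiE_def)
  note hom_simps = ring_hom_add[OF hom] ring_hom_mult[OF hom] ring_hom_one[OF hom]
  show ?thesis
  proof (rule block_algebra.intro[OF A block_algebra_axioms.intro])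
    fix x y
    assume x: "x \<in> carrier A" and y: "y \<in> carrier A"
      and eq: "\<And>i p q. \<lbrakk>i \<in> I; p < n i; q < n i\<rbrakk> \<Longrightarrow> h x i $$ (p, q) = h y i $$ (p, q)"
    have "h x i = h y i" if "i \<in> I" for i
      by (rule eq_matI) (use hM[OF x that] hM[OF y that] eq[OF that] in auto)
    then have "h x = h y" by (rule PiE_ext[OF hE[OF x] hE[OF y]])
    then show "x = y" using bij x y by (auto simp: bij_betw_def inj_on_def)
  next
    fix x y i p q assume xy: "x \<in> carrier A" "y \<in> carrier A" and i: "i \<in> I" "p < n i" "q < n i"
    show "h (x \<oplus>\<^bsub>A\<^esub> y) i $$ (p, q) = h x i $$ (p, q) + h y i $$ (p, q)"
      using hM[OF xy(1) i(1)] hM[OF xy(2) i(1)] i by (simp add: hom_simps(1)[OF xy] linf_matrix_product_def)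
  next
    fix x y i p q assume xy: "x \<in> carrier A" "y \<in> carrier A" and i: "i \<in> I" "p < n i" "q < n i"
    show "h (x \<otimes>\<^bsub>A\<^esub> y) i $$ (p, q) = (\<Sum>r<n i. h x i $$ (p, r) * h y i $$ (r, q))"
      using hM[OF xy(1) i(1)] hM[OF xy(2) i(1)] i
      by (simp add: hom_simps(2)[OF xy] linf_matrix_product_def scalar_prod_def atLeast0LessThan)
  next
    fix z x i p q assume x: "x \<in> carrier A" and i: "i \<in> I" "p < n i" "q < n i"
    show "h (z \<odot>\<^bsub>A\<^esub> x) i $$ (p, q) = z * h x i $$ (p, q)"
      using hM[OF x i(1)] i by (simp add: smult[OF x] linf_matrix_product_def)
  next
    fix x i p q assume x: "x \<in> carrier A" and i: "i \<in> I" "p < n i" "q < n i"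
    show "h (star A x) i $$ (p, q) = cnj (h x i $$ (q, p))"
      using mat_adjoint_index[OF hM[OF x i(1)] i(2,3)] i by (simp add: star[OF x] linf_matrix_product_def)
  next
    fix i p q assume i: "i \<in> I" "p < n i" "q < n i"
    show "h \<one>\<^bsub>A\<^esub> i $$ (p, q) = (if p = q then 1 else 0)"
      using i by (simp add: hom_simps(3) linf_matrix_product_def)
  next
    fix x assume x: "x \<in> carrier A"
    obtain c where c: "\<And>i. i \<in> I \<Longrightarrow> op_norm_le (h x i) c" using hL[OF x] by (auto simp: L)
    show "\<exists>c. \<forall>i\<in>I. bounded_kernel {..<n i} (\<lambda>p q. h x i $$ (p, q)) c"
      using op_norm_le_imp_bounded_kernel[OF hM[OF x] c] by blast
  next
    fix f c assume f: "\<And>i. i \<in> I \<Longrightarrow> bounded_kernel {..<n i} (f i) c"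
    define a where "a = (\<lambda>i\<in>I. mat (n i) (n i) (\<lambda>(p, q). f i p q))"
    have "op_norm_le (a i) (2 * max 1 c)" if "i \<in> I" for i
      using bounded_kernel_imp_op_norm_le[OF f[OF that]] that by (simp add: a_def)
    then have "a \<in> carrier ?L" unfolding L by (auto simp: a_def)
    then have "a \<in> h ` carrier A" using bij_betw_imp_surj_on[OF bij] by simp
    then obtain x where "x \<in> carrier A" "h x = a" by blast
    then show "\<exists>x\<in>carrier A. \<forall>i\<in>I. \<forall>p<n i. \<forall>q<n i. h x i $$ (p, q) = f i p q"
      by (intro bexI[of _ x]) (auto simp: a_def)
  qed
qed

lemma hereditarily_atomic_block_algebra:
  fixes A :: "'a star_alg"
  assumes "hereditarily_atomic A"
  shows "\<exists>(I :: 'a set) n ent. block_algebra A I n ent"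
  using assms star_iso_block_algebra unfolding hereditarily_atomic_def von_neumann_algebra_def by blast

theorem mainTheorem5:
  fixes A :: "'a star_alg" and B :: "'b star_alg"
  assumes "hereditarily_atomic A" and "hereditarily_atomic B"
  shows "(\<exists>!\<beta>. \<beta> \<in> extensional (carrier (M_dcpo (Q_dcpo A B))) \<and>
            scott_continuous (M_dcpo (Q_dcpo A B)) (Q_dcpo A B) \<beta> \<and>
            convex_linear (M_dcpo (Q_dcpo A B)) (Q_dcpo A B) \<beta> \<and>
            EM_algebra (Q_dcpo A B) \<beta>) \<and>
         (\<forall>\<beta>. scott_continuous (M_dcpo (Q_dcpo A B)) (Q_dcpo A B) \<beta> \<and>
            convex_linear (M_dcpo (Q_dcpo A B)) (Q_dcpo A B) \<beta> \<and>
            EM_algebra (Q_dcpo A B) \<beta> \<longrightarrow>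
            is_barycentre_map (Q_dcpo A B) \<beta>)"
proof -
  obtain I :: "'a set" and n entA where A: "block_algebra A I n entA"
    using hereditarily_atomic_block_algebra[OF assms(1)] by blast
  obtain J :: "'b set" and m entB where B: "block_algebra B J m entB"
    using hereditarily_atomic_block_algebra[OF assms(2)] by blast
  interpret block_pair A I n entA B J m entB by (rule block_pair.intro[OF A B])
  interpret functional_kegelspitze "Q_dcpo A B" functionals by (rule functional_kegelspitze_Q)
  show ?thesis by (rule barycentre_unique_algebra[OF approximable_Q])
qed

end
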